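(* Let $S=\{\phi_1,\dots,\phi_s\}$ be a set of endomorphisms on $\mathbb{P}^N(\overline{\mathbb{Q}})$ with distinct degrees all at least two. If $M_S$ is free, then for all $\epsilon>0$ there exists an effectively computable positive constant $b=b(S,\epsilon)$ and a constant $B_S$ depending only on $S$ such that $$(\log B)^{b}\ll\#\{f\in M_S : H(f(P))\leq B\}\ll(\log B)^{b+\epsilon}$$ holds for all $P\in\mathbb{P}^N(\overline{\mathbb{Q}})$ with $H(P)>B_S$. Moreover, the implicit constants and error terms depend on $P$ and are effectively computable if $B_S$ is.
   Context: $H$ is the absolute multiplicative Weil height on $\mathbb{P}^N(\overline{\mathbb{Q}})$. Endomorphisms are morphisms $\mathbb{P}^N\to\mathbb{P}^N$ defined over $\overline{\mathbb{Q}}$; such a morphism has degree $d$ if it is given by $N+1$ homogeneous polynomials of degree $d$ with no common zero. $M_S$ is the monoid generated by $S$ under composition (with identity map); "$M_S$ is free" means that $S$ is a free basis, i.e. every element of $M_S$ can be written in exactly one way as a (possibly empty) composition of elements of $S$. The notation $A(B)\ll C(B)$ means that there is a constant $c>0$ (which may depend on $S$, $\epsilon$ and $P$, but not on $B$) with $A(B)\le c\,C(B)$ for all sufficiently large $B$.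
   Formalization: S is assumed to contain at least two endomorphisms: for a single map the count grows only like log log B, and for the empty set it is bounded, so no positive b could satisfy the lower bound. *)

theory Defs
  imports
    "HOL-Analysis.Analysis"
    "HOL-Computational_Algebra.Computational_Algebra"
    "HOL-Library.FuncSet"
    "HOL-Library.Poly_Mapping"
    "HOL-Library.Nat_Bijection"
    "HOL-Library.Landau_Symbols"
begin

section \<open>Projective space over the algebraic numbers\<close>

text \<open>
  The algebraic closure of the rationals is realised inside the complex numbers.
  Homogeneous coordinate vectors \<open>(x\<^sub>0, \<dots>, x\<^sub>N)\<close> are functions on the naturals vanishing
  beyond \<open>N\<close>, and a point is the set of all its homogeneous coordinate vectors.
\<close>

definition Qbar :: "complex set" where
  "Qbar = {z. algebraic z}"

type_synonym cvec = "nat \<Rightarrow> complex"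
type_synonym ppoint = "cvec set"
type_synonym pmap = "ppoint \<Rightarrow> ppoint"

definition hcoords :: "nat \<Rightarrow> cvec set" where
  "hcoords N = {x. (\<forall>i. x i \<in> Qbar) \<and> (\<forall>i>N. x i = 0) \<and> (\<exists>i. x i \<noteq> 0)}"

definition point_of :: "cvec \<Rightarrow> ppoint" where
  "point_of x = {(\<lambda>i. c * x i) | c. c \<in> Qbar \<and> c \<noteq> 0}"

definition PN :: "nat \<Rightarrow> ppoint set" where
  "PN N = point_of ` hcoords N"


section \<open>Endomorphisms and the monoid they generate\<close>

text \<open>
  A polynomial maps exponent vectors (finitely supported functions on the indices of the
  variables) to coefficients.
\<close>

type_synonym mpoly = "(nat \<Rightarrow>\<^sub>0 nat) \<Rightarrow>\<^sub>0 complex"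

definition mpoly_eval :: "mpoly \<Rightarrow> cvec \<Rightarrow> complex" where
  "mpoly_eval p x = (\<Sum>m\<in>Poly_Mapping.keys p. Poly_Mapping.lookup p m *
     (\<Prod>i\<in>Poly_Mapping.keys m. x i ^ Poly_Mapping.lookup m i))"

definition homogeneous :: "nat \<Rightarrow> nat \<Rightarrow> mpoly \<Rightarrow> bool" where
  "homogeneous N d p \<longleftrightarrow>
     (\<forall>m\<in>Poly_Mapping.keys p. Poly_Mapping.lookup p m \<in> Qbar \<and>
        Poly_Mapping.keys m \<subseteq> {..N} \<and>
        (\<Sum>i\<in>Poly_Mapping.keys m. Poly_Mapping.lookup m i) = d)"

text \<open>
  The tuple \<open>F = [F\<^sub>0, \<dots>, F\<^sub>N]\<close> defines the morphism \<open>\<phi>\<close>.  Maps are extensional on \<open>PN N\<close>, so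
  that equality of the HOL functions is equality of the morphisms.
\<close>

definition defines_endo :: "nat \<Rightarrow> nat \<Rightarrow> mpoly list \<Rightarrow> pmap \<Rightarrow> bool" where
  "defines_endo N d F \<phi> \<longleftrightarrow>
     length F = Suc N \<and> (\<forall>p\<in>set F. homogeneous N d p) \<and>
     (\<forall>x\<in>hcoords N. \<exists>p\<in>set F. mpoly_eval p x \<noteq> 0) \<and>
     \<phi> \<in> extensional (PN N) \<and>
     (\<forall>x\<in>hcoords N. \<phi> (point_of x) =
        point_of (\<lambda>i. if i \<le> N then mpoly_eval (F ! i) x else 0))"

definition endo_of_degree :: "nat \<Rightarrow> nat \<Rightarrow> pmap \<Rightarrow> bool" where
  "endo_of_degree N d \<phi> \<longleftrightarrow> (\<exists>F. defines_endo N d F \<phi>)"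

inductive_set gen_monoid :: "nat \<Rightarrow> pmap set \<Rightarrow> pmap set" for N :: nat and S :: "pmap set" where
  ident: "(\<lambda>P\<in>PN N. P) \<in> gen_monoid N S"
| gen: "\<phi> \<in> S \<Longrightarrow> \<phi> \<in> gen_monoid N S"
| comp: "f \<in> gen_monoid N S \<Longrightarrow> g \<in> gen_monoid N S \<Longrightarrow> compose (PN N) f g \<in> gen_monoid N S"

definition word_map :: "nat \<Rightarrow> pmap list \<Rightarrow> pmap" where
  "word_map N w = foldr (compose (PN N)) w (\<lambda>P\<in>PN N. P)"

definition free_basis :: "nat \<Rightarrow> pmap set \<Rightarrow> bool" where
  "free_basis N S \<longleftrightarrow> (\<forall>f\<in>gen_monoid N S. \<exists>!w. w \<in> lists S \<and> word_map N w = f)"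


section \<open>The absolute multiplicative Weil height\<close>

definition is_subfield :: "complex set \<Rightarrow> bool" where
  "is_subfield K \<longleftrightarrow> 1 \<in> K \<and> (\<forall>x\<in>K. \<forall>y\<in>K. x - y \<in> K \<and> x * y \<in> K \<and> inverse x \<in> K)"

definition field_generated :: "complex set \<Rightarrow> complex set" where
  "field_generated A = \<Inter>{K. is_subfield K \<and> A \<subseteq> K}"

definition embeddings :: "complex set \<Rightarrow> (complex \<Rightarrow> complex) set" where
  "embeddings K = {\<sigma>\<in>extensional K. \<sigma> 1 = 1 \<and>
     (\<forall>x\<in>K. \<forall>y\<in>K. \<sigma> (x + y) = \<sigma> x + \<sigma> y \<and> \<sigma> (x * y) = \<sigma> x * \<sigma> y)}"

definition absolute_value_on :: "complex set \<Rightarrow> (complex \<Rightarrow> real) \<Rightarrow> bool" where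
  "absolute_value_on K v \<longleftrightarrow>
     (\<forall>x\<in>K. v x \<ge> 0 \<and> (v x = 0 \<longleftrightarrow> x = 0)) \<and>
     (\<forall>x\<in>K. \<forall>y\<in>K. v (x * y) = v x * v y \<and> v (x + y) \<le> v x + v y)"

definition padic_abs :: "nat \<Rightarrow> rat \<Rightarrow> real" where
  "padic_abs p q = (if q = 0 then 0 else
     (case quotient_of q of (a, b) \<Rightarrow>
        real p powi (int (multiplicity (int p) b) - int (multiplicity (int p) a))))"

text \<open>
  The standard absolute values on a number field \<open>K\<close> are those which restrict on the rationals
  to the usual absolute value or to one of the \<open>p\<close>-adic ones.
\<close>

definition std_absolute_values :: "complex set \<Rightarrow> (complex \<Rightarrow> real) set" where
  "std_absolute_values K = {v\<in>extensional K. absolute_value_on K v \<and>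
     ((\<forall>q. v (of_rat q) = real_of_rat \<bar>q\<bar>) \<or>
      (\<exists>p. prime p \<and> (\<forall>q. v (of_rat q) = padic_abs p q)))}"

text \<open>
  A fixed extension of the \<open>p\<close>-adic absolute value to the algebraic closure; two such
  extensions differ by an automorphism of \<open>Qbar\<close>, so nothing below depends on the choice.
\<close>

definition padic_ext :: "nat \<Rightarrow> complex \<Rightarrow> real" where
  "padic_ext p = (SOME w. absolute_value_on Qbar w \<and> (\<forall>q. w (of_rat q) = padic_abs p q))"

text \<open>
  The local degree \<open>n\<^sub>v = [K\<^sub>v : \<rat>\<^sub>v]\<close>.  The completion \<open>K\<^sub>v\<close> is a separable extension of
  \<open>\<rat>\<^sub>v\<close>, and its \<open>\<rat>\<^sub>v\<close>-embeddings into the algebraic closure of \<open>\<rat>\<^sub>v\<close> correspond by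
  restriction to the embeddings of \<open>K\<close> which pull the absolute value of that closure back to
  \<open>v\<close>; so \<open>n\<^sub>v\<close> is the number of the latter.  Likewise \<open>[K : \<rat>]\<close> is the number of all complex
  embeddings of \<open>K\<close>.
\<close>

definition local_degree :: "complex set \<Rightarrow> (complex \<Rightarrow> real) \<Rightarrow> nat" where
  "local_degree K v = card {\<sigma>\<in>embeddings K.
     \<exists>w\<in>insert cmod (padic_ext ` {p. prime p}). \<forall>x\<in>K. v x = w (\<sigma> x)}"

definition local_factor :: "nat \<Rightarrow> complex set \<Rightarrow> cvec \<Rightarrow> (complex \<Rightarrow> real) \<Rightarrow> real" where
  "local_factor N K x v = Max ((\<lambda>i. v (x i)) ` {..N}) ^ local_degree K v"

text \<open>
  All but finitely many local factors are 1; the restriction of the index set makes the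
  product a finite one.
\<close>

definition height_over :: "nat \<Rightarrow> complex set \<Rightarrow> cvec \<Rightarrow> real" where
  "height_over N K x =
     (\<Prod>v\<in>{v\<in>std_absolute_values K. local_factor N K x v \<noteq> 1}. local_factor N K x v)
       powr (1 / real (card (embeddings K)))"

definition height :: "nat \<Rightarrow> ppoint \<Rightarrow> real" where
  "height N P = (let x = (SOME x. x \<in> P) in height_over N (field_generated (x ` {..N})) x)"

definition orbit_count :: "nat \<Rightarrow> pmap set \<Rightarrow> ppoint \<Rightarrow> real \<Rightarrow> nat" where
  "orbit_count N S P B = card {f\<in>gen_monoid N S. height N (f P) \<le> B}"


section \<open>Partial recursive functions with oracles\<close>

text \<open>
  Programs for the partial recursive functions on the naturals, with oracle queries.  The
  oracles only serve to supply real-number inputs through rational approximations.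
\<close>

datatype prog =
    Zero
  | Successor
  | Proj nat
  | Query nat
  | Comp prog "prog list"
  | PrimRec prog prog
  | Minimize prog

definition minimize :: "(nat \<Rightarrow> nat option) \<Rightarrow> nat option" where
  "minimize f =
     (if \<exists>n. f n = Some 0 \<and> (\<forall>m<n. \<exists>y. f m = Some (Suc y))
      then Some (LEAST n. f n = Some 0) else None)"

primrec run :: "(nat \<Rightarrow> nat) list \<Rightarrow> prog \<Rightarrow> nat list \<Rightarrow> nat option" where
  "run os Zero = (\<lambda>xs. Some 0)"
| "run os Successor = (\<lambda>xs. case xs of [] \<Rightarrow> None | x # _ \<Rightarrow> Some (Suc x))"
| "run os (Proj i) = (\<lambda>xs. if i < length xs then Some (xs ! i) else None)"
| "run os (Query j) =
     (\<lambda>xs. case xs of [] \<Rightarrow> None | x # _ \<Rightarrow> if j < length os then Some ((os ! j) x) else None)"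
| "run os (Comp f gs) =
     (\<lambda>xs. Option.bind (those (map (\<lambda>r. r xs) (map (run os) gs))) (run os f))"
| "run os (PrimRec f g) =
     (\<lambda>xs. case xs of [] \<Rightarrow> None
       | n # ys \<Rightarrow> rec_nat (run os f ys)
           (\<lambda>m r. Option.bind r (\<lambda>y. run os g (m # y # ys))) n)"
| "run os (Minimize f) = (\<lambda>xs. minimize (\<lambda>n. run os f (n # xs)))"


section \<open>Finite presentations of the data\<close>

definition rat_of_code :: "nat \<Rightarrow> rat" where
  "rat_of_code n = (case prod_decode n of (a, b) \<Rightarrow> of_int (int_decode a) / of_nat (Suc b))"

definition real_name :: "(nat \<Rightarrow> nat) \<Rightarrow> real \<Rightarrow> bool" where
  "real_name g r \<longleftrightarrow> (\<forall>k. \<bar>of_rat (rat_of_code (g k)) - r\<bar> \<le> 1 / 2 ^ k)"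

text \<open>
  An algebraic number is presented by the integer coefficients of a nonzero polynomial and
  the rational centre \<open>u + iv\<close> and radius \<open>r\<close> of a disc in which it is the only root.
\<close>

definition algebraic_code :: "nat \<Rightarrow> complex \<Rightarrow> bool" where
  "algebraic_code c \<alpha> \<longleftrightarrow> (\<exists>cs u v r.
     c = list_encode [list_encode cs, u, v, r] \<and>
     (let p = Poly (map (\<lambda>a. of_int (int_decode a)) cs);
          D = ball (Complex (of_rat (rat_of_code u)) (of_rat (rat_of_code v)))
                   (of_rat (rat_of_code r))
      in p \<noteq> 0 \<and> {z\<in>D. poly p z = 0} = {\<alpha>}))"

definition exponents :: "nat list \<Rightarrow> nat \<Rightarrow>\<^sub>0 nat" where
  "exponents es = (\<Sum>i<length es. Poly_Mapping.single i (es ! i))"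

text \<open>A polynomial is presented as a list of terms (exponents, coefficient).\<close>

definition mpoly_code :: "nat \<Rightarrow> mpoly \<Rightarrow> bool" where
  "mpoly_code c p \<longleftrightarrow> (\<exists>ts.
     list_all2 (\<lambda>t (es, \<alpha>). \<exists>a. t = prod_encode (list_encode es, a) \<and> algebraic_code a \<alpha>)
       (list_decode c) ts \<and>
     p = (\<Sum>(es, \<alpha>)\<leftarrow>ts. Poly_Mapping.single (exponents es) \<alpha>))"

definition endo_code :: "nat \<Rightarrow> nat \<Rightarrow> pmap \<Rightarrow> bool" where
  "endo_code N c \<phi> \<longleftrightarrow> (\<exists>d ps F. c = prod_encode (d, list_encode ps) \<and>
     list_all2 mpoly_code ps F \<and> defines_endo N d F \<phi>)"

definition system_code :: "nat \<Rightarrow> nat \<Rightarrow> pmap set \<Rightarrow> bool" where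
  "system_code c N S \<longleftrightarrow> (\<exists>cs \<phi>s. c = prod_encode (N, list_encode cs) \<and>
     list_all2 (endo_code N) cs \<phi>s \<and> distinct \<phi>s \<and> set \<phi>s = S)"

definition point_code :: "nat \<Rightarrow> nat \<Rightarrow> ppoint \<Rightarrow> bool" where
  "point_code N c P \<longleftrightarrow> (\<exists>xs.
     list_all2 algebraic_code (list_decode c) xs \<and> length xs = Suc N \<and>
     (\<exists>x\<in>set xs. x \<noteq> 0) \<and> P = point_of (\<lambda>i. if i \<le> N then xs ! i else 0))"

text \<open>
  The program \<open>prg\<close> computes the real number \<open>b\<close>, to any prescribed accuracy, from a
  presentation of \<open>S\<close> and approximations to \<open>\<epsilon>\<close>.
\<close>

definition computes_exponent :: "prog \<Rightarrow> nat \<Rightarrow> pmap set \<Rightarrow> real \<Rightarrow> real \<Rightarrow> bool" where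
  "computes_exponent prg N S \<epsilon> b \<longleftrightarrow>
     (\<forall>c e. system_code c N S \<longrightarrow> real_name e \<epsilon> \<longrightarrow>
        (\<forall>k. \<exists>q. run [e] prg [c, k] = Some q \<and> \<bar>of_rat (rat_of_code q) - b\<bar> \<le> 1 / 2 ^ k))"

text \<open>
  From presentations of \<open>S\<close> and \<open>P\<close> and approximations to \<open>\<epsilon>\<close> and \<open>B\<^sub>S\<close>, the program \<open>prg\<close>
  computes admissible implicit constants \<open>c\<^sub>1\<close>, \<open>c\<^sub>2\<close> and a threshold \<open>B\<^sub>0\<close> for the two
  estimates.  Enlarging them preserves the estimates, so they may be taken to be natural numbers.
\<close>

definition computes_constants ::
    "prog \<Rightarrow> nat \<Rightarrow> pmap set \<Rightarrow> real \<Rightarrow> real \<Rightarrow> real \<Rightarrow> ppoint \<Rightarrow> bool" where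
  "computes_constants prg N S \<epsilon> b BS P \<longleftrightarrow>
     (\<forall>c p e g. system_code c N S \<longrightarrow> point_code N p P \<longrightarrow> real_name e \<epsilon> \<longrightarrow> real_name g BS \<longrightarrow>
        (\<exists>c1 c2 B0. run [e, g] prg [c, p] = Some (list_encode [c1, c2, B0]) \<and>
           c1 > 0 \<and> c2 > 0 \<and>
           (\<forall>B. B \<ge> real B0 \<longrightarrow>
              ln B powr b \<le> real c1 * real (orbit_count N S P B) \<and>
              real (orbit_count N S P B) \<le> real c2 * ln B powr (b + \<epsilon>))))"

end

theory Submission
  imports Defs
begin

text \<open>
  For an endomorphism \<open>\<phi>\<close> of degree \<open>d\<close> the logarithmic height satisfies \<open>\<bar>h(\<phi> P) - d h(P)\<bar> \<le> C\<close>; the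
  lower bound comes from the projective Nullstellensatz.  If \<open>h(P) > C + 1\<close>, then \<open>h(f P)\<close> is
  therefore comparable to \<open>deg f\<close>, uniformly in \<open>f\<close>, and by freeness the count becomes that of
  the words over \<open>S\<close> whose product of degrees is at most \<open>X = log B\<close>, up to a constant factor in \<open>X\<close>.
  The number \<open>n(X)\<close> of such words satisfies \<open>n(X) = 1 + \<Sum> n(X/d\<^sub>i)\<close>.  If \<open>\<Sum> d\<^sub>i powr -b = 1\<close>, then
  \<open>X powr b \<le> (s - 1) n(X) + 1 \<le> (d\<^sub>m\<^sub>a\<^sub>x X) powr b\<close> by induction, so this \<open>b\<close> serves for every \<open>\<epsilon>\<close>, and
  the integers \<open>n(2\<^sup>m)\<close> determine it to any accuracy.

  Since the local degrees count embeddings, the height of \<open>x\<close> is the geometric mean over the conjugates of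
  \<open>x\<close> of a product over one fixed absolute value of \<open>Qbar\<close> for each place of the rationals, and
  the places of number fields need not be classified.
\<close>

section \<open>Algebraic numbers\<close>

text \<open>Effectivity dictates the shape of the constants. The height gap \<open>C\<close>
  obtained from the Nullstellensatz is not made effective, but \<open>B_S\<close> may be chosen: as
  a power of 3 with exponent \<open>C + 1\<close> it is itself larger than \<open>C\<close>, so any
  approximation to \<open>B_S\<close> yields a bound for \<open>C\<close>, while \<open>h(P)\<close>
  is bounded through the code of \<open>P\<close>. A power law needs two generators: with one, the
  count grows like \<open>log log B\<close>. Two generators also rule out projective 0-space, where
  all maps coincide; for \<open>N \<ge> 1\<close> heights are unbounded and the degree can be read
  off from the map.

  \<open>padic_ext\<close> is only a choice, so an extension of each p-adic absolute value to
  \<open>Qbar\<close> has to be constructed; this is done with a subring maximal for omitting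
  \<open>1/p\<close>. Polynomials enter as functions, and homogeneity of an ideal is replaced by
  stability under x \<mapsto> 2x, which passes to elimination ideals. Local estimates are uniform
  over conjugates, with constants equal to 1 outside finitely many places, so they survive summing
  over places and averaging over conjugates.\<close>

interpretation ratv: vector_space "\<lambda>(q::rat) (z::complex). of_rat q * z"
  by unfold_locales (simp_all add: algebra_simps of_rat_add of_rat_mult)

text \<open>Finite-dimensional algebras over the rationals inside the complex numbers. Sums and
  products of algebraic numbers are algebraic because they lie in one of these, which turns
  algebraicity into linear algebra.\<close>

definition fin_alg :: "complex set \<Rightarrow> bool" where
  "fin_alg R \<longleftrightarrow> (\<exists>B. finite B \<and> R = ratv.span B) \<and> 1 \<in> R \<and> (\<forall>x\<in>R. \<forall>y\<in>R. x * y \<in> R)"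

text \<open>The \<open>n + 1\<close> powers of \<open>x\<close> up to \<open>x ^ n\<close> lie in a
  space of dimension at most \<open>n\<close>; a linear relation between them is a rational
  polynomial with root \<open>x\<close>.\<close>

lemma fin_alg_algebraic:
  assumes "fin_alg R" "x \<in> R"
  shows "algebraic x"
proof -
  obtain B where B: "finite B" "R = ratv.span B" and R: "1 \<in> R" "\<And>x y. x \<in> R \<Longrightarrow> y \<in> R \<Longrightarrow> x * y \<in> R"
    using assms unfolding fin_alg_def by blast
  have pow: "x ^ i \<in> R" for i
    by (induction i) (use R assms in auto)
  define n where "n = card B"
  show ?thesis
  proof (cases "inj_on (\<lambda>i. x ^ i) {..n}")
    \<comment> \<open>If two powers coincide, the set of powers may be too small for the dimension
      count, but the coincidence is itself a polynomial equation.\<close>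
    case False
    then obtain i j where ij: "i \<noteq> j" "x ^ i = x ^ j" by (auto simp: inj_on_def)
    show ?thesis
    proof (rule algebraicI'[of "monom 1 i - monom 1 j"])
      show "monom 1 i - monom 1 j \<noteq> (0 :: complex poly)"
        using ij by (simp add: monom_eq_iff')
    qed (use ij in \<open>auto simp: poly_monom\<close>)
  next
    case True
    define s where "s = (\<lambda>i. x ^ i) ` {..n}"
    have "card s = Suc n" using True by (simp add: s_def card_image)
    moreover have "s \<subseteq> ratv.span B" using pow B by (auto simp: s_def)
    ultimately have "ratv.dependent s"
      using ratv.independent_span_bound[OF B(1), of s] n_def by auto
    then obtain u v where u: "v \<in> s" "u v \<noteq> 0" "(\<Sum>v\<in>s. of_rat (u v) * v) = 0"
      using ratv.dependent_finite[of s] s_def by auto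
    define p :: "complex poly" where "p = (\<Sum>i\<le>n. monom (of_rat (u (x ^ i))) i)"
    have coeff: "coeff p i = (if i \<le> n then of_rat (u (x ^ i)) else 0)" for i
      unfolding p_def coeff_sum by (simp add: coeff_monom sum.delta)
    obtain j where j: "j \<le> n" "v = x ^ j" using u(1) by (auto simp: s_def)
    show ?thesis
    proof (rule algebraicI'[of p])
      show "p \<noteq> 0" using coeff[of j] j u(2) by auto
      have "poly p x = (\<Sum>i\<le>n. of_rat (u (x ^ i)) * x ^ i)"
        by (simp add: p_def poly_sum poly_monom)
      also have "\<dots> = (\<Sum>v\<in>s. of_rat (u v) * v)"
        unfolding s_def using True by (simp add: sum.reindex)
      finally show "poly p x = 0" using u(3) by simp
    qed (auto simp: coeff)
  qed
qed

text \<open>The module \<open>R + R z + ... + R z^(n-1)\<close> is stable under multiplication by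
  \<open>z\<close> because \<open>z ^ n\<close> folds back into it, hence is closed under products;
  over the rationals it is spanned by the products of a spanning element of \<open>R\<close> with a
  power of \<open>z\<close>.\<close>

lemma fin_alg_adjoin:
  assumes R: "fin_alg R" and z: "z ^ n = (\<Sum>i<n. r i * z ^ i)" and r: "\<And>i. r i \<in> R"
  shows "\<exists>R'. fin_alg R' \<and> R \<subseteq> R' \<and> z \<in> R'"
proof -
  obtain B where B: "finite B" "R = ratv.span B" and R1: "1 \<in> R"
    and Rm: "\<And>x y. x \<in> R \<Longrightarrow> y \<in> R \<Longrightarrow> x * y \<in> R"
    using R unfolding fin_alg_def by blast
  have R0: "0 \<in> R" and Ra: "\<And>x y. x \<in> R \<Longrightarrow> y \<in> R \<Longrightarrow> x + y \<in> R"
    and Rs: "\<And>q x. x \<in> R \<Longrightarrow> of_rat q * x \<in> R"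
    by (auto simp: B ratv.span_zero ratv.span_add ratv.span_scale)
  have n0: "n > 0" using z by (cases n) auto
  define R' where "R' = {(\<Sum>j<n. c j * z ^ j) | c. \<forall>j. c j \<in> R}"
  have R'I: "(\<Sum>j<n. c j * z ^ j) \<in> R'" if "\<And>j. c j \<in> R" for c
    using that by (auto simp: R'_def)
  have R'a: "x + y \<in> R'" if xy: "x \<in> R'" "y \<in> R'" for x y
  proof -
    obtain c d where "\<forall>j. c j \<in> R" "\<forall>j. d j \<in> R" "x = (\<Sum>j<n. c j * z ^ j)" "y = (\<Sum>j<n. d j * z ^ j)"
      using xy by (auto simp: R'_def)
    then show ?thesis using R'I[of "\<lambda>j. c j + d j"] Ra by (auto simp: sum.distrib algebra_simps)
  qed
  have R's: "a * x \<in> R'" if a: "a \<in> R" and x: "x \<in> R'" for a x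
  proof -
    obtain c where "\<forall>j. c j \<in> R" "x = (\<Sum>j<n. c j * z ^ j)"
      using x by (auto simp: R'_def)
    then show ?thesis using R'I[of "\<lambda>j. a * c j"] Rm a by (auto simp: sum_distrib_left mult.assoc)
  qed
  have RR': "R \<subseteq> R'"
  proof
    fix a assume "a \<in> R"
    then show "a \<in> R'" using R'I[of "\<lambda>j. if j = 0 then a else 0"] R0 n0
      by (simp add: if_distrib[where f="\<lambda>x. x * _"] sum.delta cong: if_cong)
  qed
  have zn: "z ^ n \<in> R'" unfolding z using r by (rule R'I)
  have R'z: "z * x \<in> R'" if x: "x \<in> R'" for x
  proof -
    obtain c where c: "\<forall>j. c j \<in> R" "x = (\<Sum>j<n. c j * z ^ j)"
      using x by (auto simp: R'_def)
    obtain m where m: "n = Suc m" using n0 by (cases n) auto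
    have "z * x = (\<Sum>j<n. c j * z ^ Suc j)" by (simp add: c sum_distrib_left algebra_simps)
    also have "\<dots> = (\<Sum>j<m. c j * z ^ Suc j) + c m * z ^ n" by (simp add: m)
    also have "(\<Sum>j<m. c j * z ^ Suc j) = (\<Sum>j<n. (case j of 0 \<Rightarrow> 0 | Suc k \<Rightarrow> c k) * z ^ j)"
      unfolding m by (subst sum.lessThan_Suc_shift) simp
    finally show ?thesis
      using c(1) R0 by (auto intro!: R'a R'I R's zn split: nat.split)
  qed
  have R'zp: "z ^ k * x \<in> R'" if "x \<in> R'" for x k
    by (induction k) (use that R'z in \<open>auto simp: mult.assoc\<close>)
  have R'0: "0 \<in> R'" using RR' R0 by auto
  have R'sum: "(\<Sum>j\<in>A. f j) \<in> R'" if "\<And>j. j \<in> A \<Longrightarrow> f j \<in> R'" for f and A :: "nat set"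
    using that by (induction A rule: infinite_finite_induct) (auto intro: R'0 R'a)
  have R'm: "x * y \<in> R'" if x: "x \<in> R'" and y: "y \<in> R'" for x y
  proof -
    obtain c where c: "\<forall>j. c j \<in> R" "x = (\<Sum>j<n. c j * z ^ j)"
      using x by (auto simp: R'_def)
    have "x * y = (\<Sum>j<n. c j * (z ^ j * y))" by (simp add: c sum_distrib_right mult.assoc)
    also have "\<dots> \<in> R'" using c y by (intro R'sum R's R'zp) auto
    finally show ?thesis .
  qed
  define C where "C = (\<lambda>(b, j). b * z ^ j) ` (B \<times> {..<n})"
  have "finite C" using B by (simp add: C_def)
  moreover have "R' = ratv.span C"
  proof
    show "ratv.span C \<subseteq> R'"
    proof (rule ratv.span_minimal)
      have "b \<in> R" if "b \<in> B" for b using that B ratv.span_base by auto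
      then have "b * z ^ j \<in> R'" if "b \<in> B" for b j
        using R'zp[of b j] RR' that by (simp add: mult.commute subset_iff)
      then show "C \<subseteq> R'" by (auto simp: C_def)
      show "ratv.subspace R'"
      proof (rule ratv.subspaceI)
        fix q x assume "x \<in> R'"
        moreover have "of_rat q \<in> R" using Rs[OF R1, of q] by simp
        ultimately show "of_rat q * x \<in> R'" by (rule R's[rotated])
      qed (auto intro: R'0 R'a)
    qed
    show "R' \<subseteq> ratv.span C"
    proof
      fix x assume "x \<in> R'"
      then obtain c where c: "\<forall>j. c j \<in> R" "x = (\<Sum>j<n. c j * z ^ j)"
        by (auto simp: R'_def)
      have "c j * z ^ j \<in> ratv.span C" if j: "j < n" for j
      proof -
        have "c j \<in> ratv.span B" using c B by auto
        then show ?thesis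
        proof (induction rule: ratv.span_induct_alt)
          case (step q b y)
          have "b * z ^ j \<in> ratv.span C"
            using step j by (intro ratv.span_base) (auto simp: C_def)
          then have "of_rat q * (b * z ^ j) + y * z ^ j \<in> ratv.span C"
            using step by (intro ratv.span_add ratv.span_scale) auto
          then show ?case by (simp add: algebra_simps)
        qed (simp add: ratv.span_zero)
      qed
      then show "x \<in> ratv.span C" unfolding c by (intro ratv.span_sum) auto
    qed
  qed
  moreover have "z \<in> R'" using R'z[of 1] R1 RR' by auto
  ultimately show ?thesis using R'm RR' R1 unfolding fin_alg_def by blast
qed

lemma fin_alg_adjoin_root:
  assumes R: "fin_alg R" and p: "p \<noteq> 0" "poly p z = 0" "\<And>i. coeff p i / lead_coeff p \<in> R"
  shows "\<exists>R'. fin_alg R' \<and> R \<subseteq> R' \<and> z \<in> R'"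
proof -
  define l where "l = lead_coeff p"
  have l: "l \<noteq> 0" using p by (simp add: l_def)
  have minus: "- x \<in> R" if "x \<in> R" for x
    using R that ratv.span_neg unfolding fin_alg_def by blast
  have "(\<Sum>i<degree p. coeff p i * z ^ i) + l * z ^ degree p = 0"
    using p(2) by (simp add: poly_altdef l_def lessThan_Suc_atMost[symmetric])
  then have "z ^ degree p = - (\<Sum>i<degree p. coeff p i * z ^ i) / l"
    using l by (simp add: field_simps add_eq_0_iff)
  also have "\<dots> = (\<Sum>i<degree p. (- (coeff p i / l)) * z ^ i)"
    by (simp add: sum_negf sum_divide_distrib)
  finally show ?thesis using p(3) minus
    by (intro fin_alg_adjoin[OF R, of z "degree p" "\<lambda>i. - (coeff p i / l)"]) (auto simp: l_def)
qed

lemma fin_alg_rat: "fin_alg (ratv.span {1})"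
proof -
  have *: "ratv.span {1} = range of_rat" by (auto simp: ratv.span_singleton)
  have "x * y \<in> ratv.span {1}" if "x \<in> ratv.span {1}" "y \<in> ratv.span {1}" for x y
    using that unfolding * by (auto simp: of_rat_mult[symmetric])
  moreover have "1 \<in> ratv.span {1}" by (simp add: ratv.span_base)
  ultimately show ?thesis unfolding fin_alg_def
    by blast
qed

lemma fin_alg_span_one: "fin_alg R \<Longrightarrow> q \<in> \<rat> \<Longrightarrow> q \<in> R"
  unfolding fin_alg_def Rats_def using ratv.span_scale[of 1] by fastforce

lemma fin_alg_cover:
  assumes "finite A" "\<And>x. x \<in> A \<Longrightarrow> algebraic x"
  shows "\<exists>R. fin_alg R \<and> A \<subseteq> R"
  using assms
proof (induction rule: finite_induct)
  case empty then show ?case using fin_alg_rat by auto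
next
  case (insert x A)
  then obtain R where R: "fin_alg R" "A \<subseteq> R" by auto
  obtain p where p: "\<And>i. coeff p i \<in> \<rat>" "p \<noteq> 0" "poly p x = 0"
    using insert.prems[of x] unfolding algebraic_altdef by blast
  have "coeff p i / lead_coeff p \<in> R" for i
    using fin_alg_span_one[OF R(1)] p by (auto intro: Rats_divide)
  then show ?case using fin_alg_adjoin_root[OF R(1) p(2,3)] R by blast
qed

lemma Qbar_add: "x \<in> Qbar \<Longrightarrow> y \<in> Qbar \<Longrightarrow> x + y \<in> Qbar"
  and Qbar_mult: "x \<in> Qbar \<Longrightarrow> y \<in> Qbar \<Longrightarrow> x * y \<in> Qbar"
proof -
  assume xy: "x \<in> Qbar" "y \<in> Qbar"
  then obtain R where R: "fin_alg R" "{x,y} \<subseteq> R"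
    using fin_alg_cover[of "{x,y}"] by (auto simp: Qbar_def)
  then have "x + y \<in> R" "x * y \<in> R" unfolding fin_alg_def by (auto intro: ratv.span_add)
  then show "x + y \<in> Qbar" "x * y \<in> Qbar" using fin_alg_algebraic[OF R(1)] by (auto simp: Qbar_def)
qed

lemma Qbar_rat: "q \<in> \<rat> \<Longrightarrow> q \<in> Qbar"
  by (simp add: Qbar_def rat_imp_algebraic)

lemma Qbar_of_rat [simp, intro]: "of_rat q \<in> Qbar"
  by (simp add: Qbar_rat)

lemma Qbar_of_nat [simp, intro]: "of_nat q \<in> Qbar"
  by (simp add: Qbar_rat)

lemma Qbar_of_int [simp, intro]: "of_int q \<in> Qbar"
  by (simp add: Qbar_rat)

lemma Qbar_0 [simp, intro]: "0 \<in> Qbar" and Qbar_1 [simp, intro]: "1 \<in> Qbar"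
  by (auto simp: Qbar_rat)

lemma Qbar_uminus: "x \<in> Qbar \<Longrightarrow> - x \<in> Qbar"
  by (simp add: Qbar_def)

lemma Qbar_diff: "x \<in> Qbar \<Longrightarrow> y \<in> Qbar \<Longrightarrow> x - y \<in> Qbar"
  using Qbar_add[of x "- y"] Qbar_uminus[of y] by simp

lemma Qbar_inverse: "x \<in> Qbar \<Longrightarrow> inverse x \<in> Qbar"
  by (auto simp: Qbar_def)

lemma Qbar_divide: "x \<in> Qbar \<Longrightarrow> y \<in> Qbar \<Longrightarrow> x / y \<in> Qbar"
  by (simp add: divide_inverse Qbar_inverse Qbar_mult)

lemma Qbar_power: "x \<in> Qbar \<Longrightarrow> x ^ n \<in> Qbar"
  by (induction n) (auto intro: Qbar_mult)

lemma Qbar_sum: "(\<And>i. i \<in> A \<Longrightarrow> f i \<in> Qbar) \<Longrightarrow> (\<Sum>i\<in>A. f i) \<in> Qbar"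
  by (induction A rule: infinite_finite_induct) (auto intro: Qbar_add)

lemma Qbar_prod: "(\<And>i. i \<in> A \<Longrightarrow> f i \<in> Qbar) \<Longrightarrow> (\<Prod>i\<in>A. f i) \<in> Qbar"
  by (induction A rule: infinite_finite_induct) (auto intro: Qbar_mult)

lemmas Qbar_closed = Qbar_add Qbar_mult Qbar_uminus Qbar_diff Qbar_inverse Qbar_divide Qbar_power
  Qbar_sum Qbar_prod

lemma Qbar_subfield: "is_subfield Qbar"
  unfolding is_subfield_def by (auto intro: Qbar_closed)

text \<open>All coefficients, divided by the leading one, lie in a single finite-dimensional
  algebra, and adjoining the root keeps it finite-dimensional. With the fundamental theorem of
  algebra this makes \<open>Qbar\<close> algebraically closed.\<close>

lemma Qbar_root:
  assumes "p \<noteq> 0" "poly p z = 0" "\<And>i. coeff p i \<in> Qbar"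
  shows "z \<in> Qbar"
proof -
  define A where "A = (\<lambda>i. coeff p i / lead_coeff p) ` {..degree p}"
  have "\<And>x. x \<in> A \<Longrightarrow> algebraic x" using assms(3) Qbar_divide by (auto simp: A_def Qbar_def)
  then obtain R where R: "fin_alg R" "A \<subseteq> R" using fin_alg_cover[of A] by (auto simp: A_def)
  have "0 \<in> R" using fin_alg_span_one[OF R(1)] by auto
  then have "coeff p i / lead_coeff p \<in> R" for i
    using R by (cases "i \<le> degree p") (auto simp: A_def coeff_eq_0)
  then obtain R' where "fin_alg R'" "z \<in> R'" using fin_alg_adjoin_root[OF R(1) assms(1,2)] by auto
  then show ?thesis using fin_alg_algebraic by (auto simp: Qbar_def)
qed


section \<open>Embeddings and Galois averages\<close>

definition polys_over :: "complex set \<Rightarrow> complex poly set" where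
  "polys_over K = {p. \<forall>i. coeff p i \<in> K}"

lemma subfieldD:
  assumes "is_subfield K"
  shows "1 \<in> K" "0 \<in> K" "x \<in> K \<Longrightarrow> y \<in> K \<Longrightarrow> x - y \<in> K" "x \<in> K \<Longrightarrow> y \<in> K \<Longrightarrow> x * y \<in> K"
    "x \<in> K \<Longrightarrow> inverse x \<in> K" "x \<in> K \<Longrightarrow> - x \<in> K" "x \<in> K \<Longrightarrow> y \<in> K \<Longrightarrow> x + y \<in> K"
proof -
  show 1: "1 \<in> K" "x \<in> K \<Longrightarrow> y \<in> K \<Longrightarrow> x - y \<in> K" "x \<in> K \<Longrightarrow> y \<in> K \<Longrightarrow> x * y \<in> K"
    "x \<in> K \<Longrightarrow> inverse x \<in> K" for x y using assms unfolding is_subfield_def by auto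
  show 0: "0 \<in> K" using 1(1) 1(2)[of 1 1] by simp
  show m: "x \<in> K \<Longrightarrow> - x \<in> K" for x using 1(2)[OF 0, of x] by simp
  show "x \<in> K \<Longrightarrow> y \<in> K \<Longrightarrow> x + y \<in> K" using 1(2)[of x "- y"] m by simp
qed

lemma subfield_of_rat:
  assumes "is_subfield K"
  shows "of_rat q \<in> K"
proof -
  note K = subfieldD[OF assms]
  have nat: "of_nat n \<in> K" for n by (induction n) (use K in auto)
  have int: "of_int n \<in> K" for n
    by (cases n rule: int_cases2) (use K nat in auto)
  obtain a b where "q = Rat.Fract a b" "b \<noteq> 0" by (cases q) auto
  then show ?thesis using K(4)[OF int K(5)[OF int], of a b] by (simp add: of_rat_rat divide_inverse)
qed

text \<open>Inverses come from algebraicity: if \<open>a + x * poly q x = 0\<close> with rational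
  \<open>a \<noteq> 0\<close>, then \<open>- poly q x / a\<close> is the inverse of
  \<open>x\<close>.\<close>

lemma subfieldI_subring:
  assumes K: "K \<subseteq> Qbar" and rat: "\<And>q. of_rat q \<in> K"
    and cl: "\<And>x y. x \<in> K \<Longrightarrow> y \<in> K \<Longrightarrow> x - y \<in> K" "\<And>x y. x \<in> K \<Longrightarrow> y \<in> K \<Longrightarrow> x * y \<in> K"
  shows "is_subfield K"
proof -
  have K0: "0 \<in> K" and K1: "1 \<in> K" using rat[of 0] rat[of 1] by auto
  have Ku: "- x \<in> K" if "x \<in> K" for x using cl(1)[OF K0 that] by simp
  have Ka: "x + y \<in> K" if "x \<in> K" "y \<in> K" for x y using cl(1)[OF that(1) Ku[OF that(2)]] by simp
  have Kp: "poly p x \<in> K" if "\<And>i. coeff p i \<in> \<rat>" "x \<in> K" for p x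
    using that
  proof (induction p)
    case (pCons a p)
    have "a \<in> \<rat>" and "coeff p i \<in> \<rat>" for i
      using pCons.prems(1)[of 0] pCons.prems(1)[of "Suc i"] by auto
    then show ?case using pCons rat by (auto intro!: Ka cl elim!: Rats_cases)
  qed (use K0 in auto)
  have "inverse x \<in> K" if x: "x \<in> K" for x
  proof (cases "x = 0")
    case False
    have "algebraic x" using x K by (auto simp: Qbar_def)
    then obtain p' where p': "coeff p' 0 \<noteq> 0" "poly (map_poly complex_of_int p') x = 0"
      using algebraicE'_nonzero[of x] False by metis
    define p where "p = map_poly complex_of_int p'"
    have p: "\<And>i. coeff p i \<in> \<rat>" "coeff p 0 \<noteq> 0" "poly p x = 0"
      using p' by (auto simp: p_def coeff_map_poly)
    obtain a q where pq: "p = pCons a q" by (cases p)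
    have "a + x * poly q x = 0" "a \<noteq> 0" using p pq by auto
    then have "inverse x = - (inverse a) * poly q x" using False by (simp add: field_simps add_eq_0_iff)
    moreover have "inverse a \<in> K" using p(1)[of 0] pq rat by (auto elim!: Rats_cases simp flip: of_rat_inverse)
    moreover have "poly q x \<in> K" using p(1)[of "Suc i" for i] pq x by (intro Kp) auto
    ultimately show ?thesis by (auto intro: cl Ku)
  qed (use K0 in auto)
  then show ?thesis using K1 cl by (auto simp: is_subfield_def)
qed

lemma Rats_subfield: "is_subfield \<rat>"
  unfolding is_subfield_def by auto

lemma embD:
  assumes "is_subfield K" "\<sigma> \<in> embeddings K"
  shows "\<sigma> 1 = 1" "\<sigma> 0 = 0" "x \<in> K \<Longrightarrow> y \<in> K \<Longrightarrow> \<sigma> (x + y) = \<sigma> x + \<sigma> y"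
    "x \<in> K \<Longrightarrow> y \<in> K \<Longrightarrow> \<sigma> (x * y) = \<sigma> x * \<sigma> y" "x \<in> K \<Longrightarrow> \<sigma> (- x) = - \<sigma> x"
    "x \<in> K \<Longrightarrow> y \<in> K \<Longrightarrow> \<sigma> (x - y) = \<sigma> x - \<sigma> y"
    "x \<in> K \<Longrightarrow> \<sigma> (inverse x) = inverse (\<sigma> x)" "x \<in> K \<Longrightarrow> \<sigma> x = 0 \<longleftrightarrow> x = 0"
    "\<sigma> (of_rat q) = of_rat q"  "x \<in> K \<Longrightarrow> y \<in> K \<Longrightarrow> \<sigma> x = \<sigma> y \<longleftrightarrow> x = y"
proof -
  note K = subfieldD[OF assms(1)]
  show 1: "\<sigma> 1 = 1" and a: "x \<in> K \<Longrightarrow> y \<in> K \<Longrightarrow> \<sigma> (x + y) = \<sigma> x + \<sigma> y"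
    and m: "x \<in> K \<Longrightarrow> y \<in> K \<Longrightarrow> \<sigma> (x * y) = \<sigma> x * \<sigma> y" for x y
    using assms(2) unfolding embeddings_def by auto
  show 0: "\<sigma> 0 = 0" using a[OF K(2) K(2)] by simp
  show u: "x \<in> K \<Longrightarrow> \<sigma> (- x) = - \<sigma> x" for x using a[of x "-x"] K 0 by (simp add: add_eq_0_iff)
  show d: "x \<in> K \<Longrightarrow> y \<in> K \<Longrightarrow> \<sigma> (x - y) = \<sigma> x - \<sigma> y" for x y using a[of x "-y"] K u by simp
  have i': "x \<in> K \<Longrightarrow> x \<noteq> 0 \<Longrightarrow> \<sigma> x * \<sigma> (inverse x) = 1" for x using m[of x "inverse x"] K 1 by simp
  show z: "x \<in> K \<Longrightarrow> \<sigma> x = 0 \<longleftrightarrow> x = 0" for x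
    by (metis i' 0 mult_zero_left zero_neq_one)
  show i: "x \<in> K \<Longrightarrow> \<sigma> (inverse x) = inverse (\<sigma> x)" for x
    using i'[of x] 0 by (cases "x = 0") (auto simp: inverse_unique)
  show "x \<in> K \<Longrightarrow> y \<in> K \<Longrightarrow> \<sigma> x = \<sigma> y \<longleftrightarrow> x = y" using z[of "x - y"] d[of x y] K by auto
  have nK: "of_nat n \<in> K" for n using subfield_of_rat[OF assms(1), of "of_nat n"] by simp
  have iK: "of_int n \<in> K" for n using subfield_of_rat[OF assms(1), of "of_int n"] by simp
  have nat: "\<sigma> (of_nat n) = of_nat n" for n by (induction n) (use 0 1 a K nK in auto)
  have int: "\<sigma> (of_int n) = of_int n" for n by (cases n rule: int_cases2) (use nat u nK in auto)
  obtain a b where "q = Rat.Fract a b" "b \<noteq> 0" by (cases q) auto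
  then show "\<sigma> (of_rat q) = of_rat q"
    using m[OF iK K(5)[OF iK], of a b] i[OF iK, of b] int by (simp add: of_rat_rat divide_inverse)
qed

lemma polys_over_intros:
  assumes "is_subfield K"
  shows "0 \<in> polys_over K" "p \<in> polys_over K \<Longrightarrow> q \<in> polys_over K \<Longrightarrow> p + q \<in> polys_over K"
    "p \<in> polys_over K \<Longrightarrow> q \<in> polys_over K \<Longrightarrow> p - q \<in> polys_over K"
    "p \<in> polys_over K \<Longrightarrow> q \<in> polys_over K \<Longrightarrow> p * q \<in> polys_over K"
    "c \<in> K \<Longrightarrow> monom c n \<in> polys_over K" "p \<in> polys_over K \<Longrightarrow> pderiv p \<in> polys_over K"
    "c \<in> K \<Longrightarrow> [:c:] \<in> polys_over K"
proof -
  note K = subfieldD[OF assms]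
  have Ksum: "(\<And>i. i \<in> A \<Longrightarrow> f i \<in> K) \<Longrightarrow> sum f A \<in> K" for f and A :: "nat set"
    by (induction A rule: infinite_finite_induct) (use K in auto)
  show "0 \<in> polys_over K" "p \<in> polys_over K \<Longrightarrow> q \<in> polys_over K \<Longrightarrow> p + q \<in> polys_over K"
    "p \<in> polys_over K \<Longrightarrow> q \<in> polys_over K \<Longrightarrow> p - q \<in> polys_over K"
    "c \<in> K \<Longrightarrow> monom c n \<in> polys_over K"
    using K by (auto simp: polys_over_def)
  show "c \<in> K \<Longrightarrow> [:c:] \<in> polys_over K"
    using K by (auto simp: polys_over_def coeff_pCons split: nat.split)
  show "p \<in> polys_over K \<Longrightarrow> q \<in> polys_over K \<Longrightarrow> p * q \<in> polys_over K"
    using K by (auto simp: polys_over_def coeff_mult intro!: Ksum)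
  have "of_nat n \<in> K" for n using subfield_of_rat[OF assms, of "of_nat n"] by simp
  then show "p \<in> polys_over K \<Longrightarrow> pderiv p \<in> polys_over K"
    using K(4)[of "of_nat n" for n] by (auto simp: polys_over_def coeff_pderiv simp del: of_nat_Suc)
qed

lemma poly_polys_over:
  assumes "is_subfield K" "p \<in> polys_over K" "x \<in> K"
  shows "poly p x \<in> K"
proof -
  note K = subfieldD[OF assms(1)]
  have "x ^ n \<in> K" for n by (induction n) (use K assms in auto)
  moreover have Ksum: "(\<And>i. i \<in> A \<Longrightarrow> f i \<in> K) \<Longrightarrow> sum f A \<in> K" for f and A :: "nat set"
    by (induction A rule: infinite_finite_induct) (use K in auto)
  ultimately show ?thesis using assms(2) K(4) by (auto simp: poly_altdef polys_over_def intro!: Ksum)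
qed

lemma emb_sum:
  assumes "is_subfield K" "\<sigma> \<in> embeddings K" "\<And>i. i \<in> A \<Longrightarrow> f i \<in> K"
  shows "sum f A \<in> K \<and> \<sigma> (sum f A) = (\<Sum>i\<in>A. \<sigma> (f i))"
  using assms(3)
  by (induction A rule: infinite_finite_induct) (use subfieldD[OF assms(1)] embD[OF assms(1,2)] in auto)

lemma emb_prod:
  assumes "is_subfield K" "\<sigma> \<in> embeddings K" "\<And>i. i \<in> A \<Longrightarrow> f i \<in> K"
  shows "prod f A \<in> K \<and> \<sigma> (prod f A) = (\<Prod>i\<in>A. \<sigma> (f i))"
  using assms(3)
  by (induction A rule: infinite_finite_induct) (use subfieldD[OF assms(1)] embD[OF assms(1,2)] in auto)

lemma emb_power:
  assumes "is_subfield K" "\<sigma> \<in> embeddings K" "x \<in> K"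
  shows "x ^ n \<in> K \<and> \<sigma> (x ^ n) = \<sigma> x ^ n"
  by (induction n) (use subfieldD[OF assms(1)] embD[OF assms(1,2)] assms(3) in auto)

lemma map_poly_emb:
  assumes K: "is_subfield K" "\<sigma> \<in> embeddings K" and p: "p \<in> polys_over K"
  shows "q \<in> polys_over K \<Longrightarrow> map_poly \<sigma> (p + q) = map_poly \<sigma> p + map_poly \<sigma> q"
    "q \<in> polys_over K \<Longrightarrow> map_poly \<sigma> (p - q) = map_poly \<sigma> p - map_poly \<sigma> q"
    "q \<in> polys_over K \<Longrightarrow> map_poly \<sigma> (p * q) = map_poly \<sigma> p * map_poly \<sigma> q"
    "degree (map_poly \<sigma> p) = degree p"
    "x \<in> K \<Longrightarrow> \<sigma> (poly p x) = poly (map_poly \<sigma> p) (\<sigma> x)"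
proof -
  note e = embD[OF K]
  have p': "coeff p i \<in> K" for i using p by (auto simp: polys_over_def)
  have c: "coeff (map_poly \<sigma> p) i = \<sigma> (coeff p i)" for i p
    using e by (simp add: coeff_map_poly)
  { assume "q \<in> polys_over K"
    then have q': "coeff q i \<in> K" for i by (auto simp: polys_over_def)
    show "map_poly \<sigma> (p + q) = map_poly \<sigma> p + map_poly \<sigma> q"
      using p' q' e by (auto simp: poly_eq_iff c)
    show "map_poly \<sigma> (p - q) = map_poly \<sigma> p - map_poly \<sigma> q"
      using p' q' e by (auto simp: poly_eq_iff c)
    have "\<sigma> (\<Sum>i\<le>n. coeff p i * coeff q (n - i)) = (\<Sum>i\<le>n. \<sigma> (coeff p i * coeff q (n - i)))" for n
      using emb_sum[OF K, of "{..n}" "\<lambda>i. coeff p i * coeff q (n - i)"] p' q' subfieldD[OF K(1)] by auto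
    then show "map_poly \<sigma> (p * q) = map_poly \<sigma> p * map_poly \<sigma> q"
      using p' q' e by (auto simp: poly_eq_iff c coeff_mult)
  }
  show d: "degree (map_poly \<sigma> p) = degree p"
    using e(8)[OF p', of "degree p"] e(2) p' by (cases "p = 0") (auto intro!: map_poly_degree_eq)
  assume x: "x \<in> K"
  have pw: "coeff p i * x ^ i \<in> K" for i
    using emb_power[OF K x] p' subfieldD[OF K(1)] by auto
  show "\<sigma> (poly p x) = poly (map_poly \<sigma> p) (\<sigma> x)"
    unfolding poly_altdef d using emb_sum[OF K, of "{..degree p}" "\<lambda>i. coeff p i * x ^ i"] pw
     emb_power[OF K x] p' e by (auto simp: c)
qed

lemma polys_over_divide:
  assumes K: "is_subfield K" and p: "p \<in> polys_over K" "p \<noteq> 0" and f: "f \<in> polys_over K"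
  shows "\<exists>q r. q \<in> polys_over K \<and> r \<in> polys_over K \<and> f = p * q + r \<and> (r = 0 \<or> degree r < degree p)"
  using f
proof (induction "degree f" arbitrary: f rule: less_induct)
  case less
  note P = polys_over_intros[OF K]
  show ?case
  proof (cases "f = 0 \<or> degree f < degree p")
    case True
    then show ?thesis using less P(1) by (intro exI[of _ 0] exI[of _ f]) auto
  next
    case False
    define c where "c = lead_coeff f / lead_coeff p"
    define g where "g = monom c (degree f - degree p)"
    have "c \<in> K" using p less subfieldD[OF K] by (auto simp: c_def polys_over_def divide_inverse)
    then have g: "g \<in> polys_over K" using P by (auto simp: g_def)
    have fg: "f - p * g \<in> polys_over K" using P less p g by auto
    have c0: "c \<noteq> 0" using False p by (simp add: c_def)
    have dg: "degree (p * g) = degree f"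
      using c0 p False by (subst degree_mult_eq) (auto simp: g_def degree_monom_eq)
    have lg: "coeff (p * g) (degree f) = lead_coeff f"
    proof -
      have "coeff (p * g) (degree f) = lead_coeff (p * g)" using dg by simp
      also have "\<dots> = lead_coeff p * c" using c0 unfolding lead_coeff_mult
        by (simp add: g_def degree_monom_eq)
      finally show ?thesis using p by (simp add: c_def)
    qed
    show ?thesis
    proof (cases "f - p * g = 0")
      case True
      then show ?thesis using g P(1) by (intro exI[of _ g] exI[of _ 0]) auto
    next
      case nz: False
      have "degree (f - p * g) \<le> degree f" by (rule degree_diff_le) (auto simp: dg)
      moreover have "degree (f - p * g) \<noteq> degree f"
        using lg nz by (metis coeff_diff diff_self leading_coeff_0_iff)
      ultimately obtain q r where "q \<in> polys_over K" "r \<in> polys_over K" "f - p * g = p * q + r"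
        "r = 0 \<or> degree r < degree p" using less(1)[OF _ fg] by force
      then show ?thesis using P g by (intro exI[of _ "g + q"] exI[of _ r]) (auto simp: algebra_simps)
    qed
  qed
qed

section \<open>Minimal polynomials and the extension of embeddings to \<open>Qbar\<close>\<close>

definition min_poly :: "complex set \<Rightarrow> complex \<Rightarrow> complex poly \<Rightarrow> bool" where
  "min_poly K \<alpha> p \<longleftrightarrow> p \<in> polys_over K \<and> p \<noteq> 0 \<and> poly p \<alpha> = 0 \<and>
     (\<forall>f\<in>polys_over K. f \<noteq> 0 \<longrightarrow> poly f \<alpha> = 0 \<longrightarrow> degree p \<le> degree f)"

lemma min_poly_exists:
  assumes K: "is_subfield K" and a: "\<alpha> \<in> Qbar"
  shows "\<exists>p. min_poly K \<alpha> p"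
proof -
  obtain f where f: "\<And>i. coeff f i \<in> \<rat>" "f \<noteq> 0" "poly f \<alpha> = 0"
    using a by (auto simp: Qbar_def algebraic_altdef)
  define Q where "Q = (\<lambda>f. f \<in> polys_over K \<and> f \<noteq> 0 \<and> poly f \<alpha> = 0)"
  have "coeff f i \<in> K" for i
    using f(1)[of i] subfield_of_rat[OF K] by (auto elim!: Rats_cases)
  then have "Q f" using f by (auto simp: Q_def polys_over_def)
  then obtain p where "Q p" "\<forall>f. Q f \<longrightarrow> degree p \<le> degree f"
    using ex_has_least_nat[of Q f degree] by auto
  then show ?thesis unfolding min_poly_def Q_def by blast
qed

lemma min_poly_dvd:
  assumes K: "is_subfield K" and p: "min_poly K \<alpha> p" and f: "f \<in> polys_over K" "poly f \<alpha> = 0"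
  shows "\<exists>q\<in>polys_over K. f = p * q"
proof -
  obtain q r where qr: "q \<in> polys_over K" "r \<in> polys_over K" "f = p * q + r" "r = 0 \<or> degree r < degree p"
    using polys_over_divide[OF K _ _ f(1)] p unfolding min_poly_def by blast
  have "poly r \<alpha> = 0" using qr f p by (auto simp: min_poly_def)
  then have "r = 0" using qr p by (auto simp: min_poly_def)
  then show ?thesis using qr by auto
qed

text \<open>\<open>K'\<close> consists of the values \<open>poly f \<alpha>\<close>, and
  \<open>\<sigma>'\<close> sends such a value to \<open>poly (map_poly \<sigma> f) \<beta>\<close>.
  Two polynomials with the same value at \<open>\<alpha>\<close> differ by a multiple of
  \<open>p\<close>, whose image vanishes at \<open>\<beta>\<close>; so the choice of
  \<open>f\<close> does not matter.\<close>

lemma emb_extend_root: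
  assumes K: "is_subfield K" "K \<subseteq> Qbar" and s: "\<sigma> \<in> embeddings K" and a: "\<alpha> \<in> Qbar"
    and p: "min_poly K \<alpha> p" and b: "poly (map_poly \<sigma> p) \<beta> = 0"
  shows "\<exists>K' \<sigma>'. is_subfield K' \<and> K' \<subseteq> Qbar \<and> K \<subseteq> K' \<and> \<alpha> \<in> K' \<and> \<sigma>' \<in> embeddings K' \<and>
    (\<forall>x\<in>K. \<sigma>' x = \<sigma> x) \<and> \<sigma>' \<alpha> = \<beta>"
proof -
  note P = polys_over_intros[OF K(1)] and M = map_poly_emb[OF K(1) s]
  define K' where "K' = (\<lambda>f. poly f \<alpha>) ` polys_over K"
  define \<sigma>' where "\<sigma>' = (\<lambda>x\<in>K'. poly (map_poly \<sigma> (SOME f. f \<in> polys_over K \<and> poly f \<alpha> = x)) \<beta>)"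
  have wd: "poly (map_poly \<sigma> f) \<beta> = poly (map_poly \<sigma> g) \<beta>"
    if "f \<in> polys_over K" "g \<in> polys_over K" "poly f \<alpha> = poly g \<alpha>" for f g
  proof -
    have "f - g \<in> polys_over K" "poly (f - g) \<alpha> = 0" using that P by auto
    then obtain q where "q \<in> polys_over K" "f - g = p * q"
      using min_poly_dvd[OF K(1) p] by blast
    then have "map_poly \<sigma> f - map_poly \<sigma> g = map_poly \<sigma> p * map_poly \<sigma> q"
      using M that p by (metis min_poly_def)
    then have "poly (map_poly \<sigma> f) \<beta> - poly (map_poly \<sigma> g) \<beta> = 0"
      using b by (metis mult_zero_left poly_diff poly_mult)
    then show ?thesis by simp
  qed
  have s': "\<sigma>' (poly f \<alpha>) = poly (map_poly \<sigma> f) \<beta>" if f: "f \<in> polys_over K" for f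
  proof -
    define g where "g = (SOME g. g \<in> polys_over K \<and> poly g \<alpha> = poly f \<alpha>)"
    have "g \<in> polys_over K \<and> poly g \<alpha> = poly f \<alpha>" unfolding g_def by (rule someI[of _ f]) (use f in auto)
    then have "poly (map_poly \<sigma> g) \<beta> = poly (map_poly \<sigma> f) \<beta>" using wd f by blast
    then show ?thesis using f by (auto simp: \<sigma>'_def K'_def g_def)
  qed
  have KK': "K \<subseteq> K'"
  proof
    fix c assume "c \<in> K"
    then show "c \<in> K'" using P(7) unfolding K'_def by (intro image_eqI[of _ _ "[:c:]"]) auto
  qed
  have K'Q: "K' \<subseteq> Qbar"
  proof
    fix x assume "x \<in> K'"
    then obtain f where "f \<in> polys_over K" "x = poly f \<alpha>" by (auto simp: K'_def)
    moreover have "f \<in> polys_over Qbar" using K(2) calculation by (auto simp: polys_over_def)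
    ultimately show "x \<in> Qbar" using poly_polys_over[OF Qbar_subfield] a by auto
  qed
  have sub: "is_subfield K'"
  proof (rule subfieldI_subring[OF K'Q])
    show "of_rat q \<in> K'" for q using KK' subfield_of_rat[OF K(1)] by auto
    show "x - y \<in> K'" "x * y \<in> K'" if xy: "x \<in> K'" "y \<in> K'" for x y
    proof -
      obtain f g where "f \<in> polys_over K" "x = poly f \<alpha>" "g \<in> polys_over K" "y = poly g \<alpha>"
        using xy by (auto simp: K'_def)
      then have "x - y = poly (f - g) \<alpha>" "f - g \<in> polys_over K"
        "x * y = poly (f * g) \<alpha>" "f * g \<in> polys_over K" using P by auto
      then show "x - y \<in> K'" "x * y \<in> K'" unfolding K'_def by blast+
    qed
  qed
  have emb: "\<sigma>' \<in> embeddings K'"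
  proof -
    have "\<sigma>' (x + y) = \<sigma>' x + \<sigma>' y \<and> \<sigma>' (x * y) = \<sigma>' x * \<sigma>' y" if xy: "x \<in> K'" "y \<in> K'" for x y
    proof -
      obtain f g where fg: "f \<in> polys_over K" "x = poly f \<alpha>" "g \<in> polys_over K" "y = poly g \<alpha>"
        using xy by (auto simp: K'_def)
      show ?thesis using s'[of "f + g"] s'[of "f * g"] s'[of f] s'[of g] fg P M by simp
    qed
    moreover have "\<sigma>' 1 = 1" using s'[of "[:1:]"] P(7)[of 1] subfieldD[OF K(1)] embD[OF K(1) s]
      by (simp add: map_poly_pCons)
    ultimately show ?thesis by (auto simp: embeddings_def \<sigma>'_def)
  qed
  have "\<sigma>' x = \<sigma> x" if "x \<in> K" for x
    using s'[of "[:x:]"] P(7)[OF that] embD[OF K(1) s] by (cases "x = 0") (auto simp: map_poly_pCons)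
  moreover have X: "monom 1 1 \<in> polys_over K" using P(5) subfieldD[OF K(1)] by auto
  then have "\<sigma>' \<alpha> = \<beta>" using s'[OF X] embD[OF K(1) s] by (simp add: map_poly_monom poly_monom)
  moreover have "\<alpha> \<in> K'" using X unfolding K'_def by (intro image_eqI[OF _ X]) (auto simp: poly_monom)
  ultimately show ?thesis using sub K'Q KK' emb by blast
qed

lemma poly_root_complex:
  fixes p :: "complex poly"
  assumes "degree p > 0"
  shows "\<exists>z. poly p z = 0"
  using fundamental_theorem_of_algebra[of p] assms by (simp add: constant_degree)

lemma min_poly_degree: "min_poly K \<alpha> p \<Longrightarrow> degree p > 0"
  by (metis degree_eq_zeroE gr0I min_poly_def mult_zero_right pCons_0_0 poly_0 poly_pCons add.right_neutral)

lemma emb_extend_step: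
  assumes K: "is_subfield K" "K \<subseteq> Qbar" and s: "\<sigma> \<in> embeddings K" and a: "\<alpha> \<in> Qbar"
  shows "\<exists>K' \<sigma>'. is_subfield K' \<and> K' \<subseteq> Qbar \<and> K \<subseteq> K' \<and> \<alpha> \<in> K' \<and> \<sigma>' \<in> embeddings K' \<and>
    (\<forall>x\<in>K. \<sigma>' x = \<sigma> x)"
proof -
  obtain p where p: "min_poly K \<alpha> p" using min_poly_exists[OF K(1) a] by blast
  have "degree (map_poly \<sigma> p) > 0"
    using map_poly_emb(4)[OF K(1) s, of p] min_poly_degree[OF p] p by (auto simp: min_poly_def)
  then obtain \<beta> where "poly (map_poly \<sigma> p) \<beta> = 0" using poly_root_complex by blast
  then show ?thesis using emb_extend_root[OF K s a p] by blast
qed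

text \<open>Partial embeddings are stored as relations, so that in Zorn's lemma the upper bound of a
  chain is simply its union.\<close>

definition emb_graph :: "(complex \<times> complex) set \<Rightarrow> bool" where
  "emb_graph \<Gamma> \<longleftrightarrow> (1, 1) \<in> \<Gamma> \<and> Domain \<Gamma> \<subseteq> Qbar \<and> (\<forall>(x, x')\<in>\<Gamma>. \<forall>(y, y')\<in>\<Gamma>.
     (x = y \<longrightarrow> x' = y') \<and> (x - y, x' - y') \<in> \<Gamma> \<and> (x * y, x' * y') \<in> \<Gamma> \<and> (inverse x, inverse x') \<in> \<Gamma>)"

lemma emb_graph_of_emb:
  assumes K: "is_subfield K" "K \<subseteq> Qbar" and s: "\<sigma> \<in> embeddings K"
  shows "emb_graph {(x, \<sigma> x) | x. x \<in> K}"
  unfolding emb_graph_def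
  using subfieldD[OF K(1)] embD[OF K(1) s] K(2) by (auto 0 3)

lemma emb_of_emb_graph:
  assumes G: "emb_graph \<Gamma>"
  shows "\<exists>K \<sigma>. is_subfield K \<and> K \<subseteq> Qbar \<and> \<sigma> \<in> embeddings K \<and> \<Gamma> = {(x, \<sigma> x) | x. x \<in> K}"
proof -
  define K where "K = Domain \<Gamma>"
  define \<sigma> where "\<sigma> = (\<lambda>x\<in>K. THE x'. (x, x') \<in> \<Gamma>)"
  have uniq: "x' = y'" if "(x, x') \<in> \<Gamma>" "(x, y') \<in> \<Gamma>" for x x' y'
    using G that unfolding emb_graph_def by blast
  have s: "x \<in> K \<and> \<sigma> x = x'" if "(x, x') \<in> \<Gamma>" for x x'
    using that uniq by (auto simp: \<sigma>_def K_def intro!: the_equality)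
  have s': "(x, \<sigma> x) \<in> \<Gamma>" if "x \<in> K" for x using that s by (auto simp: K_def)
  have cl: "(x - y, x' - y') \<in> \<Gamma>" "(x * y, x' * y') \<in> \<Gamma>" "(inverse x, inverse x') \<in> \<Gamma>"
    if "(x, x') \<in> \<Gamma>" "(y, y') \<in> \<Gamma>" for x x' y y'
    using G that unfolding emb_graph_def by blast+
  have sub: "is_subfield K" unfolding is_subfield_def
    using G s s' cl unfolding emb_graph_def by meson
  have add: "(x + y, x' + y') \<in> \<Gamma>" if xy: "(x, x') \<in> \<Gamma>" "(y, y') \<in> \<Gamma>" for x x' y y'
    using cl(1)[OF xy(1) cl(1)[OF cl(1)[OF xy(2) xy(2)] xy(2)]] by simp
  have "\<sigma> \<in> embeddings K" unfolding embeddings_def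
    using s s' cl(2) add G by (auto simp: \<sigma>_def emb_graph_def)
  moreover have "\<Gamma> = {(x, \<sigma> x) | x. x \<in> K}" using s s' by auto
  moreover have "K \<subseteq> Qbar" using G by (auto simp: emb_graph_def K_def)
  ultimately show ?thesis using sub by blast
qed

text \<open>A maximal partial embedding is defined on all of \<open>Qbar\<close>, since
  \<open>emb_extend_step\<close> would enlarge any other.\<close>

lemma emb_extend:
  assumes K: "is_subfield K" "K \<subseteq> Qbar" and s: "\<sigma> \<in> embeddings K"
  shows "\<exists>\<tau>\<in>embeddings Qbar. \<forall>x\<in>K. \<tau> x = \<sigma> x"
proof -
  define \<Gamma>0 where "\<Gamma>0 = {(x, \<sigma> x) | x. x \<in> K}"
  define A where "A = {\<Gamma>. emb_graph \<Gamma> \<and> \<Gamma>0 \<subseteq> \<Gamma>}"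
  have "\<Gamma>0 \<in> A" using emb_graph_of_emb[OF assms] by (auto simp: A_def \<Gamma>0_def)
  moreover have "\<Union>C \<in> A" if C: "C \<noteq> {}" "subset.chain A C" for C
  proof -
    have CA: "X \<in> A" if "X \<in> C" for X using C that by (auto simp: subset.chain_def)
    have "emb_graph (\<Union>C)"
      unfolding emb_graph_def
    proof (intro conjI)
      show "(1, 1) \<in> \<Union>C" using C CA by (auto simp: A_def emb_graph_def)
      show "Domain (\<Union>C) \<subseteq> Qbar" using CA unfolding A_def emb_graph_def by blast
      have "(x = y \<longrightarrow> x' = y') \<and> (x - y, x' - y') \<in> \<Union>C \<and> (x * y, x' * y') \<in> \<Union>C \<and> (inverse x, inverse x') \<in> \<Union>C"
        if xy: "(x, x') \<in> \<Union>C" "(y, y') \<in> \<Union>C" for x x' y y'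
      proof -
        obtain X Y where "X \<in> C" "Y \<in> C" "(x, x') \<in> X" "(y, y') \<in> Y" using xy by auto
        then obtain Z where Z: "Z \<in> C" "(x, x') \<in> Z" "(y, y') \<in> Z"
          using C(2) unfolding subset.chain_def by blast
        have "emb_graph Z" using CA Z by (auto simp: A_def)
        then have "(x = y \<longrightarrow> x' = y') \<and> (x - y, x' - y') \<in> Z \<and> (x * y, x' * y') \<in> Z \<and> (inverse x, inverse x') \<in> Z"
          using Z(2,3) unfolding emb_graph_def by blast
        then show ?thesis using Z(1) by blast
      qed
      then show "\<forall>(x, x')\<in>\<Union>C. \<forall>(y, y')\<in>\<Union>C. (x = y \<longrightarrow> x' = y') \<and> (x - y, x' - y') \<in> \<Union>C \<and>
        (x * y, x' * y') \<in> \<Union>C \<and> (inverse x, inverse x') \<in> \<Union>C" by blast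
    qed
    then show ?thesis using C CA unfolding A_def by blast
  qed
  ultimately obtain M where M: "M \<in> A" "\<And>X. X \<in> A \<Longrightarrow> M \<subseteq> X \<Longrightarrow> X = M"
    using subset_Zorn_nonempty[of A] by blast
  obtain L \<tau> where L: "is_subfield L" "L \<subseteq> Qbar" "\<tau> \<in> embeddings L" "M = {(x, \<tau> x) | x. x \<in> L}"
    using emb_of_emb_graph[of M] M by (auto simp: A_def)
  have ext: "x \<in> L \<and> \<tau> x = \<sigma> x" if "x \<in> K" for x using M(1) L(4) that by (auto simp: A_def \<Gamma>0_def)
  have "Qbar \<subseteq> L"
  proof
    fix \<alpha> assume "\<alpha> \<in> Qbar"
    then obtain K' \<sigma>' where K': "is_subfield K'" "K' \<subseteq> Qbar" "L \<subseteq> K'" "\<alpha> \<in> K'" "\<sigma>' \<in> embeddings K'"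
      "\<forall>x\<in>L. \<sigma>' x = \<tau> x" using emb_extend_step[OF L(1-3)] by blast
    have "{(x, \<sigma>' x) | x. x \<in> K'} = M"
    proof (rule M(2))
      show sub: "M \<subseteq> {(x, \<sigma>' x) | x. x \<in> K'}" using K' L(4) by auto
      show "{(x, \<sigma>' x) | x. x \<in> K'} \<in> A"
        using emb_graph_of_emb[OF K'(1,2,5)] M(1) sub by (auto simp: A_def)
    qed
    then show "\<alpha> \<in> L" using K'(4) L(4) by blast
  qed
  then have "L = Qbar" using L(2) by auto
  then show ?thesis using L(3) ext by blast
qed

text \<open>By minimality of its degree \<open>p\<close> has \<open>\<alpha>\<close> as a simple
  root. If \<open>\<alpha>\<close> is irrational, \<open>p\<close> has degree at least two, so its
  cofactor has a root \<open>\<beta> \<noteq> \<alpha>\<close>, and some embedding carries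
  \<open>\<alpha>\<close> to \<open>\<beta>\<close>.\<close>

lemma emb_fixed_imp_rational:
  assumes a: "\<alpha> \<in> Qbar" and fixed: "\<And>\<tau>. \<tau> \<in> embeddings Qbar \<Longrightarrow> \<tau> \<alpha> = \<alpha>"
  shows "\<alpha> \<in> \<rat>"
proof (rule ccontr)
  assume nr: "\<alpha> \<notin> \<rat>"
  define \<sigma> where "\<sigma> = (\<lambda>x\<in>(\<rat>::complex set). x)"
  have RQ: "(\<rat> :: complex set) \<subseteq> Qbar" using Qbar_rat by auto
  have s: "\<sigma> \<in> embeddings \<rat>" by (auto simp: embeddings_def \<sigma>_def)
  obtain p where p: "min_poly \<rat> \<alpha> p" using min_poly_exists[OF Rats_subfield a] by blast
  then have pr: "p \<in> polys_over \<rat>" "p \<noteq> 0" "poly p \<alpha> = 0" and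
    mn: "\<And>f. f \<in> polys_over \<rat> \<Longrightarrow> f \<noteq> 0 \<Longrightarrow> poly f \<alpha> = 0 \<Longrightarrow> degree p \<le> degree f"
    by (auto simp: min_poly_def)
  note d0 = min_poly_degree[OF p]
  have dp: "poly (pderiv p) \<alpha> \<noteq> 0"
  proof
    assume z: "poly (pderiv p) \<alpha> = 0"
    have "pderiv p \<noteq> 0" using d0 by (simp add: pderiv_eq_0_iff)
    then have "degree p \<le> degree (pderiv p)"
      using mn[of "pderiv p"] z polys_over_intros[OF Rats_subfield] pr by auto
    then show False using d0 by (simp add: degree_pderiv)
  qed
  obtain q where q: "p = [:-\<alpha>, 1:] * q" using pr(3) by (auto simp: poly_eq_0_iff_dvd)
  have "pderiv p = [:-\<alpha>, 1:] * pderiv q + q"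
    unfolding q by (subst pderiv_mult) (simp add: pderiv_pCons)
  then have "poly q \<alpha> \<noteq> 0" using dp by simp
  have "degree q > 0"
  proof (rule ccontr)
    assume "\<not> degree q > 0"
    then obtain c where c: "q = [:c:]" using degree_eq_zeroE by blast
    then have "c \<noteq> 0" "coeff p 0 = - \<alpha> * c" "coeff p 1 = c" using q pr by auto
    then have "\<alpha> = - (coeff p 0 / coeff p 1)" by simp
    moreover have "coeff p 0 \<in> \<rat>" "coeff p 1 \<in> \<rat>" using pr by (auto simp: polys_over_def)
    ultimately have "\<alpha> \<in> \<rat>" by (metis Rats_divide Rats_minus_iff)
    then show False using nr by simp
  qed
  then obtain \<beta> where b: "poly q \<beta> = 0" using poly_root_complex by blast
  have "\<beta> \<noteq> \<alpha>" using b \<open>poly q \<alpha> \<noteq> 0\<close> by auto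
  have "map_poly \<sigma> p = p" using pr by (auto simp: poly_eq_iff coeff_map_poly polys_over_def \<sigma>_def)
  then have "poly (map_poly \<sigma> p) \<beta> = 0" using b q by auto
  from emb_extend_root[OF Rats_subfield RQ s a p this]
  obtain K' \<sigma>' where K': "is_subfield K'" "K' \<subseteq> Qbar" "\<alpha> \<in> K'" "\<sigma>' \<in> embeddings K'" "\<sigma>' \<alpha> = \<beta>"
    by blast
  then obtain \<tau> where "\<tau> \<in> embeddings Qbar" "\<tau> \<alpha> = \<beta>" using emb_extend[OF K'(1,2,4)] by metis
  then show False using fixed \<open>\<beta> \<noteq> \<alpha>\<close> by auto
qed

section \<open>Embeddings of \<open>Qbar\<close> as permutations of conjugates\<close>

lemmas QembD = embD[OF Qbar_subfield]

lemma Qemb_poly_root: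
  assumes "\<tau> \<in> embeddings Qbar" "\<And>i. coeff p i \<in> \<rat>" "x \<in> Qbar" "poly p x = 0"
  shows "poly p (\<tau> x) = 0"
proof -
  have "p \<in> polys_over Qbar" using assms(2) Qbar_rat by (auto simp: polys_over_def)
  have "\<tau> (coeff p i) = coeff p i" for i using assms(2)[of i] QembD(9)[OF assms(1)] by (metis Rats_cases)
  then have "map_poly \<tau> p = p"
    using QembD(2)[OF assms(1)] by (simp add: poly_eq_iff coeff_map_poly)
  with \<open>p \<in> polys_over Qbar\<close> show ?thesis
    using map_poly_emb(5)[OF Qbar_subfield assms(1), of p x] assms QembD(2)[OF assms(1)] by simp
qed

text \<open>\<open>C\<close> is the zero set of one rational polynomial. An embedding maps this
  finite set injectively into itself, hence onto itself; surjectivity on \<open>Qbar\<close> and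
  finiteness of \<open>gal\<close> both rest on this.\<close>

lemma Qemb_conjugates:
  assumes "x \<in> Qbar"
  shows "\<exists>C. finite C \<and> C \<subseteq> Qbar \<and> x \<in> C \<and> (\<forall>\<tau>\<in>embeddings Qbar. \<tau> ` C = C)"
proof -
  obtain p where p: "\<And>i. coeff p i \<in> \<rat>" "p \<noteq> 0" "poly p x = 0"
    using assms by (auto simp: Qbar_def algebraic_altdef)
  define C where "C = {z. poly p z = 0}"
  have fin: "finite C" using p poly_roots_finite by (auto simp: C_def)
  have CQ: "C \<subseteq> Qbar" using Qbar_root[OF p(2)] p(1) Qbar_rat by (auto simp: C_def)
  have "\<tau> ` C = C" if t: "\<tau> \<in> embeddings Qbar" for \<tau>
  proof -
    have "\<tau> ` C \<subseteq> C" using Qemb_poly_root[OF t p(1)] CQ by (auto simp: C_def)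
    moreover have "inj_on \<tau> C" using QembD(10)[OF t] CQ by (auto simp: inj_on_def subset_iff)
    ultimately show ?thesis using fin by (simp add: endo_inj_surj)
  qed
  then show ?thesis using fin CQ p by (intro exI[of _ C]) (auto simp: C_def)
qed

lemma Qemb_bij:
  assumes "\<tau> \<in> embeddings Qbar"
  shows "bij_betw \<tau> Qbar Qbar"
proof -
  have "inj_on \<tau> Qbar" using QembD(10)[OF assms] by (auto simp: inj_on_def)
  moreover have "\<tau> ` Qbar = Qbar"
  proof
    show "\<tau> ` Qbar \<subseteq> Qbar" using Qemb_conjugates assms by blast
    show "Qbar \<subseteq> \<tau> ` Qbar" using Qemb_conjugates assms by (metis image_mono subsetD subsetI)
  qed
  ultimately show ?thesis by (simp add: bij_betw_def)
qed

lemma Qemb_in [simp]: "\<tau> \<in> embeddings Qbar \<Longrightarrow> x \<in> Qbar \<Longrightarrow> \<tau> x \<in> Qbar"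
  using Qemb_bij bij_betwE by blast

lemma Qemb_id: "(\<lambda>x\<in>Qbar. x) \<in> embeddings Qbar"
  by (auto simp: embeddings_def Qbar_closed)

lemma Qemb_compose:
  assumes "\<sigma> \<in> embeddings Qbar" "\<tau> \<in> embeddings Qbar"
  shows "compose Qbar \<sigma> \<tau> \<in> embeddings Qbar"
  using QembD[OF assms(1)] QembD[OF assms(2)] Qemb_in[OF assms(2)]
  by (auto simp: embeddings_def compose_def Qbar_closed)

lemma Qemb_inverse:
  assumes "\<tau> \<in> embeddings Qbar"
  shows "\<exists>\<rho>\<in>embeddings Qbar. \<forall>x\<in>Qbar. \<rho> (\<tau> x) = x"
proof -
  define \<rho> where "\<rho> = restrict (inv_into Qbar \<tau>) Qbar"
  have b: "bij_betw \<tau> Qbar Qbar" using Qemb_bij[OF assms] .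
  have 1: "\<rho> (\<tau> x) = x" if "x \<in> Qbar" for x
    using that b assms by (auto simp: \<rho>_def bij_betw_def)
  have ex: "\<exists>z\<in>Qbar. y = \<tau> z" if "y \<in> Qbar" for y using b that by (auto simp: bij_betw_def)
  have "\<rho> (x + y) = \<rho> x + \<rho> y \<and> \<rho> (x * y) = \<rho> x * \<rho> y" if "x \<in> Qbar" "y \<in> Qbar" for x y
  proof -
    obtain u v where "u \<in> Qbar" "v \<in> Qbar" "x = \<tau> u" "y = \<tau> v" using ex \<open>x \<in> Qbar\<close> \<open>y \<in> Qbar\<close> by metis
    then show ?thesis using 1[of "u + v"] 1[of "u * v"] 1[of u] 1[of v] QembD(3,4)[OF assms, of u v]
      by (simp add: Qbar_closed)
  qed
  moreover have "\<rho> 1 = 1" using 1[of 1] QembD(1)[OF assms] by simp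
  ultimately have "\<rho> \<in> embeddings Qbar" by (auto simp: embeddings_def \<rho>_def)
  then show ?thesis using 1 by blast
qed

section \<open>Averages over conjugates\<close>

definition gal :: "complex set \<Rightarrow> (complex \<Rightarrow> complex) set" where
  "gal A = (\<lambda>\<tau>. restrict \<tau> A) ` embeddings Qbar"

lemma finite_gal:
  assumes "finite A" "A \<subseteq> Qbar"
  shows "finite (gal A)"
proof -
  define C where "C = (\<lambda>x. SOME C. finite C \<and> x \<in> C \<and> (\<forall>\<tau>\<in>embeddings Qbar. \<tau> ` C = C))"
  have C: "finite (C x) \<and> x \<in> C x \<and> (\<forall>\<tau>\<in>embeddings Qbar. \<tau> ` C x = C x)" if "x \<in> Qbar" for x
    unfolding C_def by (rule someI_ex) (use Qemb_conjugates[OF that] in blast)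
  have "gal A \<subseteq> PiE A C"
    using C assms(2) unfolding gal_def by (auto simp: PiE_def Pi_def) blast
  moreover have "finite (PiE A C)" using C assms by (intro finite_PiE) auto
  ultimately show ?thesis by (rule finite_subset)
qed

lemma gal_nonempty: "gal A \<noteq> {}"
  using Qemb_id by (auto simp: gal_def)

text \<open>Replaces the average over the embeddings of a number field: only the values on the
  finite set \<open>A\<close> matter, and \<open>A\<close> can be enlarged at will by
  \<open>gal_avg_restrict\<close>.\<close>

definition gal_avg :: "complex set \<Rightarrow> ((complex \<Rightarrow> complex) \<Rightarrow> real) \<Rightarrow> real" where
  "gal_avg A \<Phi> = (\<Sum>\<sigma>\<in>gal A. \<Phi> \<sigma>) / real (card (gal A))"

lemma gal_translate:
  assumes A: "finite A" "A \<subseteq> Qbar" and t: "\<tau> \<in> embeddings Qbar"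
  shows "bij_betw (\<lambda>\<sigma>. compose A \<tau> \<sigma>) (gal A) (gal A)"
proof -
  have "(\<lambda>\<sigma>. compose A \<tau> \<sigma>) ` gal A \<subseteq> gal A"
  proof
    fix \<rho> assume "\<rho> \<in> (\<lambda>\<sigma>. compose A \<tau> \<sigma>) ` gal A"
    then obtain \<mu> where m: "\<mu> \<in> embeddings Qbar" "\<rho> = compose A \<tau> (restrict \<mu> A)" by (auto simp: gal_def)
    then have "\<rho> = restrict (compose Qbar \<tau> \<mu>) A" using A by (auto simp: compose_def fun_eq_iff)
    then show "\<rho> \<in> gal A" using Qemb_compose[OF t m(1)] by (auto simp: gal_def)
  qed
  moreover have "inj_on (\<lambda>\<sigma>. compose A \<tau> \<sigma>) (gal A)"
  proof (rule inj_onI)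
    fix \<sigma> \<rho> assume g: "\<sigma> \<in> gal A" "\<rho> \<in> gal A" and eq: "compose A \<tau> \<sigma> = compose A \<tau> \<rho>"
    have "\<sigma> x = \<rho> x" for x
    proof (cases "x \<in> A")
      case True
      then have "\<tau> (\<sigma> x) = \<tau> (\<rho> x)" using eq by (metis compose_eq)
      moreover have "\<sigma> x \<in> Qbar" "\<rho> x \<in> Qbar" using g A True by (auto simp: gal_def)
      ultimately show ?thesis using QembD(10)[OF t] by blast
    qed (use g in \<open>auto simp: gal_def\<close>)
    then show "\<sigma> = \<rho>" by auto
  qed
  ultimately show ?thesis using endo_inj_surj[OF finite_gal[OF A]] by (simp add: bij_betw_def)
qed

text \<open>All fibres of the restriction from \<open>gal B\<close> to \<open>gal A\<close> have the
  same size: for \<open>\<sigma>\<close>, \<open>\<sigma>'\<close> induced by \<open>\<tau>\<close>,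
  \<open>\<tau>'\<close>, composing with \<open>g\<close>, which is \<open>\<tau>'\<close> after the
  inverse of \<open>\<tau>\<close>, sends the fibre over \<open>\<sigma>\<close> injectively into
  the one over \<open>\<sigma>'\<close>.\<close>

lemma gal_avg_restrict:
  assumes B: "finite B" "B \<subseteq> Qbar" and AB: "A \<subseteq> B"
  shows "gal_avg B (\<lambda>\<sigma>. \<Phi> (restrict \<sigma> A)) = gal_avg A \<Phi>"
proof -
  have A: "finite A" "A \<subseteq> Qbar" using assms finite_subset by auto
  define F where "F = (\<lambda>\<sigma>. {\<rho>\<in>gal B. restrict \<rho> A = \<sigma>})"
  have finF: "finite (F \<sigma>)" for \<sigma> using finite_gal[OF B] by (auto simp: F_def)
  have le: "card (F \<sigma>) \<le> card (F \<sigma>')" if s: "\<sigma> \<in> gal A" "\<sigma>' \<in> gal A" for \<sigma> \<sigma>'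
  proof -
    obtain \<tau> \<tau>' where t: "\<tau> \<in> embeddings Qbar" "\<tau>' \<in> embeddings Qbar" "\<sigma> = restrict \<tau> A" "\<sigma>' = restrict \<tau>' A"
      using s by (auto simp: gal_def)
    obtain \<rho> where r: "\<rho> \<in> embeddings Qbar" "\<And>x. x \<in> Qbar \<Longrightarrow> \<rho> (\<tau> x) = x" using Qemb_inverse[OF t(1)] by blast
    define g where "g = compose Qbar \<tau>' \<rho>"
    have g: "g \<in> embeddings Qbar" using Qemb_compose t r by (auto simp: g_def)
    have gt: "g (\<tau> x) = \<tau>' x" if "x \<in> Qbar" for x using r that t by (simp add: g_def compose_eq)
    note bij = gal_translate[OF B g]
    have "(\<lambda>\<mu>. compose B g \<mu>) ` F \<sigma> \<subseteq> F \<sigma>'"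
    proof (clarsimp simp: F_def, intro conjI)
      fix \<mu> assume m: "\<mu> \<in> gal B" "\<sigma> = restrict \<mu> A"
      show "compose B g \<mu> \<in> gal B" using bij m by (auto simp: bij_betw_def)
      have "\<mu> x = \<tau> x" if "x \<in> A" for x using m(2) t(3) that by (metis restrict_apply')
      then show "restrict (compose B g \<mu>) A = \<sigma>'"
        using AB A(2) gt by (auto simp: fun_eq_iff t(4) compose_def restrict_def subset_iff)
    qed
    moreover have "inj_on (\<lambda>\<mu>. compose B g \<mu>) (F \<sigma>)"
      using bij by (auto simp: bij_betw_def F_def intro: inj_on_subset)
    ultimately show ?thesis using finF by (meson card_inj_on_le)
  qed
  obtain \<sigma>0 where s0: "\<sigma>0 \<in> gal A" using gal_nonempty by blast
  define m where "m = card (F \<sigma>0)"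
  have m: "card (F \<sigma>) = m" if "\<sigma> \<in> gal A" for \<sigma> using le s0 that by (auto simp: m_def intro: antisym)
  have img: "(\<lambda>\<sigma>. restrict \<sigma> A) ` gal B \<subseteq> gal A"
  proof -
    have "restrict (restrict \<tau> B) A = restrict \<tau> A" for \<tau> :: "complex \<Rightarrow> complex" using AB by (auto simp: fun_eq_iff restrict_def)
    then show ?thesis by (auto simp: gal_def)
  qed
  have gr: "(\<Sum>\<sigma>\<in>gal B. f (restrict \<sigma> A)) = real m * (\<Sum>\<sigma>\<in>gal A. f \<sigma>)" for f :: "_ \<Rightarrow> real"
  proof -
    have "(\<Sum>\<sigma>\<in>gal B. f (restrict \<sigma> A)) = (\<Sum>\<sigma>\<in>gal A. \<Sum>\<rho>\<in>F \<sigma>. f (restrict \<rho> A))"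
      unfolding F_def by (rule sum.group[symmetric]) (use finite_gal A B img in auto)
    also have "\<dots> = (\<Sum>\<sigma>\<in>gal A. \<Sum>\<rho>\<in>F \<sigma>. f \<sigma>)" by (intro sum.cong) (auto simp: F_def)
    also have "\<dots> = real m * (\<Sum>\<sigma>\<in>gal A. f \<sigma>)" using m by (simp add: sum_distrib_left)
    finally show ?thesis .
  qed
  have c: "real (card (gal B)) = real m * real (card (gal A))" using gr[of "\<lambda>_. 1"] by simp
  have "card (gal B) \<noteq> 0" using finite_gal[OF B] gal_nonempty by auto
  then have "m \<noteq> 0" using c by (metis mult_eq_0_iff of_nat_0 of_nat_eq_0_iff)
  then show ?thesis unfolding gal_avg_def gr c by simp
qed

text \<open>Composition with an embedding permutes the factors, so the product is fixed by every
  embedding and \<open>emb_fixed_imp_rational\<close> applies.\<close>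

lemma gal_norm_rational:
  assumes A: "finite A" "A \<subseteq> Qbar" and c: "c \<in> A"
  shows "(\<Prod>\<sigma>\<in>gal A. \<sigma> c) \<in> \<rat>"
proof (rule emb_fixed_imp_rational)
  have s: "\<sigma> c \<in> Qbar" if "\<sigma> \<in> gal A" for \<sigma> using that A c by (auto simp: gal_def)
  then show "(\<Prod>\<sigma>\<in>gal A. \<sigma> c) \<in> Qbar" by (intro Qbar_prod) auto
  fix \<tau> assume t: "\<tau> \<in> embeddings Qbar"
  have "\<tau> (\<Prod>\<sigma>\<in>gal A. \<sigma> c) = (\<Prod>\<sigma>\<in>gal A. \<tau> (\<sigma> c))"
    using emb_prod[OF Qbar_subfield t, of "gal A" "\<lambda>\<sigma>. \<sigma> c"] s by auto
  also have "\<dots> = (\<Prod>\<sigma>\<in>gal A. compose A \<tau> \<sigma> c)" using c by (simp add: compose_eq)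
  also have "\<dots> = (\<Prod>\<sigma>\<in>gal A. \<sigma> c)"
    using prod.reindex_bij_betw[OF gal_translate[OF A t], of "\<lambda>\<sigma>. \<sigma> c"] by simp
  finally show "\<tau> (\<Prod>\<sigma>\<in>gal A. \<sigma> c) = (\<Prod>\<sigma>\<in>gal A. \<sigma> c)" .
qed


section \<open>Extension of the p-adic absolute values\<close>

definition alg_subring :: "complex set \<Rightarrow> bool" where
  "alg_subring R \<longleftrightarrow> R \<subseteq> Qbar \<and> 1 \<in> R \<and> (\<forall>x\<in>R. \<forall>y\<in>R. x - y \<in> R \<and> x * y \<in> R)"

lemma alg_subringD:
  assumes "alg_subring R"
  shows "1 \<in> R" "0 \<in> R" "x \<in> R \<Longrightarrow> x \<in> Qbar" "x \<in> R \<Longrightarrow> y \<in> R \<Longrightarrow> x - y \<in> R"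
    "x \<in> R \<Longrightarrow> y \<in> R \<Longrightarrow> x * y \<in> R" "x \<in> R \<Longrightarrow> - x \<in> R" "x \<in> R \<Longrightarrow> y \<in> R \<Longrightarrow> x + y \<in> R"
    "x \<in> R \<Longrightarrow> x ^ n \<in> R" "(\<And>i. i \<in> A \<Longrightarrow> f i \<in> R) \<Longrightarrow> sum f A \<in> R" "of_nat n \<in> R" "of_int k \<in> R"
proof -
  show 1: "1 \<in> R" "x \<in> R \<Longrightarrow> y \<in> R \<Longrightarrow> x - y \<in> R" "x \<in> R \<Longrightarrow> y \<in> R \<Longrightarrow> x * y \<in> R"
    "x \<in> R \<Longrightarrow> x \<in> Qbar" for x y
    using assms unfolding alg_subring_def by auto
  show 0: "0 \<in> R" using 1(1) 1(2)[of 1 1] by simp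
  show m: "x \<in> R \<Longrightarrow> - x \<in> R" for x using 1(2)[OF 0, of x] by simp
  show a: "x \<in> R \<Longrightarrow> y \<in> R \<Longrightarrow> x + y \<in> R" for x y using 1(2)[of x "- y"] m by simp
  show "x \<in> R \<Longrightarrow> x ^ n \<in> R" by (induction n) (use 1 in auto)
  show "(\<And>i. i \<in> A \<Longrightarrow> f i \<in> R) \<Longrightarrow> sum f A \<in> R"
    by (induction A rule: infinite_finite_induct) (use 0 a in auto)
  show nat: "of_nat n \<in> R" for n by (induction n) (use 0 1 a in auto)
  show "of_int k \<in> R" by (cases k rule: int_cases2) (use nat m in auto)
qed

text \<open>\<open>padic_ext\<close> is picked by \<open>SOME\<close>, so the existence of an
  extension must be proved before anything is known about it. A subring maximal for not containing
  \<open>1/p\<close> is shown to be a valuation ring, and its valuation is then realised by real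
  numbers with value 1 at \<open>p\<close>.\<close>

locale max_subring =
  fixes p :: nat and R :: "complex set"
  assumes p: "prime p" and R: "alg_subring R" and pR: "inverse (of_nat p) \<notin> R"
    and maxR: "\<And>R'. alg_subring R' \<Longrightarrow> R \<subseteq> R' \<Longrightarrow> inverse (of_nat p) \<notin> R' \<Longrightarrow> R' = R"
begin

lemmas r = alg_subringD[OF R]

lemma p0: "(of_nat p :: complex) \<noteq> 0" using p by (auto simp: prime_gt_0_nat)

lemma one_not: "x \<in> R \<Longrightarrow> of_nat p * x \<noteq> 1"
  using pR by (metis inverse_unique)

lemma poly_R: "(\<And>i. coeff f i \<in> R) \<Longrightarrow> x \<in> R \<Longrightarrow> poly f x \<in> R"
  by (auto simp: poly_altdef intro!: r)

text \<open>By maximality, adjoining \<open>x\<close> to \<open>R\<close> produces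
  \<open>1/p\<close>.\<close>

lemma adjoin:
  assumes x: "x \<in> Qbar" "x \<notin> R"
  shows "\<exists>f. (\<forall>i. coeff f i \<in> R) \<and> of_nat p * poly f x = 1"
proof -
  define R' where "R' = (\<lambda>f. poly f x) ` {f. \<forall>i. coeff f i \<in> R}"
  have sub: "c \<in> R'" if "c \<in> R" for c
    unfolding R'_def using that r by (intro image_eqI[of _ _ "[:c:]"]) (auto simp: coeff_pCons split: nat.split)
  have xR': "x \<in> R'"
    unfolding R'_def using r by (intro image_eqI[of _ _ "[:0,1:]"]) (auto simp: coeff_pCons split: nat.split)
  have "alg_subring R'"
    unfolding alg_subring_def
  proof (intro conjI ballI)
    show "1 \<in> R'" using sub r by auto
    show "R' \<subseteq> Qbar"
      using r(3) x by (auto simp: R'_def poly_altdef intro!: Qbar_closed)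
    fix a b assume "a \<in> R'" "b \<in> R'"
    then obtain f g where fg: "a = poly f x" "b = poly g x" "\<forall>i. coeff f i \<in> R" "\<forall>i. coeff g i \<in> R"
      by (auto simp: R'_def)
    have "a - b = poly (f - g) x" "\<forall>i. coeff (f - g) i \<in> R"
      "a * b = poly (f * g) x" "\<forall>i. coeff (f * g) i \<in> R" using fg r by (auto simp: coeff_mult intro!: r(9))
    then show "a - b \<in> R'" "a * b \<in> R'" unfolding R'_def by blast+
  qed
  then have "inverse (of_nat p) \<in> R'" using maxR[of R'] sub xR' x by blast
  then obtain f where "\<forall>i. coeff f i \<in> R" "inverse (of_nat p) = poly f x" by (auto simp: R'_def)
  then show ?thesis using p0 by (metis right_inverse)
qed

text \<open>Otherwise \<open>p f(1/u) = 1\<close> for some \<open>f\<close> over \<open>R\<close>,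
  and clearing denominators puts \<open>u ^ k\<close> into \<open>p R\<close>. But
  \<open>u ^ k\<close> is also 1 modulo \<open>p R\<close>, so \<open>p\<close> would be invertible
  in \<open>R\<close>.\<close>

lemma unit_one_minus:
  assumes a: "a \<in> R"
  shows "inverse (1 - of_nat p * a) \<in> R"
proof (rule ccontr)
  define u where "u = 1 - of_nat p * a"
  assume "inverse (1 - of_nat p * a) \<notin> R"
  then have n: "inverse u \<notin> R" by (simp add: u_def)
  have u0: "u \<noteq> 0" using one_not[OF a] by (auto simp: u_def)
  have uR: "u \<in> R" using a r by (auto simp: u_def)
  obtain f where f: "\<And>i. coeff f i \<in> R" "of_nat p * poly f (inverse u) = 1"
    using adjoin[OF _ n] uR r(3) Qbar_inverse by blast
  define k where "k = degree f"
  have "u ^ k * poly f (inverse u) = (\<Sum>i\<le>k. coeff f i * u ^ (k - i))"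
    unfolding poly_altdef k_def sum_distrib_left
  proof (intro sum.cong refl)
    fix i assume "i \<in> {..degree f}"
    then have "u ^ degree f = u ^ (degree f - i) * u ^ i" by (simp flip: power_add)
    then show "u ^ degree f * (coeff f i * inverse u ^ i) = coeff f i * u ^ (degree f - i)"
      using u0 by (simp add: power_inverse)
  qed
  then have 1: "u ^ k * poly f (inverse u) \<in> R" using f uR by (auto intro!: r)
  have "\<exists>b\<in>R. u ^ k = 1 - of_nat p * b"
  proof (induction k)
    case (Suc k)
    then obtain b where b: "b \<in> R" "u ^ k = 1 - of_nat p * b" by auto
    have "u ^ Suc k = 1 - of_nat p * (a + b - of_nat p * (a * b))"
      by (simp add: b(2)) (simp add: u_def algebra_simps)
    moreover have "a + b - of_nat p * (a * b) \<in> R" using a b by (intro r)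
    ultimately show ?case by blast
  qed (use r in \<open>auto intro: bexI[of _ 0]\<close>)
  then obtain b where b: "b \<in> R" "u ^ k = 1 - of_nat p * b" by auto
  have "of_nat p * (b + u ^ k * poly f (inverse u)) = of_nat p * b + u ^ k"
    using f(2) by (simp add: algebra_simps)
  also have "\<dots> = 1" using b by simp
  finally show False using one_not[of "b + u ^ k * poly f (inverse u)"] 1 b r by auto
qed

definition relation :: "complex \<Rightarrow> nat \<Rightarrow> bool" where
  "relation x n \<longleftrightarrow> (\<exists>f. (\<forall>i. coeff f i \<in> R) \<and> degree f \<le> n \<and> of_nat p * poly f x = 1)"

lemma relation_pos:
  assumes "relation x n"
  shows "n > 0"
proof (rule ccontr)
  assume "\<not> n > 0"
  then obtain f where f: "\<And>i. coeff f i \<in> R" "degree f = 0" "of_nat p * poly f x = 1"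
    using assms unfolding relation_def by auto
  obtain c where "f = [:c:]" using f(2) by (rule degree_eq_zeroE)
  then show False using f(1)[of 0] f(3) one_not[of c] by simp
qed

text \<open>The relation for \<open>1/x\<close>, times \<open>x ^ n\<close>, reads
  \<open>(1 - p b0) x ^ n = p C(x)\<close> with \<open>C\<close> of degree below \<open>n\<close>.
  As \<open>1 - p b0\<close> is a unit, this rewrites the leading term of the relation for
  \<open>x\<close> in lower degree. Applied to relations of least degree it shows that
  \<open>x\<close> and \<open>1/x\<close> cannot both lie outside \<open>R\<close>.\<close>

lemma relation_reduce:
  assumes x: "x \<noteq> 0" and 1: "relation x n" and 2: "relation (inverse x) m" and mn: "m \<le> n"
  shows "relation x (n - 1)"
proof -
  have m0: "m > 0" and n0: "n > 0" using relation_pos 1 2 by auto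
  obtain a where a: "\<And>i. coeff a i \<in> R" "degree a \<le> n" "of_nat p * poly a x = 1"
    using 1 unfolding relation_def by blast
  obtain b where b: "\<And>i. coeff b i \<in> R" "degree b \<le> m" "of_nat p * poly b (inverse x) = 1"
    using 2 unfolding relation_def by blast
  obtain b0 b' where b': "b = pCons b0 b'" by (cases b)
  have b0: "b0 \<in> R" and b'R: "coeff b' i \<in> R" for i
    using b(1)[of 0] b(1)[of "Suc i"] by (auto simp: b')
  have db': "degree b' \<le> m - 1" using b(2) by (cases "b' = 0") (auto simp: b')
  define u where "u = 1 - of_nat p * b0"
  have u0: "u \<noteq> 0" using one_not[OF b0] by (auto simp: u_def)
  have iu: "inverse u \<in> R" using unit_one_minus[OF b0] by (simp add: u_def)
  define C where "C = (\<Sum>j\<le>m-1. monom (coeff b' j) (n - 1 - j))"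
  have dC: "degree C \<le> n - 1"
    unfolding C_def by (rule degree_sum_le) (auto intro: order.trans[OF degree_monom_le])
  have CR: "coeff C i \<in> R" for i
    unfolding C_def coeff_sum using b'R r by (auto intro!: r(9))
  have polyb': "poly b' y = (\<Sum>j\<le>m-1. coeff b' j * y ^ j)" for y
    unfolding poly_altdef using db' by (intro sum.mono_neutral_left) (auto simp: coeff_eq_0)
  have "x ^ n * (inverse x * poly b' (inverse x)) = x ^ (n - 1) * poly b' (inverse x)"
    using x n0 by (cases n) auto
  also have "\<dots> = poly C x"
    unfolding polyb' C_def poly_sum sum_distrib_left
  proof (intro sum.cong refl)
    fix j assume "j \<in> {..m-1}"
    then have "j \<le> n - 1" using mn by auto
    then have "x ^ (n - 1) = x ^ j * x ^ (n - 1 - j)" by (metis le_add_diff_inverse power_add)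
    then show "x ^ (n - 1) * (coeff b' j * inverse x ^ j) = poly (monom (coeff b' j) (n - 1 - j)) x"
      using x by (simp add: poly_monom power_diff power_inverse field_simps)
  qed
  finally have c: "x ^ n * (inverse x * poly b' (inverse x)) = poly C x" .
  have "u = of_nat p * (inverse x * poly b' (inverse x))"
    using b(3) by (simp add: u_def b' algebra_simps)
  then have "x ^ n * u = of_nat p * poly C x" using c by (metis mult.left_commute)
  then have xn: "x ^ n = of_nat p * inverse u * poly C x" using u0 by (simp add: field_simps)
  define a' where "a' = a - monom (coeff a n) n"
  have da': "degree a' \<le> n - 1"
  proof (rule degree_le, intro allI impI)
    fix i assume "n - 1 < i"
    then show "coeff a' i = 0" using a(2) by (cases "i = n") (auto simp: a'_def coeff_eq_0)
  qed
  define s where "s = coeff a n * of_nat p * inverse u"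
  have sR: "s \<in> R" using a(1) iu r by (auto simp: s_def)
  define f where "f = a' + smult s C"
  have "\<forall>i. coeff f i \<in> R" using a(1) sR CR by (auto simp: f_def a'_def coeff_monom intro!: r)
  moreover have "degree f \<le> n - 1" unfolding f_def
    using da' dC by (intro degree_add_le) (auto intro: order.trans[OF degree_smult_le])
  moreover have "poly f x = poly a x"
    by (simp add: f_def a'_def poly_monom xn s_def)
  ultimately show ?thesis using a(3) unfolding relation_def by auto
qed

lemma valuation_ring:
  assumes x: "x \<in> Qbar" "x \<noteq> 0"
  shows "x \<in> R \<or> inverse x \<in> R"
proof (rule ccontr)
  assume neg: "\<not> (x \<in> R \<or> inverse x \<in> R)"
  define n where "n = (LEAST n. relation x n)"
  define m where "m = (LEAST n. relation (inverse x) n)"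
  have "\<exists>n. relation x n" "\<exists>n. relation (inverse x) n"
    using adjoin[of x] adjoin[of "inverse x"] neg x Qbar_inverse unfolding relation_def by auto
  then have nm: "relation x n" "relation (inverse x) m" unfolding n_def m_def by (auto intro: LeastI_ex)
  have "n > 0" "m > 0" using relation_pos nm by auto
  have "\<not> relation x (n - 1)" using \<open>n > 0\<close> not_less_Least[of "n - 1" "relation x"] by (simp add: n_def[symmetric])
  moreover have "\<not> relation (inverse x) (m - 1)"
    using \<open>m > 0\<close> not_less_Least[of "m - 1" "relation (inverse x)"] by (simp add: m_def[symmetric])
  ultimately show False
    using relation_reduce[OF x(2) nm] relation_reduce[of "inverse x" m n] nm x by (cases "m \<le> n") auto
qed

lemma root_closed:
  assumes x: "x \<in> Qbar" and k: "k > 0" "x ^ k \<in> R"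
  shows "x \<in> R"
proof (rule ccontr)
  assume n: "x \<notin> R"
  then have "x \<noteq> 0" using r by auto
  then have i: "inverse x \<in> R" using valuation_ring x n by auto
  obtain j where j: "k = Suc j" using k by (cases k) auto
  have "x ^ k * inverse x ^ j \<in> R" by (rule r(5)[OF k(2) r(8)[OF i]])
  moreover have "x ^ k * inverse x ^ j = x" using \<open>x \<noteq> 0\<close> by (simp add: j power_inverse field_simps)
  ultimately show False using n by simp
qed

section \<open>The real valuation of a maximal subring\<close>

definition pp :: "int \<Rightarrow> complex" where "pp m = of_nat p powi m"

lemma pp: "pp 0 = 1" "pp (m + n) = pp m * pp n" "pp m \<noteq> 0" "pp 1 = of_nat p" "pp (- m) = inverse (pp m)"
  "pp (int k) = of_nat p ^ k" "pp m ^ k = pp (m * int k)" "pp m \<in> Qbar"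
proof -
  show "pp m \<in> Qbar" by (auto simp: pp_def power_int_def intro!: Qbar_closed)
qed (use p0 in \<open>auto simp: pp_def power_int_add power_int_minus power_int_mult power_int_power\<close>)

lemma pp_in: "m \<ge> 0 \<Longrightarrow> pp m \<in> R"
  using pp(6)[of "nat m"] r(8)[OF r(10)] by simp

lemma pp_in_iff: "pp m \<in> R \<longleftrightarrow> m \<ge> 0"
proof
  assume a: "pp m \<in> R"
  show "m \<ge> 0"
  proof (rule ccontr)
    assume "\<not> m \<ge> 0"
    then have "pp (- m - 1) * pp m \<in> R" using a pp_in by (intro r) auto
    then have "pp (- 1) \<in> R" by (simp flip: pp(2))
    then show False using pR pp(4,5) by simp
  qed
qed (rule pp_in)

text \<open>A fraction \<open>m / n\<close> is to be at most the valuation of \<open>x\<close>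
  exactly when \<open>x ^ n / p ^ m\<close> is integral: \<open>L x\<close> is the lower cut of that
  real number within the rationals.\<close>

definition L :: "complex \<Rightarrow> real set" where
  "L x = {of_int m / of_nat n | m n. n > 0 \<and> x ^ n * pp (- m) \<in> R}"

text \<open>The condition depends only on the value of the fraction: after cross-multiplication the
  two elements have equal powers, and \<open>R\<close> contains every algebraic number with a
  positive power in \<open>R\<close>.\<close>

lemma L_iff:
  assumes x: "x \<in> Qbar" and n: "n > 0"
  shows "of_int m / of_nat n \<in> L x \<longleftrightarrow> x ^ n * pp (- m) \<in> R"
proof
  assume "of_int m / of_nat n \<in> L x"
  then obtain m' n' where mn: "n' > 0" "x ^ n' * pp (- m') \<in> R" "of_int m / real n = of_int m' / real n'"
    by (auto simp: L_def)
  have "real_of_int (m * int n') = real_of_int (m' * int n)" using mn n by (simp add: field_simps)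
  then have eq: "m * int n' = m' * int n" by linarith
  have "(x ^ n * pp (- m)) ^ n' = (x ^ n' * pp (- m')) ^ n"
    by (simp add: power_mult_distrib pp(7) eq flip: power_mult) (simp add: mult.commute)
  then have "(x ^ n * pp (- m)) ^ n' \<in> R" using mn by (metis r(8))
  moreover have "x ^ n * pp (- m) \<in> Qbar" by (intro Qbar_closed x pp(8))
  ultimately show "x ^ n * pp (- m) \<in> R" using root_closed mn(1) by blast
qed (use n in \<open>auto simp: L_def\<close>)

lemma L_total:
  assumes x: "x \<in> Qbar" "x \<noteq> 0" and n: "n > 0" and a: "of_int m / of_nat n \<notin> L x"
  shows "- (of_int m / of_nat n) \<in> L (inverse x)"
proof -
  have "inverse (x ^ n * pp (- m)) \<in> R"
    using valuation_ring[of "x ^ n * pp (- m)"] a L_iff[OF x(1) n] x pp(3,8) by (auto intro: Qbar_closed)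
  then have "inverse x ^ n * pp (- (- m)) \<in> R" by (simp add: pp(5) power_inverse)
  then show ?thesis using L_iff[OF Qbar_inverse[OF x(1)] n, of "- m"] by simp
qed

lemma L_add:
  assumes x: "x \<in> Qbar" "y \<in> Qbar" and a: "a \<in> L x" "b \<in> L y"
  shows "a + b \<in> L (x * y)"
proof -
  obtain m n where mn: "n > 0" "x ^ n * pp (- m) \<in> R" "a = of_int m / real n"
    using a by (auto simp: L_def)
  obtain m' n' where mn': "n' > 0" "y ^ n' * pp (- m') \<in> R" "b = of_int m' / real n'"
    using a by (auto simp: L_def)
  have "(x ^ n * pp (- m)) ^ n' * (y ^ n' * pp (- m')) ^ n \<in> R" by (rule r(5)[OF r(8)[OF mn(2)] r(8)[OF mn'(2)]])
  also have "(x ^ n * pp (- m)) ^ n' * (y ^ n' * pp (- m')) ^ n = (x * y) ^ (n * n') * pp (- (m * int n' + m' * int n))"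
  proof -
    have "pp (- (m * int n' + m' * int n)) = pp (- m * int n') * pp (- m' * int n)"
      by (simp flip: pp(2))
    moreover have "(x ^ n * pp (- m)) ^ n' = x ^ (n * n') * pp (- m * int n')"
      by (simp add: power_mult_distrib pp(7) power_mult)
    moreover have "(y ^ n' * pp (- m')) ^ n = y ^ (n * n') * pp (- m' * int n)"
      by (simp add: power_mult_distrib pp(7) power_mult mult.commute[of n])
    ultimately show ?thesis by (simp add: power_mult_distrib mult_ac)
  qed
  finally have "of_int (m * int n' + m' * int n) / of_nat (n * n') \<in> L (x * y)"
    using mn mn' by (subst L_iff) (auto intro: Qbar_closed x)
  also have "real_of_int (m * int n' + m' * int n) / of_nat (n * n') = a + b"
    using mn mn' by (simp add: field_simps)
  finally show ?thesis .
qed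

text \<open>If no \<open>- M\<close> were in \<open>L x\<close>, then \<open>1/x\<close> would be
  divisible by every power of \<open>p\<close>, and so would the nonzero constant term
  \<open>c\<close> of an integer equation of \<open>1/x\<close>. An integer cannot be: Bezout for
  \<open>p\<close> and the part of \<open>c\<close> prime to \<open>p\<close> would put
  \<open>1/p\<close> into \<open>R\<close>. This is where algebraicity forces the valuation to have
  rank one.\<close>

lemma L_lower:
  assumes x: "x \<in> Qbar" "x \<noteq> 0"
  shows "\<exists>M::nat. - real M \<in> L x"
proof (rule ccontr)
  assume neg: "\<not> (\<exists>M::nat. - real M \<in> L x)"
  define y where "y = inverse x"
  have y: "y \<in> Qbar" "y \<noteq> 0" using x Qbar_inverse by (auto simp: y_def)
  have yM: "y * pp (- int M) \<in> R" for M
  proof -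
    have "of_int (- int M) / of_nat 1 \<notin> L x" using neg by auto
    from L_total[OF x _ this] have "of_int (int M) / of_nat 1 \<in> L y" by (simp add: y_def)
    then show ?thesis by (subst (asm) L_iff) (use y in auto)
  qed
  have "algebraic y" using y by (simp add: Qbar_def)
  then obtain f where f: "coeff f 0 \<noteq> 0" "poly (map_poly complex_of_int f) y = 0"
    using algebraicE'_nonzero[of y] y by metis
  obtain c g where cg: "f = pCons c g" by (cases f)
  have c0: "c \<noteq> 0" using f cg by auto
  have "y \<in> R" using yM[of 0] pp by simp
  then have gR: "poly (map_poly complex_of_int g) y \<in> R" by (intro poly_R) (auto simp: coeff_map_poly r)
  have eq: "of_int c = - (y * poly (map_poly complex_of_int g) y)"
    using f c0 by (auto simp: cg map_poly_pCons add_eq_0_iff2)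
  have all: "of_int c * pp (- int M) \<in> R" for M
  proof -
    have "- (y * pp (- int M) * poly (map_poly complex_of_int g) y) \<in> R" by (rule r(6)[OF r(5)[OF yM gR]])
    then show ?thesis unfolding eq by (simp add: mult_ac)
  qed
  define k where "k = nat \<bar>c\<bar>"
  have "of_int c * pp (- int k) \<in> R" by (rule all)
  define e where "e = multiplicity (int p) c"
  have ip: "prime (int p)" using p by simp
  obtain c' where c': "c = int p ^ e * c'" "\<not> int p dvd c'"
    using multiplicity_decompose'[of c "int p"] c0 ip not_prime_unit[of "int p"] unfolding e_def by blast
  have "coprime (int p) c'" using ip c' by (simp add: prime_imp_coprime)
  then obtain u v where uv: "u * int p + v * c' = 1" using bezout_int[of "int p" c'] by (auto simp: coprime_iff_gcd_eq_1)
  have "of_int c * pp (- int (Suc e)) = of_int c' * inverse (of_nat p)"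
    using p0 pp(5)[of "int (Suc e)"] pp(6)[of "Suc e"] by (simp add: c' field_simps del: of_nat_Suc)
  then have "of_int c' * inverse (of_nat p) \<in> R" using all by metis
  then have "of_int v * (of_int c' * inverse (of_nat p)) + of_int u \<in> R" by (intro r(7)[OF r(5)[OF r(11)] r(11)])
  moreover have "of_int v * (of_int c' * inverse (of_nat p)) + of_int u = (inverse (of_nat p) :: complex)"
  proof -
    have "of_int u * of_nat p + of_int v * of_int c' = (1 :: complex)"
      using arg_cong[OF uv, of complex_of_int] by simp
    then show ?thesis using p0 by (simp add: field_simps)
  qed
  ultimately show False using pR by simp
qed

lemma L_upper:
  assumes x: "x \<in> Qbar" "x \<noteq> 0"
  shows "\<exists>M::nat. \<forall>a\<in>L x. a \<le> real M"
proof -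
  obtain M :: nat where M: "- real M \<in> L (inverse x)" using L_lower[of "inverse x"] x Qbar_inverse by auto
  have "a \<le> real M" if a: "a \<in> L x" for a
  proof -
    have "a + - real M \<in> L (x * inverse x)" using L_add[OF _ _ a M] x Qbar_inverse by blast
    then obtain m n where mn: "n > 0" "1 ^ n * pp (- m) \<in> R" "a + - real M = of_int m / real n"
      using x by (auto simp: L_def)
    then have "m \<le> 0" using pp_in_iff[of "- m"] by simp
    then have "of_int m / real n \<le> 0" by (simp add: divide_nonpos_nonneg)
    then show ?thesis using mn by simp
  qed
  then show ?thesis by blast
qed

definition v :: "complex \<Rightarrow> real" where "v x = Sup (L x)"

lemma L_bdd: "x \<in> Qbar \<Longrightarrow> x \<noteq> 0 \<Longrightarrow> bdd_above (L x)" "x \<in> Qbar \<Longrightarrow> x \<noteq> 0 \<Longrightarrow> L x \<noteq> {}"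
  unfolding bdd_above_def using L_upper L_lower by blast+

lemma v_ge: "x \<in> Qbar \<Longrightarrow> x \<noteq> 0 \<Longrightarrow> a \<in> L x \<Longrightarrow> a \<le> v x"
  unfolding v_def using L_bdd by (intro cSup_upper) auto

lemma v_ge0: "x \<in> R \<Longrightarrow> x \<noteq> 0 \<Longrightarrow> v x \<ge> 0"
  using v_ge[of x 0] r(3) L_iff[of x 1 0] pp by auto

lemma v_mult_ge:
  assumes x: "x \<in> Qbar" "x \<noteq> 0" "y \<in> Qbar" "y \<noteq> 0"
  shows "v (x * y) \<ge> v x + v y"
proof -
  have xy: "x * y \<in> Qbar" "x * y \<noteq> 0" using x by (auto intro: Qbar_closed)
  have "a \<le> v (x * y) - v y" if a: "a \<in> L x" for a
  proof -
    have "b \<le> v (x * y) - a" if b: "b \<in> L y" for b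
      using v_ge[OF xy L_add[OF x(1,3) a b]] by simp
    then have "v y \<le> v (x * y) - a" unfolding v_def[of y] using L_bdd x by (intro cSup_least) auto
    then show ?thesis by simp
  qed
  then have "v x \<le> v (x * y) - v y" unfolding v_def[of x] using L_bdd x by (intro cSup_least) auto
  then show ?thesis by simp
qed

lemma v_one: "v 1 = 0"
proof -
  have "a \<le> 0" if "a \<in> L 1" for a
    using that pp_in_iff by (auto simp: L_def divide_nonpos_nonneg)
  then have "v 1 \<le> 0" unfolding v_def using L_bdd[of 1] by (intro cSup_least) auto
  then show ?thesis using v_ge0[of 1] r by simp
qed

text \<open>A rational \<open>q\<close> strictly between \<open>v x\<close> and
  \<open>- v (inverse x)\<close> would not lie in \<open>L x\<close>, so by \<open>L_total\<close>
  its negative would lie in \<open>L (inverse x)\<close>, above the supremum.\<close>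

lemma v_inverse:
  assumes x: "x \<in> Qbar" "x \<noteq> 0"
  shows "v (inverse x) = - v x"
proof -
  have ix: "inverse x \<in> Qbar" "inverse x \<noteq> 0" using x Qbar_inverse by auto
  have "v x + v (inverse x) \<le> 0" using v_mult_ge[OF x ix] x v_one by simp
  moreover have "- v (inverse x) \<le> v x"
  proof (rule ccontr)
    assume "\<not> - v (inverse x) \<le> v x"
    then obtain q where q: "v x < of_rat q" "of_rat q < - v (inverse x)" using of_rat_dense[of "v x" "- v (inverse x)"] \<open>\<not> - v (inverse x) \<le> v x\<close> by auto
    obtain m n where mn: "(of_rat q :: real) = of_int m / real n" "n > 0"
    proof -
      obtain a b where ab: "q = Rat.Fract a b" "b > 0" by (cases q) auto
      then have "(of_rat q :: real) = of_int a / real (nat b)" by (simp add: of_rat_rat)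
      then show ?thesis using ab by (intro that[of a "nat b"]) auto
    qed
    have "of_rat q \<notin> L x" using v_ge[OF x, of "of_rat q"] q(1) by linarith
    then have "of_int m / of_nat n \<notin> L x" by (simp only: mn(1) not_False_eq_True)
    then have "- of_rat q \<in> L (inverse x)" using L_total[OF x mn(2)] by (simp only: mn(1))
    then show False using v_ge[OF ix, of "- of_rat q"] q by simp
  qed
  ultimately show ?thesis by simp
qed

lemma v_mult:
  assumes x: "x \<in> Qbar" "x \<noteq> 0" "y \<in> Qbar" "y \<noteq> 0"
  shows "v (x * y) = v x + v y"
proof -
  have "v (x * y * inverse y) \<ge> v (x * y) + v (inverse y)"
    using x by (intro v_mult_ge) (auto intro: Qbar_closed)
  moreover have "x * y * inverse y = x" using x by simp
  ultimately show ?thesis using v_mult_ge[OF x] v_inverse[OF x(3,4)] by simp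
qed

lemma v_add:
  assumes x: "x \<in> Qbar" "x \<noteq> 0" "y \<in> Qbar" "y \<noteq> 0" "x + y \<noteq> 0"
  shows "v (x + y) \<ge> min (v x) (v y)"
proof -
  have *: "v (x + y) \<ge> v x" if x: "x \<in> Qbar" "x \<noteq> 0" "x + y \<noteq> 0" and yx: "y / x \<in> R" for x y
  proof -
    have e: "x + y = x * (1 + y / x)" using x by (simp add: field_simps)
    have R1: "1 + y / x \<in> R" using yx by (intro r)
    have n0: "1 + y / x \<noteq> 0" using e x by auto
    have "v (x + y) = v x + v (1 + y / x)" using v_mult[of x "1 + y / x"] e x n0 r(3)[OF R1] by simp
    then show ?thesis using v_ge0[OF R1 n0] by simp
  qed
  have "y / x \<in> R \<or> x / y \<in> R"
    using valuation_ring[of "y / x"] x by (auto intro: Qbar_closed)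
  then show ?thesis
  proof
    assume "y / x \<in> R"
    then show ?thesis using *[of x y] x by simp
  next
    assume "x / y \<in> R"
    then have "v (y + x) \<ge> v y" using x by (intro *) (simp_all add: add.commute[of y x])
    then show ?thesis by (simp add: add.commute[of y x])
  qed
qed

lemma v_p: "v (of_nat p) = 1"
proof -
  have "a \<le> 1" if a: "a \<in> L (of_nat p)" for a
  proof -
    obtain m n where mn: "n > 0" "of_nat p ^ n * pp (- m) \<in> R" "a = of_int m / real n"
      using a by (auto simp: L_def)
    then have "pp (int n + - m) \<in> R" by (simp only: pp(2) pp(6))
    then have "m \<le> int n" using pp_in_iff by auto
    then show ?thesis using mn by simp
  qed
  then have "v (of_nat p) \<le> 1" unfolding v_def using L_bdd[of "of_nat p"] p0 by (intro cSup_least) auto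
  moreover have "of_int 1 / of_nat 1 \<in> L (of_nat p)"
    using pp(4) pp(5)[of 1] p0 r(1) by (subst L_iff) auto
  ultimately show ?thesis using v_ge[of "of_nat p" 1] p0 by simp
qed

text \<open>Bezout gives \<open>s p + t c' = 1\<close> for the part \<open>c'\<close> of
  \<open>c\<close> prime to \<open>p\<close>; then \<open>t c' = 1 - p s\<close> is a unit by
  \<open>unit_one_minus\<close>, so \<open>c'\<close> has valuation zero.\<close>

lemma v_int:
  assumes "c \<noteq> 0"
  shows "v (of_int c) = real (multiplicity (int p) c)"
proof -
  define e where "e = multiplicity (int p) c"
  have ip: "prime (int p)" using p by simp
  obtain c' where c': "c = int p ^ e * c'" "\<not> int p dvd c'"
    using multiplicity_decompose'[of c "int p"] assms ip not_prime_unit[of "int p"] unfolding e_def by blast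
  have c'0: "c' \<noteq> 0" using c' by auto
  have "coprime (int p) c'" using ip c' by (simp add: prime_imp_coprime)
  then obtain s t where uv: "s * int p + t * c' = 1" using bezout_int[of "int p" c'] by (auto simp: coprime_iff_gcd_eq_1)
  have st: "of_int s * of_nat p + of_int t * of_int c' = (1 :: complex)"
    using arg_cong[OF uv, of complex_of_int] by simp
  have "inverse (1 - of_nat p * of_int s) \<in> R" by (intro unit_one_minus r)
  moreover have "(1 - of_nat p * of_int s :: complex) = of_int t * of_int c'"
    using st by (simp add: algebra_simps)
  ultimately have "inverse (of_int t * of_int c') \<in> R" by simp
  then have "of_int t * inverse (of_int t * of_int c') \<in> R" by (intro r)
  moreover have "t \<noteq> 0"
  proof
    assume "t = 0"
    then have "int p dvd 1" using uv dvd_triv_right[of "int p" s] by simp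
    then show False using ip not_prime_unit by blast
  qed
  ultimately have "inverse (of_int c') \<in> R" using c'0 by (simp add: field_simps)
  then have "v (inverse (of_int c')) \<ge> 0" using c'0 by (intro v_ge0) auto
  moreover have "v (of_int c') \<ge> 0" using c'0 r by (intro v_ge0) auto
  ultimately have vc': "v (of_int c') = 0" using v_inverse[of "of_int c'"] c'0 by simp
  have vp: "v (of_nat p ^ k) = real k" for k
  proof (induction k)
    case (Suc k)
    then show ?case using v_mult[of "of_nat p" "of_nat p ^ k"] p0 v_p by (simp add: Qbar_power)
  qed (use v_one in simp)
  have "v (of_int c) = v (of_nat p ^ e * of_int c')" by (simp add: c')
  also have "\<dots> = real e" using v_mult[of "of_nat p ^ e" "of_int c'"] vp vc' p0 c'0 by (simp add: Qbar_power)
  finally show ?thesis by (simp add: e_def)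
qed

lemma abs_exists: "\<exists>w. absolute_value_on Qbar w \<and> (\<forall>q. w (of_rat q) = padic_abs p q)"
proof -
  define w where "w = (\<lambda>x. if x = 0 then 0 else real p powr (- v x))"
  have p1: "real p > 1" using prime_gt_1_nat[OF p] by simp
  have w0: "w x \<ge> 0" "w x = 0 \<longleftrightarrow> x = 0" for x using p1 by (auto simp: w_def)
  have wm: "w (x * y) = w x * w y" if "x \<in> Qbar" "y \<in> Qbar" for x y
    using v_mult[of x y] that by (auto simp: w_def powr_add[symmetric])
  have wa: "w (x + y) \<le> w x + w y" if xy: "x \<in> Qbar" "y \<in> Qbar" for x y
  proof (cases "x = 0 \<or> y = 0 \<or> x + y = 0")
    case True then show ?thesis using w0 by (auto simp: w_def)
  next
    case False
    then have "min (v x) (v y) \<le> v (x + y)" using v_add[of x y] xy by auto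
    then have "w (x + y) \<le> real p powr (- min (v x) (v y))" using p1 False by (simp add: w_def)
    also have "\<dots> \<le> w x + w y" using False by (auto simp: w_def min_def)
    finally show ?thesis .
  qed
  have "w (of_rat q) = padic_abs p q" for q
  proof (cases "q = 0")
    case False
    obtain a b where ab: "quotient_of q = (a, b)" by fastforce
    then have q: "q = of_int a / of_int b" "b > 0" by (auto simp: quotient_of_div quotient_of_denom_pos)
    then have a0: "a \<noteq> 0" using False by auto
    have "(of_rat q :: complex) = of_int a / of_int b" by (simp add: q of_rat_divide)
    then have "(of_rat q :: complex) = of_int a * inverse (of_int b)" by (simp add: divide_inverse)
    then have "v (of_rat q) = v (of_int a) - v (of_int b)"
      using v_mult[of "of_int a" "inverse (of_int b)"] v_inverse[of "of_int b"] a0 q by (simp add: Qbar_inverse)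
    also have "\<dots> = real_of_int (int (multiplicity (int p) a) - int (multiplicity (int p) b))"
      using a0 q by (simp add: v_int)
    finally have "- v (of_rat q) = real_of_int (int (multiplicity (int p) b) - int (multiplicity (int p) a))" by simp
    then have "w (of_rat q) = real p powr real_of_int (int (multiplicity (int p) b) - int (multiplicity (int p) a))"
      using False by (simp only: w_def) simp
    also have "\<dots> = real p powi (int (multiplicity (int p) b) - int (multiplicity (int p) a))"
      using p1 by (subst powr_real_of_int') auto
    finally show ?thesis using False ab by (simp add: padic_abs_def)
  qed (auto simp: w_def padic_abs_def)
  then show ?thesis using w0 wm wa unfolding absolute_value_on_def by blast
qed

end

lemma max_subring_exists:
  assumes p: "prime p"
  shows "\<exists>R. max_subring p R"
proof -
  define A where "A = {R. alg_subring R \<and> inverse (of_nat p) \<notin> R}"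
  have "range of_int \<in> A"
  proof -
    have "inverse (of_nat p) \<noteq> (of_int k :: complex)" for k
    proof
      assume "inverse (of_nat p) = (of_int k :: complex)"
      then have "of_int (int p * k) = (of_int 1 :: complex)" using p by (simp add: field_simps prime_gt_0_nat)
      then have "int p * k = 1" by (simp only: of_int_eq_iff)
      then have "int p dvd 1" using dvd_triv_left[of "int p" k] by simp
      moreover have "prime (int p)" using p by simp
      ultimately show False using not_prime_unit by blast
    qed
    moreover have "alg_subring (range of_int)"
      unfolding alg_subring_def
    proof (intro conjI ballI)
      show "(1 :: complex) \<in> range of_int" by (rule range_eqI[of _ _ 1]) simp
      fix x y :: complex assume "x \<in> range of_int" "y \<in> range of_int"
      then obtain k l where "x = of_int k" "y = of_int l" by blast
      then have "x - y = of_int (k - l)" "x * y = of_int (k * l)" by auto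
      then show "x - y \<in> range of_int" "x * y \<in> range of_int" by blast+
    qed auto
    ultimately show ?thesis by (auto simp: A_def)
  qed
  moreover have "\<Union>C \<in> A" if C: "C \<noteq> {}" "subset.chain A C" for C
  proof -
    have CA: "X \<in> A" if "X \<in> C" for X using C that by (auto simp: subset.chain_def)
    have "x - y \<in> \<Union>C \<and> x * y \<in> \<Union>C" if xy: "x \<in> \<Union>C" "y \<in> \<Union>C" for x y
    proof -
      obtain X Y where "X \<in> C" "Y \<in> C" "x \<in> X" "y \<in> Y" using xy by auto
      then obtain Z where Z: "Z \<in> C" "x \<in> Z" "y \<in> Z" using C(2) unfolding subset.chain_def by blast
      then show ?thesis using CA[OF Z(1)] unfolding A_def alg_subring_def by blast
    qed
    moreover have "1 \<in> \<Union>C" using C CA unfolding A_def alg_subring_def by blast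
    moreover have "\<Union>C \<subseteq> Qbar" using CA unfolding A_def alg_subring_def by blast
    ultimately have "alg_subring (\<Union>C)" unfolding alg_subring_def by blast
    then show ?thesis using CA unfolding A_def by blast
  qed
  ultimately obtain M where M: "M \<in> A" "\<And>X. X \<in> A \<Longrightarrow> M \<subseteq> X \<Longrightarrow> X = M"
    using subset_Zorn_nonempty[of A] by blast
  then have "max_subring p M" using p by unfold_locales (auto simp: A_def)
  then show ?thesis by blast
qed

lemma padic_ext_props:
  assumes "prime p"
  shows "absolute_value_on Qbar (padic_ext p)" "padic_ext p (of_rat q) = padic_abs p q"
proof -
  obtain R where "max_subring p R" using max_subring_exists[OF assms] by blast
  then have "\<exists>w. absolute_value_on Qbar w \<and> (\<forall>q. w (of_rat q) = padic_abs p q)"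
    by (rule max_subring.abs_exists)
  then have "absolute_value_on Qbar (padic_ext p) \<and> (\<forall>q. padic_ext p (of_rat q) = padic_abs p q)"
    unfolding padic_ext_def by (rule someI_ex)
  then show "absolute_value_on Qbar (padic_ext p)" "padic_ext p (of_rat q) = padic_abs p q" by auto
qed


section \<open>Places and the product formula\<close>

text \<open>Serves to sharpen the triangle inequality to the ultrametric one by comparing
  \<open>n\<close>-th powers.\<close>

lemma le_one_if_power_le_linear:
  fixes t :: real
  assumes t: "t \<ge> 0" and le: "\<And>n. t ^ n \<le> real n + 1"
  shows "t \<le> 1"
proof (rule ccontr)
  assume "\<not> t \<le> 1"
  then have t1: "t > 1" by simp
  have "(\<lambda>n. real n / t ^ n + inverse t ^ n) \<longlonglongrightarrow> 0 + 0"
    using t1 by (intro tendsto_add lim_n_over_pown LIMSEQ_power_zero) (auto simp: inverse_less_1_iff)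
  moreover have "1 \<le> real n / t ^ n + inverse t ^ n" for n
    using le[of n] t1 by (simp add: field_simps power_inverse)
  ultimately have "(1::real) \<le> 0 + 0" by (intro LIMSEQ_le_const) auto
  then show False by simp
qed

lemma abs_valueD:
  assumes "absolute_value_on Qbar w"
  shows "x \<in> Qbar \<Longrightarrow> w x \<ge> 0" "x \<in> Qbar \<Longrightarrow> w x = 0 \<longleftrightarrow> x = 0"
    "x \<in> Qbar \<Longrightarrow> y \<in> Qbar \<Longrightarrow> w (x * y) = w x * w y"
    "x \<in> Qbar \<Longrightarrow> y \<in> Qbar \<Longrightarrow> w (x + y) \<le> w x + w y"
    "w 1 = 1" "w 0 = 0" "x \<in> Qbar \<Longrightarrow> w (- x) = w x" "x \<in> Qbar \<Longrightarrow> w (inverse x) = inverse (w x)"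
    "x \<in> Qbar \<Longrightarrow> w (x ^ n) = w x ^ n" "(\<And>i. i \<in> A \<Longrightarrow> f i \<in> Qbar) \<Longrightarrow> w (prod f A) = (\<Prod>i\<in>A. w (f i))"
    "(\<And>i. i \<in> A \<Longrightarrow> f i \<in> Qbar) \<Longrightarrow> w (sum f A) \<le> (\<Sum>i\<in>A. w (f i))"
    "x \<in> Qbar \<Longrightarrow> x \<noteq> 0 \<Longrightarrow> w x > 0"
proof -
  show 1: "x \<in> Qbar \<Longrightarrow> w x \<ge> 0" "x \<in> Qbar \<Longrightarrow> w x = 0 \<longleftrightarrow> x = 0"
    "x \<in> Qbar \<Longrightarrow> y \<in> Qbar \<Longrightarrow> w (x * y) = w x * w y"
    "x \<in> Qbar \<Longrightarrow> y \<in> Qbar \<Longrightarrow> w (x + y) \<le> w x + w y" for x y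
    using assms unfolding absolute_value_on_def by auto
  show one: "w 1 = 1" using 1(2)[of 1] 1(3)[of 1 1] by simp
  show zero: "w 0 = 0" using 1(2)[of 0] by simp
  have "w (- 1) * w (- 1) = 1" using 1(3)[of "- 1" "- 1"] one by (simp add: Qbar_uminus)
  then have "(w (- 1) - 1) * (w (- 1) + 1) = 0" by (simp add: algebra_simps)
  then have m1: "w (- 1) = 1" using 1(1)[of "- 1"] by (auto simp: Qbar_uminus)
  show "x \<in> Qbar \<Longrightarrow> w (- x) = w x" using 1(3)[of "- 1" x] m1 by (simp add: Qbar_uminus)
  show "w (inverse x) = inverse (w x)" if "x \<in> Qbar"
  proof (cases "x = 0")
    case False
    then have "w x * w (inverse x) = 1" using 1(3)[of x "inverse x"] that one by (simp add: Qbar_inverse)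
    then show ?thesis by (metis inverse_unique)
  qed (use zero in simp)
  show "x \<in> Qbar \<Longrightarrow> w (x ^ n) = w x ^ n" by (induction n) (auto simp: one 1(3) Qbar_power)
  show "(\<And>i. i \<in> A \<Longrightarrow> f i \<in> Qbar) \<Longrightarrow> w (prod f A) = (\<Prod>i\<in>A. w (f i))"
    by (induction A rule: infinite_finite_induct) (auto simp: one 1(3) Qbar_prod)
  show "w (sum f A) \<le> (\<Sum>i\<in>A. w (f i))" if "\<And>i. i \<in> A \<Longrightarrow> f i \<in> Qbar"
    using that
  proof (induction A rule: infinite_finite_induct)
    case (insert x F)
    then have "w (f x + sum f F) \<le> w (f x) + w (sum f F)" by (intro 1(4) Qbar_sum) auto
    then show ?case using insert by fastforce
  qed (auto simp: zero)
  show "x \<in> Qbar \<Longrightarrow> x \<noteq> 0 \<Longrightarrow> w x > 0" using 1(1,2)[of x] by linarith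
qed

definition places :: "nat set" where "places = insert 0 {p. prime p}"

text \<open>The archimedean place is indexed by \<open>0\<close>, the others by the primes.\<close>

definition place_abs :: "nat \<Rightarrow> complex \<Rightarrow> real" where
  "place_abs p = (if p = 0 then cmod else padic_ext p)"

lemma place_abs_absolute: "p \<in> places \<Longrightarrow> absolute_value_on Qbar (place_abs p)"
  using padic_ext_props(1)[of p]
  by (auto simp: places_def place_abs_def absolute_value_on_def norm_mult norm_triangle_ineq)

lemmas place_absD = abs_valueD[OF place_abs_absolute]

lemma place_abs_zero [simp]: "place_abs 0 = cmod" by (simp add: place_abs_def)

lemma places_cases: "p \<in> places \<Longrightarrow> p = 0 \<or> prime p" by (auto simp: places_def)
lemma zero_in_places [simp]: "0 \<in> places" by (simp add: places_def)

lemma prime_in_places: "prime p \<Longrightarrow> p \<in> places" by (simp add: places_def)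

lemma place_abs_of_rat: "prime p \<Longrightarrow> place_abs p (of_rat q) = padic_abs p q"
  using padic_ext_props(2)[of p q] by (auto simp: place_abs_def)

lemma place_abs_of_int:
  assumes "prime p" "k \<noteq> 0"
  shows "place_abs p (of_int k) = inverse (real p ^ multiplicity (int p) k)"
proof -
  have "place_abs p (of_int k) = padic_abs p (of_int k)" using place_abs_of_rat[OF assms(1), of "of_int k"] by simp
  also have "\<dots> = real p powi (- int (multiplicity (int p) k))"
    using assms by (simp add: padic_abs_def)
  finally show ?thesis by (simp add: power_int_minus)
qed

lemma place_abs_of_int_le_1: "prime p \<Longrightarrow> place_abs p (of_int k) \<le> 1"
  using place_abs_of_int[of p k] prime_gt_1_nat[of p] place_absD(6)[of p]
  by (cases "k = 0") (auto simp: prime_in_places inverse_le_1_iff intro: one_le_power)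

text \<open>\<open>padic_ext\<close> comes only with the triangle inequality. Binomial coefficients
  have absolute value at most 1, so the expansion of \<open>(x + y) ^ n\<close> is bounded by
  \<open>n + 1\<close> times \<open>M ^ n\<close>, and the linear factor is harmless as
  \<open>n\<close> grows.\<close>

lemma place_abs_ultrametric:
  assumes p: "prime p" and x: "x \<in> Qbar" "y \<in> Qbar"
  shows "place_abs p (x + y) \<le> max (place_abs p x) (place_abs p y)"
proof (cases "x = 0 \<and> y = 0")
  case False
  note w = place_absD[OF prime_in_places[OF p]]
  define M where "M = max (place_abs p x) (place_abs p y)"
  have M: "M > 0" using False w(12)[of x] w(12)[of y] w(1)[of x] w(1)[of y] x by (auto simp: M_def less_max_iff_disj)
  have "place_abs p (x + y) ^ n \<le> (real n + 1) * M ^ n" for n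
  proof -
    have "place_abs p (x + y) ^ n = place_abs p (\<Sum>k\<le>n. of_nat (n choose k) * x ^ k * y ^ (n - k))"
      using w(9)[of "x + y" n] x by (simp add: binomial_ring Qbar_add)
    also have "\<dots> \<le> (\<Sum>k\<le>n. place_abs p (of_nat (n choose k) * x ^ k * y ^ (n - k)))"
      using x by (intro w(11)) (auto intro!: Qbar_closed)
    also have "\<dots> \<le> (\<Sum>k\<le>n. M ^ n)"
    proof (intro sum_mono)
      fix k assume k: "k \<in> {..n}"
      have "place_abs p (of_nat (n choose k) * x ^ k * y ^ (n - k)) = place_abs p (of_nat (n choose k)) * place_abs p x ^ k * place_abs p y ^ (n - k)"
        using x w(3,9) by (simp add: Qbar_closed)
      also have "\<dots> \<le> 1 * M ^ k * M ^ (n - k)"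
        using x w(1) place_abs_of_int_le_1[OF p, of "int (n choose k)"] M
        by (intro mult_mono power_mono) (auto simp: M_def)
      also have "\<dots> = M ^ n" using k by (simp flip: power_add)
      finally show "place_abs p (of_nat (n choose k) * x ^ k * y ^ (n - k)) \<le> M ^ n" .
    qed
    also have "\<dots> = (real n + 1) * M ^ n" by simp
    finally show ?thesis .
  qed
  then have "(place_abs p (x + y) / M) ^ n \<le> real n + 1" for n
    using M by (simp add: power_divide divide_le_eq)
  then have "place_abs p (x + y) / M \<le> 1"
    using M w(1)[of "x + y"] x by (intro le_one_if_power_le_linear) (auto simp: Qbar_add)
  then show ?thesis using M by (simp add: M_def divide_le_eq)
qed (use place_absD(6)[OF prime_in_places[OF p]] in auto)

lemma place_abs_sum_le:
  assumes p: "prime p" and f: "\<And>i. i \<in> A \<Longrightarrow> f i \<in> Qbar" "\<And>i. i \<in> A \<Longrightarrow> place_abs p (f i) \<le> M" and M: "M \<ge> 0"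
  shows "place_abs p (sum f A) \<le> M"
  using f
proof (induction A rule: infinite_finite_induct)
  case (insert x F)
  then have "place_abs p (f x + sum f F) \<le> max (place_abs p (f x)) (place_abs p (sum f F))"
    using p by (intro place_abs_ultrametric Qbar_sum) auto
  then show ?case using insert by fastforce
qed (use M place_absD(6)[OF prime_in_places[OF p]] in auto)

section \<open>Roots of integer polynomials at each place\<close>

lemma int_poly_root_expand:
  assumes "poly (map_poly complex_of_int g) x = 0"
  shows "of_int (lead_coeff g) * x ^ degree g = - (\<Sum>i<degree g. of_int (coeff g i) * x ^ i)"
proof -
  have d: "degree (map_poly complex_of_int g) = degree g"
    by (cases "g = 0") (auto intro!: map_poly_degree_eq)
  have "(\<Sum>i<degree g. of_int (coeff g i) * x ^ i) + of_int (lead_coeff g) * x ^ degree g = 0"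
    using assms unfolding poly_altdef d by (simp add: coeff_map_poly lessThan_Suc_atMost[symmetric])
  then show ?thesis by (simp add: eq_neg_iff_add_eq_0 add.commute)
qed

text \<open>If \<open>|x| > 1\<close>, every term below the leading one is at most
  \<open>|x| ^ (n - 1)\<close> for the degree \<open>n\<close>, so \<open>|l| |x| \<le> 1\<close>
  for the leading coefficient \<open>l\<close>. The bound depends on the polynomial only, hence is
  the same for all conjugates of \<open>x\<close>.\<close>

lemma root_bound_finite:
  assumes p: "prime p" and g: "g \<noteq> 0" and x: "x \<in> Qbar" "poly (map_poly complex_of_int g) x = 0"
  shows "max 1 (place_abs p x) \<le> inverse (place_abs p (of_int (lead_coeff g)))"
proof -
  note w = place_absD[OF prime_in_places[OF p]]
  have l0: "lead_coeff g \<noteq> 0" using g by simp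
  have lp: "place_abs p (of_int (lead_coeff g)) > 0" using l0 by (intro w(12)) auto
  have l1: "1 \<le> inverse (place_abs p (of_int (lead_coeff g)))" using place_abs_of_int_le_1[OF p] lp by (simp add: one_le_inverse)
  show ?thesis
  proof (cases "place_abs p x \<le> 1")
    case False
    have d: "degree g > 0"
    proof (rule ccontr)
      assume "\<not> degree g > 0"
      then obtain c where "g = [:c:]" using degree_eq_zeroE by blast
      then show False using g x by (auto simp: map_poly_pCons)
    qed
    have "place_abs p (of_int (lead_coeff g)) * place_abs p x ^ degree g = place_abs p (of_int (lead_coeff g) * x ^ degree g)"
      using w(3,9) x by (simp add: Qbar_power)
    also have "\<dots> = place_abs p (\<Sum>i<degree g. of_int (coeff g i) * x ^ i)"
      unfolding int_poly_root_expand[OF x(2)] using x by (intro w(7)) (auto intro!: Qbar_closed)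
    also have "\<dots> \<le> place_abs p x ^ (degree g - 1)"
    proof (rule place_abs_sum_le[OF p])
      fix i assume i: "i \<in> {..<degree g}"
      have "place_abs p (of_int (coeff g i) * x ^ i) = place_abs p (of_int (coeff g i)) * place_abs p x ^ i"
        using w(3,9) x by (simp add: Qbar_power)
      also have "\<dots> \<le> 1 * place_abs p x ^ i" using place_abs_of_int_le_1[OF p] w(1)[OF x(1)] by (intro mult_right_mono) auto
      also have "\<dots> \<le> place_abs p x ^ (degree g - 1)" using False i by (simp add: power_increasing)
      finally show "place_abs p (of_int (coeff g i) * x ^ i) \<le> place_abs p x ^ (degree g - 1)" .
    qed (use x w(1) in \<open>auto intro!: Qbar_closed\<close>)
    finally have "(place_abs p (of_int (lead_coeff g)) * place_abs p x) * place_abs p x ^ (degree g - 1) \<le> 1 * place_abs p x ^ (degree g - 1)"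
      using d by (cases "degree g") (auto simp: mult_ac)
    then have "place_abs p (of_int (lead_coeff g)) * place_abs p x \<le> 1"
      using False by (simp only: mult_le_cancel_right) (auto simp: not_less dest: zero_less_power)
    then have "place_abs p x \<le> inverse (place_abs p (of_int (lead_coeff g)))" using lp by (simp add: field_simps)
    then show ?thesis using l1 by simp
  qed (use l1 in auto)
qed

text \<open>The leading coefficient is kept as a denominator, as at the finite places, so that in a
  sum over all places it cancels by the product formula.\<close>

lemma root_bound_arch:
  assumes g: "g \<noteq> 0" and x: "poly (map_poly complex_of_int g) x = 0"
  shows "max 1 (cmod x) \<le> (\<Sum>i\<le>degree g. \<bar>of_int (coeff g i)\<bar>) / \<bar>of_int (lead_coeff g)\<bar>"
proof -
  have l0: "\<bar>of_int (lead_coeff g)\<bar> > (0::real)" using g by simp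
  define S :: real where "S = (\<Sum>i\<le>degree g. \<bar>of_int (coeff g i)\<bar>)"
  have "\<bar>of_int (lead_coeff g)\<bar> \<le> S" unfolding S_def
    by (rule member_le_sum[of "degree g" _ "\<lambda>i. \<bar>of_int (coeff g i)\<bar>"]) auto
  then have l1: "1 \<le> S / \<bar>of_int (lead_coeff g)\<bar>" using l0 by (simp add: le_divide_eq)
  have "cmod x \<le> S / \<bar>of_int (lead_coeff g)\<bar>" if x1: "cmod x > 1"
  proof -
    have d: "degree g > 0"
    proof (rule ccontr)
      assume "\<not> degree g > 0"
      then obtain c where "g = [:c:]" using degree_eq_zeroE by blast
      then show False using g x by (auto simp: map_poly_pCons)
    qed
    have "\<bar>of_int (lead_coeff g)\<bar> * cmod x ^ degree g = cmod (of_int (lead_coeff g) * x ^ degree g)"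
      by (simp add: norm_mult norm_power)
    also have "\<dots> = cmod (\<Sum>i<degree g. of_int (coeff g i) * x ^ i)"
      unfolding int_poly_root_expand[OF x] by (rule norm_minus_cancel)
    also have "\<dots> \<le> (\<Sum>i<degree g. cmod (of_int (coeff g i) * x ^ i))" by (rule norm_sum)
    also have "\<dots> \<le> (\<Sum>i<degree g. \<bar>of_int (coeff g i)\<bar> * cmod x ^ (degree g - 1))"
      using x1 by (intro sum_mono) (auto simp: norm_mult norm_power intro!: mult_left_mono power_increasing)
    also have "\<dots> \<le> S * cmod x ^ (degree g - 1)"
      unfolding S_def sum_distrib_right[symmetric] by (intro mult_right_mono sum_mono2) auto
    finally have "(\<bar>of_int (lead_coeff g)\<bar> * cmod x) * cmod x ^ (degree g - 1) \<le> S * cmod x ^ (degree g - 1)"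
      using d by (cases "degree g") (auto simp: mult_ac)
    then have "\<bar>of_int (lead_coeff g)\<bar> * cmod x \<le> S"
      by (rule mult_right_le_imp_le) (use x1 in \<open>auto intro!: zero_less_power intro: less_trans[OF zero_less_one]\<close>)
    then show ?thesis using l0 by (simp add: field_simps)
  qed
  then show ?thesis using l1 by (cases "cmod x > 1") (auto simp: S_def)
qed

text \<open>A family of local constants equal to 1 outside a finite set of places, as in Weil's
  theory of heights: the sum of their logarithms over all places stays finite.\<close>

definition place_bound :: "nat set \<Rightarrow> real \<Rightarrow> nat \<Rightarrow> real" where
  "place_bound T C p = (if p \<in> T then C else 1)"

lemma Qbar_int_poly:
  assumes "a \<in> Qbar"
  obtains g where "g \<noteq> 0" "poly (map_poly complex_of_int g) a = 0"
proof (cases "a = 0")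
  case True
  then show ?thesis using that[of "[:0,1:]"] by (simp add: map_poly_pCons)
next
  case False
  have "algebraic a" using assms by (simp add: Qbar_def)
  then obtain g where "coeff g 0 \<noteq> 0" "poly (map_poly complex_of_int g) a = 0"
    using algebraicE'_nonzero[of a] False by metis
  then show ?thesis using that[of g] by (cases "g = 0") simp_all
qed

lemma const_place_bound:
  assumes a: "a \<in> Qbar"
  shows "\<exists>T C. finite T \<and> T \<subseteq> places \<and> C \<ge> 1 \<and> (\<forall>\<tau>\<in>embeddings Qbar. \<forall>p\<in>places. place_abs p (\<tau> a) \<le> place_bound T C p)"
proof -
  obtain g where g: "g \<noteq> 0" "poly (map_poly complex_of_int g) a = 0" using Qbar_int_poly[OF a] .
  define l where "l = lead_coeff g"
  have l0: "l \<noteq> 0" using g by (simp add: l_def)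
  define T where "T = insert 0 (prime_factors (nat \<bar>l\<bar>))"
  \<comment> \<open>At a prime dividing \<open>l\<close> the bound is a power of \<open>p\<close>
    dividing \<open>l\<close>, hence at most \<open>\<bar>l\<bar>\<close>; the sum of the absolute
    values of the coefficients serves the archimedean place.\<close>
  define C where "C = max (real_of_int \<bar>l\<bar>) (\<Sum>i\<le>degree g. \<bar>of_int (coeff g i)\<bar>)"
  have C1: "C \<ge> 1" using l0 by (auto simp: C_def le_max_iff_disj)
  have "place_abs p (\<tau> a) \<le> place_bound T C p" if t: "\<tau> \<in> embeddings Qbar" and p: "p \<in> places" for \<tau> p
  proof -
    have ta: "\<tau> a \<in> Qbar" "poly (map_poly complex_of_int g) (\<tau> a) = 0"
      using t a Qemb_poly_root[OF t, of "map_poly complex_of_int g"] g by (auto simp: coeff_map_poly)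
    show ?thesis
    proof (cases "p = 0")
      case True
      have "cmod (\<tau> a) \<le> (\<Sum>i\<le>degree g. \<bar>of_int (coeff g i)\<bar>) / \<bar>of_int l\<bar>"
        using root_bound_arch[OF g(1) ta(2)] by (simp add: l_def)
      also have "\<dots> \<le> (\<Sum>i\<le>degree g. \<bar>of_int (coeff g i)\<bar>)"
      proof -
        have "1 \<le> \<bar>l\<bar>" using l0 by linarith
        then have "1 \<le> \<bar>real_of_int l\<bar>" by linarith
        then have "(\<Sum>i\<le>degree g. \<bar>real_of_int (coeff g i)\<bar>) / \<bar>of_int l\<bar> \<le> (\<Sum>i\<le>degree g. \<bar>of_int (coeff g i)\<bar>) / 1"
          by (intro divide_left_mono) (auto intro: sum_nonneg)
        then show ?thesis by simp
      qed
      finally show ?thesis using True by (simp add: place_bound_def T_def C_def)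
    next
      case False
      then have pr: "prime p" using p places_cases by auto
      have "place_abs p (\<tau> a) \<le> inverse (place_abs p (of_int l))"
        using root_bound_finite[OF pr g(1) ta] by (simp add: l_def)
      also have "\<dots> = real p ^ multiplicity (int p) l" using place_abs_of_int[OF pr l0] by simp
      also have "\<dots> \<le> place_bound T C p"
      proof (cases "int p dvd l")
        case True
        have "int p ^ multiplicity (int p) l \<le> \<bar>l\<bar>"
          using l0 by (intro zdvd_imp_le) (auto simp: multiplicity_dvd)
        then have "real_of_int (int p ^ multiplicity (int p) l) \<le> real_of_int \<bar>l\<bar>" by (rule of_int_le_iff[THEN iffD2])
        moreover have "p \<in> T" using True pr l0 by (auto simp: T_def in_prime_factors_iff nat_abs_dvd_iff int_dvd_int_iff simp flip: zdvd1_eq)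
        ultimately show ?thesis by (simp add: place_bound_def C_def)
      next
        case False
        then have "multiplicity (int p) l = 0" by (rule not_dvd_imp_multiplicity_0)
        then show ?thesis using C1 by (simp add: place_bound_def)
      qed
      finally show ?thesis .
    qed
  qed
  moreover have "finite T" "T \<subseteq> places" by (auto simp: T_def places_def)
  ultimately show ?thesis using C1 by blast
qed

text \<open>Away from the exceptional sets of \<open>a\<close> and of its inverse, the absolute
  value and its reciprocal are both at most 1.\<close>

lemma const_unit_places:
  assumes a: "a \<in> Qbar" "a \<noteq> 0"
  shows "\<exists>T. finite T \<and> T \<subseteq> places \<and> (\<forall>\<tau>\<in>embeddings Qbar. \<forall>p\<in>places - T. place_abs p (\<tau> a) = 1)"
proof -
  obtain T C where T: "finite T" "T \<subseteq> places" "\<And>\<tau> p. \<tau> \<in> embeddings Qbar \<Longrightarrow> p \<in> places \<Longrightarrow> place_abs p (\<tau> a) \<le> place_bound T C p"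
    using const_place_bound[OF a(1)] by blast
  obtain T' C' where T': "finite T'" "T' \<subseteq> places" "\<And>\<tau> p. \<tau> \<in> embeddings Qbar \<Longrightarrow> p \<in> places \<Longrightarrow> place_abs p (\<tau> (inverse a)) \<le> place_bound T' C' p"
    using const_place_bound[OF Qbar_inverse[OF a(1)]] by blast
  have "place_abs p (\<tau> a) = 1" if t: "\<tau> \<in> embeddings Qbar" and p: "p \<in> places - (T \<union> T')" for \<tau> p
  proof -
    have "place_abs p (\<tau> a) \<le> 1" using T(3)[OF t, of p] p by (auto simp: place_bound_def)
    moreover have "inverse (place_abs p (\<tau> a)) \<le> 1"
      using T'(3)[OF t, of p] p place_absD(8)[of p "\<tau> a"] QembD(7)[OF t a(1)] t a by (auto simp: place_bound_def)
    moreover have "place_abs p (\<tau> a) > 0" using place_absD(12)[of p "\<tau> a"] p t a QembD(8)[OF t a(1)] by auto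
    ultimately show ?thesis by (simp add: inverse_le_1_iff)
  qed
  then show ?thesis using T T' by (intro exI[of _ "T \<union> T'"]) auto
qed

section \<open>Sums over places and the product formula\<close>

definition fin_places :: "(nat \<Rightarrow> real) \<Rightarrow> bool" where
  "fin_places f \<longleftrightarrow> finite {p\<in>places. f p \<noteq> 0}"

text \<open>HOL gives a sum over an infinite set the value 0, so the additivity rules below carry
  \<open>fin_places\<close>.\<close>

definition places_sum :: "(nat \<Rightarrow> real) \<Rightarrow> real" where
  "places_sum f = (\<Sum>p\<in>{p\<in>places. f p \<noteq> 0}. f p)"

lemma places_sum_eq:
  assumes "finite T" "T \<subseteq> places" "\<And>p. p \<in> places - T \<Longrightarrow> f p = 0"
  shows "places_sum f = sum f T" "fin_places f"
proof -
  have sub: "{p\<in>places. f p \<noteq> 0} \<subseteq> T" using assms by auto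
  then show "fin_places f" unfolding fin_places_def using assms finite_subset by blast
  show "places_sum f = sum f T" unfolding places_sum_def
    using sub assms by (intro sum.mono_neutral_left) auto
qed

lemma places_sum_add:
  assumes "fin_places f" "fin_places g"
  shows "places_sum (\<lambda>p. f p + g p) = places_sum f + places_sum g" "fin_places (\<lambda>p. f p + g p)"
proof -
  define T where "T = {p\<in>places. f p \<noteq> 0} \<union> {p\<in>places. g p \<noteq> 0}"
  have T: "finite T" "T \<subseteq> places" using assms by (auto simp: T_def fin_places_def)
  have z: "p \<in> places - T \<Longrightarrow> f p = 0" "p \<in> places - T \<Longrightarrow> g p = 0" for p by (auto simp: T_def)
  show "places_sum (\<lambda>p. f p + g p) = places_sum f + places_sum g"
    using places_sum_eq(1)[OF T, of f] places_sum_eq(1)[OF T, of g] places_sum_eq(1)[OF T, of "\<lambda>p. f p + g p"] z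
    by (simp add: sum.distrib)
  show "fin_places (\<lambda>p. f p + g p)" using places_sum_eq(2)[OF T, of "\<lambda>p. f p + g p"] z by simp
qed

lemma places_sum_cmult: "places_sum (\<lambda>p. c * f p) = c * places_sum f"
  by (cases "c = 0") (auto simp: places_sum_def sum_distrib_left)

lemma fin_places_cmult: "fin_places f \<Longrightarrow> fin_places (\<lambda>p. c * f p)"
  unfolding fin_places_def by (erule rev_finite_subset) auto

lemma places_sum_cong: "(\<And>p. p \<in> places \<Longrightarrow> f p = g p) \<Longrightarrow> places_sum f = places_sum g"
  unfolding places_sum_def by (intro sum.cong) auto

lemma fin_places_cong: "(\<And>p. p \<in> places \<Longrightarrow> f p = g p) \<Longrightarrow> fin_places f = fin_places g"
  unfolding fin_places_def by (intro arg_cong[where f=finite]) auto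

lemma places_sum_mono:
  assumes "fin_places f" "fin_places g" "\<And>p. p \<in> places \<Longrightarrow> f p \<le> g p"
  shows "places_sum f \<le> places_sum g"
proof -
  define T where "T = {p\<in>places. f p \<noteq> 0} \<union> {p\<in>places. g p \<noteq> 0}"
  have T: "finite T" "T \<subseteq> places" using assms by (auto simp: T_def fin_places_def)
  have z: "p \<in> places - T \<Longrightarrow> f p = 0" "p \<in> places - T \<Longrightarrow> g p = 0" for p by (auto simp: T_def)
  show ?thesis using places_sum_eq(1)[OF T, of f] places_sum_eq(1)[OF T, of g] z assms(3) T(2)
    by (auto intro!: sum_mono)
qed

lemma places_sum_sum:
  assumes "finite I" "\<And>i. i \<in> I \<Longrightarrow> fin_places (f i)"
  shows "places_sum (\<lambda>p. \<Sum>i\<in>I. f i p) = (\<Sum>i\<in>I. places_sum (f i)) \<and> fin_places (\<lambda>p. \<Sum>i\<in>I. f i p)"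
  using assms
proof (induction I rule: finite_induct)
  case empty
  then show ?case by (auto simp: places_sum_def fin_places_def)
next
  case (insert i I)
  then show ?case using places_sum_add[of "f i" "\<lambda>p. \<Sum>i\<in>I. f i p"] by simp
qed

lemma multiplicity_int_nat: "multiplicity (int p) (int n) = multiplicity p n"
proof (cases "n = 0 \<or> is_unit p")
  case False
  have d: "int p ^ k dvd int n \<longleftrightarrow> p ^ k dvd n" for k
    using int_dvd_int_iff[of "p ^ k" n] by simp
  show ?thesis
  proof (rule multiplicity_eqI)
    show "int p ^ multiplicity p n dvd int n" unfolding d by (rule multiplicity_dvd)
    show "\<not> int p ^ Suc (multiplicity p n) dvd int n" unfolding d
      using False by (subst power_dvd_iff_le_multiplicity) auto
  qed
qed (auto simp: multiplicity_unit_left)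

lemma product_formula_nat:
  assumes "n > 0"
  shows "places_sum (\<lambda>p. ln (place_abs p (of_nat n))) = 0" "fin_places (\<lambda>p. ln (place_abs p (of_nat n)))"
proof -
  define T where "T = insert 0 (prime_factors n)"
  have T: "finite T" "T \<subseteq> places" by (auto simp: T_def places_def)
  have v: "ln (place_abs p (of_nat n)) = - (real (multiplicity p n) * ln (real p))" if "prime p" for p
    using place_abs_of_int[OF that, of "int n"] assms prime_gt_0_nat[OF that]
    by (simp add: ln_inverse ln_realpow multiplicity_int_nat)
  have z: "ln (place_abs p (of_nat n)) = 0" if "p \<in> places - T" for p
  proof -
    have pr: "prime p" using that places_cases by (auto simp: T_def)
    moreover have "\<not> p dvd n" using that pr assms by (auto simp: T_def in_prime_factors_iff)
    ultimately show ?thesis using v[OF pr] by (simp add: not_dvd_imp_multiplicity_0)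
  qed
  show "fin_places (\<lambda>p. ln (place_abs p (of_nat n)))" by (rule places_sum_eq(2)[OF T z])
  have "real n = real (\<Prod>p\<in>prime_factors n. p ^ multiplicity p n)"
    by (rule arg_cong[OF prime_factorization_nat[OF assms]])
  also have "\<dots> = (\<Prod>p\<in>prime_factors n. real p ^ multiplicity p n)" by simp
  finally have "ln (real n) = ln (\<Prod>p\<in>prime_factors n. real p ^ multiplicity p n)" by (rule arg_cong)
  also have "\<dots> = (\<Sum>p\<in>prime_factors n. ln (real p ^ multiplicity p n))"
    by (intro ln_prod) (auto simp: in_prime_factors_iff prime_gt_0_nat)
  also have "\<dots> = (\<Sum>p\<in>prime_factors n. real (multiplicity p n) * ln (real p))"
    by (intro sum.cong) (auto simp: ln_realpow in_prime_factors_iff prime_gt_0_nat)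
  finally have l: "ln (real n) = (\<Sum>p\<in>prime_factors n. real (multiplicity p n) * ln (real p))" .
  have 0: "0 \<notin> prime_factors n" by (auto simp: in_prime_factors_iff)
  have "places_sum (\<lambda>p. ln (place_abs p (of_nat n))) = (\<Sum>p\<in>T. ln (place_abs p (of_nat n)))" by (rule places_sum_eq(1)[OF T z])
  also have "\<dots> = ln (real n) + (\<Sum>p\<in>prime_factors n. ln (place_abs p (of_nat n)))"
    unfolding T_def using 0 by simp
  also have "(\<Sum>p\<in>prime_factors n. ln (place_abs p (of_nat n))) = (\<Sum>p\<in>prime_factors n. - (real (multiplicity p n) * ln (real p)))"
    by (intro sum.cong v) (auto simp: in_prime_factors_iff)
  finally show "places_sum (\<lambda>p. ln (place_abs p (of_nat n))) = 0" by (simp add: l sum_negf)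
qed

lemma product_formula_rat:
  assumes "r \<in> \<rat>" "r \<noteq> 0"
  shows "places_sum (\<lambda>p. ln (place_abs p r)) = 0 \<and> fin_places (\<lambda>p. ln (place_abs p r))"
proof -
  obtain q where q: "r = of_rat q" using assms by (auto elim: Rats_cases)
  obtain a b where ab: "q = Rat.Fract a b" "b > 0" by (cases q) auto
  have r: "r = of_int a / of_int b" using ab q by (simp add: of_rat_rat)
  have a0: "a \<noteq> 0" using r assms by auto
  have int: "place_abs p (of_int k) = place_abs p (of_nat (nat \<bar>k\<bar>))" if "p \<in> places" for p k
    using place_absD(7)[OF that, of "of_int k"] by (cases "k \<ge> 0") auto
  have e: "ln (place_abs p r) = ln (place_abs p (of_nat (nat \<bar>a\<bar>))) + (-1) * ln (place_abs p (of_nat (nat \<bar>b\<bar>)))" if p: "p \<in> places" for p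
  proof -
    have "place_abs p r = place_abs p (of_int a) * inverse (place_abs p (of_int b))"
      unfolding r divide_inverse using place_absD(3,8)[OF p] by (simp add: Qbar_inverse)
    moreover have "place_abs p (of_int a) > 0" "place_abs p (of_int b) > 0"
      using a0 ab by (auto intro!: place_absD(12)[OF p])
    ultimately show ?thesis
      unfolding int[OF p, of a, symmetric] int[OF p, of b, symmetric] by (simp add: ln_mult ln_inverse)
  qed
  note A = product_formula_nat[of "nat \<bar>a\<bar>"]
  note B = product_formula_nat[of "nat \<bar>b\<bar>"]
  have "nat \<bar>a\<bar> > 0" "nat \<bar>b\<bar> > 0" using a0 ab by auto
  note S = places_sum_add[OF A(2)[OF this(1)] fin_places_cmult[OF B(2)[OF this(2)], of "- 1"]]
    and Z = A(1)[OF this(1)] B(1)[OF this(2)]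
  have "places_sum (\<lambda>p. ln (place_abs p r)) = places_sum (\<lambda>p. ln (place_abs p (of_nat (nat \<bar>a\<bar>))) + (-1) * ln (place_abs p (of_nat (nat \<bar>b\<bar>))))"
    by (intro places_sum_cong e)
  also have "\<dots> = 0 + (-1) * 0" unfolding S(1) by (simp only: places_sum_cmult Z)
  finally have "places_sum (\<lambda>p. ln (place_abs p r)) = 0" by simp
  moreover have "fin_places (\<lambda>p. ln (place_abs p r))"
    using S(2) by (rule iffD2[OF fin_places_cong[OF e], rotated])
  ultimately show ?thesis by blast
qed

text \<open>Summing over conjugates first replaces \<open>c\<close> by its norm, which is rational;
  so the formula over the rationals suffices. It is the average that vanishes, not the sum for a
  single conjugate, because only one extension of each p-adic absolute value is used.\<close>

lemma product_formula:
  assumes A: "finite A" "A \<subseteq> Qbar" and c: "c \<in> A" "c \<noteq> 0"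
  shows "gal_avg A (\<lambda>\<sigma>. places_sum (\<lambda>p. ln (place_abs p (\<sigma> c)))) = 0"
    and "\<And>\<sigma>. \<sigma> \<in> gal A \<Longrightarrow> fin_places (\<lambda>p. ln (place_abs p (\<sigma> c)))"
proof -
  have cQ: "c \<in> Qbar" using A c by auto
  obtain T where T: "finite T" "T \<subseteq> places" "\<And>\<tau> p. \<tau> \<in> embeddings Qbar \<Longrightarrow> p \<in> places - T \<Longrightarrow> place_abs p (\<tau> c) = 1"
    using const_unit_places[OF cQ c(2)] by blast
  show fin: "fin_places (\<lambda>p. ln (place_abs p (\<sigma> c)))" if s: "\<sigma> \<in> gal A" for \<sigma>
  proof -
    obtain \<tau> where t: "\<tau> \<in> embeddings Qbar" "\<sigma> = restrict \<tau> A" using s by (auto simp: gal_def)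
    show ?thesis by (rule places_sum_eq(2)[OF T(1,2)]) (use T(3)[OF t(1)] t c in simp)
  qed
  have s: "\<sigma> c \<in> Qbar" "\<sigma> c \<noteq> 0" if "\<sigma> \<in> gal A" for \<sigma>
    using that cQ c QembD(8) by (auto simp: gal_def)
  have fg: "finite (gal A)" by (rule finite_gal[OF A])
  define n where "n = (\<Prod>\<sigma>\<in>gal A. \<sigma> c)"
  have n: "n \<in> \<rat>" "n \<noteq> 0" using gal_norm_rational[OF A c(1)] s fg by (auto simp: n_def)
  have "(\<Sum>\<sigma>\<in>gal A. places_sum (\<lambda>p. ln (place_abs p (\<sigma> c)))) = places_sum (\<lambda>p. \<Sum>\<sigma>\<in>gal A. ln (place_abs p (\<sigma> c)))"
    using places_sum_sum[of "gal A" "\<lambda>\<sigma> p. ln (place_abs p (\<sigma> c))"] fg fin by simp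
  also have "\<dots> = places_sum (\<lambda>p. ln (place_abs p n))"
  proof (rule places_sum_cong)
    fix p assume p: "p \<in> places"
    have "place_abs p n = (\<Prod>\<sigma>\<in>gal A. place_abs p (\<sigma> c))" unfolding n_def using s by (intro place_absD(10)[OF p]) auto
    moreover have pos: "place_abs p (\<sigma> c) > 0" if "\<sigma> \<in> gal A" for \<sigma> using place_absD(12)[OF p] s that by blast
    ultimately show "(\<Sum>\<sigma>\<in>gal A. ln (place_abs p (\<sigma> c))) = ln (place_abs p n)"
      using ln_prod[of "gal A" "\<lambda>\<sigma>. place_abs p (\<sigma> c)"] fg pos by (metis less_irrefl)
  qed
  also have "\<dots> = 0" using product_formula_rat[OF n] by simp
  finally show "gal_avg A (\<lambda>\<sigma>. places_sum (\<lambda>p. ln (place_abs p (\<sigma> c)))) = 0" by (simp add: gal_avg_def)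
qed


section \<open>The height as a Galois average\<close>

definition good_vec :: "nat \<Rightarrow> cvec \<Rightarrow> bool" where
  "good_vec N x \<longleftrightarrow> (\<forall>i\<le>N. x i \<in> Qbar) \<and> (\<exists>i\<le>N. x i \<noteq> 0)"

definition local_max :: "nat \<Rightarrow> nat \<Rightarrow> cvec \<Rightarrow> real" where
  "local_max N p x = Max ((\<lambda>i. place_abs p (x i)) ` {..N})"

definition places_height :: "nat \<Rightarrow> cvec \<Rightarrow> real" where
  "places_height N x = places_sum (\<lambda>p. ln (local_max N p x))"

definition log_height :: "nat \<Rightarrow> cvec \<Rightarrow> real" where
  "log_height N x = gal_avg (x ` {..N}) (\<lambda>\<sigma>. places_height N (\<lambda>i. \<sigma> (x i)))"

lemma hcoords_good: "x \<in> hcoords N \<Longrightarrow> good_vec N x"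
  unfolding hcoords_def good_vec_def by (auto simp: not_less) (metis leI)

lemma local_max_ge: "i \<le> N \<Longrightarrow> place_abs p (x i) \<le> local_max N p x"
  unfolding local_max_def by (intro Max_ge) auto

lemma local_max_le: "(\<And>i. i \<le> N \<Longrightarrow> place_abs p (x i) \<le> M) \<Longrightarrow> local_max N p x \<le> M"
  unfolding local_max_def by (subst Max_le_iff) auto

lemma local_max_attained: "\<exists>i\<le>N. local_max N p x = place_abs p (x i)"
proof -
  have "local_max N p x \<in> (\<lambda>i. place_abs p (x i)) ` {..N}" unfolding local_max_def by (intro Max_in) auto
  then show ?thesis by auto
qed

lemma local_max_cong: "(\<And>i. i \<le> N \<Longrightarrow> x i = y i) \<Longrightarrow> local_max N p x = local_max N p y"
  unfolding local_max_def by (intro arg_cong[where f=Max] image_cong) auto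

lemma places_height_cong: "(\<And>i. i \<le> N \<Longrightarrow> x i = y i) \<Longrightarrow> places_height N x = places_height N y"
  unfolding places_height_def using local_max_cong[of N x y] by presburger

lemma local_max_pos:
  assumes "p \<in> places" "good_vec N x"
  shows "local_max N p x > 0"
proof -
  obtain i where "i \<le> N" "x i \<noteq> 0" "x i \<in> Qbar" using assms(2) by (auto simp: good_vec_def)
  then show ?thesis using local_max_ge[of i N p x] place_absD(12)[OF assms(1), of "x i"] by simp
qed

lemma good_vec_emb:
  assumes "good_vec N x" "\<tau> \<in> embeddings Qbar"
  shows "good_vec N (\<lambda>i. \<tau> (x i))"
  using assms QembD(8)[OF assms(2)] by (auto simp: good_vec_def)

lemma local_max_unit_places:
  assumes x: "good_vec N x"
  shows "\<exists>T. finite T \<and> T \<subseteq> places \<and> (\<forall>\<tau>\<in>embeddings Qbar. \<forall>p\<in>places - T. local_max N p (\<lambda>i. \<tau> (x i)) = 1)"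
proof -
  define U where "U = (\<lambda>a. SOME T. finite T \<and> T \<subseteq> places \<and> (\<forall>\<tau>\<in>embeddings Qbar. \<forall>p\<in>places - T. place_abs p (\<tau> a) = 1))"
  have U: "finite (U a) \<and> U a \<subseteq> places \<and> (\<forall>\<tau>\<in>embeddings Qbar. \<forall>p\<in>places - U a. place_abs p (\<tau> a) = 1)"
    if "a \<in> Qbar" "a \<noteq> 0" for a
    unfolding U_def by (rule someI_ex) (rule const_unit_places[OF that])
  define J where "J = {i. i \<le> N \<and> x i \<noteq> 0}"
  have J: "finite J" "J \<noteq> {}" "\<And>i. i \<in> J \<Longrightarrow> x i \<in> Qbar \<and> x i \<noteq> 0 \<and> i \<le> N"
    using x by (auto simp: J_def good_vec_def)
  define T where "T = (\<Union>i\<in>J. U (x i))"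
  have "finite T" "T \<subseteq> places" using U J by (auto simp: T_def)
  moreover have "local_max N p (\<lambda>i. \<tau> (x i)) = 1" if t: "\<tau> \<in> embeddings Qbar" and p: "p \<in> places - T" for \<tau> p
  proof (rule antisym)
    have 1: "place_abs p (\<tau> (x i)) = 1" if i: "i \<in> J" for i
    proof -
      have "p \<in> places - U (x i)" using p i by (auto simp: T_def)
      then show ?thesis using U[of "x i"] J(3)[OF i] t by blast
    qed
    have 0: "place_abs p (\<tau> (x i)) = 0" if "i \<notin> J" "i \<le> N" for i
      using that QembD(2)[OF t] place_absD(6)[of p] p by (simp add: J_def)
    show "local_max N p (\<lambda>i. \<tau> (x i)) \<le> 1"
    proof (rule local_max_le)
      fix i assume "i \<le> N"
      then show "place_abs p (\<tau> (x i)) \<le> 1" using 0[of i] 1[of i] by (cases "i \<in> J") auto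
    qed
    obtain i where "i \<in> J" using J by auto
    then show "1 \<le> local_max N p (\<lambda>i. \<tau> (x i))"
      using 1[of i] J(3)[of i] local_max_ge[of i N p "\<lambda>i. \<tau> (x i)"] by simp
  qed
  ultimately show ?thesis by blast
qed

lemma fin_places_local_max:
  assumes x: "good_vec N x" and t: "\<tau> \<in> embeddings Qbar"
  shows "fin_places (\<lambda>p. ln (local_max N p (\<lambda>i. \<tau> (x i))))"
proof -
  obtain T where T: "finite T" "T \<subseteq> places" "\<forall>\<tau>\<in>embeddings Qbar. \<forall>p\<in>places - T. local_max N p (\<lambda>i. \<tau> (x i)) = 1"
    using local_max_unit_places[OF x] by auto
  show ?thesis by (rule places_sum_eq(2)[OF T(1,2)]) (use T(3) t in simp)
qed

section \<open>Comparison with the product over the absolute values of a number field\<close>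

lemma field_generated_subfield: "is_subfield (field_generated A)"
  unfolding field_generated_def is_subfield_def by auto

lemma field_generated_superset: "A \<subseteq> field_generated A"
  unfolding field_generated_def by auto

lemma field_generated_least: "is_subfield K \<Longrightarrow> A \<subseteq> K \<Longrightarrow> field_generated A \<subseteq> K"
  unfolding field_generated_def by auto

text \<open>Two embeddings that agree on \<open>A\<close> agree on a subfield, hence on the field
  generated by \<open>A\<close>; and each embedding of that field extends to
  \<open>Qbar\<close>.\<close>

lemma embeddings_bij_gal:
  assumes A: "A \<subseteq> Qbar"
  shows "bij_betw (\<lambda>\<sigma>. restrict \<sigma> A) (embeddings (field_generated A)) (gal A)"
proof -
  define K where "K = field_generated A"
  have K: "is_subfield K" "A \<subseteq> K" "K \<subseteq> Qbar"
    using field_generated_subfield field_generated_superset field_generated_least[OF Qbar_subfield A]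
    by (auto simp: K_def)
  have "inj_on (\<lambda>\<sigma>. restrict \<sigma> A) (embeddings K)"
  proof (rule inj_onI)
    fix \<sigma> \<rho> assume s: "\<sigma> \<in> embeddings K" "\<rho> \<in> embeddings K" and eq: "restrict \<sigma> A = restrict \<rho> A"
    define F where "F = {y\<in>K. \<sigma> y = \<rho> y}"
    have "is_subfield F"
      unfolding is_subfield_def F_def
      using subfieldD[OF K(1)] embD[OF K(1) s(1)] embD[OF K(1) s(2)] by simp
    moreover have "A \<subseteq> F" using eq K by (auto simp: F_def) (metis restrict_apply')
    ultimately have "K \<subseteq> F" unfolding K_def by (rule field_generated_least)
    then have "\<sigma> y = \<rho> y" for y
      using s by (cases "y \<in> K") (auto simp: F_def embeddings_def extensional_def)
    then show "\<sigma> = \<rho>" by auto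
  qed
  moreover have "(\<lambda>\<sigma>. restrict \<sigma> A) ` embeddings K = gal A"
  proof
    show "(\<lambda>\<sigma>. restrict \<sigma> A) ` embeddings K \<subseteq> gal A"
    proof clarify
      fix \<sigma> assume "\<sigma> \<in> embeddings K"
      then obtain \<tau> where t: "\<tau> \<in> embeddings Qbar" "\<forall>x\<in>K. \<tau> x = \<sigma> x" using emb_extend[OF K(1,3)] by blast
      then have "restrict \<sigma> A = restrict \<tau> A" using K by (auto simp: fun_eq_iff restrict_def)
      then show "restrict \<sigma> A \<in> gal A" using t by (auto simp: gal_def)
    qed
    show "gal A \<subseteq> (\<lambda>\<sigma>. restrict \<sigma> A) ` embeddings K"
    proof
      fix \<rho> assume "\<rho> \<in> gal A"
      then obtain \<tau> where t: "\<tau> \<in> embeddings Qbar" "\<rho> = restrict \<tau> A" by (auto simp: gal_def)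
      have "restrict \<tau> K \<in> embeddings K"
        using t subfieldD[OF K(1)] QembD[OF t(1)] K(3) by (auto simp: embeddings_def subset_iff)
      moreover have "\<rho> = restrict (restrict \<tau> K) A" using K t by (auto simp: fun_eq_iff restrict_def)
      ultimately show "\<rho> \<in> (\<lambda>\<sigma>. restrict \<sigma> A) ` embeddings K" by blast
    qed
  qed
  ultimately show ?thesis by (simp add: bij_betw_def K_def)
qed

text \<open>A prime has absolute value below 1 at its own place and at least 1 at every other
  place.\<close>

lemma place_abs_distinct:
  assumes p: "p \<in> places" "q \<in> places" and eq: "\<And>r. place_abs p (of_rat r) = place_abs q (of_rat r)"
  shows "p = q"
proof (rule ccontr)
  assume ne: "p \<noteq> q"
  have *: "place_abs q (of_rat (of_nat p)) \<ge> 1 \<and> place_abs p (of_rat (of_nat p)) < 1" if pr: "prime p" "q \<in> places" "p \<noteq> q" for p q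
  proof
    have p1: "p > 1" using pr prime_gt_1_nat by blast
    have "multiplicity (int p) (int p) = 1" using p1 by (subst multiplicity_int_nat) (simp add: multiplicity_self)
    then have "place_abs p (of_int (int p)) = inverse (real p)" using place_abs_of_int[OF pr(1), of "int p"] p1 by simp
    then show "place_abs p (of_rat (of_nat p)) < 1" using p1 by (simp add: inverse_less_1_iff)
    show "place_abs q (of_rat (of_nat p)) \<ge> 1"
    proof (cases "q = 0")
      case False
      then have q: "prime q" using pr places_cases by auto
      then have "\<not> q dvd p" using pr by (metis primes_dvd_imp_eq)
      then have "multiplicity (int q) (int p) = 0" by (intro not_dvd_imp_multiplicity_0) simp
      then show ?thesis using place_abs_of_int[OF q, of "int p"] p1 by simp
    qed (use p1 in simp)
  qed
  have "prime p \<or> prime q" using ne places_cases[OF p(1)] places_cases[OF p(2)] by auto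
  then show False using *[of p q] *[of q p] eq[of "of_nat p"] eq[of "of_nat q"] p ne by auto
qed

definition pull_abs :: "complex set \<Rightarrow> nat \<Rightarrow> (complex \<Rightarrow> complex) \<Rightarrow> complex \<Rightarrow> real" where
  "pull_abs K p \<sigma> = restrict (\<lambda>y. place_abs p (\<sigma> y)) K"

lemma emb_in_Qbar:
  assumes "is_subfield K" "K \<subseteq> Qbar" "\<sigma> \<in> embeddings K" "y \<in> K"
  shows "\<sigma> y \<in> Qbar"
  using emb_extend[OF assms(1-3)] assms(2,4) Qemb_in by (metis subsetD)

lemma pull_abs_std:
  assumes K: "is_subfield K" "K \<subseteq> Qbar" and p: "p \<in> places" and s: "\<sigma> \<in> embeddings K"
  shows "pull_abs K p \<sigma> \<in> std_absolute_values K"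
proof -
  note in_Q = emb_in_Qbar[OF K s]
  note w = place_absD[OF p] and e = embD[OF K(1) s] and k = subfieldD[OF K(1)]
  have "absolute_value_on K (pull_abs K p \<sigma>)"
    unfolding absolute_value_on_def pull_abs_def
    using w(1-4)[OF in_Q] in_Q e(3,4,8) k(4,7) by (simp add: w(3,4))
  moreover have q: "pull_abs K p \<sigma> (of_rat q) = place_abs p (of_rat q)" for q
    using subfield_of_rat[OF K(1)] e(9) by (simp add: pull_abs_def)
  have "(\<forall>q. pull_abs K p \<sigma> (of_rat q) = real_of_rat \<bar>q\<bar>) \<or>
      (\<exists>r. prime r \<and> (\<forall>q. pull_abs K p \<sigma> (of_rat q) = padic_abs r q))"
  proof (cases "p = 0")
    case True
    have "cmod (of_rat q) = real_of_rat \<bar>q\<bar>" for q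
    proof -
      have "(of_rat q :: complex) = of_real (of_rat q)" by (cases q) (simp add: of_rat_rat)
      then have "cmod (of_rat q) = \<bar>of_rat q\<bar>" by (metis norm_of_real)
      also have "\<dots> = of_rat \<bar>q\<bar>" by (cases "q \<ge> 0") (auto simp: of_rat_minus not_le)
      finally show ?thesis .
    qed
    then show ?thesis using True q by simp
  next
    case False
    then have "prime p" using p places_cases by auto
    then show ?thesis using q place_abs_of_rat by auto
  qed
  ultimately show ?thesis by (auto simp: std_absolute_values_def pull_abs_def)
qed

lemma local_degree_eq:
  assumes K: "is_subfield K" "K \<subseteq> Qbar" and v: "v \<in> std_absolute_values K"
  shows "local_degree K v = card {\<sigma>\<in>embeddings K. \<exists>p\<in>places. v = pull_abs K p \<sigma>}"
proof -
  have "(\<exists>w\<in>insert cmod (padic_ext ` {p. prime p}). \<forall>x\<in>K. v x = w (\<sigma> x)) \<longleftrightarrow> (\<exists>p\<in>places. v = pull_abs K p \<sigma>)" for \<sigma>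
  proof -
    have "insert cmod (padic_ext ` {p. prime p}) = place_abs ` places"
    proof -
      have "place_abs ` {p. prime p} = padic_ext ` {p. prime p}"
        by (intro image_cong refl) (auto simp: place_abs_def)
      then show ?thesis by (simp add: places_def)
    qed
    moreover have "(\<forall>x\<in>K. v x = place_abs p (\<sigma> x)) \<longleftrightarrow> v = pull_abs K p \<sigma>" for p
      using v by (auto simp: pull_abs_def std_absolute_values_def extensional_def fun_eq_iff restrict_def)
    ultimately show ?thesis by simp
  qed
  then show ?thesis unfolding local_degree_def by simp
qed

text \<open>Double counting over pairs \<open>(p, \<sigma>)\<close> of a place of the rationals and
  an embedding. Each pair pulls back to an absolute value \<open>v\<close>; the pairs over
  \<open>v\<close> are counted by the local degree, because \<open>v\<close> determines
  \<open>p\<close>. An absolute value that is not reached has local degree 0, hence local factor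
  1.\<close>

theorem height_over_eq:
  assumes x: "good_vec N x"
  shows "height_over N (field_generated (x ` {..N})) x = exp (log_height N x)"
proof -
  define A where "A = x ` {..N}"
  define K where "K = field_generated A"
  define E where "E = embeddings K"
  have A: "finite A" "A \<subseteq> Qbar" using x by (auto simp: A_def good_vec_def)
  have K: "is_subfield K" "K \<subseteq> Qbar" and AK: "A \<subseteq> K"
    using field_generated_subfield field_generated_superset field_generated_least[OF Qbar_subfield A(2)]
    by (auto simp: K_def)
  have xK: "x i \<in> K" if "i \<le> N" for i using AK that by (auto simp: A_def)
  have bij: "bij_betw (\<lambda>\<sigma>. restrict \<sigma> A) E (gal A)" using embeddings_bij_gal[OF A(2)] by (simp add: E_def K_def)
  have finE: "finite E" using bij finite_gal[OF A] bij_betw_finite by blast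
  have ext: "\<exists>\<tau>\<in>embeddings Qbar. \<forall>i\<le>N. \<tau> (x i) = \<sigma> (x i)" if s: "\<sigma> \<in> E" for \<sigma>
  proof -
    obtain \<tau> where "\<tau> \<in> embeddings Qbar" "\<forall>y\<in>K. \<tau> y = \<sigma> y"
      using emb_extend[OF K s[unfolded E_def]] by blast
    then show ?thesis using xK by (intro bexI[of _ \<tau>]) auto
  qed
  obtain T where T: "finite T" "T \<subseteq> places" "\<forall>\<tau>\<in>embeddings Qbar. \<forall>p\<in>places - T. local_max N p (\<lambda>i. \<tau> (x i)) = 1"
    using local_max_unit_places[OF x] by auto
  have T1: "local_max N p (\<lambda>i. \<sigma> (x i)) = 1" if s: "\<sigma> \<in> E" and p: "p \<in> places - T" for \<sigma> p
  proof -
    obtain \<tau> where t: "\<tau> \<in> embeddings Qbar" "\<forall>i\<le>N. \<tau> (x i) = \<sigma> (x i)" using ext[OF s] by auto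
    then have "local_max N p (\<lambda>i. \<sigma> (x i)) = local_max N p (\<lambda>i. \<tau> (x i))" by (intro local_max_cong) auto
    then show ?thesis using T(3) t(1) p by simp
  qed
  define g where "g = (\<lambda>(p, \<sigma>). pull_abs K p \<sigma>)"
  have max_g: "Max ((\<lambda>i. g (p, \<sigma>) (x i)) ` {..N}) = local_max N p (\<lambda>i. \<sigma> (x i))" for p \<sigma>
    unfolding local_max_def by (intro arg_cong[where f=Max] image_cong) (auto simp: g_def pull_abs_def xK)
  have g_std: "g (p, \<sigma>) \<in> std_absolute_values K" if "p \<in> places" "\<sigma> \<in> E" for p \<sigma>
    using pull_abs_std[OF K that(1)] that(2) by (simp add: g_def E_def)
  have g_inj: "p = q" if eq: "g (p, \<sigma>) = g (q, \<rho>)" and pq: "p \<in> places" "q \<in> places" and s: "\<sigma> \<in> E" "\<rho> \<in> E" for p q \<sigma> \<rho>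
  proof (rule place_abs_distinct[OF pq])
    fix r
    have "g (p, \<sigma>) (of_rat r) = place_abs p (of_rat r)" "g (q, \<rho>) (of_rat r) = place_abs q (of_rat r)"
      using subfield_of_rat[OF K(1)] embD(9)[OF K(1), of \<sigma>] embD(9)[OF K(1), of \<rho>] s by (auto simp: g_def pull_abs_def E_def)
    then show "place_abs p (of_rat r) = place_abs q (of_rat r)" using eq by simp
  qed
  define deg where "deg = local_degree K"
  have deg: "deg v = card {\<sigma>\<in>E. \<exists>p\<in>places. v = g (p, \<sigma>)}" if "v \<in> std_absolute_values K" for v
    using local_degree_eq[OF K that] by (simp add: deg_def g_def E_def)
  define L where "L = (\<lambda>v :: complex \<Rightarrow> real. ln (Max ((\<lambda>i. v (x i)) ` {..N})))"
  \<comment> \<open>Outside \<open>T\<close> every conjugate has local maximum 1, so these finitely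
    many pairs carry the whole product.\<close>
  define I where "I = T \<times> E"
  have finI: "finite I" using T finE by (simp add: I_def)
  have g_std': "v \<in> std_absolute_values K" if "v \<in> g ` I" for v
    using that g_std T(2) by (auto simp: I_def)
  have Mpos: "Max ((\<lambda>i. v (x i)) ` {..N}) > 0" if v: "v \<in> std_absolute_values K" for v
  proof -
    obtain i where i: "i \<le> N" "x i \<noteq> 0" using x by (auto simp: good_vec_def)
    have av: "absolute_value_on K v" using v by (simp add: std_absolute_values_def)
    have "v (x i) \<ge> 0 \<and> (v (x i) = 0 \<longleftrightarrow> x i = 0)" using av xK[OF i(1)] unfolding absolute_value_on_def by blast
    then have "v (x i) > 0" using i by linarith
    also have "v (x i) \<le> Max ((\<lambda>i. v (x i)) ` {..N})" using i by (intro Max_ge) auto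
    finally show ?thesis .
  qed
  have lf: "ln (local_factor N K x v) = real (deg v) * L v" "local_factor N K x v > 0" if "v \<in> std_absolute_values K" for v
    using Mpos[OF that] by (simp_all add: local_factor_def deg_def L_def ln_realpow)
  define V where "V = {v\<in>std_absolute_values K. local_factor N K x v \<noteq> 1}"
  have VI: "V \<subseteq> g ` I"
  proof
    fix v assume v: "v \<in> V"
    then have vs: "v \<in> std_absolute_values K" and l1: "local_factor N K x v \<noteq> 1" by (auto simp: V_def)
    have "deg v \<noteq> 0"
    proof
      assume "deg v = 0"
      then show False using l1 by (simp add: local_factor_def deg_def)
    qed
    then obtain \<sigma> p where sp: "\<sigma> \<in> E" "p \<in> places" "v = g (p, \<sigma>)" using deg[OF vs] by (auto simp: card_gt_0_iff)
    have "p \<in> T"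
    proof (rule ccontr)
      assume "p \<notin> T"
      then have "Max ((\<lambda>i. v (x i)) ` {..N}) = 1" using T1[OF sp(1), of p] sp(2) max_g[of p \<sigma>] sp(3) by simp
      then show False using l1 by (simp add: local_factor_def)
    qed
    then show "v \<in> g ` I" using sp by (auto simp: I_def)
  qed
  have "ln (\<Prod>v\<in>V. local_factor N K x v) = (\<Sum>v\<in>V. ln (local_factor N K x v))"
  proof (rule ln_prod)
    show "finite V" using VI finI finite_subset by blast
    fix v assume "v \<in> V"
    then show "local_factor N K x v \<noteq> 0" using lf(2)[of v] by (auto simp: V_def)
  qed
  also have "\<dots> = (\<Sum>v\<in>g ` I. ln (local_factor N K x v))"
    using VI finI g_std' by (intro sum.mono_neutral_left) (auto simp: V_def)
  also have "\<dots> = (\<Sum>v\<in>g ` I. real (deg v) * L v)" using g_std' lf by (intro sum.cong) auto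
  also have "\<dots> = (\<Sum>v\<in>g ` I. \<Sum>z\<in>{z. z \<in> I \<and> g z = v}. L (g z))"
  proof (rule sum.cong[OF refl])
    fix v assume v: "v \<in> g ` I"
    \<comment> \<open>Within a fibre the place is fixed by the values of \<open>v\<close> on the
      rationals, so projecting to the embedding loses nothing.\<close>
    have "bij_betw snd {z. z \<in> I \<and> g z = v} {\<sigma>\<in>E. \<exists>p\<in>places. v = g (p, \<sigma>)}"
      unfolding bij_betw_def
    proof
      show "inj_on snd {z. z \<in> I \<and> g z = v}"
      proof (rule inj_onI)
        fix z z' assume z: "z \<in> {z. z \<in> I \<and> g z = v}" "z' \<in> {z. z \<in> I \<and> g z = v}" "snd z = snd z'"
        obtain p \<sigma> q \<rho> where zz: "z = (p, \<sigma>)" "z' = (q, \<rho>)" by (cases z; cases z')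
        have "g (p, \<sigma>) = g (q, \<rho>)" "p \<in> T" "q \<in> T" "\<sigma> \<in> E" "\<rho> \<in> E" using z unfolding zz I_def by auto
        then have "p = q" using g_inj[of p \<sigma> q \<rho>] T(2) by blast
        then show "z = z'" using z(3) by (simp add: zz)
      qed
      obtain p0 \<sigma>0 where v0: "v = g (p0, \<sigma>0)" "p0 \<in> T" "\<sigma>0 \<in> E" using v by (auto simp: I_def)
      show "snd ` {z. z \<in> I \<and> g z = v} = {\<sigma>\<in>E. \<exists>p\<in>places. v = g (p, \<sigma>)}"
      proof (intro set_eqI iffI)
        fix \<sigma> assume "\<sigma> \<in> snd ` {z. z \<in> I \<and> g z = v}"
        then show "\<sigma> \<in> {\<sigma>\<in>E. \<exists>p\<in>places. v = g (p, \<sigma>)}" using T(2) by (auto simp: I_def)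
      next
        fix \<sigma> assume "\<sigma> \<in> {\<sigma>\<in>E. \<exists>p\<in>places. v = g (p, \<sigma>)}"
        then obtain p where p: "\<sigma> \<in> E" "p \<in> places" "v = g (p, \<sigma>)" by auto
        then have "p = p0" using g_inj[of p \<sigma> p0 \<sigma>0] v0 T(2) by auto
        then have "(p, \<sigma>) \<in> {z. z \<in> I \<and> g z = v}" using p v0 by (auto simp: I_def)
        then show "\<sigma> \<in> snd ` {z. z \<in> I \<and> g z = v}" by force
      qed
    qed
    then have "card {z. z \<in> I \<and> g z = v} = deg v" using deg[OF g_std'[OF v]] by (simp add: bij_betw_same_card)
    then show "real (deg v) * L v = (\<Sum>z\<in>{z. z \<in> I \<and> g z = v}. L (g z))" by simp
  qed
  also have "\<dots> = (\<Sum>z\<in>I. L (g z))" by (rule sum.image_gen[OF finI, symmetric])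
  also have "\<dots> = (\<Sum>z\<in>I. case z of (p, \<sigma>) \<Rightarrow> ln (local_max N p (\<lambda>i. \<sigma> (x i))))"
    by (intro sum.cong refl) (auto simp: L_def max_g)
  also have "\<dots> = (\<Sum>p\<in>T. \<Sum>\<sigma>\<in>E. ln (local_max N p (\<lambda>i. \<sigma> (x i))))"
    unfolding I_def by (rule sum.cartesian_product[symmetric])
  also have "\<dots> = (\<Sum>\<sigma>\<in>E. \<Sum>p\<in>T. ln (local_max N p (\<lambda>i. \<sigma> (x i))))" by (rule sum.swap)
  also have "\<dots> = (\<Sum>\<sigma>\<in>E. places_height N (\<lambda>i. \<sigma> (x i)))"
  proof (rule sum.cong[OF refl])
    fix \<sigma> assume "\<sigma> \<in> E"
    then show "(\<Sum>p\<in>T. ln (local_max N p (\<lambda>i. \<sigma> (x i)))) = places_height N (\<lambda>i. \<sigma> (x i))"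
      unfolding places_height_def using T1 by (intro places_sum_eq(1)[OF T(1,2), symmetric]) auto
  qed
  also have "\<dots> = (\<Sum>\<rho>\<in>gal A. places_height N (\<lambda>i. \<rho> (x i)))"
  proof -
    have "(\<Sum>\<rho>\<in>gal A. places_height N (\<lambda>i. \<rho> (x i))) = (\<Sum>\<sigma>\<in>E. places_height N (\<lambda>i. restrict \<sigma> A (x i)))"
      using sum.reindex_bij_betw[OF bij, of "\<lambda>\<rho>. places_height N (\<lambda>i. \<rho> (x i))"] by simp
    also have "\<dots> = (\<Sum>\<sigma>\<in>E. places_height N (\<lambda>i. \<sigma> (x i)))"
      by (intro sum.cong refl places_height_cong) (auto simp: A_def)
    finally show ?thesis by simp
  qed
  finally have sum: "ln (\<Prod>v\<in>V. local_factor N K x v) = (\<Sum>\<rho>\<in>gal A. places_height N (\<lambda>i. \<rho> (x i)))" .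
  have pos: "(\<Prod>v\<in>V. local_factor N K x v) > 0" using lf(2) by (intro prod_pos) (auto simp: V_def)
  have card: "card (embeddings K) = card (gal A)" using bij bij_betw_same_card by (auto simp: E_def)
  have "height_over N K x = exp (1 / real (card (gal A)) * ln (\<Prod>v\<in>V. local_factor N K x v))"
    using pos unfolding height_over_def V_def[symmetric] card powr_def by (simp del: prod_eq_1_iff)
  also have "\<dots> = exp (log_height N x)" unfolding sum log_height_def gal_avg_def A_def by simp
  finally show ?thesis by (simp add: K_def A_def)
qed

lemma log_height_superset:
  assumes x: "good_vec N x" and B: "finite B" "B \<subseteq> Qbar" "x ` {..N} \<subseteq> B"
  shows "log_height N x = gal_avg B (\<lambda>\<sigma>. places_height N (\<lambda>i. \<sigma> (x i)))"
proof -
  have "log_height N x = gal_avg B (\<lambda>\<sigma>. places_height N (\<lambda>i. restrict \<sigma> (x ` {..N}) (x i)))"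
    unfolding log_height_def by (rule gal_avg_restrict[OF B, symmetric])
  also have "\<dots> = gal_avg B (\<lambda>\<sigma>. places_height N (\<lambda>i. \<sigma> (x i)))"
  proof -
    have "places_height N (\<lambda>i. restrict \<sigma> (x ` {..N}) (x i)) = places_height N (\<lambda>i. \<sigma> (x i))" for \<sigma>
      by (intro places_height_cong) auto
    then show ?thesis by simp
  qed
  finally show ?thesis .
qed

text \<open>For one conjugate, scaling shifts the sum over places by that of \<open>c\<close>; these
  shifts average to zero by the product formula. The set \<open>B\<close> contains \<open>c\<close>
  so that one average sees both.\<close>

lemma log_height_scale:
  assumes x: "good_vec N x" and c: "c \<in> Qbar" "c \<noteq> 0"
  shows "log_height N (\<lambda>i. c * x i) = log_height N x"
proof -
  define B where "B = insert c (x ` {..N} \<union> (\<lambda>i. c * x i) ` {..N})"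
  have B: "finite B" "B \<subseteq> Qbar" "x ` {..N} \<subseteq> B" "(\<lambda>i. c * x i) ` {..N} \<subseteq> B" "c \<in> B"
    using x c by (auto simp: B_def good_vec_def Qbar_mult)
  have gc: "good_vec N (\<lambda>i. c * x i)" using x c by (auto simp: good_vec_def Qbar_mult)
  have e: "places_height N (\<lambda>i. \<sigma> (c * x i)) = places_sum (\<lambda>p. ln (place_abs p (\<sigma> c))) + places_height N (\<lambda>i. \<sigma> (x i))" if s: "\<sigma> \<in> gal B" for \<sigma>
  proof -
    obtain \<tau> where t: "\<tau> \<in> embeddings Qbar" "\<sigma> = restrict \<tau> B" using s by (auto simp: gal_def)
    have sx: "\<sigma> (x i) = \<tau> (x i)" "\<sigma> (c * x i) = \<tau> c * \<tau> (x i)" if "i \<le> N" for i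
      using that B t QembD(4)[OF t(1) c(1)] x by (auto simp: good_vec_def)
    have sc: "\<sigma> c = \<tau> c" using t B by simp
    have gt: "good_vec N (\<lambda>i. \<tau> (x i))" by (rule good_vec_emb[OF x t(1)])
    have tc: "\<tau> c \<in> Qbar" "\<tau> c \<noteq> 0" using t c QembD(8)[OF t(1)] by auto
    have m: "local_max N p (\<lambda>i. \<tau> c * \<tau> (x i)) = place_abs p (\<tau> c) * local_max N p (\<lambda>i. \<tau> (x i))" if p: "p \<in> places" for p
    proof -
      have w: "place_abs p (\<tau> c * \<tau> (x i)) = place_abs p (\<tau> c) * place_abs p (\<tau> (x i))" if "i \<le> N" for i
        using place_absD(3)[OF p tc(1)] gt that by (auto simp: good_vec_def)
      have c0: "place_abs p (\<tau> c) > 0" using place_absD(12)[OF p tc] .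
      show ?thesis
      proof (rule antisym)
        show "local_max N p (\<lambda>i. \<tau> c * \<tau> (x i)) \<le> place_abs p (\<tau> c) * local_max N p (\<lambda>i. \<tau> (x i))"
          using w c0 local_max_ge[of _ N p "\<lambda>i. \<tau> (x i)"] by (intro local_max_le) (simp add: mult_left_mono)
        obtain i where "i \<le> N" "local_max N p (\<lambda>i. \<tau> (x i)) = place_abs p (\<tau> (x i))" using local_max_attained by blast
        then show "place_abs p (\<tau> c) * local_max N p (\<lambda>i. \<tau> (x i)) \<le> local_max N p (\<lambda>i. \<tau> c * \<tau> (x i))"
          using w local_max_ge[of i N p "\<lambda>i. \<tau> c * \<tau> (x i)"] by simp
      qed
    qed
    have "places_height N (\<lambda>i. \<sigma> (c * x i)) = places_height N (\<lambda>i. \<tau> c * \<tau> (x i))" by (intro places_height_cong sx)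
    also have "\<dots> = places_sum (\<lambda>p. ln (place_abs p (\<tau> c)) + ln (local_max N p (\<lambda>i. \<tau> (x i))))"
      unfolding places_height_def
    proof (rule places_sum_cong)
      fix p assume p: "p \<in> places"
      show "ln (local_max N p (\<lambda>i. \<tau> c * \<tau> (x i))) = ln (place_abs p (\<tau> c)) + ln (local_max N p (\<lambda>i. \<tau> (x i)))"
        unfolding m[OF p] using local_max_pos[OF p gt] place_absD(12)[OF p tc] by (simp add: ln_mult)
    qed
    also have "\<dots> = places_sum (\<lambda>p. ln (place_abs p (\<tau> c))) + places_height N (\<lambda>i. \<tau> (x i))"
      unfolding places_height_def using product_formula(2)[OF B(1,2,5) c(2) s] fin_places_local_max[OF x t(1)] sc
      by (intro places_sum_add(1)) simp_all
    also have "places_height N (\<lambda>i. \<tau> (x i)) = places_height N (\<lambda>i. \<sigma> (x i))" by (intro places_height_cong sx[symmetric])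
    finally show ?thesis by (simp add: sc)
  qed
  have "log_height N (\<lambda>i. c * x i) = gal_avg B (\<lambda>\<sigma>. places_height N (\<lambda>i. \<sigma> (c * x i)))"
    by (rule log_height_superset[OF gc B(1,2,4)])
  also have "\<dots> = gal_avg B (\<lambda>\<sigma>. places_sum (\<lambda>p. ln (place_abs p (\<sigma> c)))) + gal_avg B (\<lambda>\<sigma>. places_height N (\<lambda>i. \<sigma> (x i)))"
    unfolding gal_avg_def using e by (simp add: sum.distrib add_divide_distrib)
  also have "\<dots> = log_height N x" using product_formula(1)[OF B(1,2,5) c(2)] log_height_superset[OF x B(1-3)] by simp
  finally show ?thesis .
qed

text \<open>The representative chosen in \<open>height\<close> is a scalar multiple of
  \<open>x\<close>, and \<open>log_height\<close> does not see the scalar.\<close>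

theorem height_point_of:
  assumes x: "x \<in> hcoords N"
  shows "height N (point_of x) = exp (log_height N x)"
proof -
  define y where "y = (SOME y. y \<in> point_of x)"
  have "x \<in> point_of x" unfolding point_of_def by (auto intro: exI[of _ 1])
  then have "y \<in> point_of x" unfolding y_def by (rule someI[of "\<lambda>y. y \<in> point_of x"])
  then obtain c where c: "y = (\<lambda>i. c * x i)" "c \<in> Qbar" "c \<noteq> 0" by (auto simp: point_of_def)
  have gx: "good_vec N x" by (rule hcoords_good[OF x])
  have gy: "good_vec N y" using gx c by (auto simp: good_vec_def Qbar_mult)
  have "height N (point_of x) = exp (log_height N y)"
    unfolding height_def Let_def y_def[symmetric] by (rule height_over_eq[OF gy])
  then show ?thesis using log_height_scale[OF gx c(2,3)] c by simp
qed


section \<open>Homogeneous polynomial functions\<close>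

text \<open>Forms in the first \<open>n\<close> coordinates with algebraic coefficients, taken as
  functions, since values are all that the height estimates see. Zero has every degree, which makes
  each degree closed under addition.\<close>

inductive homfun :: "nat \<Rightarrow> nat \<Rightarrow> (cvec \<Rightarrow> complex) \<Rightarrow> bool" for n :: nat where
  zero: "homfun n d (\<lambda>x. 0)"
| const: "c \<in> Qbar \<Longrightarrow> homfun n 0 (\<lambda>x. c)"
| var: "i < n \<Longrightarrow> homfun n 1 (\<lambda>x. x i)"
| add: "homfun n d f \<Longrightarrow> homfun n d g \<Longrightarrow> homfun n d (\<lambda>x. f x + g x)"
| mult: "homfun n d f \<Longrightarrow> homfun n e g \<Longrightarrow> homfun n (d + e) (\<lambda>x. f x * g x)"

lemma homfun_sum: "(\<And>i. i \<in> A \<Longrightarrow> homfun n d (f i)) \<Longrightarrow> homfun n d (\<lambda>x. \<Sum>i\<in>A. f i x)"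
  by (induction A rule: infinite_finite_induct) (auto intro: homfun.intros)

lemma homfun_cmult: "c \<in> Qbar \<Longrightarrow> homfun n d f \<Longrightarrow> homfun n d (\<lambda>x. c * f x)"
  using homfun.mult[OF homfun.const, of c n d f] by simp

lemma homfun_power: "homfun n d f \<Longrightarrow> homfun n (k * d) (\<lambda>x. f x ^ k)"
  by (induction k) (auto intro: homfun.intros)

lemma homfun_mono: "homfun n d f \<Longrightarrow> n \<le> m \<Longrightarrow> homfun m d f"
  by (induction rule: homfun.induct) (auto intro: homfun.intros homfun.var[simplified])

lemma homfun_prod_vars:
  assumes "finite A" "\<And>i. i \<in> A \<Longrightarrow> i < n"
  shows "homfun n (\<Sum>i\<in>A. e i) (\<lambda>x. \<Prod>i\<in>A. x i ^ e i)"
  using assms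
proof (induction A rule: finite_induct)
  case (insert i A)
  then show ?case using homfun.mult[OF homfun_power[OF homfun.var, of i n "e i"], of "\<Sum>i\<in>A. e i"] by simp
qed (auto intro: homfun.const)

lemma homfun_scale: "homfun n d f \<Longrightarrow> f (\<lambda>i. c * x i) = c ^ d * f x"
  by (induction rule: homfun.induct) (auto simp: algebra_simps power_add)

lemma homfun_depends: "homfun n d f \<Longrightarrow> (\<And>i. i < n \<Longrightarrow> x i = y i) \<Longrightarrow> f x = f y"
  by (induction rule: homfun.induct) auto

lemma homfun_Qbar: "homfun n d f \<Longrightarrow> (\<And>i. i < n \<Longrightarrow> x i \<in> Qbar) \<Longrightarrow> f x \<in> Qbar"
  by (induction rule: homfun.induct) (auto intro: Qbar_closed)

lemma homfun_zero_pos: "homfun n d f \<Longrightarrow> d > 0 \<Longrightarrow> f (\<lambda>_. 0) = 0"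
  using homfun_scale[of n d f 0 "\<lambda>_. 0"] by (simp add: power_0_left)

lemma homfun_const: "homfun n d f \<Longrightarrow> d = 0 \<Longrightarrow> \<exists>c\<in>Qbar. f = (\<lambda>x. c)"
proof (induction rule: homfun.induct)
  case (add d f g) then show ?case using Qbar_add by fastforce
next
  case (mult d f e g) then show ?case using Qbar_mult by fastforce
qed auto

text \<open>The components beyond \<open>D\<close> are required to vanish so that two expansions can
  be padded to a common bound and multiplied by \<open>polynomial_product\<close>.\<close>

definition polyfun :: "nat \<Rightarrow> (cvec \<Rightarrow> complex) \<Rightarrow> bool" where
  "polyfun n f \<longleftrightarrow> (\<exists>D h. (\<forall>k. homfun n k (h k)) \<and> (\<forall>k>D. h k = (\<lambda>x. 0)) \<and> f = (\<lambda>x. \<Sum>k\<le>D. h k x))"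

lemma polyfun_homfun:
  assumes "homfun n d f"
  shows "polyfun n f"
proof -
  define h where "h = (\<lambda>k x. if k = d then f x else 0)"
  have "homfun n k (h k)" for k using assms homfun.zero by (cases "k = d") (simp_all add: h_def)
  moreover have "h k = (\<lambda>x. 0)" if "k > d" for k using that by (simp add: h_def)
  moreover have "f = (\<lambda>x. \<Sum>k\<le>d. h k x)" by (simp add: h_def)
  ultimately show ?thesis unfolding polyfun_def by (intro exI[of _ d] exI[of _ h]) simp
qed

lemma polyfun_const: "c \<in> Qbar \<Longrightarrow> polyfun n (\<lambda>x. c)"
  by (rule polyfun_homfun[OF homfun.const])

lemma polyfun_bound:
  fixes h :: "nat \<Rightarrow> cvec \<Rightarrow> complex"
  assumes "\<forall>k>D. h k = (\<lambda>x. 0)" "D \<le> E"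
  shows "(\<Sum>k\<le>E. h k x) = (\<Sum>k\<le>D. h k x)"
  using assms by (intro sum.mono_neutral_right) auto

lemma polyfun_add:
  assumes "polyfun n f" "polyfun n g"
  shows "polyfun n (\<lambda>x. f x + g x)"
proof -
  obtain D h where h: "\<forall>k. homfun n k (h k)" "\<forall>k>D. h k = (\<lambda>x. 0)" "f = (\<lambda>x. \<Sum>k\<le>D. h k x)"
    using assms(1) unfolding polyfun_def by auto
  obtain E j where j: "\<forall>k. homfun n k (j k)" "\<forall>k>E. j k = (\<lambda>x. 0)" "g = (\<lambda>x. \<Sum>k\<le>E. j k x)"
    using assms(2) unfolding polyfun_def by auto
  have "homfun n k (\<lambda>x. h k x + j k x)" for k using h(1) j(1) by (intro homfun.add) auto
  moreover have "(\<lambda>x. h k x + j k x) = (\<lambda>x. 0)" if "k > max D E" for k using h(2) j(2) that by simp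
  moreover have "f x + g x = (\<Sum>k\<le>max D E. h k x + j k x)" for x
    unfolding h(3) j(3) sum.distrib
    using polyfun_bound[OF h(2), of "max D E" x] polyfun_bound[OF j(2), of "max D E" x] by simp
  ultimately show ?thesis unfolding polyfun_def
    by (intro exI[of _ "max D E"] exI[of _ "\<lambda>k x. h k x + j k x"]) simp
qed

lemma polyfun_mult:
  assumes "polyfun n f" "polyfun n g"
  shows "polyfun n (\<lambda>x. f x * g x)"
proof -
  obtain D h where h: "\<forall>k. homfun n k (h k)" "\<forall>k>D. h k = (\<lambda>x. 0)" "f = (\<lambda>x. \<Sum>k\<le>D. h k x)"
    using assms(1) unfolding polyfun_def by auto
  obtain E j where j: "\<forall>k. homfun n k (j k)" "\<forall>k>E. j k = (\<lambda>x. 0)" "g = (\<lambda>x. \<Sum>k\<le>E. j k x)"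
    using assms(2) unfolding polyfun_def by auto
  define m where "m = (\<lambda>r x. \<Sum>k\<le>r. h k x * j (r - k) x)"
  have "homfun n r (m r)" for r
    unfolding m_def
  proof (rule homfun_sum)
    fix k assume "k \<in> {..r}"
    then show "homfun n r (\<lambda>x. h k x * j (r - k) x)"
      using homfun.mult[OF spec[OF h(1), of k] spec[OF j(1), of "r - k"]] by simp
  qed
  moreover have "m r = (\<lambda>x. 0)" if "r > D + E" for r
  proof -
    have "h k x * j (r - k) x = 0" for k x
    proof (cases "k > D")
      case True
      then show ?thesis using h(2) by simp
    next
      case False
      then have "r - k > E" using that by simp
      then show ?thesis using j(2) by simp
    qed
    then show ?thesis by (simp only: m_def sum.neutral_const)
  qed
  moreover have "f x * g x = (\<Sum>r\<le>D + E. m r x)" for x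
  proof -
    have "(\<Sum>i\<le>D. h i x * 1 ^ i) * (\<Sum>i\<le>E. j i x * 1 ^ i) = (\<Sum>r\<le>D + E. (\<Sum>k\<le>r. h k x * j (r - k) x) * 1 ^ r)"
      by (rule polynomial_product[of D "\<lambda>k. h k x" E "\<lambda>k. j k x" 1]) (simp_all add: h(2) j(2))
    then show ?thesis by (simp add: h(3) j(3) m_def)
  qed
  ultimately show ?thesis unfolding polyfun_def by (intro exI[of _ "D + E"] exI[of _ m] conjI allI impI) blast+
qed

lemma polyfun_power: "polyfun n f \<Longrightarrow> polyfun n (\<lambda>x. f x ^ k)"
proof (induction k)
  case 0
  show ?case using polyfun_const[of 1 n] by simp
next
  case (Suc k)
  then show ?case using polyfun_mult[of n f "\<lambda>x. f x ^ k"] by simp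
qed

lemma polyfun_sum: "(\<And>i. i \<in> A \<Longrightarrow> polyfun n (f i)) \<Longrightarrow> polyfun n (\<lambda>x. \<Sum>i\<in>A. f i x)"
proof (induction A rule: infinite_finite_induct)
  case (insert i A)
  then show ?case using polyfun_add[of n "f i" "\<lambda>x. \<Sum>i\<in>A. f i x"] by simp
qed (use polyfun_const[of 0 n] in auto)

lemma polyfun_mono:
  assumes "polyfun n f" "n \<le> m"
  shows "polyfun m f"
proof -
  obtain D h where h: "\<forall>k. homfun n k (h k)" "\<forall>k>D. h k = (\<lambda>x. 0)" "f = (\<lambda>x. \<Sum>k\<le>D. h k x)"
    using assms(1) unfolding polyfun_def by auto
  have "\<forall>k. homfun m k (h k)" using h(1) homfun_mono[OF _ assms(2)] by simp
  then show ?thesis unfolding polyfun_def using h(2,3) by blast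
qed

lemma polyfun_depends:
  assumes "polyfun n f" "\<And>i. i < n \<Longrightarrow> x i = y i"
  shows "f x = f y"
proof -
  obtain D h where h: "\<forall>k. homfun n k (h k)" "f = (\<lambda>x. \<Sum>k\<le>D. h k x)"
    using assms(1) unfolding polyfun_def by auto
  have "h k x = h k y" for k by (rule homfun_depends[OF spec[OF h(1)] assms(2)])
  then show ?thesis by (simp add: h)
qed

lemma polyfun_Qbar:
  assumes "polyfun n f" "\<And>i. i < n \<Longrightarrow> x i \<in> Qbar"
  shows "f x \<in> Qbar"
proof -
  obtain D h where h: "\<forall>k. homfun n k (h k)" "f = (\<lambda>x. \<Sum>k\<le>D. h k x)"
    using assms(1) unfolding polyfun_def by auto
  have "h k x \<in> Qbar" for k by (rule homfun_Qbar[OF spec[OF h(1)] assms(2)])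
  then show ?thesis unfolding h(2) by (rule Qbar_sum)
qed

text \<open>Separates the last coordinate, the one that the induction in the Nullstellensatz
  eliminates.\<close>

lemma homfun_expand:
  assumes "homfun (Suc n) d f"
  shows "\<exists>c. (\<forall>i\<le>d. homfun n (d - i) (c i)) \<and> (\<forall>i>d. c i = (\<lambda>x. 0)) \<and> (\<forall>x. f x = (\<Sum>i\<le>d. c i x * x n ^ i))"
  using assms
proof (induction rule: homfun.induct)
  case (zero d)
  show ?case by (rule exI[of _ "\<lambda>i x. 0"]) (auto intro: homfun.zero)
next
  case (const a)
  show ?case by (rule exI[of _ "\<lambda>i. if i = 0 then (\<lambda>x. a) else (\<lambda>x. 0)"]) (use const in \<open>auto intro: homfun.const\<close>)
next
  case (var i)
  show ?case
  proof (cases "i = n")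
    case True
    then show ?thesis
      by (intro exI[of _ "\<lambda>i. if i = 1 then (\<lambda>x. 1) else (\<lambda>x. 0)"]) (auto intro: homfun.const homfun.zero)
  next
    case False
    then have "i < n" using var by simp
    then show ?thesis
      by (intro exI[of _ "\<lambda>k. if k = 0 then (\<lambda>x. x i) else (\<lambda>x. 0)"]) (auto intro: homfun.var[of i n, simplified] homfun.zero)
  qed
next
  case (add d f g)
  then obtain a b where ab: "\<forall>i\<le>d. homfun n (d - i) (a i)" "\<forall>i>d. a i = (\<lambda>x. 0)" "\<forall>x. f x = (\<Sum>i\<le>d. a i x * x n ^ i)"
    "\<forall>i\<le>d. homfun n (d - i) (b i)" "\<forall>i>d. b i = (\<lambda>x. 0)" "\<forall>x. g x = (\<Sum>i\<le>d. b i x * x n ^ i)" by auto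
  show ?case
    by (rule exI[of _ "\<lambda>i x. a i x + b i x"]) (use ab in \<open>auto intro: homfun.add simp: sum.distrib algebra_simps\<close>)
next
  case (mult d f e g)
  then obtain a b where ab: "\<forall>i\<le>d. homfun n (d - i) (a i)" "\<forall>i>d. a i = (\<lambda>x. 0)" "\<forall>x. f x = (\<Sum>i\<le>d. a i x * x n ^ i)"
    "\<forall>i\<le>e. homfun n (e - i) (b i)" "\<forall>i>e. b i = (\<lambda>x. 0)" "\<forall>x. g x = (\<Sum>i\<le>e. b i x * x n ^ i)" by auto
  define m where "m = (\<lambda>r x. \<Sum>k\<le>r. a k x * b (r - k) x)"
  have "homfun n (d + e - r) (m r)" if r: "r \<le> d + e" for r
    unfolding m_def
  proof (rule homfun_sum)
    fix k assume k: "k \<in> {..r}"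
    show "homfun n (d + e - r) (\<lambda>x. a k x * b (r - k) x)"
    proof (cases "k \<le> d \<and> r - k \<le> e")
      case True
      then show ?thesis using homfun.mult[of n "d - k" "a k" "e - (r - k)" "b (r - k)"] ab k by simp
    next
      case False
      then have "(\<lambda>x. a k x * b (r - k) x) = (\<lambda>x. 0)" using ab by (auto simp: not_le)
      then show ?thesis by (simp add: homfun.zero)
    qed
  qed
  moreover have "m r = (\<lambda>x. 0)" if "r > d + e" for r
  proof -
    have "a k x * b (r - k) x = 0" for k x
    proof (cases "k > d")
      case True
      then show ?thesis using ab(2) by simp
    next
      case False
      then have "r - k > e" using that by simp
      then show ?thesis using ab(5) by simp
    qed
    then show ?thesis by (simp only: m_def sum.neutral_const)
  qed
  moreover have "f x * g x = (\<Sum>r\<le>d + e. m r x * x n ^ r)" for x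
  proof -
    have "(\<Sum>i\<le>d. a i x * x n ^ i) * (\<Sum>i\<le>e. b i x * x n ^ i) = (\<Sum>r\<le>d + e. (\<Sum>k\<le>r. a k x * b (r - k) x) * x n ^ r)"
      by (rule polynomial_product[of d "\<lambda>k. a k x" e "\<lambda>k. b k x" "x n"]) (simp_all add: ab(2,5))
    then show ?thesis by (simp add: ab(3,6) m_def)
  qed
  ultimately show ?case by (intro exI[of _ m]) auto
qed

lemma polyfun_expand:
  assumes "polyfun (Suc n) f"
  shows "\<exists>D c. (\<forall>i. polyfun n (c i)) \<and> (\<forall>x. f x = (\<Sum>i\<le>D. c i x * x n ^ i))"
proof -
  obtain D h where h: "\<And>k. homfun (Suc n) k (h k)" "f = (\<lambda>x. \<Sum>k\<le>D. h k x)"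
    using assms unfolding polyfun_def by auto
  have "\<forall>d. \<exists>c. (\<forall>i\<le>d. homfun n (d - i) (c i)) \<and> (\<forall>i>d. c i = (\<lambda>x. 0)) \<and> (\<forall>x. h d x = (\<Sum>i\<le>d. c i x * x n ^ i))"
    using homfun_expand[OF h(1)] by blast
  then obtain c where c: "\<And>d i. i \<le> d \<Longrightarrow> homfun n (d - i) (c d i)" "\<And>d i. i > d \<Longrightarrow> c d i = (\<lambda>x. 0)"
    "\<And>d x. h d x = (\<Sum>i\<le>d. c d i x * x n ^ i)" by metis
  have cp: "polyfun n (c d i)" for d i
    using polyfun_homfun[OF c(1)] polyfun_const[of 0 n] c(2) by (cases "i \<le> d") auto
  define e where "e = (\<lambda>i x. \<Sum>d\<le>D. c d i x)"
  have "f x = (\<Sum>i\<le>D. e i x * x n ^ i)" for x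
  proof -
    have "f x = (\<Sum>d\<le>D. \<Sum>i\<le>D. c d i x * x n ^ i)"
      unfolding h(2) c(3) by (intro sum.cong refl sum.mono_neutral_left) (auto simp: c(2))
    also have "\<dots> = (\<Sum>i\<le>D. \<Sum>d\<le>D. c d i x * x n ^ i)" by (rule sum.swap)
    finally show ?thesis by (simp add: e_def sum_distrib_right)
  qed
  moreover have "polyfun n (e i)" for i unfolding e_def by (intro polyfun_sum cp)
  ultimately show ?thesis by blast
qed

section \<open>Ideals of polynomial functions\<close>

definition pf_ideal :: "nat \<Rightarrow> (cvec \<Rightarrow> complex) set \<Rightarrow> bool" where
  "pf_ideal n J \<longleftrightarrow> (\<forall>f\<in>J. polyfun n f) \<and> (\<lambda>x. 0) \<in> J \<and> (\<forall>f\<in>J. \<forall>g\<in>J. (\<lambda>x. f x + g x) \<in> J) \<and>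
     (\<forall>f\<in>J. \<forall>g. polyfun n g \<longrightarrow> (\<lambda>x. g x * f x) \<in> J)"

lemma pf_idealD:
  assumes "pf_ideal n J"
  shows "f \<in> J \<Longrightarrow> polyfun n f" "(\<lambda>x. 0) \<in> J" "f \<in> J \<Longrightarrow> g \<in> J \<Longrightarrow> (\<lambda>x. f x + g x) \<in> J"
    "f \<in> J \<Longrightarrow> polyfun n g \<Longrightarrow> (\<lambda>x. g x * f x) \<in> J"
    "f \<in> J \<Longrightarrow> g \<in> J \<Longrightarrow> (\<lambda>x. f x - g x) \<in> J"
    "(\<And>i. i \<in> A \<Longrightarrow> h i \<in> J) \<Longrightarrow> (\<lambda>x. \<Sum>i\<in>A. h i x) \<in> J"
proof -
  show 1: "f \<in> J \<Longrightarrow> polyfun n f" "(\<lambda>x. 0) \<in> J" "f \<in> J \<Longrightarrow> g \<in> J \<Longrightarrow> (\<lambda>x. f x + g x) \<in> J"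
    "f \<in> J \<Longrightarrow> polyfun n g \<Longrightarrow> (\<lambda>x. g x * f x) \<in> J" for f g
    using assms unfolding pf_ideal_def by auto
  show "f \<in> J \<Longrightarrow> g \<in> J \<Longrightarrow> (\<lambda>x. f x - g x) \<in> J"
    using 1(3)[of f "\<lambda>x. (- 1) * g x"] 1(4)[of g "\<lambda>x. - 1"] polyfun_const[of "- 1" n] by (simp add: Qbar_uminus)
  show "(\<And>i. i \<in> A \<Longrightarrow> h i \<in> J) \<Longrightarrow> (\<lambda>x. \<Sum>i\<in>A. h i x) \<in> J"
  proof (induction A rule: infinite_finite_induct)
    case (insert i A)
    then show ?case using 1(3)[of "h i" "\<lambda>x. \<Sum>i\<in>A. h i x"] by simp
  qed (use 1(2) in auto)
qed

text \<open>Closure under \<open>f \<mapsto> f(2x)\<close> is homogeneity in disguise: the components of an element are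
  separated by the distinct eigenvalues \<open>2\<^sup>k\<close>.\<close>

lemma component_mem:
  fixes h :: "nat \<Rightarrow> cvec \<Rightarrow> complex"
  assumes "finite A" and h: "\<And>k. k \<in> A \<Longrightarrow> homfun n k (h k)"
    and add: "\<And>f g. f \<in> J \<Longrightarrow> g \<in> J \<Longrightarrow> (\<lambda>x. f x + g x) \<in> J"
    and cm: "\<And>c f. c \<in> \<rat> \<Longrightarrow> f \<in> J \<Longrightarrow> (\<lambda>x. c * f x) \<in> J"
    and scale: "\<And>f. f \<in> J \<Longrightarrow> (\<lambda>x. f (\<lambda>i. 2 * x i)) \<in> J"
    and mem: "(\<lambda>x. \<Sum>k\<in>A. h k x) \<in> J" and k: "k \<in> A"
  shows "h k \<in> J"
  using assms(1) h mem k
proof (induction A arbitrary: h k rule: finite_induct)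
  case (insert j A)
  have add': "(\<lambda>x. f x - g x) \<in> J" if "f \<in> J" "g \<in> J" for f g
    using add[OF that(1) cm[of "- 1" g]] that(2) by simp
  have sumJ: "(\<lambda>x. \<Sum>i\<in>B. g i x) \<in> J" if "finite B" "B \<noteq> {}" "\<And>i. i \<in> B \<Longrightarrow> g i \<in> J" for B and g :: "nat \<Rightarrow> cvec \<Rightarrow> complex"
    using that by (induction B rule: finite_ne_induct) (auto intro: add)
  define f where "f = (\<lambda>x. \<Sum>k\<in>insert j A. h k x)"
  have fJ: "f \<in> J" using insert.prems(2) by (simp add: f_def)
  \<comment> \<open>The difference kills the component of degree \<open>j\<close> and multiplies
    each other one by \<open>2 ^ k - 2 ^ j\<close>, which is nonzero; so the induction hypothesis
    applies to \<open>A\<close>.\<close>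
  have "(\<lambda>x. f (\<lambda>i. 2 * x i) - 2 ^ j * f x) \<in> J"
    by (intro add' scale fJ cm) auto
  moreover have "f (\<lambda>i. 2 * x i) - 2 ^ j * f x = (\<Sum>k\<in>A. (2 ^ k - 2 ^ j) * h k x)" for x
  proof -
    have "f (\<lambda>i. 2 * x i) = (\<Sum>k\<in>insert j A. 2 ^ k * h k x)"
      unfolding f_def by (intro sum.cong refl homfun_scale[OF insert.prems(1)])
    then have "f (\<lambda>i. 2 * x i) - 2 ^ j * f x = (\<Sum>k\<in>insert j A. 2 ^ k * h k x - 2 ^ j * h k x)"
      by (simp only: f_def sum_distrib_left sum_subtractf)
    also have "\<dots> = (\<Sum>k\<in>A. (2 ^ k - 2 ^ j) * h k x)"
      using insert.hyps by (simp add: algebra_simps)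
    finally show ?thesis .
  qed
  ultimately have memA: "(\<lambda>x. \<Sum>k\<in>A. (2 ^ k - 2 ^ j) * h k x) \<in> J" by simp
  have IH: "(\<lambda>x. (2 ^ k - 2 ^ j) * h k x) \<in> J" if "k \<in> A" for k
  proof (rule insert.IH[OF _ memA that])
    fix k assume "k \<in> A"
    moreover have "(2 ^ k - 2 ^ j :: complex) \<in> Qbar" by (intro Qbar_rat) simp
    ultimately show "homfun n k (\<lambda>x. (2 ^ k - 2 ^ j) * h k x)" using insert.prems(1) by (intro homfun_cmult) auto
  qed
  have hA: "h k \<in> J" if k: "k \<in> A" for k
  proof -
    have ne: "(2 ^ k - 2 ^ j :: complex) \<noteq> 0"
    proof
      assume "(2 ^ k - 2 ^ j :: complex) = 0"
      then have "of_nat (2 ^ k) = (of_nat (2 ^ j) :: complex)" by simp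
      then have "(2::nat) ^ k = 2 ^ j" by (simp only: of_nat_eq_iff)
      then have "k = j" by simp
      then show False using k insert.hyps by simp
    qed
    have "(\<lambda>x. inverse (2 ^ k - 2 ^ j) * ((2 ^ k - 2 ^ j) * h k x)) \<in> J"
      by (intro cm IH k Rats_inverse) auto
    then show ?thesis using ne by (simp add: mult.assoc[symmetric])
  qed
  show ?case
  proof (cases "k = j")
    case True
    show ?thesis
    proof (cases "A = {}")
      case True
      then show ?thesis using insert.prems \<open>k = j\<close> by simp
    next
      case False
      have "(\<lambda>x. f x - (\<Sum>k\<in>A. h k x)) \<in> J" using fJ sumJ[OF insert.hyps(1) False hA] by (intro add')
      moreover have "(\<lambda>x. f x - (\<Sum>k\<in>A. h k x)) = h j" using insert.hyps by (simp add: f_def)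
      ultimately show ?thesis using True by simp
    qed
  qed (use hA insert.prems in auto)
qed simp

lemma pf_ideal_components:
  assumes J: "pf_ideal n J" and scale: "\<And>f. f \<in> J \<Longrightarrow> (\<lambda>x. f (\<lambda>i. 2 * x i)) \<in> J" and f: "f \<in> J"
  shows "\<exists>D h. (\<forall>k. homfun n k (h k)) \<and> f = (\<lambda>x. \<Sum>k\<le>D. h k x) \<and> (\<forall>k\<le>D. h k \<in> J)"
proof -
  obtain D h where h: "\<forall>k. homfun n k (h k)" "f = (\<lambda>x. \<Sum>k\<le>D. h k x)"
    using pf_idealD(1)[OF J f] unfolding polyfun_def by auto
  have "h k \<in> J" if "k \<le> D" for k
  proof (rule component_mem[of "{..D}" n h J])
    fix c :: complex and f assume "c \<in> \<rat>" "f \<in> J"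
    then show "(\<lambda>x. c * f x) \<in> J" using pf_idealD(4)[OF J _ polyfun_const[of c]] Qbar_rat by auto
  qed (use h f that pf_idealD(3)[OF J] scale in auto)
  then show ?thesis using h by blast
qed


section \<open>The projective Nullstellensatz\<close>

lemma polyfun_scale:
  assumes "polyfun n f"
  shows "polyfun n (\<lambda>x. f (\<lambda>i. 2 * x i))"
proof -
  obtain D h where h: "\<forall>k. homfun n k (h k)" "f = (\<lambda>x. \<Sum>k\<le>D. h k x)"
    using assms(1) unfolding polyfun_def by auto
  have "h k (\<lambda>i. 2 * x i) = 2 ^ k * h k x" for k x by (rule homfun_scale[OF spec[OF h(1)]])
  moreover have "polyfun n (\<lambda>x. \<Sum>k\<le>D. 2 ^ k * h k x)"
    by (intro polyfun_sum polyfun_mult polyfun_const polyfun_homfun[OF spec[OF h(1)]]) (auto intro: Qbar_rat)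
  ultimately show ?thesis by (simp add: h(2))
qed

definition pf_rad :: "nat \<Rightarrow> (cvec \<Rightarrow> complex) set \<Rightarrow> (cvec \<Rightarrow> complex) set" where
  "pf_rad n J = {f. polyfun n f \<and> (\<exists>e. (\<lambda>x. f x ^ e) \<in> J)}"

lemma pf_rad_mult:
  assumes J: "pf_ideal n J" and f: "f \<in> pf_rad n J" and g: "polyfun n g"
  shows "(\<lambda>x. g x * f x) \<in> pf_rad n J"
proof -
  obtain e where e: "polyfun n f" "(\<lambda>x. f x ^ e) \<in> J" using f by (auto simp: pf_rad_def)
  have "(\<lambda>x. g x ^ e * f x ^ e) \<in> J" by (rule pf_idealD(4)[OF J e(2) polyfun_power[OF g]])
  then have "(\<lambda>x. (g x * f x) ^ e) \<in> J" by (simp add: power_mult_distrib)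
  then show ?thesis using polyfun_mult[OF g e(1)] by (auto simp: pf_rad_def)
qed

lemma pf_rad_add:
  assumes J: "pf_ideal n J" and f: "f \<in> pf_rad n J" and g: "g \<in> pf_rad n J"
  shows "(\<lambda>x. f x + g x) \<in> pf_rad n J"
proof -
  obtain a where a: "polyfun n f" "(\<lambda>x. f x ^ a) \<in> J" using f by (auto simp: pf_rad_def)
  obtain b where b: "polyfun n g" "(\<lambda>x. g x ^ b) \<in> J" using g by (auto simp: pf_rad_def)
  have "(\<lambda>x. \<Sum>k\<le>a+b. of_nat ((a + b) choose k) * f x ^ k * g x ^ (a + b - k)) \<in> J"
  proof (rule pf_idealD(6)[OF J])
    fix k assume k: "k \<in> {..a+b}"
    have c: "polyfun n (\<lambda>x. of_nat ((a + b) choose k))" by (rule polyfun_const) auto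
    show "(\<lambda>x. of_nat ((a + b) choose k) * f x ^ k * g x ^ (a + b - k)) \<in> J"
    proof (cases "a \<le> k")
      case True
      have "(\<lambda>x. (of_nat ((a + b) choose k) * (f x ^ (k - a) * g x ^ (a + b - k))) * f x ^ a) \<in> J"
        by (intro pf_idealD(4)[OF J a(2)] polyfun_mult c polyfun_power a b)
      moreover have "f x ^ k = f x ^ (k - a) * f x ^ a" for x using True by (simp flip: power_add)
      ultimately show ?thesis by (simp add: mult_ac)
    next
      case False
      have "(\<lambda>x. (of_nat ((a + b) choose k) * (f x ^ k * g x ^ (a - k))) * g x ^ b) \<in> J"
        by (intro pf_idealD(4)[OF J b(2)] polyfun_mult c polyfun_power a b)
      moreover have "g x ^ (a + b - k) = g x ^ (a - k) * g x ^ b" for x using False by (simp flip: power_add)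
      ultimately show ?thesis by (simp add: mult_ac)
    qed
  qed
  then have "(\<lambda>x. (f x + g x) ^ (a + b)) \<in> J" by (simp add: binomial_ring)
  then show ?thesis using polyfun_add[OF a(1) b(1)] by (auto simp: pf_rad_def)
qed

lemma pf_rad_zero: "pf_ideal n J \<Longrightarrow> (\<lambda>x. 0) \<in> pf_rad n J"
  unfolding pf_rad_def using pf_idealD(2)[of n J] polyfun_const[of 0 n] by (auto intro!: exI[of _ 1])

lemma pf_rad_sum:
  assumes J: "pf_ideal n J" and f: "\<And>i. i \<in> A \<Longrightarrow> f i \<in> pf_rad n J"
  shows "(\<lambda>x. \<Sum>i\<in>A. f i x) \<in> pf_rad n J"
  using f
proof (induction A rule: infinite_finite_induct)
  case (insert i A)
  then show ?case using pf_rad_add[OF J, of "f i" "\<lambda>x. \<Sum>i\<in>A. f i x"] by simp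
qed (use pf_rad_zero[OF J] in auto)

text \<open>In a product of positive degree one factor has positive degree and lies in the radical
  by induction.\<close>

lemma homfun_in_pf_rad:
  assumes J: "pf_ideal m J" and v: "\<And>i. i < n \<Longrightarrow> (\<lambda>x. x i) \<in> pf_rad m J" and nm: "n \<le> m"
  shows "homfun n d f \<Longrightarrow> d > 0 \<Longrightarrow> f \<in> pf_rad m J"
proof (induction rule: homfun.induct)
  case (zero d) show ?case by (rule pf_rad_zero[OF J])
next
  case (var i) then show ?case using v by simp
next
  case (add d f g) then show ?case using pf_rad_add[OF J] by simp
next
  case (mult d f e g)
  have pf: "polyfun m f" "polyfun m g" using mult polyfun_homfun homfun_mono[OF _ nm] by blast+
  show ?case
  proof (cases "d > 0")
    case True
    then show ?thesis using pf_rad_mult[OF J mult.IH(1) pf(2)] by (simp add: mult.commute)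
  next
    case False
    then show ?thesis using pf_rad_mult[OF J mult.IH(2) pf(1)] mult.prems by simp
  qed
qed auto

text \<open>\<open>pf_mod n J k\<close> is the module \<open>J + R\<^sub>n 1 + \<dots> + R\<^sub>n t\<^sup>k\<^sup>-\<^sup>1\<close> where \<open>R\<^sub>n\<close> is the ring of polynomial
  functions of the first \<open>n\<close> coordinates and \<open>t\<close> is the next coordinate.\<close>

definition pf_mod :: "nat \<Rightarrow> (cvec \<Rightarrow> complex) set \<Rightarrow> nat \<Rightarrow> (cvec \<Rightarrow> complex) set" where
  "pf_mod n J k = {f. \<exists>j\<in>J. \<exists>b. (\<forall>i. polyfun n (b i)) \<and> f = (\<lambda>x. j x + (\<Sum>i<k. b i x * x n ^ i))}"

lemma pf_modI: "j \<in> J \<Longrightarrow> (\<And>i. polyfun n (b i)) \<Longrightarrow> (\<lambda>x. j x + (\<Sum>i<k. b i x * x n ^ i)) \<in> pf_mod n J k"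
  unfolding pf_mod_def by blast

lemma pf_modE:
  assumes "f \<in> pf_mod n J k"
  obtains j b where "j \<in> J" "\<And>i. polyfun n (b i)" "f = (\<lambda>x. j x + (\<Sum>i<k. b i x * x n ^ i))"
  using assms unfolding pf_mod_def by blast

context
  fixes n :: nat and J :: "(cvec \<Rightarrow> complex) set"
  assumes J: "pf_ideal (Suc n) J"
begin

lemma pf_mod_add:
  assumes "f \<in> pf_mod n J k" "g \<in> pf_mod n J k"
  shows "(\<lambda>x. f x + g x) \<in> pf_mod n J k"
proof -
  obtain j b where 1: "j \<in> J" "\<And>i. polyfun n (b i)" "f = (\<lambda>x. j x + (\<Sum>i<k. b i x * x n ^ i))"
    using assms(1) by (rule pf_modE) blast
  obtain j' b' where 2: "j' \<in> J" "\<And>i. polyfun n (b' i)" "g = (\<lambda>x. j' x + (\<Sum>i<k. b' i x * x n ^ i))"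
    using assms(2) by (rule pf_modE) blast
  have "(\<lambda>x. (j x + j' x) + (\<Sum>i<k. (b i x + b' i x) * x n ^ i)) \<in> pf_mod n J k"
    by (intro pf_modI pf_idealD(3)[OF J] polyfun_add 1 2)
  then show ?thesis by (simp add: 1(3) 2(3) sum.distrib algebra_simps)
qed

lemma pf_mod_mult:
  assumes "f \<in> pf_mod n J k" and r: "polyfun n r"
  shows "(\<lambda>x. r x * f x) \<in> pf_mod n J k"
proof -
  obtain j b where 1: "j \<in> J" "\<And>i. polyfun n (b i)" "f = (\<lambda>x. j x + (\<Sum>i<k. b i x * x n ^ i))"
    using assms(1) by (rule pf_modE) blast
  have "(\<lambda>x. r x * j x + (\<Sum>i<k. (r x * b i x) * x n ^ i)) \<in> pf_mod n J k"
    by (intro pf_modI pf_idealD(4)[OF J] polyfun_mult 1 r polyfun_mono[OF r]) simp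
  then show ?thesis by (simp add: 1(3) algebra_simps sum_distrib_left)
qed

lemma pf_mod_ideal: "j \<in> J \<Longrightarrow> j \<in> pf_mod n J k"
  using pf_modI[of j J n "\<lambda>i x. 0" k] polyfun_const[of 0 n] by simp

lemma pf_mod_base:
  assumes "b \<in> Collect (polyfun n)" "i < k"
  shows "(\<lambda>x. b x * x n ^ i) \<in> pf_mod n J k"
proof -
  have "(\<lambda>x. 0 + (\<Sum>l<k. (if l = i then b x else 0) * x n ^ l)) \<in> pf_mod n J k"
  proof (rule pf_modI)
    fix l show "polyfun n (\<lambda>x. if l = i then b x else 0)"
      using assms(1) polyfun_const[of 0 n] by (cases "l = i") simp_all
  qed (rule pf_idealD(2)[OF J])
  moreover have "(\<Sum>l<k. (if l = i then b x else 0) * x n ^ l) = b x * x n ^ i" for x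
  proof -
    have "(\<Sum>l<k. (if l = i then b x else 0) * x n ^ l) = (\<Sum>l<k. if l = i then b x * x n ^ l else 0)"
      by (intro sum.cong) auto
    then show ?thesis using assms(2) by simp
  qed
  ultimately show ?thesis by simp
qed

lemma pf_mod_sum:
  assumes "\<And>i. i \<in> A \<Longrightarrow> f i \<in> pf_mod n J k"
  shows "(\<lambda>x. \<Sum>i\<in>A. f i x) \<in> pf_mod n J k"
  using assms
proof (induction A rule: infinite_finite_induct)
  case (insert i A)
  then show ?case using pf_mod_add[of "f i" k "\<lambda>x. \<Sum>i\<in>A. f i x"] by simp
qed (use pf_mod_ideal[OF pf_idealD(2)[OF J]] in auto)

lemma coord_power_polyfun: "polyfun (Suc n) (\<lambda>x. x n ^ i)"
  by (intro polyfun_power polyfun_homfun[OF homfun.var]) simp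

text \<open>\<open>g\<close> is monic in \<open>t\<close> up to the unit \<open>c0\<close>, so
  \<open>t ^ d\<close>, and with it every power of \<open>t\<close>, reduces modulo \<open>J\<close>
  to powers below \<open>d\<close>: division with remainder by \<open>g\<close>.\<close>

lemma pf_mod_all:
  assumes g: "g \<in> J" "g = (\<lambda>x. \<Sum>i\<le>d. c i x * x n ^ i)" "\<And>i. polyfun n (c i)"
    and c: "c d = (\<lambda>x. c0)" "c0 \<in> Qbar" "c0 \<noteq> 0" and f: "polyfun (Suc n) f"
  shows "f \<in> pf_mod n J d"
proof -
  have td: "(\<lambda>x. x n ^ d) \<in> pf_mod n J d"
  proof -
    have "(\<lambda>x. inverse c0 * (g x + (\<Sum>i<d. (- 1 * c i x) * x n ^ i))) \<in> pf_mod n J d"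
      using c by (intro pf_mod_mult pf_modI g polyfun_const polyfun_mult) (auto intro: Qbar_closed)
    moreover have "inverse c0 * (g x + (\<Sum>i<d. (- 1 * c i x) * x n ^ i)) = x n ^ d" for x
      unfolding g(2) using c by (simp add: lessThan_Suc_atMost[symmetric] sum_negf)
    ultimately show ?thesis by simp
  qed
  have base: "(\<lambda>x. b x * x n ^ i) \<in> pf_mod n J d" if "polyfun n b" "i \<le> d" for b i
    using pf_mod_base[of b i d] pf_mod_mult[OF td, of b] that by (cases "i = d") auto
  have tm: "(\<lambda>x. x n ^ m) \<in> pf_mod n J d" for m
  proof (induction m)
    case 0
    show ?case using base[of "\<lambda>x. 1" 0] polyfun_const[of 1 n] by simp
  next
    case (Suc m)
    obtain j b where 1: "j \<in> J" "\<And>i. polyfun n (b i)" "(\<lambda>x. x n ^ m) = (\<lambda>x. j x + (\<Sum>i<d. b i x * x n ^ i))"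
      using Suc.IH by (rule pf_modE) blast
    have "(\<lambda>x. x n ^ 1 * j x + (\<Sum>i<d. b i x * x n ^ Suc i)) \<in> pf_mod n J d"
      using 1 by (intro pf_mod_add pf_mod_ideal pf_idealD(4)[OF J] pf_mod_sum base coord_power_polyfun) auto
    moreover have "x n ^ 1 * j x + (\<Sum>i<d. b i x * x n ^ Suc i) = x n ^ Suc m" for x
      using fun_cong[OF 1(3), of x] by (simp add: algebra_simps sum_distrib_left)
    ultimately show ?case by simp
  qed
  obtain D e where e: "\<And>i. polyfun n (e i)" "\<And>x. f x = (\<Sum>i\<le>D. e i x * x n ^ i)"
    using polyfun_expand[OF f] by blast
  have "(\<lambda>x. \<Sum>i\<le>D. e i x * x n ^ i) \<in> pf_mod n J d" by (intro pf_mod_sum pf_mod_mult tm e(1))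
  moreover have "f = (\<lambda>x. \<Sum>i\<le>D. e i x * x n ^ i)" using e(2) by (rule ext)
  ultimately show ?thesis by simp
qed

text \<open>Nakayama's lemma for the finite module \<open>R/J\<close> over the ring of functions of the first \<open>n\<close>
  coordinates, localised at the point \<open>a\<close>; the generators \<open>t\<^sup>k\<close> are removed one at a time.\<close>

lemma nakayama:
  assumes all: "\<And>f. polyfun (Suc n) f \<Longrightarrow> f \<in> pf_mod n J d"
    and f1: "f1 \<in> J" "\<And>t. f1 (a(n := t)) = 1"
  shows "\<exists>r\<in>J. polyfun n r \<and> r a = 1"
proof -
  have ra: "r (a(n := t)) = r a" if "polyfun n r" for r t
    by (rule polyfun_depends[OF that]) auto
  \<comment> \<open>Modulo \<open>J\<close> the constant 1 equals \<open>u\<close>, and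
    \<open>u\<close> vanishes on the line over \<open>a\<close>, so all its coefficients in
    \<open>t\<close> vanish at \<open>a\<close>.\<close>
  define u where "u = (\<lambda>x. 1 + - 1 * f1 x)"
  have "polyfun (Suc n) u"
    unfolding u_def by (intro polyfun_add polyfun_mult polyfun_const pf_idealD(1)[OF J f1(1)]) (auto intro: Qbar_closed)
  then obtain D c where c: "\<And>i. polyfun n (c i)" "\<And>x. u x = (\<Sum>i\<le>D. c i x * x n ^ i)"
    using polyfun_expand by blast
  have ca: "c i a = 0" if i: "i \<le> D" for i
  proof -
    have "(\<Sum>i\<le>D. c i a * t ^ i) = 0" for t
      using c(2)[of "a(n := t)"] f1(2)[of t] ra[OF c(1)] by (simp add: u_def)
    then show ?thesis using i polyfun_eq_0[of "\<lambda>i. c i a" D] by simp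
  qed
  \<comment> \<open>A function with \<open>r a = 1\<close> is a unit of the local ring at
    \<open>a\<close>; instead of localising, everything is multiplied by it.\<close>
  have "\<exists>r. polyfun n r \<and> r a = 1 \<and> (\<forall>f. polyfun (Suc n) f \<longrightarrow> (\<lambda>x. r x * f x) \<in> pf_mod n J (d - m))" if "m \<le> d" for m
    using that
  proof (induction m)
    case 0
    show ?case using all polyfun_const[of 1 n] by (intro exI[of _ "\<lambda>x. 1"]) simp
  next
    case (Suc m)
    define k where "k = d - Suc m"
    have dk: "d - m = Suc k" using Suc.prems by (simp add: k_def)
    obtain r where r: "polyfun n r" "r a = 1" "\<And>f. polyfun (Suc n) f \<Longrightarrow> (\<lambda>x. r x * f x) \<in> pf_mod n J (Suc k)"
      using Suc dk by auto
    define P where "P = (\<lambda>i j b. j \<in> J \<and> (\<forall>l. polyfun n (b l)) \<and>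
      (\<lambda>x. r x * (x n ^ i * x n ^ k)) = (\<lambda>x. j x + (\<Sum>l<Suc k. b l x * x n ^ l)))"
    have "\<exists>j b. P i j b" for i
    proof -
      have "(\<lambda>x. r x * (x n ^ i * x n ^ k)) \<in> pf_mod n J (Suc k)"
        by (intro r(3) polyfun_mult coord_power_polyfun)
      then show ?thesis unfolding P_def by (rule pf_modE) blast
    qed
    then have "\<exists>j. \<forall>i. \<exists>b. P i (j i) b" by (intro choice allI)
    then obtain j where "\<forall>i. \<exists>b. P i (j i) b" by blast
    then have "\<exists>b. \<forall>i. P i (j i) (b i)" by (rule choice)
    then obtain b where P: "\<And>i. P i (j i) (b i)" by blast
    then have jb: "\<And>i. j i \<in> J" "\<And>i l. polyfun n (b i l)"
      "\<And>i. (\<lambda>x. r x * (x n ^ i * x n ^ k)) = (\<lambda>x. j i x + (\<Sum>l<Suc k. b i l x * x n ^ l))"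
      unfolding P_def by blast+
    \<comment> \<open>Modulo \<open>J\<close>, \<open>r t ^ k\<close> equals
      \<open>u r t ^ k\<close>. Expanding \<open>u\<close> and then each
      \<open>r t ^ (i + k)\<close> in the remaining generators gives coefficients
      \<open>\<mu> l\<close> that are combinations of the coefficients of \<open>u\<close>, hence
      zero at \<open>a\<close>.\<close>
    define \<mu> where "\<mu> = (\<lambda>l x. \<Sum>i\<le>D. c i x * b i l x)"
    have \<mu>p: "polyfun n (\<mu> l)" for l unfolding \<mu>_def by (intro polyfun_sum polyfun_mult c jb)
    have \<mu>a: "\<mu> l a = 0" for l using ca by (simp add: \<mu>_def)
    define j0 where "j0 = (\<lambda>x. (r x * x n ^ k) * f1 x + (\<Sum>i\<le>D. c i x * j i x))"
    have j0: "j0 \<in> J" unfolding j0_def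
      using polyfun_mono[OF r(1), of "Suc n"] polyfun_mono[OF c(1), of "Suc n"]
      by (intro pf_idealD(3,4,6)[OF J] polyfun_mult coord_power_polyfun f1 jb) auto
    \<comment> \<open>Moving the \<open>t ^ k\<close> term to the left leaves the factor
      \<open>r'\<close>, still 1 at \<open>a\<close>, and expresses \<open>r' t ^ k\<close> by lower
      powers.\<close>
    define r' where "r' = (\<lambda>x. r x + - 1 * \<mu> k x)"
    have "polyfun n r'" unfolding r'_def
      by (intro polyfun_add polyfun_mult polyfun_const \<mu>p r(1) Qbar_uminus) simp
    moreover have "r' a = 1" using r(2) \<mu>a by (simp add: r'_def)
    ultimately have r': "polyfun n r'" "r' a = 1" by blast+
    have eq: "r' x * x n ^ k = j0 x + (\<Sum>l<k. \<mu> l x * x n ^ l)" for x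
    proof -
      have "r x * x n ^ k = (r x * x n ^ k) * f1 x + u x * (r x * x n ^ k)" by (simp add: u_def algebra_simps)
      also have "u x * (r x * x n ^ k) = (\<Sum>i\<le>D. c i x * (r x * (x n ^ i * x n ^ k)))"
        unfolding c(2) sum_distrib_right by (simp add: mult_ac)
      also have "\<dots> = (\<Sum>i\<le>D. c i x * j i x + (\<Sum>l<Suc k. c i x * b i l x * x n ^ l))"
        by (intro sum.cong refl) (simp only: fun_cong[OF jb(3)] distrib_left sum_distrib_left mult.assoc)
      also have "\<dots> = (\<Sum>i\<le>D. c i x * j i x) + (\<Sum>l<Suc k. \<mu> l x * x n ^ l)"
        unfolding sum.distrib \<mu>_def sum_distrib_right by (subst (2) sum.swap) simp
      finally have "r x * x n ^ k = j0 x + ((\<Sum>l<k. \<mu> l x * x n ^ l) + \<mu> k x * x n ^ k)"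
        unfolding j0_def sum.lessThan_Suc add.assoc .
      moreover have "r' x * x n ^ k = r x * x n ^ k - \<mu> k x * x n ^ k"
        unfolding r'_def by (simp only: mult_minus_left mult_1 distrib_right add_uminus_conv_diff left_diff_distrib)
      ultimately show ?thesis by simp
    qed
    have tk: "(\<lambda>x. r' x * x n ^ k) \<in> pf_mod n J k"
      unfolding eq by (intro pf_modI j0 \<mu>p)
    \<comment> \<open>First \<open>r\<close> brings \<open>f\<close> into the span of the powers up
      to \<open>t ^ k\<close>, then \<open>r'\<close> trades \<open>t ^ k\<close> for lower
      ones.\<close>
    have "(\<lambda>x. (r' x * r x) * f x) \<in> pf_mod n J k" if f: "polyfun (Suc n) f" for f
    proof -
      obtain i e where ie: "i \<in> J" "\<And>l. polyfun n (e l)" "(\<lambda>x. r x * f x) = (\<lambda>x. i x + (\<Sum>l<Suc k. e l x * x n ^ l))"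
        using r(3)[OF f] by (rule pf_modE) blast
      have "(\<lambda>x. (r' x * i x + (\<Sum>l<k. (r' x * e l x) * x n ^ l)) + e k x * (r' x * x n ^ k)) \<in> pf_mod n J k"
        by (intro pf_mod_add pf_modI pf_idealD(4)[OF J] ie polyfun_mult r' polyfun_mono[OF r'(1)] pf_mod_mult tk) simp
      moreover have "(r' x * i x + (\<Sum>l<k. (r' x * e l x) * x n ^ l)) + e k x * (r' x * x n ^ k) = (r' x * r x) * f x" for x
      proof -
        have "r x * f x = i x + ((\<Sum>l<k. e l x * x n ^ l) + e k x * x n ^ k)"
          using fun_cong[OF ie(3), of x] by simp
        then have "(r' x * r x) * f x = r' x * (i x + ((\<Sum>l<k. e l x * x n ^ l) + e k x * x n ^ k))"
          by (simp only: mult.assoc)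
        then show ?thesis by (simp only: distrib_left sum_distrib_left mult_ac add_ac)
      qed
      ultimately show ?thesis by simp
    qed
    moreover have "polyfun n (\<lambda>x. r' x * r x)" using r r' by (intro polyfun_mult)
    ultimately show ?case using r r' unfolding k_def by (intro exI[of _ "\<lambda>x. r' x * r x"]) simp
  qed
  from this[of d] obtain r where r: "polyfun n r" "r a = 1" "\<And>f. polyfun (Suc n) f \<Longrightarrow> (\<lambda>x. r x * f x) \<in> pf_mod n J 0"
    by auto
  have "(\<lambda>x. r x * 1) \<in> pf_mod n J 0" by (rule r(3)[OF polyfun_const]) simp
  then have "r \<in> J" by (rule pf_modE) simp
  then show ?thesis using r by blast
qed

text \<open>The functions \<open>t \<mapsto> f(a, t)\<close> with \<open>f \<in> J\<close> form an ideal of univariate polynomials; its monic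
  generator either is constant or has a root \<open>t\<close>.\<close>

lemma extend_zero:
  assumes a: "\<And>i. a i \<in> Qbar" and g: "g \<in> J" "g (a(n := t1)) \<noteq> 0"
    and no1: "\<nexists>f1. f1 \<in> J \<and> (\<forall>t. f1 (a(n := t)) = 1)"
  shows "\<exists>t\<in>Qbar. \<forall>f\<in>J. f (a(n := t)) = 0"
proof -
  have univ: "\<exists>q\<in>polys_over Qbar. \<forall>t. f (a(n := t)) = poly q t" if f: "polyfun (Suc n) f" for f
  proof -
    obtain D c where c: "\<And>i. polyfun n (c i)" "\<And>x. f x = (\<Sum>i\<le>D. c i x * x n ^ i)"
      using polyfun_expand[OF f] by blast
    define q where "q = (\<Sum>i\<le>D. monom (c i a) i)"
    have "c i (a(n := t)) = c i a" for i t by (rule polyfun_depends[OF c(1)]) auto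
    then have "f (a(n := t)) = poly q t" for t by (simp add: c(2) q_def poly_sum poly_monom)
    moreover have "q \<in> polys_over Qbar"
      unfolding q_def polys_over_def using polyfun_Qbar[OF c(1)] a by (auto simp: coeff_sum intro!: Qbar_sum)
    ultimately show ?thesis by blast
  qed
  define Q where "Q = (\<lambda>q. q \<in> polys_over Qbar \<and> q \<noteq> 0 \<and> (\<exists>f\<in>J. \<forall>t. f (a(n := t)) = poly q t))"
  obtain q0 where "Q q0"
  proof -
    obtain q where "q \<in> polys_over Qbar" "\<forall>t. g (a(n := t)) = poly q t" using univ[OF pf_idealD(1)[OF J g(1)]] by blast
    moreover have "q \<noteq> 0" using calculation g(2) by auto
    ultimately show ?thesis using g(1) that[of q] unfolding Q_def by blast
  qed
  then obtain q where q: "Q q" "\<And>r. Q r \<Longrightarrow> degree q \<le> degree r"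
    using ex_has_least_nat[of Q q0 degree] by blast
  then obtain f0 where f0: "f0 \<in> J" "\<And>t. f0 (a(n := t)) = poly q t" and qQ: "q \<in> polys_over Qbar" "q \<noteq> 0"
    unfolding Q_def by blast
  \<comment> \<open>A constant generator could be scaled to 1, which \<open>no1\<close>
    forbids.\<close>
  have "degree q > 0"
  proof (rule ccontr)
    assume "\<not> degree q > 0"
    then obtain c where c: "q = [:c:]" using degree_eq_zeroE by blast
    then have "c \<noteq> 0" "c \<in> Qbar" using qQ by (auto simp: polys_over_def coeff_pCons split: nat.splits)
    then have "(\<lambda>x. inverse c * f0 x) \<in> J" by (intro pf_idealD(4)[OF J f0(1)] polyfun_const Qbar_inverse)
    moreover have "\<forall>t. inverse c * f0 (a(n := t)) = 1" using f0(2) c \<open>c \<noteq> 0\<close> by simp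
    ultimately show False using no1 by blast
  qed
  then obtain t where t: "poly q t = 0" using poly_root_complex by blast
  have "t \<in> Qbar" using Qbar_root[OF qQ(2) t] qQ(1) by (auto simp: polys_over_def)
  moreover have "f (a(n := t)) = 0" if f: "f \<in> J" for f
  proof -
    obtain p where p: "p \<in> polys_over Qbar" "\<forall>t. f (a(n := t)) = poly p t" using univ[OF pf_idealD(1)[OF J f]] by blast
    obtain s r where sr: "s \<in> polys_over Qbar" "r \<in> polys_over Qbar" "p = q * s + r" "r = 0 \<or> degree r < degree q"
      using polys_over_divide[OF Qbar_subfield qQ p(1)] by blast
    \<comment> \<open>\<open>h\<close> lies in \<open>J\<close> and realises the remainder
      \<open>r\<close> on the line, so by minimality of \<open>q\<close> the remainder is
      zero.\<close>
    define h where "h = (\<lambda>x. f x - poly s (x n) * f0 x)"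
    have "polyfun (Suc n) (\<lambda>x. poly s (x n))"
      unfolding poly_altdef using sr(1)
      by (intro polyfun_sum polyfun_mult polyfun_const coord_power_polyfun) (auto simp: polys_over_def)
    then have "h \<in> J" unfolding h_def by (intro pf_idealD(4,5)[OF J] f f0)
    moreover have "\<forall>t. h (a(n := t)) = poly r t" using p(2) f0(2) sr(3) by (simp add: h_def)
    ultimately have "Q r" if "r \<noteq> 0" using that sr(2) unfolding Q_def by blast
    then have "r = 0" using q(2)[of r] sr(4) by (cases "r = 0") auto
    then show ?thesis using p(2) sr(3) t by simp
  qed
  ultimately show ?thesis by blast
qed

end

text \<open>Induction on the number of coordinates by elimination. Nonvanishing at the last
  coordinate point puts into \<open>J\<close> a form containing a pure power of the last coordinate,
  so that \<open>R/J\<close> is a finite module over the functions of the others. A nonzero common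
  zero \<open>a\<close> of the elimination ideal \<open>J'\<close> would lift to one of
  \<open>J\<close>: \<open>nakayama\<close> shows that the fibre ideal over \<open>a\<close> is
  proper, and \<open>extend_zero\<close> supplies the missing coordinate.\<close>

theorem projective_nullstellensatz:
  assumes J: "pf_ideal n J" and scale: "\<And>f. f \<in> J \<Longrightarrow> (\<lambda>x. f (\<lambda>i. 2 * x i)) \<in> J"
    and nz: "\<And>x. (\<And>i. x i \<in> Qbar) \<Longrightarrow> (\<And>i. i \<ge> n \<Longrightarrow> x i = 0) \<Longrightarrow> (\<exists>i. x i \<noteq> 0) \<Longrightarrow> \<exists>f\<in>J. f x \<noteq> 0"
  shows "\<forall>i<n. (\<lambda>x. x i) \<in> pf_rad n J"
  using assms
proof (induction n arbitrary: J)
  case (Suc n)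
  note J = Suc.prems(1) and scale = Suc.prems(2) and nz = Suc.prems(3)
  define en :: cvec where "en = (\<lambda>i. if i = n then 1 else 0)"
  have "\<exists>f\<in>J. f en \<noteq> 0"
  proof (rule nz)
    show "\<exists>i. en i \<noteq> 0" by (rule exI[of _ n]) (simp add: en_def)
  qed (simp_all add: en_def)
  then obtain f where f: "f \<in> J" "f en \<noteq> 0" by blast
  obtain D h where h: "\<forall>k. homfun (Suc n) k (h k)" "f = (\<lambda>x. \<Sum>k\<le>D. h k x)" "\<forall>k\<le>D. h k \<in> J"
    using pf_ideal_components[OF J scale f(1)] by blast
  obtain d where d: "d \<le> D" "h d en \<noteq> 0"
    using f(2) unfolding h(2) by (metis atMost_iff sum.neutral)
  define g where "g = h d"
  have gJ: "g \<in> J" using h d by (simp add: g_def)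
  obtain c where c: "\<And>i. i \<le> d \<Longrightarrow> homfun n (d - i) (c i)" "\<And>i. i > d \<Longrightarrow> c i = (\<lambda>x. 0)" "\<And>x. g x = (\<Sum>i\<le>d. c i x * x n ^ i)"
    using homfun_expand[OF spec[OF h(1), of d]] unfolding g_def by blast
  obtain c0 where c0: "c0 \<in> Qbar" "c d = (\<lambda>x. c0)" using homfun_const[OF c(1)[of d]] by auto
  have "c i en = 0" if i: "i < d" for i
  proof -
    have hi: "homfun n (d - i) (c i)" using c(1) i by simp
    have "c i en = c i (\<lambda>_. 0)" by (rule homfun_depends[OF hi]) (simp add: en_def)
    also have "\<dots> = 0" using homfun_zero_pos[OF hi] i by simp
    finally show ?thesis .
  qed
  then have "g en = c0" unfolding c(3) by (simp add: lessThan_Suc_atMost[symmetric] c0 en_def)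
  then have c0n: "c0 \<noteq> 0" using d by (simp add: g_def)
  have cp: "polyfun n (c i)" for i
    using polyfun_homfun[OF c(1), of i] polyfun_const[of 0 n] c(2)[of i] by (cases "i \<le> d") auto
  have all: "k \<in> pf_mod n J d" if "polyfun (Suc n) k" for k
  proof (rule pf_mod_all[of n J g c d c0 k])
    show "g = (\<lambda>x. \<Sum>i\<le>d. c i x * x n ^ i)" by (rule ext, rule c(3))
  qed (use J gJ cp c0 c0n that in blast)+
  define J' where "J' = {f\<in>J. polyfun n f}"
  have J': "pf_ideal n J'"
    unfolding pf_ideal_def J'_def
    using pf_idealD(2,3,4)[OF J] polyfun_const[of 0 n] polyfun_add[of n] polyfun_mult[of n] polyfun_mono[of n _ "Suc n"]
    by auto
  have IH: "\<forall>i<n. (\<lambda>x. x i) \<in> pf_rad n J'"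
  proof (rule Suc.IH[OF J'])
    show "(\<lambda>x. f (\<lambda>i. 2 * x i)) \<in> J'" if "f \<in> J'" for f
      using that scale polyfun_scale by (simp add: J'_def)
    fix a :: cvec assume a: "\<And>i. a i \<in> Qbar" "\<And>i. i \<ge> n \<Longrightarrow> a i = 0" "\<exists>i. a i \<noteq> 0"
    show "\<exists>f\<in>J'. f a \<noteq> 0"
    proof (rule ccontr)
      assume no: "\<not> (\<exists>f\<in>J'. f a \<noteq> 0)"
      have no1: "\<nexists>f1. f1 \<in> J \<and> (\<forall>t. f1 (a(n := t)) = 1)"
      proof
        assume "\<exists>f1. f1 \<in> J \<and> (\<forall>t. f1 (a(n := t)) = 1)"
        then obtain f1 where "f1 \<in> J" "\<And>t. f1 (a(n := t)) = 1" by blast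
        then obtain r where "r \<in> J" "polyfun n r" "r a = 1" using nakayama[OF J all] by blast
        then show False using no by (auto simp: J'_def)
      qed
      have val: "\<exists>f\<in>J. f (a(n := t)) \<noteq> 0" if "t \<in> Qbar" for t
      proof (rule nz)
        obtain i where "a i \<noteq> 0" using a(3) by blast
        moreover have "i \<noteq> n" using calculation a(2)[of i] by auto
        ultimately show "\<exists>i. (a(n := t)) i \<noteq> 0" by (intro exI[of _ i]) simp
      qed (use a that in auto)
      obtain k where "k \<in> J" "k (a(n := 0)) \<noteq> 0" using val[of 0] by auto
      then obtain t where "t \<in> Qbar" "\<forall>f\<in>J. f (a(n := t)) = 0" using extend_zero[OF J a(1) _ _ no1] by blast
      then show False using val by blast
    qed
  qed
  have v: "(\<lambda>x. x i) \<in> pf_rad (Suc n) J" if "i < n" for i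
    using IH that polyfun_mono[of n _ "Suc n"] unfolding pf_rad_def J'_def by auto
  have "(\<lambda>x. x n ^ d) \<in> pf_rad (Suc n) J"
  proof -
    have cr: "c i \<in> pf_rad (Suc n) J" if "i < d" for i
      using homfun_in_pf_rad[OF J v _ c(1)] that by simp
    have gr: "g \<in> pf_rad (Suc n) J"
      using gJ pf_idealD(1)[OF J gJ] unfolding pf_rad_def by (auto intro!: exI[of _ 1])
    \<comment> \<open>Apart from the pure power, the coefficients of \<open>g\<close> are forms of
      positive degree in the other coordinates, hence already in the radical.\<close>
    have "(\<lambda>x. inverse c0 * (g x + - 1 * (\<Sum>i<d. x n ^ i * c i x))) \<in> pf_rad (Suc n) J"
      using c0 by (intro pf_rad_mult[OF J] pf_rad_add[OF J] pf_rad_sum[OF J] cr gr polyfun_const coord_power_polyfun[OF J])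
        (auto intro: Qbar_closed)
    moreover have "inverse c0 * (g x + - 1 * (\<Sum>i<d. x n ^ i * c i x)) = x n ^ d" for x
      unfolding c(3) using c0n by (simp add: lessThan_Suc_atMost[symmetric] c0 mult.commute)
    ultimately show ?thesis by simp
  qed
  then obtain e where "(\<lambda>x. (x n ^ d) ^ e) \<in> J" by (auto simp: pf_rad_def)
  then have "(\<lambda>x. x n ^ (d * e)) \<in> J" by (simp add: power_mult)
  then have "(\<lambda>x. x n) \<in> pf_rad (Suc n) J"
    using coord_power_polyfun[OF J, of 1] by (auto simp: pf_rad_def)
  then show ?case using v less_Suc_eq by auto
qed simp


section \<open>Heights under endomorphisms\<close>

lemma homfun_mpoly_eval:
  assumes "homogeneous N d p"
  shows "homfun (Suc N) d (mpoly_eval p)"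
proof -
  have *: "homfun (Suc N) d (\<lambda>x. Poly_Mapping.lookup p m * (\<Prod>i\<in>Poly_Mapping.keys m. x i ^ Poly_Mapping.lookup m i))"
    if m: "m \<in> Poly_Mapping.keys p" for m
  proof (rule homfun_cmult)
    show "Poly_Mapping.lookup p m \<in> Qbar" using assms m by (simp add: homogeneous_def)
    have s: "(\<Sum>i\<in>Poly_Mapping.keys m. Poly_Mapping.lookup m i) = d" and k: "Poly_Mapping.keys m \<subseteq> {..N}"
      using assms m by (simp_all add: homogeneous_def)
    show "homfun (Suc N) d (\<lambda>x. \<Prod>i\<in>Poly_Mapping.keys m. x i ^ Poly_Mapping.lookup m i)"
      using homfun_prod_vars[of "Poly_Mapping.keys m" "Suc N" "Poly_Mapping.lookup m"] s k
      by (simp add: subset_iff less_Suc_eq_le)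
  qed
  show ?thesis unfolding mpoly_eval_def by (rule homfun_sum[OF *])
qed

text \<open>The Nullstellensatz for the ideal generated by the coordinate forms, stable under
  doubling because the \<open>F j\<close> are homogeneous. Taking homogeneous parts then gives
  coefficients of the exact degree \<open>e - d\<close>, as the lower height bound requires.\<close>

lemma null_form:
  assumes F: "\<And>j. j \<le> N \<Longrightarrow> homfun (Suc N) d (F j)"
    and nz: "\<And>x. x \<in> hcoords N \<Longrightarrow> \<exists>j\<le>N. F j x \<noteq> 0"
  shows "\<exists>e\<ge>d. \<forall>i\<le>N. \<exists>G. (\<forall>j\<le>N. homfun (Suc N) (e - d) (G j)) \<and> (\<forall>x. x i ^ e = (\<Sum>j\<le>N. G j x * F j x))"
proof -
  define J where "J = {f. \<exists>G. (\<forall>j. polyfun (Suc N) (G j)) \<and> f = (\<lambda>x. \<Sum>j\<le>N. G j x * F j x)}"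
  have JI: "(\<lambda>x. \<Sum>j\<le>N. G j x * F j x) \<in> J" if "\<And>j. polyfun (Suc N) (G j)" for G
    using that by (auto simp: J_def)
  have JE: "\<exists>G. (\<forall>j. polyfun (Suc N) (G j)) \<and> f = (\<lambda>x. \<Sum>j\<le>N. G j x * F j x)" if "f \<in> J" for f
    using that by (simp add: J_def)
  have J: "pf_ideal (Suc N) J"
    unfolding pf_ideal_def
  proof (intro conjI ballI allI impI)
    fix f assume "f \<in> J"
    then obtain G where G: "\<forall>j. polyfun (Suc N) (G j)" "f = (\<lambda>x. \<Sum>j\<le>N. G j x * F j x)" using JE by blast
    show "polyfun (Suc N) f" unfolding G(2)
      by (intro polyfun_sum polyfun_mult spec[OF G(1)] polyfun_homfun[OF F]) simp
    { fix g assume g: "polyfun (Suc N) g"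
      have "(\<lambda>x. \<Sum>j\<le>N. (g x * G j x) * F j x) \<in> J" by (intro JI polyfun_mult g spec[OF G(1)])
      then show "(\<lambda>x. g x * f x) \<in> J" by (simp add: G(2) sum_distrib_left mult.assoc) }
    { fix g assume "g \<in> J"
      then obtain H where H: "\<forall>j. polyfun (Suc N) (H j)" "g = (\<lambda>x. \<Sum>j\<le>N. H j x * F j x)" using JE by blast
      have "(\<lambda>x. \<Sum>j\<le>N. (G j x + H j x) * F j x) \<in> J" by (intro JI polyfun_add spec[OF G(1)] spec[OF H(1)])
      then show "(\<lambda>x. f x + g x) \<in> J" by (simp add: G(2) H(2) sum.distrib algebra_simps) }
  next
    show "(\<lambda>x. 0) \<in> J" using JI[of "\<lambda>j x. 0"] polyfun_const[of 0 "Suc N"] by simp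
  qed
  have rad: "\<forall>i<Suc N. (\<lambda>x. x i) \<in> pf_rad (Suc N) J"
  proof (rule projective_nullstellensatz[OF J])
    fix f assume "f \<in> J"
    then obtain G where G: "\<forall>j. polyfun (Suc N) (G j)" "f = (\<lambda>x. \<Sum>j\<le>N. G j x * F j x)" using JE by blast
    have "(\<lambda>x. \<Sum>j\<le>N. (2 ^ d * G j (\<lambda>i. 2 * x i)) * F j x) \<in> J"
      by (intro JI polyfun_mult polyfun_const polyfun_scale spec[OF G(1)]) (auto intro: Qbar_rat)
    moreover have "(\<Sum>j\<le>N. (2 ^ d * G j (\<lambda>i. 2 * x i)) * F j x) = f (\<lambda>i. 2 * x i)" for x
      unfolding G(2) by (intro sum.cong refl) (simp add: homfun_scale[OF F])
    ultimately show "(\<lambda>x. f (\<lambda>i. 2 * x i)) \<in> J" by simp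
  next
    fix x :: cvec assume x: "\<And>i. x i \<in> Qbar" "\<And>i. i \<ge> Suc N \<Longrightarrow> x i = 0" "\<exists>i. x i \<noteq> 0"
    then have "x \<in> hcoords N" by (auto simp: hcoords_def)
    then obtain j where j: "j \<le> N" "F j x \<noteq> 0" using nz by blast
    have "(\<lambda>x. \<Sum>l\<le>N. (if l = j then 1 else 0) * F l x) \<in> J"
      by (rule JI) (auto intro: polyfun_const)
    moreover have "(\<Sum>l\<le>N. (if l = j then 1 else 0) * F l x) = F j x" for x
    proof -
      have "(\<Sum>l\<le>N. (if l = j then 1 else 0) * F l x) = (\<Sum>l\<le>N. if l = j then F l x else 0)"
        by (intro sum.cong) auto
      then show ?thesis using j by simp
    qed
    ultimately show "\<exists>f\<in>J. f x \<noteq> 0" using j by (intro bexI[of _ "F j"]) auto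
  qed
  have "\<forall>i\<in>{..N}. \<exists>e. (\<lambda>x. x i ^ e) \<in> J" using rad by (auto simp: pf_rad_def less_Suc_eq_le)
  then obtain e0 where e0: "\<And>i. i \<le> N \<Longrightarrow> (\<lambda>x. x i ^ e0 i) \<in> J" using bchoice[of "{..N}" "\<lambda>i e. (\<lambda>x. x i ^ e) \<in> J"] by auto
  \<comment> \<open>One exponent for all coordinates: at least each \<open>e0 i\<close>, and at
    least \<open>d\<close>, so that \<open>e - d\<close> is not truncated.\<close>
  define e where "e = d + (\<Sum>i\<le>N. e0 i)"
  have mem: "(\<lambda>x. x i ^ e) \<in> J" if i: "i \<le> N" for i
  proof -
    have "e0 i \<le> e" using member_le_sum[of i "{..N}" e0] i by (simp add: e_def)
    then have "x i ^ e = x i ^ (e - e0 i) * x i ^ e0 i" for x :: cvec by (simp flip: power_add)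
    moreover have "(\<lambda>x. x i ^ (e - e0 i) * x i ^ e0 i) \<in> J"
      using i by (intro pf_idealD(4)[OF J e0] polyfun_power polyfun_homfun[OF homfun.var]) auto
    ultimately show ?thesis by simp
  qed
  have "\<exists>G. (\<forall>j\<le>N. homfun (Suc N) (e - d) (G j)) \<and> (\<forall>x. x i ^ e = (\<Sum>j\<le>N. G j x * F j x))" if i: "i \<le> N" for i
  proof -
    obtain G where G: "\<And>j. polyfun (Suc N) (G j)" "(\<lambda>x. x i ^ e) = (\<lambda>x. \<Sum>j\<le>N. G j x * F j x)"
      using JE[OF mem[OF i]] by blast
    have "\<forall>j. \<exists>D. \<exists>h. (\<forall>k. homfun (Suc N) k (h k)) \<and> (\<forall>k>D. h k = (\<lambda>x. 0)) \<and> G j = (\<lambda>x. \<Sum>k\<le>D. h k x)"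
      using G(1) unfolding polyfun_def by blast
    then obtain D where "\<forall>j. \<exists>h. (\<forall>k. homfun (Suc N) k (h k)) \<and> (\<forall>k>D j. h k = (\<lambda>x. 0)) \<and> G j = (\<lambda>x. \<Sum>k\<le>D j. h k x)"
      using choice[of "\<lambda>j D. \<exists>h. (\<forall>k. homfun (Suc N) k (h k)) \<and> (\<forall>k>D. h k = (\<lambda>x. 0)) \<and> G j = (\<lambda>x. \<Sum>k\<le>D. h k x)"] by blast
    then obtain h where h: "\<And>j. \<forall>k. homfun (Suc N) k (h j k)" "\<And>j. \<forall>k>D j. h j k = (\<lambda>x. 0)" "\<And>j. G j = (\<lambda>x. \<Sum>k\<le>D j. h j k x)"
      using choice[of "\<lambda>j h. (\<forall>k. homfun (Suc N) k (h k)) \<and> (\<forall>k>D j. h k = (\<lambda>x. 0)) \<and> G j = (\<lambda>x. \<Sum>k\<le>D j. h k x)"] by blast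
    define DD where "DD = e + (\<Sum>j\<le>N. D j)"
    have GD: "G j x = (\<Sum>k\<le>DD. h j k x)" if "j \<le> N" for j x
    proof -
      have "D j \<le> DD" using member_le_sum[of j "{..N}" D] that by (simp add: DD_def)
      then show ?thesis unfolding h(3) by (rule polyfun_bound[OF h(2), symmetric])
    qed
    \<comment> \<open>The component of degree \<open>m\<close> of the difference of both sides; the
      power of \<open>x i\<close> enters at \<open>m = e\<close> only. \<open>component_mem\<close>
      for the ideal consisting of 0 then says that each component of the zero function
      vanishes.\<close>
    define H where "H = (\<lambda>m x. (\<Sum>j\<le>N. h j (m - d) x * F j x) + (if m = e then - 1 else 0) * x i ^ e)"
    have xi: "homfun (Suc N) e (\<lambda>x. x i ^ e)" using homfun_power[OF homfun.var, of i "Suc N" e] i by simp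
    have Hh: "homfun (Suc N) m (H m)" if m: "m \<in> {d..DD + d}" for m
    proof -
      have "homfun (Suc N) m (\<lambda>x. h j (m - d) x * F j x)" if "j \<le> N" for j
        using homfun.mult[OF spec[OF h(1), of "m - d" j] F[OF that]] m by simp
      then have 1: "homfun (Suc N) m (\<lambda>x. \<Sum>j\<le>N. h j (m - d) x * F j x)" by (intro homfun_sum) simp
      have 2: "homfun (Suc N) m (\<lambda>x. (if m = e then - 1 else 0) * x i ^ e)"
        using homfun_cmult[OF _ xi, of "- 1"] homfun.zero by (cases "m = e") (simp_all add: Qbar_uminus)
      show ?thesis unfolding H_def by (rule homfun.add[OF 1 2])
    qed
    have "(\<Sum>m\<in>{d..DD + d}. H m x) = 0" for x
    proof -
      have "(\<Sum>m\<in>{d..DD + d}. H m x) = (\<Sum>m\<in>{d..DD + d}. \<Sum>j\<le>N. h j (m - d) x * F j x) + (\<Sum>m\<in>{d..DD + d}. if m = e then - (x i ^ e) else 0)"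
        unfolding H_def sum.distrib by (intro arg_cong2[where f=plus] sum.cong) auto
      also have "(\<Sum>m\<in>{d..DD + d}. if m = e then - (x i ^ e) else 0) = - (x i ^ e)" by (simp add: e_def DD_def)
      also have "(\<Sum>m\<in>{d..DD + d}. \<Sum>j\<le>N. h j (m - d) x * F j x) = (\<Sum>k\<le>DD. \<Sum>j\<le>N. h j k x * F j x)"
        by (rule sum.reindex_bij_witness[of _ "\<lambda>k. k + d" "\<lambda>m. m - d"]) auto
      also have "\<dots> = (\<Sum>j\<le>N. G j x * F j x)"
        by (subst sum.swap) (simp add: GD sum_distrib_right)
      also have "\<dots> = x i ^ e" using fun_cong[OF G(2), of x] by simp
      finally show ?thesis by simp
    qed
    then have z: "(\<lambda>x. \<Sum>m\<in>{d..DD + d}. H m x) \<in> {\<lambda>x. 0}" by simp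
    have "H e \<in> {\<lambda>x. 0}"
      by (rule component_mem[OF _ Hh _ _ _ z]) (auto simp: e_def DD_def)
    then have He: "H e x = 0" for x by (auto simp: fun_eq_iff)
    have "x i ^ e = (\<Sum>j\<le>N. h j (e - d) x * F j x)" for x using He[of x] by (simp add: H_def)
    then show ?thesis using h(1) by (intro exI[of _ "\<lambda>j. h j (e - d)"]) simp
  qed
  moreover have "e \<ge> d" by (simp add: e_def)
  ultimately show ?thesis by blast
qed

section \<open>Place-by-place bounds for forms and the passage to heights\<close>

lemma place_bound_pos: "C \<ge> 1 \<Longrightarrow> place_bound T C p \<ge> 1"
  by (simp add: place_bound_def)

lemma place_bound_mono: "C \<ge> 1 \<Longrightarrow> C \<le> C' \<Longrightarrow> T \<subseteq> T' \<Longrightarrow> place_bound T C p \<le> place_bound T' C' p"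
  by (auto simp: place_bound_def)

lemma places_sum_place_bound:
  assumes "finite T" "T \<subseteq> places"
  shows "places_sum (\<lambda>p. ln (place_bound T C p)) = card T * ln C" "fin_places (\<lambda>p. ln (place_bound T C p))"
proof -
  have z: "ln (place_bound T C p) = 0" if "p \<in> places - T" for p using that by (simp add: place_bound_def)
  show "fin_places (\<lambda>p. ln (place_bound T C p))" by (rule places_sum_eq(2)[OF assms z])
  have "places_sum (\<lambda>p. ln (place_bound T C p)) = (\<Sum>p\<in>T. ln (place_bound T C p))" by (rule places_sum_eq(1)[OF assms z])
  then show "places_sum (\<lambda>p. ln (place_bound T C p)) = card T * ln C" by (simp add: place_bound_def)
qed

lemma local_max_nonneg: "p \<in> places \<Longrightarrow> (\<And>i. i \<le> N \<Longrightarrow> x i \<in> Qbar) \<Longrightarrow> local_max N p x \<ge> 0"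
  using local_max_ge[of 0 N p x] place_absD(1)[of p "x 0"] by fastforce

text \<open>Uniform over the conjugates, so that the same local constants serve the whole Galois
  average.\<close>

definition homfun_bounded :: "nat \<Rightarrow> nat \<Rightarrow> (cvec \<Rightarrow> complex) \<Rightarrow> nat set \<Rightarrow> real \<Rightarrow> bool" where
  "homfun_bounded N d f T C \<longleftrightarrow> (\<forall>\<tau>\<in>embeddings Qbar. \<forall>p\<in>places. \<forall>x. (\<forall>i\<le>N. x i \<in> Qbar) \<longrightarrow>
     place_abs p (\<tau> (f x)) \<le> place_bound T C p * local_max N p (\<lambda>i. \<tau> (x i)) ^ d)"

lemma homfun_boundedD:
  assumes "homfun_bounded N d f T C" "\<tau> \<in> embeddings Qbar" "p \<in> places" "\<And>i. i \<le> N \<Longrightarrow> x i \<in> Qbar"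
  shows "place_abs p (\<tau> (f x)) \<le> place_bound T C p * local_max N p (\<lambda>i. \<tau> (x i)) ^ d"
  using assms unfolding homfun_bounded_def by blast

lemma homfun_bounded_mono:
  assumes "homfun_bounded N d f T C" "C \<ge> 1" "C \<le> C'" "T \<subseteq> T'"
  shows "homfun_bounded N d f T' C'"
  unfolding homfun_bounded_def
proof (intro ballI allI impI)
  fix \<tau> p x assume t: "\<tau> \<in> embeddings Qbar" "p \<in> places" and x: "\<forall>i\<le>N. x i \<in> Qbar"
  have "place_abs p (\<tau> (f x)) \<le> place_bound T C p * local_max N p (\<lambda>i. \<tau> (x i)) ^ d"
    using x by (intro homfun_boundedD[OF assms(1) t]) auto
  also have "\<dots> \<le> place_bound T' C' p * local_max N p (\<lambda>i. \<tau> (x i)) ^ d"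
    using x t place_bound_mono[OF assms(2-4)] by (intro mult_right_mono zero_le_power local_max_nonneg) auto
  finally show "place_abs p (\<tau> (f x)) \<le> place_bound T' C' p * local_max N p (\<lambda>i. \<tau> (x i)) ^ d" .
qed

lemma homfun_place_bound:
  "homfun (Suc N) d f \<Longrightarrow> \<exists>T C. finite T \<and> T \<subseteq> places \<and> C \<ge> 1 \<and> homfun_bounded N d f T C"
proof (induction rule: homfun.induct)
  case (zero d)
  have "homfun_bounded N d (\<lambda>x. 0) {} 1"
    unfolding homfun_bounded_def
  proof (intro ballI allI impI)
    fix \<tau> p x assume t: "\<tau> \<in> embeddings Qbar" and p: "p \<in> places" and x: "\<forall>i\<le>N. x i \<in> Qbar"
    have "local_max N p (\<lambda>i. \<tau> (x i)) ^ d \<ge> 0" using x t p by (intro zero_le_power local_max_nonneg) auto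
    then show "place_abs p (\<tau> 0) \<le> place_bound {} 1 p * local_max N p (\<lambda>i. \<tau> (x i)) ^ d"
      using QembD(2)[OF t] place_absD(6)[OF p] by (simp add: place_bound_def)
  qed
  then show ?case by (intro exI[of _ "{}"] exI[of _ 1]) auto
next
  case (const c)
  then show ?case using const_place_bound[OF const] by (simp add: homfun_bounded_def)  blast
next
  case (var i)
  have "homfun_bounded N 1 (\<lambda>x. x i) {} 1"
    unfolding homfun_bounded_def
  proof (intro ballI allI impI)
    fix \<tau> p and x :: cvec
    show "place_abs p (\<tau> (x i)) \<le> place_bound {} 1 p * local_max N p (\<lambda>i. \<tau> (x i)) ^ 1"
      using var local_max_ge[of i N p "\<lambda>i. \<tau> (x i)"] by (simp add: place_bound_def)
  qed
  then show ?case by (intro exI[of _ "{}"] exI[of _ 1]) auto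
next
  case (add d f g)
  obtain T C where 1: "finite T" "T \<subseteq> places" "C \<ge> 1" "homfun_bounded N d f T C" using add.IH(1) by blast
  obtain T' C' where 2: "finite T'" "T' \<subseteq> places" "C' \<ge> 1" "homfun_bounded N d g T' C'" using add.IH(2) by blast
  \<comment> \<open>Adding two forms costs nothing at finite places by the ultrametric inequality;
    the archimedean place, where the constants add, must belong to the exceptional set.\<close>
  define U where "U = insert 0 (T \<union> T')"
  have "homfun_bounded N d (\<lambda>x. f x + g x) U (C + C')"
    unfolding homfun_bounded_def
  proof (intro ballI allI impI)
    fix \<tau> p x assume t: "\<tau> \<in> embeddings Qbar" and p: "p \<in> places" and x: "\<forall>i\<le>N. x i \<in> Qbar"
    define M where "M = local_max N p (\<lambda>i. \<tau> (x i)) ^ d"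
    have M0: "M \<ge> 0" unfolding M_def using x t p by (intro zero_le_power local_max_nonneg) auto
    have fQ: "f x \<in> Qbar" "g x \<in> Qbar" using homfun_Qbar[OF add.hyps(1)] homfun_Qbar[OF add.hyps(2)] x by auto
    have f: "place_abs p (\<tau> (f x)) \<le> place_bound T C p * M" unfolding M_def using x by (intro homfun_boundedD[OF 1(4) t p]) auto
    have g: "place_abs p (\<tau> (g x)) \<le> place_bound T' C' p * M" unfolding M_def using x by (intro homfun_boundedD[OF 2(4) t p]) auto
    have e: "\<tau> (f x + g x) = \<tau> (f x) + \<tau> (g x)" using QembD(3)[OF t fQ] .
    have tQ: "\<tau> (f x) \<in> Qbar" "\<tau> (g x) \<in> Qbar" using t fQ by auto
    show "place_abs p (\<tau> (f x + g x)) \<le> place_bound U (C + C') p * local_max N p (\<lambda>i. \<tau> (x i)) ^ d"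
      unfolding M_def[symmetric]
    proof (cases "p = 0")
      case True
      have "place_abs p (\<tau> (f x + g x)) \<le> (place_bound T C p + place_bound T' C' p) * M"
        using place_absD(4)[OF p tQ] f g unfolding e by (simp add: algebra_simps)
      also have "\<dots> \<le> (C + C') * M" using M0 1(3) 2(3) by (intro mult_right_mono add_mono) (auto simp: place_bound_def)
      finally show "place_abs p (\<tau> (f x + g x)) \<le> place_bound U (C + C') p * M" using True by (simp add: place_bound_def U_def)
    next
      case False
      then have pr: "prime p" using p places_cases by auto
      have b: "place_bound T C p \<le> place_bound U (C + C') p" "place_bound T' C' p \<le> place_bound U (C + C') p"
        using 1(3) 2(3) by (auto simp: place_bound_def U_def)
      have "place_abs p (\<tau> (f x)) \<le> place_bound U (C + C') p * M" using f mult_right_mono[OF b(1) M0] by simp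
      moreover have "place_abs p (\<tau> (g x)) \<le> place_bound U (C + C') p * M" using g mult_right_mono[OF b(2) M0] by simp
      ultimately show "place_abs p (\<tau> (f x + g x)) \<le> place_bound U (C + C') p * M"
        using place_abs_ultrametric[OF pr tQ] unfolding e by simp
    qed
  qed
  moreover have "finite U" "U \<subseteq> places" using 1 2 by (auto simp: U_def)
  ultimately show ?case using 1(3) 2(3) by (intro exI[of _ U] exI[of _ "C + C'"]) auto
next
  case (mult d f e g)
  obtain T C where 1: "finite T" "T \<subseteq> places" "C \<ge> 1" "homfun_bounded N d f T C" using mult.IH(1) by blast
  obtain T' C' where 2: "finite T'" "T' \<subseteq> places" "C' \<ge> 1" "homfun_bounded N e g T' C'" using mult.IH(2) by blast
  have CC: "C * C' \<ge> 1" "C \<le> C * C'" "C' \<le> C * C'" using 1(3) 2(3) mult_mono[of 1 C 1 C'] by auto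
  have "homfun_bounded N (d + e) (\<lambda>x. f x * g x) (T \<union> T') (C * C')"
    unfolding homfun_bounded_def
  proof (intro ballI allI impI)
    fix \<tau> p x assume t: "\<tau> \<in> embeddings Qbar" and p: "p \<in> places" and x: "\<forall>i\<le>N. x i \<in> Qbar"
    define M where "M = local_max N p (\<lambda>i. \<tau> (x i))"
    have M0: "M \<ge> 0" unfolding M_def using x t p by (intro local_max_nonneg) auto
    have fQ: "f x \<in> Qbar" "g x \<in> Qbar" using homfun_Qbar[OF mult.hyps(1)] homfun_Qbar[OF mult.hyps(2)] x by auto
    have tQ: "\<tau> (f x) \<in> Qbar" "\<tau> (g x) \<in> Qbar" using t fQ by auto
    have "place_abs p (\<tau> (f x * g x)) = place_abs p (\<tau> (f x)) * place_abs p (\<tau> (g x))"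
      using QembD(4)[OF t fQ] place_absD(3)[OF p tQ] by simp
    also have "\<dots> \<le> (place_bound T C p * M ^ d) * (place_bound T' C' p * M ^ e)"
      unfolding M_def using x place_absD(1)[OF p tQ(1)] place_absD(1)[OF p tQ(2)] M0[unfolded M_def] place_bound_pos[OF 1(3), of T p]
      by (intro mult_mono homfun_boundedD[OF 1(4) t p] homfun_boundedD[OF 2(4) t p]) auto
    also have "\<dots> = (place_bound T C p * place_bound T' C' p) * M ^ (d + e)" by (simp add: power_add)
    also have "\<dots> \<le> place_bound (T \<union> T') (C * C') p * M ^ (d + e)"
      using M0 CC by (intro mult_right_mono) (auto simp: place_bound_def)
    finally show "place_abs p (\<tau> (f x * g x)) \<le> place_bound (T \<union> T') (C * C') p * local_max N p (\<lambda>i. \<tau> (x i)) ^ (d + e)"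
      by (simp add: M_def)
  qed
  then show ?case using 1 2 CC(1) by (intro exI[of _ "T \<union> T'"] exI[of _ "C * C'"]) auto
qed

lemma homfun_place_bound_family:
  assumes "finite A" "\<And>j. j \<in> A \<Longrightarrow> homfun (Suc N) d (F j)"
  shows "\<exists>T C. finite T \<and> T \<subseteq> places \<and> C \<ge> 1 \<and> (\<forall>j\<in>A. homfun_bounded N d (F j) T C)"
  using assms
proof (induction A rule: finite_induct)
  case empty
  show ?case by (intro exI[of _ "{}"] exI[of _ 1]) auto
next
  case (insert j A)
  obtain T C where 1: "finite T" "T \<subseteq> places" "C \<ge> 1" "\<forall>j\<in>A. homfun_bounded N d (F j) T C" using insert by auto
  obtain T' C' where 2: "finite T'" "T' \<subseteq> places" "C' \<ge> 1" "homfun_bounded N d (F j) T' C'"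
    using homfun_place_bound[of N d "F j"] insert.prems by auto
  have "\<forall>l\<in>insert j A. homfun_bounded N d (F l) (T \<union> T') (C + C')"
  proof
    fix l assume "l \<in> insert j A"
    then show "homfun_bounded N d (F l) (T \<union> T') (C + C')"
      using homfun_bounded_mono[of N d "F l" T C "C + C'" "T \<union> T'"] homfun_bounded_mono[of N d "F l" T' C' "C + C'" "T \<union> T'"] 1 2
      by auto
  qed
  then show ?case using 1 2 by (intro exI[of _ "T \<union> T'"] exI[of _ "C + C'"]) auto
qed

lemma gal_avg_mono:
  assumes "finite B" "B \<subseteq> Qbar" "\<And>\<tau>. \<tau> \<in> embeddings Qbar \<Longrightarrow> \<Phi> (restrict \<tau> B) \<le> \<Psi> (restrict \<tau> B)"
  shows "gal_avg B \<Phi> \<le> gal_avg B \<Psi>"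
  unfolding gal_avg_def using assms(3) by (intro divide_right_mono sum_mono) (auto simp: gal_def)

lemma gal_avg_linear:
  assumes "finite B" "B \<subseteq> Qbar"
  shows "gal_avg B (\<lambda>\<sigma>. a * \<Phi> \<sigma> + c) = a * gal_avg B \<Phi> + c"
proof -
  have "card (gal B) \<noteq> 0" using finite_gal[OF assms] gal_nonempty by auto
  then show ?thesis unfolding gal_avg_def by (simp add: sum.distrib sum_distrib_left[symmetric] add_divide_distrib)
qed

text \<open>Summing over the places turns the local constants into \<open>card T * ln C\<close>, and
  averaging over conjugates keeps the inequality. The factors \<open>a\<close> and \<open>b\<close>
  let it serve both directions of the comparison under an endomorphism.\<close>

lemma log_height_le_of_local:
  assumes x: "good_vec N x" and y: "good_vec N y" and T: "finite T" "T \<subseteq> places"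
    and le: "\<And>\<tau> p. \<tau> \<in> embeddings Qbar \<Longrightarrow> p \<in> places \<Longrightarrow>
      a * ln (local_max N p (\<lambda>i. \<tau> (y i))) \<le> ln (place_bound T C p) + b * ln (local_max N p (\<lambda>i. \<tau> (x i)))"
  shows "a * log_height N y \<le> card T * ln C + b * log_height N x"
proof -
  define B where "B = x ` {..N} \<union> y ` {..N}"
  have B: "finite B" "B \<subseteq> Qbar" "x ` {..N} \<subseteq> B" "y ` {..N} \<subseteq> B"
    using x y by (auto simp: B_def good_vec_def)
  have "gal_avg B (\<lambda>\<sigma>. a * places_height N (\<lambda>i. \<sigma> (y i)) + 0) \<le> gal_avg B (\<lambda>\<sigma>. b * places_height N (\<lambda>i. \<sigma> (x i)) + card T * ln C)"
  proof (rule gal_avg_mono[OF B(1,2)])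
    fix \<tau> assume t: "\<tau> \<in> embeddings Qbar"
    have ex: "places_height N (\<lambda>i. restrict \<tau> B (x i)) = places_height N (\<lambda>i. \<tau> (x i))" using B by (intro places_height_cong) auto
    have ey: "places_height N (\<lambda>i. restrict \<tau> B (y i)) = places_height N (\<lambda>i. \<tau> (y i))" using B by (intro places_height_cong) auto
    note fx = fin_places_local_max[OF x t] and fy = fin_places_local_max[OF y t]
    have "a * places_height N (\<lambda>i. \<tau> (y i)) = places_sum (\<lambda>p. a * ln (local_max N p (\<lambda>i. \<tau> (y i))))" unfolding places_height_def by (rule places_sum_cmult[symmetric])
    also have "\<dots> \<le> places_sum (\<lambda>p. ln (place_bound T C p) + b * ln (local_max N p (\<lambda>i. \<tau> (x i))))"
      by (intro places_sum_mono fin_places_cmult fy places_sum_add(2) places_sum_place_bound(2) T fx le t)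
    also have "\<dots> = card T * ln C + b * places_height N (\<lambda>i. \<tau> (x i))"
      unfolding places_height_def places_sum_add(1)[OF places_sum_place_bound(2)[OF T] fin_places_cmult[OF fx]] places_sum_place_bound(1)[OF T] places_sum_cmult ..
    finally show "a * places_height N (\<lambda>i. restrict \<tau> B (y i)) + 0 \<le> b * places_height N (\<lambda>i. restrict \<tau> B (x i)) + card T * ln C"
      unfolding ex ey by simp
  qed
  then show ?thesis
    unfolding gal_avg_linear[OF B(1,2)] log_height_superset[OF x B(1-3)] log_height_superset[OF y B(1,2,4)] by simp
qed

text \<open>From above, a form of degree \<open>d\<close> is locally at most a constant times the
  \<open>d\<close>-th power of the largest coordinate. From below, if \<open>x i\<close> is the
  largest coordinate, writing \<open>x i ^ e\<close> as the sum of the \<open>G i j\<close> times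
  \<open>F j\<close> gives \<open>|x| ^ e \<le> C |x| ^ (e - d) |F(x)|\<close>, and
  \<open>|x| ^ (e - d)\<close> cancels.\<close>

theorem height_endo:
  assumes "defines_endo N d F \<phi>"
  shows "\<exists>C\<ge>0. \<forall>P\<in>PN N. \<phi> P \<in> PN N \<and> \<bar>ln (height N (\<phi> P)) - real d * ln (height N P)\<bar> \<le> C"
proof -
  define f where "f = (\<lambda>j. mpoly_eval (F ! j))"
  have len: "length F = Suc N" using assms by (simp add: defines_endo_def)
  have f: "homfun (Suc N) d (f j)" if "j \<le> N" for j
    unfolding f_def using assms that by (intro homfun_mpoly_eval) (auto simp: defines_endo_def)
  have nz: "\<exists>j\<le>N. f j x \<noteq> 0" if x: "x \<in> hcoords N" for x
  proof -
    obtain p where "p \<in> set F" "mpoly_eval p x \<noteq> 0" using assms x unfolding defines_endo_def by blast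
    then show ?thesis using len by (auto simp: f_def in_set_conv_nth less_Suc_eq_le)
  qed
  obtain e where e: "e \<ge> d" "\<And>i. i \<le> N \<Longrightarrow> \<exists>G. (\<forall>j\<le>N. homfun (Suc N) (e - d) (G j)) \<and> (\<forall>x. x i ^ e = (\<Sum>j\<le>N. G j x * f j x))"
    using null_form[OF f nz] by blast
  then have "\<forall>i. \<exists>G. i \<le> N \<longrightarrow> (\<forall>j\<le>N. homfun (Suc N) (e - d) (G j)) \<and> (\<forall>x. x i ^ e = (\<Sum>j\<le>N. G j x * f j x))" by blast
  then obtain G where G: "\<And>i j. i \<le> N \<Longrightarrow> j \<le> N \<Longrightarrow> homfun (Suc N) (e - d) (G i j)"
    "\<And>i x. i \<le> N \<Longrightarrow> x i ^ e = (\<Sum>j\<le>N. G i j x * f j x)"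
    using choice[of "\<lambda>i G. i \<le> N \<longrightarrow> (\<forall>j\<le>N. homfun (Suc N) (e - d) (G j)) \<and> (\<forall>x. x i ^ e = (\<Sum>j\<le>N. G j x * f j x))"] by blast
  obtain T C where T: "finite T" "T \<subseteq> places" "C \<ge> 1" "\<forall>j\<in>{..N}. homfun_bounded N d (f j) T C"
    using homfun_place_bound_family[of "{..N}" N d f] f by auto
  obtain T' C' where T': "finite T'" "T' \<subseteq> places" "C' \<ge> 1" "\<forall>z\<in>{..N} \<times> {..N}. homfun_bounded N (e - d) ((\<lambda>(i, j). G i j) z) T' C'"
    using homfun_place_bound_family[of "{..N} \<times> {..N}" N "e - d" "\<lambda>(i, j). G i j"] G(1) by auto
  define U where "U = insert 0 T'"
  \<comment> \<open>At the archimedean place the \<open>N + 1\<close> summands add up; elsewhere the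
    ultrametric inequality needs only \<open>C'\<close>.\<close>
  define K where "K = real (Suc N) * C'"
  have K1: "K \<ge> 1" using T'(3) mult_mono[of 1 "real (Suc N)" 1 C'] by (simp add: K_def)
  have U: "finite U" "U \<subseteq> places" using T' by (auto simp: U_def)
  define c where "c = card T * ln C + card U * ln K"
  have c0: "c \<ge> 0" "card T * ln C \<le> c" "card U * ln K \<le> c" using T(3) K1 by (auto simp: c_def)
  have main: "\<phi> (point_of x) \<in> PN N \<and> \<bar>ln (height N (\<phi> (point_of x))) - real d * ln (height N (point_of x))\<bar> \<le> c"
    if x: "x \<in> hcoords N" for x
  proof -
    define y where "y = (\<lambda>i. if i \<le> N then mpoly_eval (F ! i) x else 0)"
    have yf: "y i = f i x" if "i \<le> N" for i using that by (simp add: y_def f_def)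
    have xQ: "x i \<in> Qbar" for i using x by (simp add: hcoords_def)
    have yQ: "f i x \<in> Qbar" if "i \<le> N" for i using homfun_Qbar[OF f[OF that]] xQ by blast
    have "y i \<in> Qbar" for i using yQ[of i] yf[of i] by (cases "i \<le> N") (auto simp: y_def)
    moreover have "\<exists>i. y i \<noteq> 0" using nz[OF x] yf by metis
    ultimately have y: "y \<in> hcoords N" by (auto simp: hcoords_def y_def)
    have py: "\<phi> (point_of x) = point_of y" using assms x unfolding defines_endo_def y_def by blast
    note gx = hcoords_good[OF x] and gy = hcoords_good[OF y]
    have up: "1 * log_height N y \<le> card T * ln C + real d * log_height N x"
    proof (rule log_height_le_of_local[OF gx gy T(1,2)])
      fix \<tau> p assume t: "\<tau> \<in> embeddings Qbar" and p: "p \<in> places"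
      define M where "M = local_max N p (\<lambda>i. \<tau> (x i))"
      have M: "M > 0" unfolding M_def by (rule local_max_pos[OF p good_vec_emb[OF gx t]])
      have Y: "local_max N p (\<lambda>i. \<tau> (y i)) > 0" by (rule local_max_pos[OF p good_vec_emb[OF gy t]])
      have "local_max N p (\<lambda>i. \<tau> (y i)) \<le> place_bound T C p * M ^ d"
        unfolding M_def using T(4) xQ by (intro local_max_le) (auto simp: yf intro!: homfun_boundedD[OF _ t p])
      then have "ln (local_max N p (\<lambda>i. \<tau> (y i))) \<le> ln (place_bound T C p * M ^ d)" using Y by simp
      also have "\<dots> = ln (place_bound T C p) + real d * ln M"
        using M place_bound_pos[OF T(3), of T p] by (simp add: ln_mult ln_realpow)
      finally show "1 * ln (local_max N p (\<lambda>i. \<tau> (y i))) \<le> ln (place_bound T C p) + real d * ln (local_max N p (\<lambda>i. \<tau> (x i)))"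
        by (simp add: M_def)
    qed
    have low: "real d * log_height N x \<le> card U * ln K + 1 * log_height N y"
    proof (rule log_height_le_of_local[OF gy gx U])
      fix \<tau> p assume t: "\<tau> \<in> embeddings Qbar" and p: "p \<in> places"
      define M where "M = local_max N p (\<lambda>i. \<tau> (x i))"
      define Y where "Y = local_max N p (\<lambda>i. \<tau> (y i))"
      have M: "M > 0" unfolding M_def by (rule local_max_pos[OF p good_vec_emb[OF gx t]])
      have Y: "Y > 0" unfolding Y_def by (rule local_max_pos[OF p good_vec_emb[OF gy t]])
      obtain i where i: "i \<le> N" "M = place_abs p (\<tau> (x i))" using local_max_attained[of N p "\<lambda>i. \<tau> (x i)"] by (auto simp: M_def)
      define b where "b = place_bound T' C' p * M ^ (e - d) * Y"
      have b0: "b \<ge> 0" using M Y place_bound_pos[OF T'(3), of T' p] by (simp add: b_def)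
      have GQ: "G i j x \<in> Qbar" if "j \<le> N" for j using homfun_Qbar[OF G(1)[OF i(1) that]] xQ by blast
      have GF: "G i j x * f j x \<in> Qbar" if "j \<le> N" for j using GQ[OF that] yQ[OF that] by (rule Qbar_mult)
      have trm: "place_abs p (\<tau> (G i j x * f j x)) \<le> b" if j: "j \<le> N" for j
      proof -
        have "place_abs p (\<tau> (G i j x * f j x)) = place_abs p (\<tau> (G i j x)) * place_abs p (\<tau> (f j x))"
          using QembD(4)[OF t GQ[OF j] yQ[OF j]] place_absD(3)[OF p] t GQ[OF j] yQ[OF j] by simp
        also have "\<dots> \<le> (place_bound T' C' p * M ^ (e - d)) * Y"
        proof (intro mult_mono)
          show "place_abs p (\<tau> (G i j x)) \<le> place_bound T' C' p * M ^ (e - d)"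
            unfolding M_def using T'(4) i(1) j xQ by (intro homfun_boundedD[OF _ t p]) auto
          show "place_abs p (\<tau> (f j x)) \<le> Y" unfolding Y_def yf[OF j, symmetric] by (rule local_max_ge[OF j])
          show "0 \<le> place_bound T' C' p * M ^ (e - d)" using M place_bound_pos[OF T'(3), of T' p] by simp
          show "0 \<le> place_abs p (\<tau> (f j x))" using place_absD(1)[OF p] t yQ[OF j] by simp
        qed
        finally show ?thesis by (simp add: b_def)
      qed
      have "M ^ e = place_abs p (\<tau> (x i ^ e))"
        using i emb_power[OF Qbar_subfield t xQ] place_absD(9)[OF p] t xQ by simp
      also have "\<tau> (x i ^ e) = (\<Sum>j\<le>N. \<tau> (G i j x * f j x))"
        unfolding G(2)[OF i(1)] using emb_sum[OF Qbar_subfield t, of "{..N}" "\<lambda>j. G i j x * f j x"] GF by simp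
      also have "place_abs p \<dots> \<le> place_bound U K p * (M ^ (e - d) * Y)"
      proof (cases "p = 0")
        case True
        have "place_abs p (\<Sum>j\<le>N. \<tau> (G i j x * f j x)) \<le> (\<Sum>j\<le>N. place_abs p (\<tau> (G i j x * f j x)))"
          using GF t by (intro place_absD(11)[OF p]) auto
        also have "\<dots> \<le> (\<Sum>j\<le>N. b)" using trm by (intro sum_mono) auto
        also have "\<dots> = real (Suc N) * b" by simp
        also have "\<dots> \<le> real (Suc N) * (C' * (M ^ (e - d) * Y))"
          using M Y T'(3) unfolding b_def mult.assoc by (intro mult_left_mono mult_right_mono) (auto simp: place_bound_def)
        also have "\<dots> = place_bound U K p * (M ^ (e - d) * Y)" using True by (simp add: place_bound_def U_def K_def)
        finally show ?thesis .
      next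
        case False
        then have pr: "prime p" using p places_cases by auto
        have CK: "C' \<le> K" using T'(3) mult_right_mono[of 1 "real (Suc N)" C'] by (simp add: K_def)
        have "place_abs p (\<Sum>j\<le>N. \<tau> (G i j x * f j x)) \<le> b"
          using GF t trm b0 by (intro place_abs_sum_le[OF pr]) auto
        also have "\<dots> \<le> place_bound U K p * (M ^ (e - d) * Y)"
          using M Y T'(3) CK unfolding b_def mult.assoc by (intro mult_right_mono place_bound_mono) (auto simp: U_def)
        finally show ?thesis .
      qed
      finally have "M ^ d * M ^ (e - d) \<le> (place_bound U K p * Y) * M ^ (e - d)"
        using e(1) by (simp add: mult_ac flip: power_add)
      then have "M ^ d \<le> place_bound U K p * Y" by (rule mult_right_le_imp_le) (use M in simp)
      moreover have "0 < M ^ d" "0 < place_bound U K p * Y" using M Y place_bound_pos[OF K1, of U p] by simp_all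
      ultimately have "ln (M ^ d) \<le> ln (place_bound U K p * Y)" by (simp only: ln_le_cancel_iff)
      then show "real d * ln (local_max N p (\<lambda>i. \<tau> (x i))) \<le> ln (place_bound U K p) + 1 * ln (local_max N p (\<lambda>i. \<tau> (y i)))"
        using M Y place_bound_pos[OF K1, of U p] by (simp add: M_def Y_def ln_mult ln_realpow)
    qed
    have "point_of y \<in> PN N" using y by (auto simp: PN_def)
    moreover have "ln (height N (point_of y)) = log_height N y" "ln (height N (point_of x)) = log_height N x"
      using height_point_of[OF x] height_point_of[OF y] by auto
    ultimately show ?thesis using up low c0 unfolding py by (simp add: abs_le_iff)
  qed
  show ?thesis using c0(1) main by (intro exI[of _ c]) (auto simp: PN_def)
qed


section \<open>Degrees and explicit height bounds\<close>

lemma gal_avg_le_const: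
  assumes B: "finite B" "B \<subseteq> Qbar" and le: "\<And>\<tau>. \<tau> \<in> embeddings Qbar \<Longrightarrow> \<Phi> (restrict \<tau> B) \<le> c"
  shows "gal_avg B \<Phi> \<le> c"
  using gal_avg_mono[OF B, of \<Phi> "\<lambda>_. 0 * 0 + c"] le gal_avg_linear[OF B, of 0 "\<lambda>_. 0" c] by simp

lemma gal_avg_ge_const:
  assumes B: "finite B" "B \<subseteq> Qbar" and le: "\<And>\<tau>. \<tau> \<in> embeddings Qbar \<Longrightarrow> c \<le> \<Phi> (restrict \<tau> B)"
  shows "c \<le> gal_avg B \<Phi>"
  using gal_avg_mono[OF B, of "\<lambda>_. 0 * 0 + c" \<Phi>] le gal_avg_linear[OF B, of 0 "\<lambda>_. 0" c] by simp

text \<open>The witness is \<open>[2^k : 1 : 0 : ... : 0]\<close>, whose local maximum is 1 at every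
  prime. Unbounded heights make the degree of a map visible.\<close>

lemma unbounded_height:
  assumes N: "N \<ge> 1"
  shows "\<exists>P\<in>PN N. ln (height N P) = real k * ln 2"
proof -
  define x :: cvec where "x = (\<lambda>i. if i = 0 then 2 ^ k else if i = 1 then 1 else 0)"
  have xr: "x i \<in> \<rat>" for i by (simp add: x_def)
  have xQ: "x i \<in> Qbar" for i by (rule Qbar_rat[OF xr])
  have x: "x \<in> hcoords N" using N xQ by (auto simp: hcoords_def x_def intro!: exI[of _ 1])
  note gx = hcoords_good[OF x]
  have lm0: "local_max N 0 x = 2 ^ k"
  proof (rule antisym)
    show "local_max N 0 x \<le> 2 ^ k" by (rule local_max_le) (simp add: x_def norm_power)
    show "2 ^ k \<le> local_max N 0 x" using local_max_ge[of 0 N 0 x] by (simp add: x_def norm_power)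
  qed
  have lmp: "local_max N p x = 1" if p: "prime p" for p
  proof (rule antisym)
    have "place_abs p (2 ^ k) \<le> 1" using place_abs_of_int_le_1[OF p, of "2 ^ k"] by simp
    then show "local_max N p x \<le> 1"
      using place_absD(5,6)[OF prime_in_places[OF p]] by (intro local_max_le) (simp add: x_def)
    show "1 \<le> local_max N p x" using local_max_ge[of 1 N p x] N place_absD(5)[OF prime_in_places[OF p]] by (simp add: x_def)
  qed
  have "places_height N x = (\<Sum>p\<in>{0}. ln (local_max N p x))"
    unfolding places_height_def
  proof (rule places_sum_eq(1))
    fix p assume "p \<in> places - {0}"
    then have "prime p" using places_cases by auto
    then show "ln (local_max N p x) = 0" using lmp by simp
  qed simp_all
  then have places_height: "places_height N x = real k * ln 2" by (simp add: lm0 ln_realpow)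
  have fx: "places_height N (\<lambda>i. restrict \<tau> (x ` {..N}) (x i)) = real k * ln 2" if t: "\<tau> \<in> embeddings Qbar" for \<tau>
  proof -
    have "\<tau> (x i) = x i" for i using xr[of i] QembD(9)[OF t] by (metis Rats_cases)
    then have "places_height N (\<lambda>i. restrict \<tau> (x ` {..N}) (x i)) = places_height N x" by (intro places_height_cong) simp
    then show ?thesis using places_height by simp
  qed
  have B: "finite (x ` {..N})" "x ` {..N} \<subseteq> Qbar" using xQ by auto
  have "log_height N x = real k * ln 2"
    unfolding log_height_def
    by (intro antisym gal_avg_le_const[OF B] gal_avg_ge_const[OF B]) (simp_all only: fx order_refl)
  then have "ln (height N (point_of x)) = real k * ln 2" using height_point_of[OF x] by simp
  then show ?thesis using x by (auto simp: PN_def)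
qed

text \<open>Both degrees are the growth rate of the height of \<open>\<phi> P\<close> against that
  of \<open>P\<close>. Hence the degree written in a presentation of a map is an invariant of the
  map.\<close>

theorem degree_unique:
  assumes N: "N \<ge> 1" and 1: "defines_endo N d F \<phi>" and 2: "defines_endo N d' F' \<phi>"
  shows "d = d'"
proof -
  have le: "d \<le> d'" if 1: "defines_endo N d F \<phi>" and 2: "defines_endo N d' F' \<phi>" for d d' F F'
  proof (rule ccontr)
    assume "\<not> d \<le> d'"
    then have dd: "real d \<ge> real d' + 1" by simp
    obtain C where C: "\<forall>P\<in>PN N. \<phi> P \<in> PN N \<and> \<bar>ln (height N (\<phi> P)) - real d * ln (height N P)\<bar> \<le> C"
      using height_endo[OF 1] by blast
    obtain C' where C': "\<forall>P\<in>PN N. \<phi> P \<in> PN N \<and> \<bar>ln (height N (\<phi> P)) - real d' * ln (height N P)\<bar> \<le> C'"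
      using height_endo[OF 2] by blast
    obtain k where k: "(C + C') / ln 2 < real k" using reals_Archimedean2 by blast
    obtain P where P: "P \<in> PN N" "ln (height N P) = real k * ln 2" using unbounded_height[OF N] by blast
    have "real k * ln 2 > C + C'" using k by (simp add: field_simps)
    moreover have "(real d - real d') * ln (height N P) \<le> C + C'"
      using C C' P(1) by (fastforce simp: abs_le_iff algebra_simps)
    moreover have "1 * (real k * ln 2) \<le> (real d - real d') * (real k * ln 2)"
      using dd by (intro mult_right_mono) auto
    ultimately show False using P(2) by simp
  qed
  show ?thesis using le[OF 1 2] le[OF 2 1] by simp
qed

text \<open>At each place \<open>x i\<close> is bounded by \<open>1 / |l i|\<close>, times the
  coefficient sum at the archimedean place; the product formula for the integer \<open>l i\<close>
  removes the leading coefficients.\<close>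

theorem log_height_le_roots:
  assumes x: "good_vec N x"
    and g: "\<And>i. i \<le> N \<Longrightarrow> g i \<noteq> 0" "\<And>i. i \<le> N \<Longrightarrow> poly (map_poly complex_of_int (g i)) (x i) = 0"
  shows "log_height N x \<le> (\<Sum>i\<le>N. ln (\<Sum>k\<le>degree (g i). \<bar>of_int (coeff (g i) k)\<bar>))"
proof -
  define S :: "nat \<Rightarrow> real" where "S = (\<lambda>i. \<Sum>k\<le>degree (g i). \<bar>of_int (coeff (g i) k)\<bar>)"
  define l where "l = (\<lambda>i. lead_coeff (g i))"
  have l0: "l i \<noteq> 0" if "i \<le> N" for i using g(1)[OF that] by (simp add: l_def)
  define h where "h = (\<lambda>i p. (if p = 0 then ln (S i) else 0) + (-1) * ln (place_abs p (of_int (l i))))"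
  have S0: "places_sum (\<lambda>p. if p = 0 then ln (S i) else 0) = ln (S i)" "fin_places (\<lambda>p. if p = 0 then ln (S i) else 0)" for i
    using places_sum_eq[of "{0}" "\<lambda>p. if p = 0 then ln (S i) else 0"] by auto
  have hp: "places_sum (h i) = ln (S i)" "fin_places (h i)" if i: "i \<le> N" for i
  proof -
    have pf: "places_sum (\<lambda>p. ln (place_abs p (of_int (l i)))) = 0" "fin_places (\<lambda>p. ln (place_abs p (of_int (l i))))"
      using product_formula_rat[of "of_int (l i)"] l0[OF i] by auto
    note a = places_sum_add[OF S0(2) fin_places_cmult[OF pf(2)], of i "- 1"]
    show "fin_places (h i)" unfolding h_def by (rule a(2))
    show "places_sum (h i) = ln (S i)" unfolding h_def a(1) places_sum_cmult pf(1) S0(1) by simp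
  qed
  have sumh: "places_sum (\<lambda>p. \<Sum>i\<le>N. h i p) = (\<Sum>i\<le>N. ln (S i))" "fin_places (\<lambda>p. \<Sum>i\<le>N. h i p)"
    using places_sum_sum[of "{..N}" h] hp by auto
  have loc: "ln (local_max N p (\<lambda>i. \<tau> (x i))) \<le> (\<Sum>i\<le>N. h i p)" if t: "\<tau> \<in> embeddings Qbar" and p: "p \<in> places" for \<tau> p
  proof -
    have xQ: "x i \<in> Qbar" if "i \<le> N" for i using x that by (simp add: good_vec_def)
    have root: "poly (map_poly complex_of_int (g i)) (\<tau> (x i)) = 0" if "i \<le> N" for i
      using Qemb_poly_root[OF t _ xQ[OF that] g(2)[OF that]] by (simp add: coeff_map_poly)
    have each: "ln (max 1 (place_abs p (\<tau> (x i)))) \<le> h i p" if i: "i \<le> N" for i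
    proof -
      have lp: "place_abs p (of_int (l i)) > 0" using l0[OF i] by (intro place_absD(12)[OF p]) auto
      have "max 1 (place_abs p (\<tau> (x i))) \<le> (if p = 0 then S i else 1) / place_abs p (of_int (l i))"
      proof (cases "p = 0")
        case True
        then show ?thesis using root_bound_arch[OF g(1)[OF i] root[OF i]] by (simp add: S_def l_def)
      next
        case False
        then have "prime p" using p places_cases by auto
        then show ?thesis using root_bound_finite[OF _ g(1)[OF i] _ root[OF i]] t xQ[OF i] False
          by (simp add: l_def divide_inverse)
      qed
      then have le: "ln (max 1 (place_abs p (\<tau> (x i)))) \<le> ln ((if p = 0 then S i else 1) / place_abs p (of_int (l i)))"
        and pos: "(if p = 0 then S i else 1) / place_abs p (of_int (l i)) > 0"
        by (auto intro!: ln_mono)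
      have "(if p = 0 then S i else 1) > 0" using pos lp by (simp add: zero_less_divide_iff)
      then have "ln ((if p = 0 then S i else 1) / place_abs p (of_int (l i))) = h i p"
        using lp by (auto simp: h_def ln_div)
      then show ?thesis using le by simp
    qed
    obtain i where i: "i \<le> N" "local_max N p (\<lambda>i. \<tau> (x i)) = place_abs p (\<tau> (x i))" using local_max_attained by blast
    have "local_max N p (\<lambda>i. \<tau> (x i)) > 0" by (rule local_max_pos[OF p good_vec_emb[OF x t]])
    then have "ln (local_max N p (\<lambda>i. \<tau> (x i))) \<le> ln (max 1 (place_abs p (\<tau> (x i))))" using i by (intro ln_mono) auto
    also have "\<dots> \<le> (\<Sum>i\<le>N. ln (max 1 (place_abs p (\<tau> (x i)))))"
      by (rule member_le_sum[of i "{..N}" "\<lambda>i. ln (max 1 (place_abs p (\<tau> (x i))))"]) (use i in auto)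
    also have "\<dots> \<le> (\<Sum>i\<le>N. h i p)" using each by (intro sum_mono) auto
    finally show ?thesis .
  qed
  have B: "finite (x ` {..N})" "x ` {..N} \<subseteq> Qbar" using x by (auto simp: good_vec_def)
  have "log_height N x \<le> (\<Sum>i\<le>N. ln (S i))"
    unfolding log_height_def
  proof (rule gal_avg_le_const[OF B])
    fix \<tau> assume t: "\<tau> \<in> embeddings Qbar"
    have "places_height N (\<lambda>i. restrict \<tau> (x ` {..N}) (x i)) = places_height N (\<lambda>i. \<tau> (x i))" by (intro places_height_cong) auto
    also have "\<dots> \<le> places_sum (\<lambda>p. \<Sum>i\<le>N. h i p)"
      unfolding places_height_def by (intro places_sum_mono fin_places_local_max[OF x t] sumh(2) loc t)
    finally show "places_height N (\<lambda>i. restrict \<tau> (x ` {..N}) (x i)) \<le> (\<Sum>i\<le>N. ln (S i))" using sumh(1) by simp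
  qed
  then show ?thesis by (simp add: S_def)
qed

lemma list_encode_length: "length xs \<le> list_encode xs"
  by (induction xs) (auto intro: order.trans[OF _ le_prod_encode_2])

lemma list_encode_member: "x \<in> set xs \<Longrightarrow> x < list_encode xs"
proof (induction xs)
  case (Cons a xs)
  then show ?case using le_prod_encode_1[of a "list_encode xs"] le_prod_encode_2[of "list_encode xs" a] by force
qed simp

lemma int_decode_bound: "\<bar>int_decode a\<bar> \<le> int a"
  unfolding int_decode_def sum_decode_def by (auto split: sum.splits if_splits) presburger+

text \<open>Crude but primitive recursive: every integer in a presentation is at most its code number.\<close>

theorem height_le_code:
  assumes "point_code N c P"
  shows "P \<in> PN N \<and> ln (height N P) \<le> real ((c + 1) ^ 3)"
proof -
  obtain xs where xs: "list_all2 algebraic_code (list_decode c) xs" "length xs = Suc N" "\<exists>x\<in>set xs. x \<noteq> 0"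
    "P = point_of (\<lambda>i. if i \<le> N then xs ! i else 0)" using assms unfolding point_code_def by blast
  define x where "x = (\<lambda>i. if i \<le> N then xs ! i else 0)"
  have len: "length (list_decode c) = Suc N" using list_all2_lengthD[OF xs(1)] xs(2) by simp
  have Nc: "Suc N \<le> c" using list_encode_length[of "list_decode c"] len by simp
  have ex: "\<exists>g. g \<noteq> 0 \<and> poly (map_poly complex_of_int g) (x i) = 0 \<and>
      (\<Sum>k\<le>degree g. \<bar>of_int (coeff g k)\<bar>) \<le> (real (c + 1)) ^ 2" if i: "i \<le> N" for i
  proof -
    have "algebraic_code (list_decode c ! i) (xs ! i)" using list_all2_nthD[OF xs(1), of i] len i by simp
    then obtain cs u v r where cs: "list_decode c ! i = list_encode [list_encode cs, u, v, r]"
      and p: "Poly (map (\<lambda>a. of_int (int_decode a)) cs) \<noteq> (0 :: complex poly)"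
      and z: "{z \<in> ball (Complex (of_rat (rat_of_code u)) (of_rat (rat_of_code v))) (of_rat (rat_of_code r)).
         poly (Poly (map (\<lambda>a. of_int (int_decode a)) cs)) z = 0} = {xs ! i}"
      unfolding algebraic_code_def Let_def by blast
    define g where "g = Poly (map int_decode cs)"
    have mg: "map_poly complex_of_int g = Poly (map (\<lambda>a. of_int (int_decode a)) cs)"
      by (auto simp: g_def poly_eq_iff coeff_map_poly coeff_Poly_eq nth_default_def)
    have lt: "list_encode cs < c"
    proof -
      have "list_encode cs < list_decode c ! i" unfolding cs by (rule list_encode_member) simp
      also have "\<dots> < list_encode (list_decode c)" using len i by (intro list_encode_member nth_mem) simp
      finally show ?thesis by simp
    qed
    have co: "\<bar>of_int (coeff g k)\<bar> \<le> real c" for k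
    proof (cases "k < length cs")
      case True
      have "\<bar>int_decode (cs ! k)\<bar> \<le> int (cs ! k)" by (rule int_decode_bound)
      also have "int (cs ! k) \<le> int c" using list_encode_member[OF nth_mem[OF True]] lt by simp
      finally show ?thesis using True by (simp add: g_def coeff_Poly_eq nth_default_def)
    qed (simp add: g_def coeff_Poly_eq nth_default_def)
    have "g \<noteq> 0" using p mg by auto
    moreover have "poly (map_poly complex_of_int g) (x i) = 0" unfolding mg using z i by (auto simp: x_def)
    moreover have "(\<Sum>k\<le>degree g. \<bar>of_int (coeff g k)\<bar>) \<le> (real (c + 1)) ^ 2"
    proof -
      have "degree g \<le> length cs" unfolding g_def by (rule order.trans[OF degree_Poly]) simp
      also have "\<dots> \<le> c" using list_encode_length[of cs] lt by simp
      finally have dg: "degree g \<le> c" .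
      have "(\<Sum>k\<le>degree g. \<bar>real_of_int (coeff g k)\<bar>) \<le> (\<Sum>k\<le>degree g. real c)" by (intro sum_mono co)
      also have "\<dots> \<le> real (c + 1) * real (c + 1)" using dg by (simp only: sum_constant card_atMost) (intro mult_mono, auto)
      finally show ?thesis by (simp add: power2_eq_square)
    qed
    ultimately show ?thesis by blast
  qed
  then have "\<forall>i. \<exists>g. i \<le> N \<longrightarrow> g \<noteq> 0 \<and> poly (map_poly complex_of_int g) (x i) = 0 \<and>
      (\<Sum>k\<le>degree g. \<bar>of_int (coeff g k)\<bar>) \<le> (real (c + 1)) ^ 2" by blast
  then obtain g where g: "\<And>i. i \<le> N \<Longrightarrow> g i \<noteq> 0" "\<And>i. i \<le> N \<Longrightarrow> poly (map_poly complex_of_int (g i)) (x i) = 0"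
    "\<And>i. i \<le> N \<Longrightarrow> (\<Sum>k\<le>degree (g i). \<bar>of_int (coeff (g i) k)\<bar>) \<le> (real (c + 1)) ^ 2"
    using choice[of "\<lambda>i g. i \<le> N \<longrightarrow> g \<noteq> 0 \<and> poly (map_poly complex_of_int g) (x i) = 0 \<and>
      (\<Sum>k\<le>degree g. \<bar>of_int (coeff g k)\<bar>) \<le> (real (c + 1)) ^ 2"] by blast
  have xQ: "x i \<in> Qbar" if i: "i \<le> N" for i
    using Qbar_root[of "map_poly complex_of_int (g i)" "x i"] g(1,2)[OF i]
    by (auto simp: coeff_map_poly map_poly_eq_0_iff)
  obtain i0 where "i0 \<le> N" "xs ! i0 \<noteq> 0" using xs(2,3) by (auto simp: in_set_conv_nth less_Suc_eq_le)
  then have "x i0 \<noteq> 0" by (simp add: x_def)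
  have "x i \<in> Qbar" for i using xQ[of i] by (cases "i \<le> N") (auto simp: x_def)
  moreover have "x i = 0" if "i > N" for i using that by (simp add: x_def)
  ultimately have xh: "x \<in> hcoords N" using \<open>x i0 \<noteq> 0\<close> unfolding hcoords_def by blast
  have "log_height N x \<le> (\<Sum>i\<le>N. ln (\<Sum>k\<le>degree (g i). \<bar>of_int (coeff (g i) k)\<bar>))"
    by (rule log_height_le_roots[OF hcoords_good[OF xh] g(1,2)])
  \<comment> \<open>Each coordinate has an integer polynomial with at most \<open>c + 1\<close>
    coefficients of size at most \<open>c\<close>; the logarithm is estimated by its argument to
    stay with integers.\<close>
  also have "\<dots> \<le> (\<Sum>i\<le>N. (real (c + 1)) ^ 2)"
  proof (rule sum_mono)
    fix i assume "i \<in> {..N}"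
    then have i: "i \<le> N" by simp
    define s :: real where "s = (\<Sum>k\<le>degree (g i). \<bar>of_int (coeff (g i) k)\<bar>)"
    have "\<bar>of_int (lead_coeff (g i))\<bar> \<le> s" unfolding s_def
      by (rule member_le_sum[of "degree (g i)" _ "\<lambda>k. \<bar>of_int (coeff (g i) k)\<bar>"]) auto
    moreover have "\<bar>of_int (lead_coeff (g i))\<bar> > (0::real)" using g(1)[OF i] by simp
    ultimately have "s > 0" by linarith
    then have "ln s \<le> s" using ln_le_minus_one[of s] by linarith
    also have "s \<le> (real (c + 1)) ^ 2" using g(3)[OF i] by (simp add: s_def)
    finally show "ln (\<Sum>k\<le>degree (g i). \<bar>of_int (coeff (g i) k)\<bar>) \<le> (real (c + 1)) ^ 2" by (simp add: s_def)
  qed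
  also have "\<dots> = real (Suc N) * (real (c + 1)) ^ 2" by simp
  also have "\<dots> \<le> real (c + 1) * (real (c + 1)) ^ 2" using Nc by (intro mult_right_mono) auto
  also have "\<dots> = real ((c + 1) ^ 3)" by (simp only: power3_eq_cube power2_eq_square of_nat_mult mult.assoc)
  finally have "log_height N x \<le> real ((c + 1) ^ 3)" .
  moreover have "P = point_of x" unfolding xs(4) x_def ..
  ultimately show ?thesis using height_point_of[OF xh] xh by (auto simp: PN_def)
qed


section \<open>Counting words\<close>

definition word_weight :: "('a \<Rightarrow> nat) \<Rightarrow> 'a list \<Rightarrow> nat" where
  "word_weight deg w = prod_list (map deg w)"

lemma word_weight_simps [simp]: "word_weight deg [] = 1" "word_weight deg (a # w) = deg a * word_weight deg w"
  by (simp_all add: word_weight_def)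

definition light_words :: "'a set \<Rightarrow> ('a \<Rightarrow> nat) \<Rightarrow> real \<Rightarrow> 'a list set" where
  "light_words S deg X = {w\<in>lists S. real (word_weight deg w) \<le> X}"

locale alphabet =
  fixes S :: "'a set" and deg :: "'a \<Rightarrow> nat"
  assumes fin: "finite S" and deg2: "\<And>a. a \<in> S \<Longrightarrow> deg a \<ge> 2" and card2: "card S \<ge> 2"
begin

lemma weight_ge_length: "w \<in> lists S \<Longrightarrow> length w < word_weight deg w"
proof (induction w)
  case (Cons a w)
  then have "Suc (length w) \<le> word_weight deg w" "2 \<le> deg a" using deg2 by auto
  then have "2 * Suc (length w) \<le> deg a * word_weight deg w" by (rule mult_le_mono[rotated])
  then show ?case by simp
qed simp

lemma weight_pos: "w \<in> lists S \<Longrightarrow> word_weight deg w \<ge> 1"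
  using weight_ge_length by fastforce

lemma finite_light: "finite (light_words S deg X)"
proof (rule finite_subset)
  show "light_words S deg X \<subseteq> {w. set w \<subseteq> S \<and> length w \<le> nat \<lceil>X\<rceil>}"
  proof
    fix w assume w: "w \<in> light_words S deg X"
    then have wS: "w \<in> lists S" and "real (word_weight deg w) \<le> X" by (auto simp: light_words_def)
    then have "real (length w) \<le> X" using weight_ge_length[OF wS] by linarith
    then have "length w \<le> nat \<lceil>X\<rceil>" by linarith
    then show "w \<in> {w. set w \<subseteq> S \<and> length w \<le> nat \<lceil>X\<rceil>}" using wS by (simp add: lists_eq_set)
  qed
qed (rule finite_lists_length_le[OF fin])

definition count :: "real \<Rightarrow> nat" where "count X = card (light_words S deg X)"

lemma count_small: "X < 1 \<Longrightarrow> count X = 0"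
proof -
  assume "X < 1"
  have "light_words S deg X = {}"
  proof (rule ccontr)
    assume "light_words S deg X \<noteq> {}"
    then obtain w where "w \<in> lists S" "real (word_weight deg w) \<le> X" by (auto simp: light_words_def)
    then show False using weight_pos[of w] \<open>X < 1\<close> by linarith
  qed
  then show ?thesis by (simp add: count_def)
qed

text \<open>Nonempty words are classified by their first letter; the 1 is the empty word.\<close>

lemma count_rec:
  assumes "X \<ge> 1"
  shows "count X = 1 + (\<Sum>a\<in>S. count (X / deg a))"
proof -
  have dpos: "deg a > 0" if "a \<in> S" for a using deg2[OF that] by simp
  have eq: "light_words S deg X = insert [] (\<Union>a\<in>S. (#) a ` light_words S deg (X / deg a))"
  proof (intro set_eqI iffI)
    fix w assume w: "w \<in> light_words S deg X"
    show "w \<in> insert [] (\<Union>a\<in>S. (#) a ` light_words S deg (X / deg a))"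
    proof (cases w)
      case (Cons a v)
      then have a: "a \<in> S" "v \<in> lists S" "real (deg a) * real (word_weight deg v) \<le> X"
        using w by (auto simp: light_words_def)
      then have "v \<in> light_words S deg (X / deg a)" using dpos[OF a(1)] by (simp add: light_words_def field_simps)
      then show ?thesis using a Cons by auto
    qed simp
  next
    fix w assume "w \<in> insert [] (\<Union>a\<in>S. (#) a ` light_words S deg (X / deg a))"
    then show "w \<in> light_words S deg X"
      using assms dpos by (auto simp: light_words_def field_simps)
  qed
  have "count X = 1 + card (\<Union>a\<in>S. (#) a ` light_words S deg (X / deg a))"
    unfolding count_def eq by (subst card_insert_disjoint) (use fin finite_light in auto)
  also have "card (\<Union>a\<in>S. (#) a ` light_words S deg (X / deg a)) = (\<Sum>a\<in>S. card ((#) a ` light_words S deg (X / deg a)))"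
    by (rule card_UN_disjoint) (use fin finite_light in auto)
  also have "\<dots> = (\<Sum>a\<in>S. count (X / deg a))"
    by (intro sum.cong refl) (simp add: count_def card_image)
  finally show ?thesis .
qed

definition char_eq :: "real \<Rightarrow> bool" where
  "char_eq b \<longleftrightarrow> (\<Sum>a\<in>S. real (deg a) powr (- b)) = 1"

text \<open>The sum is \<open>s = card S \<ge> 2\<close> at 0 and at most
  \<open>s / 2 ^ s \<le> 1\<close> at \<open>s\<close>. The bound \<open>b \<le> card S\<close> lets
  the programs estimate powers with exponent \<open>b\<close>.\<close>

lemma exponent_exists: "\<exists>b::real. 0 < b \<and> b \<le> card S \<and> char_eq b"
proof -
  define f where "f = (\<lambda>b. \<Sum>a\<in>S. real (deg a) powr (- b))"
  have "f (card S) \<le> (\<Sum>a\<in>S. 2 powr (- real (card S)))"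
    unfolding f_def
  proof (rule sum_mono)
    fix a assume "a \<in> S"
    then have "real (deg a) \<ge> 2" using deg2[of a] by simp
    then show "real (deg a) powr (- real (card S)) \<le> 2 powr (- real (card S))"
      by (intro powr_mono2') auto
  qed
  also have "\<dots> = real (card S) / 2 ^ card S" by (simp add: powr_minus powr_realpow divide_inverse)
  also have "\<dots> \<le> 1" using less_exp[of "card S"] by (simp add: divide_le_eq)
  finally have 1: "f (real (card S)) \<le> 1" .
  have 0: "f 0 = card S"
  proof -
    have "real (deg a) powr 0 = 1" if "a \<in> S" for a using deg2[OF that] by simp
    then show ?thesis by (simp add: f_def)
  qed
  have cont: "continuous_on {0..real (card S)} f"
  proof -
    have "f b = (\<Sum>a\<in>S. exp (- b * ln (real (deg a))))" for b
      unfolding f_def using deg2 by (intro sum.cong refl) (fastforce simp: powr_def)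
    then have "f = (\<lambda>b. \<Sum>a\<in>S. exp (- b * ln (real (deg a))))" by (rule ext)
    then show ?thesis by (simp only:) (intro continuous_intros)
  qed
  obtain b :: real where b: "0 \<le> b" "b \<le> card S" "f b = 1"
    using IVT2'[of f "real (card S)" 1 0, OF 1 _ _ cont] 0 card2 by auto
  have "b \<noteq> 0" using 0 b card2 by auto
  then show ?thesis using b by (intro exI[of _ b]) (auto simp: char_eq_def f_def)
qed

text \<open>For \<open>m(X) = (s - 1) n(X) + 1\<close> the recurrence becomes homogeneous,
  \<open>m(X)\<close> being the sum of the \<open>m(X / d)\<close>, and by \<open>char_eq\<close> it
  is solved by \<open>X powr b\<close> too. The comparison starts on \<open>1/D \<le> X < 1\<close>,
  where \<open>m(X) = 1\<close> lies between \<open>X powr b\<close> and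
  \<open>(D X) powr b\<close>; dividing some \<open>X \<ge> 1\<close> by a degree never leads below
  \<open>1/D\<close>.\<close>

lemma count_bounds:
  fixes X b :: real and D :: nat
  assumes b: "char_eq b" "b \<ge> 0" and D: "\<And>a. a \<in> S \<Longrightarrow> deg a \<le> D" and X: "X * D \<ge> 1" "X > 0"
  shows "X powr b - 1 \<le> (card S - 1) * count X" "(card S - 1) * count X \<le> (D * X) powr b - 1"
proof -
  obtain a0 where a0: "a0 \<in> S" using card2 by (metis card.empty ex_in_conv not_numeral_le_zero)
  have D2: "D \<ge> 2" using deg2[OF a0] D[OF a0] by simp
  have main: "X * D \<ge> 1 \<Longrightarrow> X > 0 \<Longrightarrow> X \<le> real n \<Longrightarrow> X powr b - 1 \<le> (card S - 1) * count X \<and> (card S - 1) * count X \<le> (D * X) powr b - 1" for n :: nat and X :: real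
  proof (induction n arbitrary: X rule: less_induct)
    case (less n)
    show ?case
    proof (cases "X < 1")
      case True
      have "X powr b \<le> 1" using True less.prems b(2) by (intro powr_le1) auto
      moreover have "1 \<le> (D * X) powr b" using less.prems b(2) by (intro ge_one_powr_ge_zero) (auto simp: mult.commute)
      ultimately show ?thesis using count_small[OF True] by simp
    next
      case False
      then have X1: "X \<ge> 1" by simp
      then have n1: "n \<ge> 1" using less.prems by linarith
      have step: "(X / deg a) powr b - 1 \<le> (card S - 1) * count (X / deg a) \<and> (card S - 1) * count (X / deg a) \<le> (D * (X / deg a)) powr b - 1"
        if a: "a \<in> S" for a
      proof (cases "X / deg a \<le> real (n - 1)")
        case True
        have "real (deg a) \<le> real D" using D[OF a] by simp
        then have "1 * real (deg a) \<le> X * real D" using X1 by (intro mult_mono) auto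
        then have "X / deg a * D \<ge> 1" using deg2[OF a] by (simp add: field_simps)
        then show ?thesis using less.IH[of "n - 1" "X / deg a"] True X1 deg2[OF a] n1 by simp
      next
        case False
        \<comment> \<open>The induction runs over an integer bound \<open>n\<close> of
          \<open>X\<close>. Division by a degree fails to lower it only for \<open>n = 1\<close>,
          that is \<open>X = 1\<close>, and then \<open>X / deg a\<close> lies in the starting
          range.\<close>
        have "X / deg a \<le> X / 2" using deg2[OF a] X1 by (intro divide_left_mono) auto
        then have "X / 2 > real (n - 1)" using False by linarith
        then have "real n > 2 * (real n - 1)" using less.prems n1 by (simp add: of_nat_diff)
        then have "n = 1" using n1 by simp
        then have "X = 1" using less.prems X1 by simp
        then have lt: "X / deg a < 1" using deg2[OF a] by simp
        have "(X / deg a) powr b \<le> 1" using lt X1 b(2) by (intro powr_le1) auto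
        moreover have "real D * (X / deg a) \<ge> 1" using D[OF a] deg2[OF a] \<open>X = 1\<close> by simp
        then have "1 \<le> (D * (X / deg a)) powr b" using b(2) by (intro ge_one_powr_ge_zero) auto
        ultimately show ?thesis using count_small[OF lt] by simp
      qed
      have pw: "(\<Sum>a\<in>S. (Y / deg a) powr b) = Y powr b" if Y: "Y > 0" for Y
      proof -
        have "(\<Sum>a\<in>S. (Y / deg a) powr b) = (\<Sum>a\<in>S. Y powr b * real (deg a) powr (- b))"
          using Y by (intro sum.cong refl) (simp add: powr_divide powr_minus_divide)
        then show ?thesis using b(1) by (simp add: char_eq_def flip: sum_distrib_left)
      qed
      have rec: "real ((card S - 1) * count X) = real (card S - 1) + (\<Sum>a\<in>S. real ((card S - 1) * count (X / deg a)))"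
        unfolding count_rec[OF X1] by (simp add: algebra_simps sum_distrib_left)
      have s1: "real (card S - 1) = real (card S) - 1" using card2 by (simp add: of_nat_diff)
      have "X powr b - 1 = real (card S - 1) + (\<Sum>a\<in>S. (X / deg a) powr b - 1)"
        using pw[of X] X1 s1 by (simp add: sum_subtractf)
      also have "\<dots> \<le> real ((card S - 1) * count X)" unfolding rec using step by (intro add_left_mono sum_mono) auto
      finally have low: "X powr b - 1 \<le> real ((card S - 1) * count X)" .
      have "real ((card S - 1) * count X) \<le> real (card S - 1) + (\<Sum>a\<in>S. ((D * X) / deg a) powr b - 1)"
        unfolding rec using step by (intro add_left_mono sum_mono) simp
      also have "\<dots> = (D * X) powr b - 1" using pw[of "D * X"] X1 D2 s1 by (simp add: sum_subtractf)
      finally show ?thesis using low by simp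
    qed
  qed
  have "X \<le> real (nat \<lceil>X\<rceil>)" by linarith
  from main[OF X this] show "X powr b - 1 \<le> (card S - 1) * count X" "(card S - 1) * count X \<le> (D * X) powr b - 1" by auto
qed

end


section \<open>Computable functions\<close>

text \<open>Total functions of fixed arity. One program must give the value under every list of
  oracles, so these functions can be combined with oracle queries later.\<close>

definition computable :: "nat \<Rightarrow> (nat list \<Rightarrow> nat) \<Rightarrow> bool" where
  "computable n f \<longleftrightarrow> (\<exists>prg. \<forall>os xs. length xs = n \<longrightarrow> run os prg xs = Some (f xs))"

lemma those_map_Some: "those (map (\<lambda>x. Some (h x)) l) = Some (map h l)"
  by (induction l) auto

lemma run_Comp:
  assumes "length prgs = length fs" "\<And>i. i < length fs \<Longrightarrow> run os (prgs ! i) xs = Some ((fs ! i) xs)"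
  shows "run os (Comp prg prgs) xs = run os prg (map (\<lambda>f. f xs) fs)"
proof -
  have "map (\<lambda>r. r xs) (map (run os) prgs) = map (\<lambda>f. Some (f xs)) fs"
    using assms by (intro nth_equalityI) auto
  then show ?thesis by (simp add: those_map_Some del: map_map)
qed

lemma computable_comp:
  assumes g: "computable (length fs) g" and f: "\<And>f. f \<in> set fs \<Longrightarrow> computable n f"
  shows "computable n (\<lambda>xs. g (map (\<lambda>f. f xs) fs))"
proof -
  obtain prg where prg: "\<And>os xs. length xs = length fs \<Longrightarrow> run os prg xs = Some (g xs)"
    using g unfolding computable_def by blast
  have "\<forall>f. \<exists>q. f \<in> set fs \<longrightarrow> (\<forall>os xs. length xs = n \<longrightarrow> run os q xs = Some (f xs))"
    using f unfolding computable_def by blast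
  then obtain q where q: "\<And>f os xs. f \<in> set fs \<Longrightarrow> length xs = n \<Longrightarrow> run os (q f) xs = Some (f xs)"
    using choice[of "\<lambda>f q. f \<in> set fs \<longrightarrow> (\<forall>os xs. length xs = n \<longrightarrow> run os q xs = Some (f xs))"] by blast
  have "run os (Comp prg (map q fs)) xs = Some (g (map (\<lambda>f. f xs) fs))" if "length xs = n" for os xs
    using run_Comp[of "map q fs" fs os xs prg] q that prg by simp
  then show ?thesis unfolding computable_def by blast
qed

lemma computable_prim:
  assumes a: "computable n a" and s: "computable (Suc (Suc n)) s"
    and f0: "\<And>xs. length xs = n \<Longrightarrow> f (0 # xs) = a xs"
    and fS: "\<And>m xs. length xs = n \<Longrightarrow> f (Suc m # xs) = s (m # f (m # xs) # xs)"
  shows "computable (Suc n) f"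
proof -
  obtain A where A: "\<And>os xs. length xs = n \<Longrightarrow> run os A xs = Some (a xs)"
    using a unfolding computable_def by blast
  obtain B where B: "\<And>os xs. length xs = Suc (Suc n) \<Longrightarrow> run os B xs = Some (s xs)"
    using s unfolding computable_def by blast
  have "run os (PrimRec A B) xs = Some (f xs)" if len: "length xs = Suc n" for os xs
  proof -
    obtain m ys where xs: "xs = m # ys" "length ys = n" using len by (cases xs) auto
    have "rec_nat (run os A ys) (\<lambda>m r. Option.bind r (\<lambda>y. run os B (m # y # ys))) m = Some (f (m # ys))"
      by (induction m) (simp_all add: A B f0 fS xs(2))
    then show ?thesis by (simp add: xs(1))
  qed
  then show ?thesis unfolding computable_def by blast
qed

lemma computable_proj: "i < n \<Longrightarrow> computable n (\<lambda>xs. xs ! i)"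
  unfolding computable_def by (rule exI[of _ "Proj i"]) simp

abbreviation "computable1 f \<equiv> computable 1 (\<lambda>xs. f (xs ! 0))"
abbreviation "computable2 f \<equiv> computable 2 (\<lambda>xs. f (xs ! 0) (xs ! 1))"
abbreviation "computable3 f \<equiv> computable 3 (\<lambda>xs. f (xs ! 0) (xs ! 1) (xs ! 2))"
abbreviation "computable4 f \<equiv> computable 4 (\<lambda>xs. f (xs ! 0) (xs ! 1) (xs ! 2) (xs ! 3))"

lemma computable1_app: "computable1 f \<Longrightarrow> computable n g \<Longrightarrow> computable n (\<lambda>xs. f (g xs))"
  using computable_comp[of "[g]" "\<lambda>xs. f (xs ! 0)" n] by simp

lemma computable2_app:
  assumes "computable2 f" "computable n g" "computable n h"
  shows "computable n (\<lambda>xs. f (g xs) (h xs))"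
proof -
  have "computable n (\<lambda>xs. (\<lambda>ys. f (ys ! 0) (ys ! 1)) (map (\<lambda>f. f xs) [g, h]))"
    by (rule computable_comp) (use assms in \<open>auto simp: numeral_2_eq_2\<close>)
  then show ?thesis by simp
qed

lemma computable3_app:
  assumes "computable3 f" "computable n g" "computable n h" "computable n k"
  shows "computable n (\<lambda>xs. f (g xs) (h xs) (k xs))"
proof -
  have "computable n (\<lambda>xs. (\<lambda>ys. f (ys ! 0) (ys ! 1) (ys ! 2)) (map (\<lambda>f. f xs) [g, h, k]))"
    by (rule computable_comp) (use assms in \<open>auto simp: numeral_3_eq_3 numeral_2_eq_2\<close>)
  then show ?thesis by (simp add: numeral_2_eq_2)
qed

lemma computable_Suc: "computable n f \<Longrightarrow> computable n (\<lambda>xs. Suc (f xs))"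
proof (rule computable1_app[of Suc])
  show "computable1 Suc" unfolding computable_def
    by (rule exI[of _ Successor]) (auto simp: length_Suc_conv)
qed

lemma computable_const: "computable n (\<lambda>xs. k)"
proof (induction k)
  case 0
  show ?case unfolding computable_def by (rule exI[of _ Zero]) simp
qed (rule computable_Suc)

lemma computable1_rec:
  assumes s: "computable2 s" and f: "f 0 = a" "\<And>m. f (Suc m) = s m (f m)"
  shows "computable1 f"
  using computable_prim[OF computable_const[of 0 a], of "\<lambda>xs. s (xs ! 0) (xs ! 1)" "\<lambda>xs. f (xs ! 0)"] s f
  by (simp add: numeral_2_eq_2)

lemma computable2_rec:
  assumes a: "computable1 a" and s: "computable3 s" and f: "\<And>y. f 0 y = a y" "\<And>m y. f (Suc m) y = s m (f m y) y"
  shows "computable2 f"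
  using computable_prim[of 1 "\<lambda>xs. a (xs ! 0)" "\<lambda>xs. s (xs ! 0) (xs ! 1) (xs ! 2)" "\<lambda>xs. f (xs ! 0) (xs ! 1)"] a s f
  by (simp add: numeral_2_eq_2 numeral_3_eq_3)

lemma computable3_rec:
  assumes a: "computable2 a" and s: "computable4 s"
    and f: "\<And>y z. f 0 y z = a y z" "\<And>m y z. f (Suc m) y z = s m (f m y z) y z"
  shows "computable3 f"
  using computable_prim[of 2 "\<lambda>xs. a (xs ! 0) (xs ! 1)" "\<lambda>xs. s (xs ! 0) (xs ! 1) (xs ! 2) (xs ! 3)" "\<lambda>xs. f (xs ! 0) (xs ! 1) (xs ! 2)"] a s f
  by (simp add: numeral_2_eq_2 numeral_3_eq_3 eval_nat_numeral)

lemma computable_add: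
  assumes "computable n f" "computable n g" shows "computable n (\<lambda>xs. f xs + g xs)"
proof (rule computable2_app[of plus, OF _ assms])
  show "computable2 (plus :: nat \<Rightarrow> _)"
    by (rule computable2_rec[of "\<lambda>y. y" "\<lambda>m r y. Suc r"]) (auto intro!: computable_Suc computable_proj)
qed

lemma computable_mult:
  assumes "computable n f" "computable n g" shows "computable n (\<lambda>xs. f xs * g xs)"
proof (rule computable2_app[of times, OF _ assms])
  show "computable2 (times :: nat \<Rightarrow> _)"
    by (rule computable2_rec[of "\<lambda>y. 0" "\<lambda>m r y. y + r"]) (auto intro!: computable_add computable_const computable_proj)
qed

lemma computable_power:
  assumes "computable n f" "computable n g" shows "computable n (\<lambda>xs. f xs ^ g xs)"
\<comment> \<open>Primitive recursion runs on the first argument, so the exponent is put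
  there.\<close>
proof (rule computable2_app[of "\<lambda>k y. y ^ k", OF _ assms(2,1)])
  show "computable2 (\<lambda>k y. y ^ k :: nat)"
    by (rule computable2_rec[of "\<lambda>y. 1" "\<lambda>m r y. y * r"]) (auto intro!: computable_mult computable_const computable_proj)
qed

lemma computable_diff:
  assumes "computable n f" "computable n g" shows "computable n (\<lambda>xs. f xs - g xs)"
proof (rule computable2_app[of "\<lambda>k y. y - k", OF _ assms(2,1)])
  have "computable1 (\<lambda>k. k - 1 :: nat)"
    by (rule computable1_rec[of "\<lambda>m r. m" _ 0]) (auto intro!: computable_proj)
  note pred = computable1_app[of "\<lambda>k. k - 1", OF this]
  show "computable2 (\<lambda>k y. y - k :: nat)"
  proof (rule computable2_rec[of "\<lambda>y. y" "\<lambda>m r y. r - 1"])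
    show "computable3 (\<lambda>m r y. r - 1)" by (rule pred, rule computable_proj) simp
  qed (simp_all add: computable_proj)
qed

lemma computable_cond:
  assumes "computable n f" "computable n g" "computable n h"
  shows "computable n (\<lambda>xs. if f xs = 0 then g xs else h xs)"
proof (rule computable3_app[of "\<lambda>z a b. if z = 0 then a else b", OF _ assms])
  show "computable3 (\<lambda>z a b. if z = 0 then a else b)"
    by (rule computable3_rec[of "\<lambda>a b. a" "\<lambda>m r a b. b"]) (auto intro!: computable_proj)
qed

lemma computable_le:
  assumes "computable n f" "computable n g" "computable n h" "computable n k"
  shows "computable n (\<lambda>xs. if f xs \<le> g xs then h xs else k xs)"
  using computable_cond[OF computable_diff[OF assms(1,2)] assms(3,4)] by simp

lemmas computable_intros = computable_proj computable_const computable_Suc computable_add computable_mult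
  computable_power computable_diff computable_cond computable_le

section \<open>Unpairing, division and binary logarithm by primitive recursion\<close>

lemma computable_triangle:
  assumes "computable n f" shows "computable n (\<lambda>xs. triangle (f xs))"
proof (rule computable1_app[OF _ assms])
  show "computable1 triangle"
    by (rule computable1_rec[of "\<lambda>m r. r + Suc m" _ 0]) (auto intro!: computable_intros)
qed

lemma computable_prod_encode:
  assumes "computable n f" "computable n g" shows "computable n (\<lambda>xs. prod_encode (f xs, g xs))"
  unfolding prod_encode_def prod.case by (intro computable_add computable_triangle assms)

text \<open>The largest \<open>k\<close> with \<open>triangle k \<le> c\<close>, the antidiagonal of
  \<open>c\<close> in the pairing. It replaces the loop inside \<open>prod_decode\<close> by a
  primitive recursion on \<open>c\<close>.\<close>

primrec diag_index :: "nat \<Rightarrow> nat" where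
  "diag_index 0 = 0"
| "diag_index (Suc c) = (if triangle (Suc (diag_index c)) \<le> Suc c then Suc (diag_index c) else diag_index c)"

lemma diag_index: "triangle (diag_index c) \<le> c" "c < triangle (Suc (diag_index c))"
  by (induction c) auto

lemma computable_diag_index:
  assumes "computable n f" shows "computable n (\<lambda>xs. diag_index (f xs))"
proof (rule computable1_app[OF _ assms])
  show "computable1 diag_index"
    by (rule computable1_rec[of "\<lambda>m r. if triangle (Suc r) \<le> Suc m then Suc r else r" _ 0])
       (auto intro!: computable_intros computable_triangle simp del: triangle_Suc)
qed

lemma prod_decode_diag:
  "prod_decode c = (c - triangle (diag_index c), diag_index c - (c - triangle (diag_index c)))"
proof -
  define k where "k = diag_index c"
  define m where "m = c - triangle k"
  have c: "c = triangle k + m" "m \<le> k" using diag_index[of c] by (auto simp: k_def m_def)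
  have "prod_decode c = prod_decode_aux k m" unfolding c(1) by (rule prod_decode_triangle_add)
  also have "\<dots> = (m, k - m)" using c(2) by (simp add: prod_decode_aux.simps)
  finally show ?thesis by (simp add: k_def m_def)
qed

lemma computable_fst: "computable n f \<Longrightarrow> computable n (\<lambda>xs. fst (prod_decode (f xs)))"
  unfolding prod_decode_diag fst_conv by (intro computable_diff computable_triangle computable_diag_index)

lemma computable_snd: "computable n f \<Longrightarrow> computable n (\<lambda>xs. snd (prod_decode (f xs)))"
  unfolding prod_decode_diag snd_conv by (intro computable_diff computable_triangle computable_diag_index)

text \<open>The quotient grows by one whenever the dividend reaches the next multiple of
  \<open>d\<close>. For \<open>d = 0\<close> this returns \<open>n\<close>, unlike
  \<open>div\<close>; only degrees are used as divisors.\<close>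

primrec pdiv :: "nat \<Rightarrow> nat \<Rightarrow> nat" where
  "pdiv 0 d = 0"
| "pdiv (Suc n) d = (if d * Suc (pdiv n d) \<le> Suc n then Suc (pdiv n d) else pdiv n d)"

lemma pdiv: "d > 0 \<Longrightarrow> pdiv n d = n div d"
proof -
  assume d: "d > 0"
  have "d * pdiv n d \<le> n \<and> n < d * Suc (pdiv n d)" by (induction n) (use d in auto)
  then show ?thesis by (intro div_nat_eqI[symmetric]) (auto simp: mult.commute)
qed

lemma computable_pdiv: "computable2 pdiv"
  by (rule computable2_rec[of "\<lambda>y. 0" "\<lambda>m r d. if d * Suc r \<le> Suc m then Suc r else r"])
     (auto intro!: computable_intros)

primrec floor_log2 :: "nat \<Rightarrow> nat" where
  "floor_log2 0 = 0"
| "floor_log2 (Suc n) = (if 2 ^ Suc (floor_log2 n) \<le> Suc n then Suc (floor_log2 n) else floor_log2 n)"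

lemma floor_log2: "n < 2 ^ Suc (floor_log2 n)" "n > 0 \<Longrightarrow> 2 ^ floor_log2 n \<le> n"
proof -
  have "n < 2 ^ Suc (floor_log2 n) \<and> (n > 0 \<longrightarrow> 2 ^ floor_log2 n \<le> n)"
    by (induction n) auto
  then show "n < 2 ^ Suc (floor_log2 n)" "n > 0 \<Longrightarrow> 2 ^ floor_log2 n \<le> n" by auto
qed

lemma computable_floor_log2: "computable1 floor_log2"
  by (rule computable1_rec[of "\<lambda>m r. if 2 ^ Suc r \<le> Suc m then Suc r else r" _ 0])
     (auto intro!: computable_intros simp del: power_Suc)


section \<open>Computing the exponent and the constants\<close>

text \<open>Inverts \<open>list_encode (x # xs) = Suc (prod_encode (x, list_encode xs))\<close>. On
  the code 0 of the empty list truncated subtraction gives the tail 0, so dropping past the end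
  stays at 0 and \<open>code_drop i c = 0\<close> tests the length.\<close>

definition code_hd :: "nat \<Rightarrow> nat" where "code_hd c = fst (prod_decode (c - 1))"
definition code_tl :: "nat \<Rightarrow> nat" where "code_tl c = snd (prod_decode (c - 1))"

primrec code_drop :: "nat \<Rightarrow> nat \<Rightarrow> nat" where
  "code_drop 0 c = c"
| "code_drop (Suc i) c = code_tl (code_drop i c)"

definition code_nth :: "nat \<Rightarrow> nat \<Rightarrow> nat" where "code_nth i c = code_hd (code_drop i c)"

definition code_cons :: "nat \<Rightarrow> nat \<Rightarrow> nat" where "code_cons x c = Suc (prod_encode (x, c))"

lemma code_cons: "code_cons x (list_encode xs) = list_encode (x # xs)"
  by (simp add: code_cons_def)

lemma code_tl: "code_tl (list_encode xs) = list_encode (tl xs)"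
proof (cases xs)
  case Nil
  have "prod_decode (prod_encode (0, 0)) = (0, 0)" by (rule prod_encode_inverse)
  then show ?thesis using Nil by (simp add: code_tl_def prod_encode_def)
qed (simp add: code_tl_def)

lemma code_drop: "code_drop i (list_encode xs) = list_encode (drop i xs)"
  by (induction i) (simp_all add: code_tl drop_Suc tl_drop)

lemma code_nth: "i < length xs \<Longrightarrow> code_nth i (list_encode xs) = xs ! i"
  unfolding code_nth_def code_drop by (simp add: Cons_nth_drop_Suc[symmetric] code_hd_def)

lemma code_drop_eq_0: "code_drop i (list_encode xs) = 0 \<longleftrightarrow> length xs \<le> i"
proof -
  have "list_encode ys = 0 \<longleftrightarrow> ys = []" for ys by (cases ys) auto
  then show ?thesis by (simp add: code_drop)
qed

lemma computable_code_drop: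
  assumes "computable n f" "computable n g" shows "computable n (\<lambda>xs. code_drop (f xs) (g xs))"
proof (rule computable2_app[OF _ assms])
  show "computable2 code_drop"
  proof (rule computable2_rec[of "\<lambda>y. y" "\<lambda>m r y. code_tl r"])
    show "computable3 (\<lambda>m r y. code_tl r)"
      unfolding code_tl_def by (intro computable_snd computable_intros) simp_all
  qed (simp_all add: computable_proj)
qed

lemma computable_code_nth:
  assumes "computable n f" "computable n g" shows "computable n (\<lambda>xs. code_nth (f xs) (g xs))"
  unfolding code_nth_def code_hd_def
  by (intro computable_fst computable_diff computable_code_drop computable_const assms)

lemma computable_code_cons:
  assumes "computable n f" "computable n g" shows "computable n (\<lambda>xs. code_cons (f xs) (g xs))"
  unfolding code_cons_def by (intro computable_Suc computable_prod_encode assms)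

abbreviation "computable5 f \<equiv> computable 5 (\<lambda>xs. f (xs ! 0) (xs ! 1) (xs ! 2) (xs ! 3) (xs ! 4))"

lemma computable4_rec:
  assumes a: "computable3 a" and s: "computable5 s"
    and f: "\<And>y z w. f 0 y z w = a y z w" "\<And>m y z w. f (Suc m) y z w = s m (f m y z w) y z w"
  shows "computable4 f"
  using computable_prim[of 3 "\<lambda>xs. a (xs ! 0) (xs ! 1) (xs ! 2)" "\<lambda>xs. s (xs ! 0) (xs ! 1) (xs ! 2) (xs ! 3) (xs ! 4)"
    "\<lambda>xs. f (xs ! 0) (xs ! 1) (xs ! 2) (xs ! 3)"] a s f
  by (simp add: eval_nat_numeral)

lemma computable4_app:
  assumes "computable4 f" "computable n g" "computable n h" "computable n k" "computable n l"
  shows "computable n (\<lambda>xs. f (g xs) (h xs) (k xs) (l xs))"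
proof -
  have "computable n (\<lambda>xs. (\<lambda>ys. f (ys ! 0) (ys ! 1) (ys ! 2) (ys ! 3)) (map (\<lambda>f. f xs) [g, h, k, l]))"
    by (rule computable_comp) (use assms in \<open>auto simp: eval_nat_numeral\<close>)
  then show ?thesis by (simp add: eval_nat_numeral)
qed

text \<open>A list is at most as long as its code, so \<open>code_length L L\<close> is the length
  of the list coded by \<open>L\<close>.\<close>

primrec code_length :: "nat \<Rightarrow> nat \<Rightarrow> nat" where
  "code_length 0 c = 0"
| "code_length (Suc j) c = code_length j c + (if code_drop j c = 0 then 0 else 1)"

lemma code_length: "code_length j (list_encode xs) = min j (length xs)"
  by (induction j) (auto simp: code_drop_eq_0)

lemma computable_code_length:
  assumes "computable n f" "computable n g" shows "computable n (\<lambda>xs. code_length (f xs) (g xs))"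
proof (rule computable2_app[OF _ assms])
  show "computable2 code_length"
    by (rule computable2_rec[of "\<lambda>y. 0" "\<lambda>m r c. r + (if code_drop m c = 0 then 0 else 1)"])
       (auto intro!: computable_intros computable_code_drop)
qed

text \<open>The table \<open>T\<close> of the counts up to \<open>X\<close> is a list code in descending order; \<open>L\<close> is a code of the
  list of presentations of the generators, each of which has the degree as its first component.\<close>

primrec table_sum :: "nat \<Rightarrow> nat \<Rightarrow> nat \<Rightarrow> nat \<Rightarrow> nat" where
  "table_sum 0 L X T = 0"
| "table_sum (Suc j) L X T = table_sum j L X T + (if code_drop j L = 0 then 0
     else code_nth (X - pdiv (Suc X) (fst (prod_decode (code_nth j L)))) T)"

primrec count_table :: "nat \<Rightarrow> nat \<Rightarrow> nat" where
  "count_table 0 L = code_cons 0 0"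
| "count_table (Suc X) L = code_cons (Suc (table_sum L L X (count_table X L))) (count_table X L)"

lemma computable_table_sum:
  assumes "computable n f" "computable n g" "computable n h" "computable n k"
  shows "computable n (\<lambda>xs. table_sum (f xs) (g xs) (h xs) (k xs))"
proof (rule computable4_app[OF _ assms])
  show "computable4 table_sum"
  proof (rule computable4_rec[of "\<lambda>L X T. 0" "\<lambda>j r L X T. r + (if code_drop j L = 0 then 0
     else code_nth (X - pdiv (Suc X) (fst (prod_decode (code_nth j L)))) T)"])
    show "computable5 (\<lambda>j r L X T. r + (if code_drop j L = 0 then 0
       else code_nth (X - pdiv (Suc X) (fst (prod_decode (code_nth j L)))) T))"
      by (intro computable_add computable_cond computable_code_drop computable_code_nth computable_diff
        computable2_app[OF computable_pdiv] computable_Suc computable_fst computable_const computable_proj) simp_all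
  qed (simp_all add: computable_const)
qed

lemma computable_count_table:
  assumes "computable n f" "computable n g" shows "computable n (\<lambda>xs. count_table (f xs) (g xs))"
proof (rule computable2_app[OF _ assms])
  show "computable2 count_table"
  proof (rule computable2_rec[of "\<lambda>L. code_cons 0 0" "\<lambda>X r L. code_cons (Suc (table_sum L L X r)) r"])
    show "computable3 (\<lambda>X r L. code_cons (Suc (table_sum L L X r)) r)"
      by (intro computable_code_cons computable_Suc computable_table_sum computable_proj) simp_all
  qed (simp_all add: computable_const)
qed

text \<open>Weights are integers, so the counts at fractions needed by the recurrence are found in a
  table over the naturals.\<close>

lemma (in alphabet) count_floor:
  assumes "d > 0"
  shows "count (real n / real d) = count (real (n div d))"
proof -
  have "real m \<le> real n / real d \<longleftrightarrow> real m \<le> real (n div d)" for m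
    using assms less_eq_div_iff_mult_less_eq[of d m n] by (simp add: le_divide_eq flip: of_nat_mult)
  then show ?thesis by (simp add: count_def light_words_def)
qed

lemma (in alphabet) table_correct:
  assumes as: "distinct as" "set as = S" and ps: "length ps = length as"
    "\<And>i. i < length as \<Longrightarrow> fst (prod_decode (ps ! i)) = deg (as ! i)"
  shows "count_table X (list_encode ps) = list_encode (map (\<lambda>i. count (real i)) (rev [0..<Suc X]))"
proof (induction X)
  case 0
  show ?case using code_cons[of 0 "[]"] count_small[of 0] by simp
next
  case (Suc X)
  define T where "T = list_encode (map (\<lambda>i. count (real i)) (rev [0..<Suc X]))"
  have nth: "code_nth (X - m) T = count (real m)" if "m \<le> X" for m
  proof -
    have "code_nth (X - m) T = map (\<lambda>i. count (real i)) (rev [0..<Suc X]) ! (X - m)"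
      unfolding T_def by (rule code_nth) simp
    also have "\<dots> = count (real (rev [0..<Suc X] ! (X - m)))" by (rule nth_map) simp
    also have "rev [0..<Suc X] ! (X - m) = m" using that by (subst rev_nth) (auto simp del: upt_Suc)
    finally show ?thesis .
  qed
  have ts: "table_sum j (list_encode ps) X T = (\<Sum>i<min j (length ps). count (real (Suc X) / real (deg (as ! i))))" for j
  proof (induction j)
    case (Suc j)
    show ?case
    proof (cases "j < length ps")
      case True
      then have a: "as ! j \<in> S" using as ps by auto
      have d: "fst (prod_decode (code_nth j (list_encode ps))) = deg (as ! j)"
        using True ps code_nth[OF True] by simp
      have d2: "deg (as ! j) \<ge> 2" by (rule deg2[OF a])
      then have "Suc X div deg (as ! j) < Suc X" by (intro div_less_dividend) auto
      then have "Suc X div deg (as ! j) \<le> X" by linarith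
      then have "code_nth (X - pdiv (Suc X) (deg (as ! j))) T = count (real (Suc X) / real (deg (as ! j)))"
        using nth[of "Suc X div deg (as ! j)"] pdiv[of "deg (as ! j)" "Suc X"] count_floor[of "deg (as ! j)" "Suc X"] d2 by simp
      moreover have "min (Suc j) (length ps) = Suc j" "min j (length ps) = j" using True by auto
      ultimately show ?thesis using Suc True d by (simp add: code_drop_eq_0)
    next
      case False
      then have "min (Suc j) (length ps) = min j (length ps)" by auto
      then show ?thesis using Suc False by (simp add: code_drop_eq_0)
    qed
  qed simp
  have "length ps \<le> list_encode ps" by (rule list_encode_length)
  then have "table_sum (list_encode ps) (list_encode ps) X T = (\<Sum>i<length ps. count (real (Suc X) / real (deg (as ! i))))"
    unfolding ts by (simp add: min_absorb2)
  also have "\<dots> = (\<Sum>a\<leftarrow>as. count (real (Suc X) / real (deg a)))"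
    using ps(1) by (simp add: sum_list_sum_nth atLeast0LessThan)
  also have "\<dots> = (\<Sum>a\<in>S. count (real (Suc X) / real (deg a)))"
    using as by (simp add: sum_list_distinct_conv_sum_set)
  finally have "Suc (table_sum (list_encode ps) (list_encode ps) X T) = count (real (Suc X))"
    using count_rec[of "real (Suc X)"] by simp
  moreover have "map (\<lambda>i. count (real i)) (rev [0..<Suc (Suc X)]) = count (real (Suc X)) # map (\<lambda>i. count (real i)) (rev [0..<Suc X])"
    by simp
  ultimately show ?case unfolding count_table.simps Suc.IH T_def[symmetric] by (simp only: T_def code_cons)
qed

section \<open>Rational approximations to the exponent\<close>

definition log_count :: "nat \<Rightarrow> nat \<Rightarrow> nat" where
  "log_count n L = floor_log2 (Suc ((code_length L L - 1) * code_hd (count_table (2 ^ n) L)))"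

text \<open>\<open>log_count n\<close> differs from \<open>n b\<close> by at most
  \<open>1 + c * c\<close>: rounding costs 1, and the factor \<open>D\<close> of
  \<open>count_bounds\<close>, taken as \<open>2 ^ c\<close>, costs \<open>c b\<close>, which is at
  most \<open>c * c\<close>. Dividing by \<open>n\<close> leaves \<open>1 / 2 ^ k\<close>. An even
  numerator code stands for a nonnegative integer, and a denominator is coded by its
  predecessor.\<close>

definition exponent_code :: "nat \<Rightarrow> nat \<Rightarrow> nat" where
  "exponent_code c k = (let n = 2 ^ k * (1 + c * c) in prod_encode (2 * log_count n (snd (prod_decode c)), n - 1))"

lemma computable_exponent_code: "computable2 exponent_code"
  unfolding exponent_code_def log_count_def Let_def code_hd_def
  by (intro computable_prod_encode computable_mult computable1_app[OF computable_floor_log2] computable_code_length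
      computable_count_table computable_fst computable_snd computable_diff computable_power computable_add
      computable_Suc computable_const computable_proj) simp_all

lemma rat_of_code_quotient: "n > 0 \<Longrightarrow> (of_rat (rat_of_code (prod_encode (2 * m, n - 1))) :: real) = real m / real n"
  by (simp add: rat_of_code_def int_decode_def sum_decode_def of_rat_divide)

lemma (in alphabet) code_bounds:
  assumes as: "distinct as" "set as = S" and ps: "length ps = length as"
    "\<And>i. i < length as \<Longrightarrow> fst (prod_decode (ps ! i)) = deg (as ! i)"
  shows "card S \<le> prod_encode (N, list_encode ps)" "a \<in> S \<Longrightarrow> deg a \<le> prod_encode (N, list_encode ps)"
proof -
  have Lc: "list_encode ps \<le> prod_encode (N, list_encode ps)" by (rule le_prod_encode_2)
  have "card S = length ps" using as ps(1) by (metis distinct_card)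
  then show "card S \<le> prod_encode (N, list_encode ps)" using list_encode_length[of ps] Lc by simp
  assume "a \<in> S"
  then obtain i where i: "i < length as" "as ! i = a" using as by (metis in_set_conv_nth)
  have "deg a = fst (prod_decode (ps ! i))" using ps(2)[OF i(1)] i(2) by simp
  also have "\<dots> \<le> ps ! i" by (metis le_prod_encode_1 prod.collapse prod_decode_inverse)
  also have "\<dots> \<le> list_encode ps" using i ps(1) by (intro less_imp_le list_encode_member) simp
  finally show "deg a \<le> prod_encode (N, list_encode ps)" using Lc by simp
qed

text \<open>\<open>log\<^sub>2 ((s - 1) N(2\<^sup>n) + 1)\<close> lies between \<open>n b\<close> and \<open>(n + c) b\<close>.\<close>

lemma (in alphabet) exponent_approx:
  assumes as: "distinct as" "set as = S" and ps: "length ps = length as"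
    "\<And>i. i < length as \<Longrightarrow> fst (prod_decode (ps ! i)) = deg (as ! i)"
    and b: "char_eq b" "0 \<le> b" "b \<le> card S"
  shows "\<bar>of_rat (rat_of_code (exponent_code (prod_encode (N, list_encode ps)) k)) - b\<bar> \<le> 1 / 2 ^ k"
proof -
  define L where "L = list_encode ps"
  define c where "c = prod_encode (N, L)"
  define n where "n = 2 ^ k * (1 + c * c)"
  define M where "M = Suc ((card S - 1) * count (2 ^ n))"
  define l where "l = floor_log2 M"
  have n0: "n > 0" by (simp add: n_def)
  have Lc: "L \<le> c" unfolding c_def by (rule le_prod_encode_2)
  have lenL: "length ps \<le> L" unfolding L_def by (rule list_encode_length)
  have cardS: "card S = length ps" using as ps(1) by (metis distinct_card)
  have "code_length L L = length ps" using code_length[of L ps] lenL by (simp add: L_def min_absorb2)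
  moreover have "code_hd (count_table (2 ^ n) L) = count (2 ^ n)"
  proof -
    have "count_table (2 ^ n) L = list_encode (count (real (2 ^ n)) # map (\<lambda>i. count (real i)) (rev [0..<2 ^ n]))"
    proof -
      have "count_table (2 ^ n) L = list_encode (map (\<lambda>i. count (real i)) (rev [0..<Suc (2 ^ n)]))"
        unfolding L_def by (rule table_correct[OF as ps])
      then show ?thesis by simp
    qed
    then show ?thesis by (simp add: code_hd_def)
  qed
  ultimately have lc: "log_count n L = l" by (simp add: log_count_def l_def M_def cardS)
  have "exponent_code c k = prod_encode (2 * l, n - 1)"
  proof -
    have "snd (prod_decode c) = L" by (simp add: c_def)
    then show ?thesis using lc by (simp only: exponent_code_def Let_def flip: n_def)
  qed
  then have val: "of_rat (rat_of_code (exponent_code c k)) = real l / real n" using rat_of_code_quotient[OF n0] by simp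
  \<comment> \<open>The degrees are at most \<open>c\<close>; the weaker bound \<open>2 ^ c\<close>
    turns the constant into a shift of the binary logarithm by \<open>c b\<close>.\<close>
  have D: "deg a \<le> 2 ^ c" if "a \<in> S" for a
  proof -
    have "deg a \<le> c" unfolding c_def L_def by (rule code_bounds(2)[OF as ps that])
    also have "c \<le> 2 ^ c" by (simp add: less_imp_le)
    finally show ?thesis .
  qed
  have X1: "(2 ^ n :: real) * real (2 ^ c) \<ge> 1" using one_le_power[of "2::real" "n + c"] by (simp add: power_add)
  note cb = count_bounds[OF b(1,2) D, of "2 ^ n", OF _ X1]
  have up: "real M \<le> (2 ^ c * 2 ^ n) powr b" and low: "(2 ^ n) powr b \<le> real M"
    using cb by (auto simp: M_def)
  have p2: "((2::real) ^ m) powr b = 2 powr (real m * b)" for m by (simp add: powr_realpow[symmetric] powr_powr)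
  have M0: "M > 0" by (simp add: M_def)
  have "2 powr (real l) \<le> real M"
  proof -
    have "2 ^ l \<le> M" unfolding l_def by (rule floor_log2(2)[OF M0])
    then have "real (2 ^ l) \<le> real M" by (simp only: of_nat_le_iff)
    then show ?thesis by (simp add: powr_realpow)
  qed
  also have "real M \<le> 2 powr (real (c + n) * b)" using up p2[of "c + n"] by (simp add: power_add)
  finally have u: "real l \<le> real (c + n) * b" by simp
  have "2 powr (real n * b) \<le> real M" using low p2[of n] by simp
  also have "real M < 2 powr (real l + 1)"
  proof -
    have "M < 2 ^ Suc l" unfolding l_def by (rule floor_log2(1))
    then have "real M < real (2 ^ Suc l)" by (simp only: of_nat_less_iff)
    then show ?thesis by (simp add: powr_add powr_realpow)
  qed
  finally have lw: "real n * b < real l + 1" by simp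
  have bc: "b \<le> real c" using b(3) cardS lenL Lc by linarith
  have k0: "real n = 2 ^ k * (1 + real c * real c)" by (simp add: n_def distrib_left)
  have "real l - real n * b \<le> real c * b" using u by (simp add: algebra_simps)
  also have "\<dots> \<le> real c * real c" using bc by (intro mult_left_mono) auto
  finally have A: "real l - real n * b \<le> 1 + real c * real c" by simp
  have B: "real n * b - real l \<le> 1 + real c * real c" using lw by (smt (verit) mult_nonneg_nonneg of_nat_0_le_iff)
  have "\<bar>real l - real n * b\<bar> \<le> 1 + real c * real c" using A B by linarith
  then have "\<bar>real l - real n * b\<bar> / real n \<le> (1 + real c * real c) / real n" using n0 by (intro divide_right_mono) auto
  also have "(1 + real c * real c) / real n = 1 / 2 ^ k"
  proof -
    have "1 + real c * real c \<noteq> 0" by (smt (verit) mult_nonneg_nonneg of_nat_0_le_iff)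
    then show ?thesis unfolding k0 by simp
  qed
  also have "\<bar>real l - real n * b\<bar> / real n = \<bar>real l / real n - b\<bar>"
  proof -
    have "real l / real n - b = (real l - real n * b) / real n" using n0 by (simp add: field_simps)
    then show ?thesis by simp
  qed
  finally show ?thesis using val by (simp add: c_def L_def)
qed

lemma exponent_program: "\<exists>prg. \<forall>os c k. run os prg [c, k] = Some (exponent_code c k)"
proof -
  obtain prg where prg: "\<And>os xs. length xs = 2 \<Longrightarrow> run os prg xs = Some (exponent_code (xs ! 0) (xs ! 1))"
    using computable_exponent_code unfolding computable_def by blast
  have "run os prg [c, k] = Some (exponent_code c k)" for os c k using prg[of "[c, k]" os] by simp
  then show ?thesis by blast
qed

text \<open>Bounds \<open>h(P) + C\<close>: the threshold \<open>3 ^ (C + 1)\<close> exceeds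
  \<open>C\<close> and is at most 1 above the rational coded by \<open>g0\<close>, a rational is at
  most its code, and the cube comes from \<open>height_le_code\<close>.\<close>

definition height_const :: "nat \<Rightarrow> nat \<Rightarrow> nat" where
  "height_const g0 p = g0 + 2 + (p + 1) ^ 3"

text \<open>The query asks the second oracle at 0 for an approximation to \<open>B_S\<close> within
  1. With \<open>A = height_const (g 0) p\<close>, the three numbers dominate
  \<open>s A powr b\<close>, then \<open>D powr b\<close> for \<open>D = 2 ^ c\<close>, and a value
  of \<open>B\<close> from which on \<open>ln B \<ge> A\<close>.\<close>

lemma constants_program:
  "\<exists>prg. \<forall>e g c p. run [e, g] prg [c, p] =
     Some (list_encode [c * height_const (g 0) p ^ c, 2 ^ (c * c), 3 ^ height_const (g 0) p])"
proof -
  define f where "f = (\<lambda>c p g0. code_cons (c * height_const g0 p ^ c) (code_cons (2 ^ (c * c)) (code_cons (3 ^ height_const g0 p) 0)))"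
  have f: "list_encode [c * height_const g0 p ^ c, 2 ^ (c * c), 3 ^ height_const g0 p] = f c p g0" for c p g0
    unfolding f_def code_cons_def by simp
  have "computable3 f"
    unfolding f_def height_const_def
    by (intro computable_code_cons computable_mult computable_power computable_add computable_const computable_proj) simp_all
  then obtain P where P: "\<And>os xs. length xs = 3 \<Longrightarrow> run os P xs = Some (f (xs ! 0) (xs ! 1) (xs ! 2))"
    unfolding computable_def by blast
  have "run [e, g] (Comp P [Proj 0, Proj 1, Comp (Query 1) [Zero]]) [c, p] = Some (f c p (g 0))" for e g c p
    using P[of "[c, p, g 0]"] by simp
  then show ?thesis unfolding f by blast
qed


section \<open>Counting in orbits\<close>

text \<open>Nonzero vectors with one homogeneous coordinate are proportional. Hence two distinct
  generators exist only for \<open>N \<ge> 1\<close>, where the degree of a map is unique.\<close>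

lemma PN_0_unique:
  assumes "P \<in> PN 0" "Q \<in> PN 0"
  shows "P = Q"
proof -
  have *: "point_of x = hcoords 0" if x: "x \<in> hcoords 0" for x
  proof
    have x0: "x 0 \<noteq> 0" using x unfolding hcoords_def by (auto intro: ccontr) (metis gr0I)
    have xz: "x i = 0" if "i > 0" for i using x that by (simp add: hcoords_def)
    show "point_of x \<subseteq> hcoords 0" using x0 x by (auto simp: point_of_def hcoords_def Qbar_mult)
    show "hcoords 0 \<subseteq> point_of x"
    proof
      fix z assume z: "z \<in> hcoords 0"
      have z0: "z 0 \<noteq> 0" using z unfolding hcoords_def by (auto intro: ccontr) (metis gr0I)
      have zz: "z i = 0" if "i > 0" for i using z that by (simp add: hcoords_def)
      have "z i = (z 0 / x 0) * x i" for i using x0 xz zz by (cases "i = 0") auto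
      then have "z = (\<lambda>i. (z 0 / x 0) * x i)" by (rule ext)
      moreover have "z 0 / x 0 \<in> Qbar" "z 0 / x 0 \<noteq> 0" using x z x0 z0 by (auto simp: hcoords_def intro: Qbar_divide)
      ultimately show "z \<in> point_of x" unfolding point_of_def by blast
    qed
  qed
  then show ?thesis using assms by (auto simp: PN_def)
qed

definition deg_of :: "nat \<Rightarrow> pmap \<Rightarrow> nat" where
  "deg_of N \<phi> = (SOME d. endo_of_degree N d \<phi>)"

text \<open>Depends on \<open>N\<close> and \<open>S\<close> alone, the degrees being recovered from
  the maps by \<open>deg_of\<close>.\<close>

definition growth_exponent :: "nat \<Rightarrow> pmap set \<Rightarrow> real" where
  "growth_exponent N S = (SOME b. 0 < b \<and> b \<le> real (card S) \<and> alphabet.char_eq S (deg_of N) b)"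

definition height_gap :: "nat \<Rightarrow> pmap set \<Rightarrow> nat" where
  "height_gap N S = (SOME C. \<forall>\<phi>\<in>S. \<forall>P\<in>PN N. \<phi> P \<in> PN N \<and>
     \<bar>ln (height N (\<phi> P)) - real (deg_of N \<phi>) * ln (height N P)\<bar> \<le> real C)"

text \<open>A natural number, so that an upper bound for the height gap can be read off from any
  approximation to it; this is what makes the constants computable relative to it.\<close>

definition height_threshold :: "nat \<Rightarrow> pmap set \<Rightarrow> real" where
  "height_threshold N S = real (3 ^ (height_gap N S + 1))"

locale free_system =
  fixes N :: nat and S :: "pmap set"
  assumes finS: "finite S" and cardS: "card S \<ge> 2" and endo: "\<And>\<phi>. \<phi> \<in> S \<Longrightarrow> \<exists>d\<ge>2. endo_of_degree N d \<phi>"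
    and free: "free_basis N S"
begin

lemma N_pos: "N \<ge> 1"
proof (rule ccontr)
  assume "\<not> N \<ge> 1"
  then have N0: "N = 0" by simp
  have "\<phi> = \<psi>" if S: "\<phi> \<in> S" "\<psi> \<in> S" for \<phi> \<psi>
  proof -
    obtain d F e G where d: "defines_endo N d F \<phi>" "defines_endo N e G \<psi>"
      using endo[OF S(1)] endo[OF S(2)] unfolding endo_of_degree_def by blast
    have "\<phi> P = \<psi> P" if "P \<in> PN N" for P
      using height_endo[OF d(1)] height_endo[OF d(2)] that PN_0_unique N0 by blast
    moreover have "\<phi> \<in> extensional (PN N)" "\<psi> \<in> extensional (PN N)" using d by (simp_all add: defines_endo_def)
    ultimately show ?thesis by (intro extensionalityI) auto
  qed
  then have "card S \<le> 1" using finS by (simp add: card_le_Suc0_iff_eq)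
  then show False using cardS by simp
qed

lemma deg_eq:
  assumes "endo_of_degree N d \<phi>"
  shows "deg_of N \<phi> = d"
proof -
  have "endo_of_degree N (deg_of N \<phi>) \<phi>" unfolding deg_of_def by (rule someI[of "\<lambda>d. endo_of_degree N d \<phi>"]) (rule assms)
  then show ?thesis using assms degree_unique[OF N_pos] unfolding endo_of_degree_def by blast
qed

lemma deg2: "\<phi> \<in> S \<Longrightarrow> deg_of N \<phi> \<ge> 2"
  using endo deg_eq by metis

sublocale alphabet S "deg_of N"
  by unfold_locales (use finS deg2 cardS in auto)

lemma growth_exponent: "0 < growth_exponent N S" "growth_exponent N S \<le> card S" "char_eq (growth_exponent N S)"
proof -
  have "0 < growth_exponent N S \<and> growth_exponent N S \<le> card S \<and> char_eq (growth_exponent N S)"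
    unfolding growth_exponent_def by (rule someI_ex) (rule exponent_exists)
  then show "0 < growth_exponent N S" "growth_exponent N S \<le> card S" "char_eq (growth_exponent N S)" by auto
qed

lemma height_gap:
  assumes "\<phi> \<in> S" "P \<in> PN N"
  shows "\<phi> P \<in> PN N" "\<bar>ln (height N (\<phi> P)) - real (deg_of N \<phi>) * ln (height N P)\<bar> \<le> real (height_gap N S)"
proof -
  define Q where "Q = (\<lambda>\<phi> C. \<forall>P\<in>PN N. \<phi> P \<in> PN N \<and>
     \<bar>ln (height N (\<phi> P)) - real (deg_of N \<phi>) * ln (height N P)\<bar> \<le> C)"
  have ex: "\<exists>C. Q \<phi> C" if S: "\<phi> \<in> S" for \<phi>
  proof -
    obtain d F where d: "defines_endo N d F \<phi>" using endo[OF S] unfolding endo_of_degree_def by blast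
    then have "deg_of N \<phi> = d" using deg_eq unfolding endo_of_degree_def by blast
    then show ?thesis using height_endo[OF d] unfolding Q_def by blast
  qed
  have "\<exists>C::nat. \<forall>\<phi>\<in>A. Q \<phi> (real C)" if "A \<subseteq> S" for A
    using finite_subset[OF that finS] that
  proof (induction A rule: finite_induct)
    case (insert \<phi> A)
    then obtain C :: nat where C: "\<forall>\<phi>\<in>A. Q \<phi> (real C)" by auto
    obtain C' where C': "Q \<phi> C'" using ex insert.prems by blast
    have mono: "Q \<psi> a \<Longrightarrow> a \<le> b \<Longrightarrow> Q \<psi> b" for \<psi> a b unfolding Q_def by fastforce
    define M where "M = C + nat \<lceil>C'\<rceil>"
    have "real C \<le> real M" "C' \<le> real M" unfolding M_def by linarith+
    then have "\<forall>\<psi>\<in>insert \<phi> A. Q \<psi> (real M)" using C C' mono by auto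
    then show ?case by blast
  qed simp
  then have "\<exists>C::nat. \<forall>\<phi>\<in>S. Q \<phi> (real C)" by blast
  then have "\<forall>\<phi>\<in>S. Q \<phi> (real (height_gap N S))" unfolding height_gap_def Q_def by (rule someI_ex)
  then show "\<phi> P \<in> PN N" "\<bar>ln (height N (\<phi> P)) - real (deg_of N \<phi>) * ln (height N P)\<bar> \<le> real (height_gap N S)"
    using assms unfolding Q_def by auto
qed

lemma word_map_simps: "word_map N [] = (\<lambda>P\<in>PN N. P)" "word_map N (\<phi> # w) = compose (PN N) \<phi> (word_map N w)"
  by (simp_all add: word_map_def)

text \<open>Shifting by \<open>C\<close> makes the estimates multiplicative: since
  \<open>d \<ge> 2\<close>, one has \<open>d h - 2 C \<ge> d (h - C)\<close> and
  \<open>d h + 2 C \<le> d (h + C)\<close>. So both bounds multiply along a word, with no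
  accumulated error.\<close>

lemma height_word:
  assumes P: "P \<in> PN N" and w: "w \<in> lists S"
  shows "word_map N w P \<in> PN N \<and>
    real (word_weight (deg_of N) w) * (ln (height N P) - height_gap N S) \<le> ln (height N (word_map N w P)) - height_gap N S \<and>
    ln (height N (word_map N w P)) + height_gap N S \<le> real (word_weight (deg_of N) w) * (ln (height N P) + height_gap N S)"
  using w
proof (induction w)
  case Nil
  then show ?case using P by (simp add: word_map_simps)
next
  case (Cons \<phi> w)
  define Q where "Q = word_map N w P"
  define W where "W = real (word_weight (deg_of N) w)"
  define C where "C = real (height_gap N S)"
  define d where "d = real (deg_of N \<phi>)"
  have w: "w \<in> lists S" "\<phi> \<in> S" using Cons by auto
  have IH: "Q \<in> PN N" "W * (ln (height N P) - C) \<le> ln (height N Q) - C" "ln (height N Q) + C \<le> W * (ln (height N P) + C)"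
    using Cons.IH w by (simp_all add: Q_def W_def C_def)
  have e: "word_map N (\<phi> # w) P = \<phi> Q" using P by (simp add: word_map_simps compose_eq Q_def)
  have g: "\<phi> Q \<in> PN N" "\<bar>ln (height N (\<phi> Q)) - d * ln (height N Q)\<bar> \<le> C"
    using height_gap[OF w(2) IH(1)] by (simp_all add: C_def d_def)
  have d2: "d \<ge> 2" using deg2[OF w(2)] by (simp add: d_def)
  have dC: "2 * C \<le> d * C" using d2 by (intro mult_right_mono) (auto simp: C_def)
  have "d * (W * (ln (height N P) - C)) \<le> d * (ln (height N Q) - C)" using IH(2) d2 by (intro mult_left_mono) auto
  also have "\<dots> \<le> ln (height N (\<phi> Q)) - C" using g(2) dC by (simp add: algebra_simps abs_le_iff)
  finally have 1: "d * (W * (ln (height N P) - C)) \<le> ln (height N (\<phi> Q)) - C" .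
  have "ln (height N (\<phi> Q)) + C \<le> d * (ln (height N Q) + C)" using g(2) dC by (simp add: algebra_simps abs_le_iff)
  also have "\<dots> \<le> d * (W * (ln (height N P) + C))" using IH(3) d2 by (intro mult_left_mono) auto
  finally have 2: "ln (height N (\<phi> Q)) + C \<le> d * (W * (ln (height N P) + C))" .
  show ?case unfolding e using 1 2 g(1) by (simp add: C_def d_def W_def mult.assoc)
qed

lemma word_map_gen_monoid: "w \<in> lists S \<Longrightarrow> word_map N w \<in> gen_monoid N S"
  by (induction w) (auto simp: word_map_simps intro: gen_monoid.intros)

text \<open>This is where freeness enters: \<open>word_map\<close> is a bijection from the words
  over \<open>S\<close> to the monoid.\<close>

lemma orbit_count_eq: "orbit_count N S P B = card {w\<in>lists S. height N (word_map N w P) \<le> B}"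
proof -
  have uniq: "\<exists>!w. w \<in> lists S \<and> word_map N w = f" if "f \<in> gen_monoid N S" for f
    using free that by (simp add: free_basis_def)
  have "bij_betw (word_map N) {w\<in>lists S. height N (word_map N w P) \<le> B} {f\<in>gen_monoid N S. height N (f P) \<le> B}"
    unfolding bij_betw_def
  proof
    show "inj_on (word_map N) {w\<in>lists S. height N (word_map N w P) \<le> B}"
    proof (rule inj_onI)
      fix v w assume v: "v \<in> {w\<in>lists S. height N (word_map N w P) \<le> B}"
        and w: "w \<in> {w\<in>lists S. height N (word_map N w P) \<le> B}" and eq: "word_map N v = word_map N w"
      then show "v = w" using uniq[OF word_map_gen_monoid[of v]] by auto
    qed
    show "word_map N ` {w\<in>lists S. height N (word_map N w P) \<le> B} = {f\<in>gen_monoid N S. height N (f P) \<le> B}"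
    proof (intro set_eqI iffI)
      fix f assume f: "f \<in> {f\<in>gen_monoid N S. height N (f P) \<le> B}"
      then obtain w where "w \<in> lists S" "word_map N w = f" using uniq[of f] by blast
      then show "f \<in> word_map N ` {w\<in>lists S. height N (word_map N w P) \<le> B}" using f by blast
    qed (auto intro: word_map_gen_monoid)
  qed
  then show ?thesis unfolding orbit_count_def by (rule bij_betw_same_card[symmetric])
qed

lemma height_pos: "P \<in> PN N \<Longrightarrow> height N P > 0"
  using height_point_of by (auto simp: PN_def)

text \<open>The base 3 of the threshold exceeds Euler's number, so its logarithm is at least the
  exponent \<open>C + 1\<close>.\<close>

lemma ln_threshold:
  assumes P: "P \<in> PN N" and big: "height N P > height_threshold N S"
  shows "ln (height N P) - height_gap N S \<ge> 1"
proof -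
  have ln3: "ln (3 :: real) \<ge> 1" using ln_mono[OF exp_le] by simp
  have "real (height_gap N S + 1) * 1 \<le> real (height_gap N S + 1) * ln 3" using ln3 by (intro mult_left_mono) auto
  also have "\<dots> = ln (3 ^ (height_gap N S + 1))" by (rule ln_realpow[symmetric])
  also have "\<dots> \<le> ln (height N P)" using big by (intro ln_mono) (auto simp: height_threshold_def)
  finally show ?thesis by simp
qed

text \<open>Since \<open>1 \<le> h - C\<close> and \<open>h + C \<le> A\<close>,
  \<open>height_word\<close> places the words counted in the orbit between those of weight at most
  \<open>ln B / A\<close> and those of weight at most \<open>ln B\<close>;
  \<open>count_bounds\<close> applies to both.\<close>

theorem orbit_count_bounds:
  assumes P: "P \<in> PN N" and big: "height N P > height_threshold N S"
    and D: "\<And>\<phi>. \<phi> \<in> S \<Longrightarrow> deg_of N \<phi> \<le> D"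
    and A: "A \<ge> ln (height N P) + height_gap N S" and B: "ln B \<ge> A" "B > 0"
  shows "ln B powr growth_exponent N S \<le> card S * A powr growth_exponent N S * orbit_count N S P B"
    "orbit_count N S P B \<le> real D powr growth_exponent N S * ln B powr growth_exponent N S"
proof -
  define b where "b = growth_exponent N S"
  have b: "char_eq b" "b \<ge> 0" using growth_exponent by (simp_all add: b_def)
  define h where "h = ln (height N P)"
  define C where "C = real (height_gap N S)"
  have hC: "h - C \<ge> 1" "A \<ge> h + C" "C \<ge> 0" using ln_threshold[OF P big] A by (simp_all add: h_def C_def)
  have A1: "A \<ge> 1" using hC by linarith
  define Orb where "Orb = {w\<in>lists S. height N (word_map N w P) \<le> B}"
  have hw: "height N (word_map N w P) \<le> B \<longleftrightarrow> ln (height N (word_map N w P)) \<le> ln B" if "w \<in> lists S" for w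
    using height_word[OF P that] height_pos B(2) by (simp add: ln_le_cancel_iff)
  have sub1: "Orb \<subseteq> light_words S (deg_of N) (ln B)"
  proof
    fix w assume "w \<in> Orb"
    then have w: "w \<in> lists S" "ln (height N (word_map N w P)) \<le> ln B" using hw by (auto simp: Orb_def)
    have "real (word_weight (deg_of N) w) * 1 \<le> real (word_weight (deg_of N) w) * (h - C)" using hC by (intro mult_left_mono) auto
    also have "\<dots> \<le> ln (height N (word_map N w P)) - C" using height_word[OF P w(1)] by (simp add: h_def C_def)
    finally show "w \<in> light_words S (deg_of N) (ln B)" using w hC by (simp add: light_words_def)
  qed
  have sub2: "light_words S (deg_of N) (ln B / A) \<subseteq> Orb"
  proof
    fix w assume "w \<in> light_words S (deg_of N) (ln B / A)"
    then have w: "w \<in> lists S" "real (word_weight (deg_of N) w) * A \<le> ln B" using A1 by (auto simp: light_words_def field_simps)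
    have "ln (height N (word_map N w P)) \<le> real (word_weight (deg_of N) w) * (h + C)"
      using height_word[OF P w(1)] hC(3) by (simp add: h_def C_def)
    also have "\<dots> \<le> real (word_weight (deg_of N) w) * A" using hC by (intro mult_left_mono) auto
    also have "\<dots> \<le> ln B" by (rule w(2))
    finally show "w \<in> Orb" using hw[OF w(1)] w(1) by (simp add: Orb_def)
  qed
  have finO: "finite Orb" using finite_subset[OF sub1 finite_light] .
  have oc: "orbit_count N S P B = card Orb" by (simp add: orbit_count_eq Orb_def)
  obtain \<phi> where f: "\<phi> \<in> S" using cardS by (metis card.empty ex_in_conv not_numeral_le_zero)
  have D1: "real D \<ge> 1" using deg2[OF f] D[OF f] by simp
  have lB: "ln B \<ge> 1" using B A1 by simp
  define Y where "Y = ln B / A"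
  have Y1: "Y \<ge> 1" using B A1 by (simp add: Y_def)
  have s1: "real (card S - 1) = real (card S) - 1" using cardS by (simp add: of_nat_diff)
  have "orbit_count N S P B \<le> count (ln B)" unfolding oc count_def by (rule card_mono[OF finite_light sub1])
  also have "real (count (ln B)) \<le> real ((card S - 1) * count (ln B))"
    proof -
    have "1 * count (ln B) \<le> (card S - 1) * count (ln B)" using cardS by (intro mult_right_mono) linarith+
    then show ?thesis by (simp only: of_nat_le_iff mult_1)
  qed
  also have "\<dots> \<le> (real D * ln B) powr b - 1"
  proof (rule count_bounds(2)[OF b D])
    show "1 \<le> ln B * real D" using mult_mono[OF lB D1] lB by simp
  qed (use lB in auto)
  also have "\<dots> \<le> real D powr b * ln B powr b" using lB by (simp add: powr_mult)
  finally show "orbit_count N S P B \<le> real D powr growth_exponent N S * ln B powr growth_exponent N S" by (simp add: b_def)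
  have "Y powr b - 1 \<le> real ((card S - 1) * count Y)"
  proof (rule count_bounds(1)[OF b D])
    show "1 \<le> Y * real D" using mult_mono[OF Y1 D1] Y1 by simp
  qed (use Y1 in auto)
  \<comment> \<open>The empty word is counted, so the additive 1 is absorbed into one more copy of
    the count, turning the factor \<open>s - 1\<close> into \<open>s\<close>.\<close>
  moreover have "count Y \<ge> 1" using count_rec[OF Y1] by simp
  ultimately have "Y powr b \<le> card S * real (count Y)" unfolding of_nat_mult s1 by (simp add: algebra_simps)
  also have "\<dots> \<le> card S * real (card Orb)"
    unfolding count_def Y_def using card_mono[OF finO sub2] by (intro mult_left_mono) auto
  finally have "Y powr b \<le> card S * real (card Orb)" .
  then have "A powr b * Y powr b \<le> A powr b * (card S * real (card Orb))" by (intro mult_left_mono) auto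
  moreover have "A powr b * Y powr b = ln B powr b" using A1 lB by (simp add: Y_def powr_divide)
  ultimately show "ln B powr growth_exponent N S \<le> card S * A powr growth_exponent N S * orbit_count N S P B"
    by (simp add: oc b_def mult_ac)
qed

lemma orbit_count_asymptotics:
  assumes P: "P \<in> PN N" and big: "height N P > height_threshold N S" and e: "\<epsilon> > 0"
  shows "(\<lambda>B. ln B powr growth_exponent N S) \<in> O[at_top](\<lambda>B. real (orbit_count N S P B))"
    "(\<lambda>B. real (orbit_count N S P B)) \<in> O[at_top](\<lambda>B. ln B powr (growth_exponent N S + \<epsilon>))"
proof -
  define A where "A = ln (height N P) + height_gap N S"
  define D where "D = Max (deg_of N ` S)"
  have D: "deg_of N \<phi> \<le> D" if "\<phi> \<in> S" for \<phi> using that finS by (simp add: D_def)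
  have ev: "eventually (\<lambda>B. ln B \<ge> A \<and> B > 0 \<and> ln B \<ge> 1) at_top"
    using eventually_ge_at_top[of "exp (max A 1)"]
  proof (rule eventually_mono)
    fix B assume B: "exp (max A 1) \<le> B"
    then have B0: "B > 0" using exp_gt_zero[of "max A 1"] by linarith
    then have "max A 1 \<le> ln B" using B ln_ge_iff[OF B0, of "max A 1"] by blast
    then show "ln B \<ge> A \<and> B > 0 \<and> ln B \<ge> 1" using B0 by linarith
  qed
  note bd = orbit_count_bounds[OF P big D, of A]
  show "(\<lambda>B. ln B powr growth_exponent N S) \<in> O[at_top](\<lambda>B. real (orbit_count N S P B))"
  proof (rule bigoI[of _ "card S * A powr growth_exponent N S"])
    show "eventually (\<lambda>B. norm (ln B powr growth_exponent N S) \<le> card S * A powr growth_exponent N S * norm (real (orbit_count N S P B))) at_top"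
      using ev by (rule eventually_mono) (use bd(1) in \<open>simp add: A_def\<close>)
  qed
  show "(\<lambda>B. real (orbit_count N S P B)) \<in> O[at_top](\<lambda>B. ln B powr (growth_exponent N S + \<epsilon>))"
  proof (rule bigoI[of _ "real D powr growth_exponent N S"])
    show "eventually (\<lambda>B. norm (real (orbit_count N S P B)) \<le> real D powr growth_exponent N S * norm (ln B powr (growth_exponent N S + \<epsilon>))) at_top"
      using ev
    proof (rule eventually_mono)
      fix B assume B: "ln B \<ge> A \<and> B > 0 \<and> ln B \<ge> 1"
      then have "real (orbit_count N S P B) \<le> real D powr growth_exponent N S * ln B powr growth_exponent N S"
        using bd(2) by (simp add: A_def)
      also have "\<dots> \<le> real D powr growth_exponent N S * ln B powr (growth_exponent N S + \<epsilon>)"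
        using B e by (intro mult_left_mono powr_mono) auto
      finally show "norm (real (orbit_count N S P B)) \<le> real D powr growth_exponent N S * norm (ln B powr (growth_exponent N S + \<epsilon>))"
        by simp
    qed
  qed
qed

lemma system_codeE:
  assumes "system_code c N S"
  obtains cs \<phi>s where "c = prod_encode (N, list_encode cs)" "distinct \<phi>s" "set \<phi>s = S" "length cs = length \<phi>s"
    "\<And>i. i < length \<phi>s \<Longrightarrow> fst (prod_decode (cs ! i)) = deg_of N (\<phi>s ! i)"
proof -
  obtain cs \<phi>s where c: "c = prod_encode (N, list_encode cs)" "list_all2 (endo_code N) cs \<phi>s" "distinct \<phi>s" "set \<phi>s = S"
    using assms unfolding system_code_def by blast
  have len: "length cs = length \<phi>s" using c(2) by (rule list_all2_lengthD)
  have "fst (prod_decode (cs ! i)) = deg_of N (\<phi>s ! i)" if i: "i < length \<phi>s" for i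
  proof -
    have "endo_code N (cs ! i) (\<phi>s ! i)" using list_all2_nthD2[OF c(2) i] .
    then obtain d ps F where d: "cs ! i = prod_encode (d, list_encode ps)" "defines_endo N d F (\<phi>s ! i)"
      unfolding endo_code_def by blast
    then show ?thesis using deg_eq[of d "\<phi>s ! i"] unfolding endo_of_degree_def by auto
  qed
  then show ?thesis using that c len by blast
qed

lemma computes_growth_exponent:
  assumes prg: "\<And>os c k. run os prg [c, k] = Some (exponent_code c k)"
  shows "computes_exponent prg N S \<epsilon> (growth_exponent N S)"
  unfolding computes_exponent_def
proof (intro allI impI)
  fix c e k assume "system_code c N S"
  then obtain cs \<phi>s where c: "c = prod_encode (N, list_encode cs)" "distinct \<phi>s" "set \<phi>s = S" "length cs = length \<phi>s"
    "\<And>i. i < length \<phi>s \<Longrightarrow> fst (prod_decode (cs ! i)) = deg_of N (\<phi>s ! i)" by (rule system_codeE) blast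
  have "\<bar>of_rat (rat_of_code (exponent_code c k)) - growth_exponent N S\<bar> \<le> 1 / 2 ^ k"
    unfolding c(1) by (rule exponent_approx[OF c(2-5) growth_exponent(3)]) (use growth_exponent in auto)
  then show "\<exists>q. run [e] prg [c, k] = Some q \<and> \<bar>of_rat (rat_of_code q) - growth_exponent N S\<bar> \<le> 1 / 2 ^ k"
    using prg by blast
qed

lemma computes_orbit_constants:
  assumes prg: "\<And>e g c p. run [e, g] prg [c, p] =
     Some (list_encode [c * height_const (g 0) p ^ c, 2 ^ (c * c), 3 ^ height_const (g 0) p])"
    and P: "P \<in> PN N" and big: "height N P > height_threshold N S" and e: "\<epsilon> > 0"
  shows "computes_constants prg N S \<epsilon> (growth_exponent N S) (height_threshold N S) P"
  unfolding computes_constants_def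
proof (intro allI impI)
  fix c p e g
  assume "system_code c N S" and pc: "point_code N p P" and g: "real_name g (height_threshold N S)"
  then obtain cs \<phi>s where c: "c = prod_encode (N, list_encode cs)" "distinct \<phi>s" "set \<phi>s = S" "length cs = length \<phi>s"
    "\<And>i. i < length \<phi>s \<Longrightarrow> fst (prod_decode (cs ! i)) = deg_of N (\<phi>s ! i)" by - (rule system_codeE, assumption, blast)
  have cS: "card S \<le> c" unfolding c(1) by (rule code_bounds(1)[OF c(2-5)])
  have "c \<le> 2 ^ c" by (simp add: less_imp_le)
  then have D: "deg_of N \<phi> \<le> 2 ^ c" if "\<phi> \<in> S" for \<phi>
    using code_bounds(2)[OF c(2-5) that, of N] unfolding c(1) by linarith
  define A where "A = height_const (g 0) p"
  define b where "b = growth_exponent N S"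
  have b: "0 < b" "b \<le> card S" using growth_exponent by (simp_all add: b_def)
  have bc: "b \<le> real c" using b(2) cS by linarith
  have A1: "A \<ge> 1" by (simp add: A_def height_const_def)
  have gap: "real (height_gap N S) \<le> real (g 0) + 1"
  proof -
    have "height_gap N S < 3 ^ (height_gap N S + 1)"
    proof -
      have "height_gap N S < 2 ^ (height_gap N S + 1)" using less_exp[of "height_gap N S + 1"] by linarith
      also have "(2::nat) ^ (height_gap N S + 1) \<le> 3 ^ (height_gap N S + 1)" by (rule power_mono) auto
      finally show ?thesis .
    qed
    then have "real (height_gap N S) \<le> height_threshold N S" unfolding height_threshold_def by (simp only: of_nat_le_iff less_imp_le)
    also have "\<dots> \<le> of_rat (rat_of_code (g 0)) + 1" using g unfolding real_name_def by (auto simp: abs_le_iff dest: spec[of _ 0])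
    \<comment> \<open>The numerator is at most its code and the denominator is at least 1.\<close>
    also have "of_rat (rat_of_code (g 0)) \<le> real (g 0)"
    proof -
      obtain a d where ad: "prod_decode (g 0) = (a, d)" by fastforce
      have "a \<le> g 0" using le_prod_encode_1[of a d] ad by (metis prod_decode_inverse)
      have "real_of_int (int_decode a) / real (Suc d) \<le> \<bar>real_of_int (int_decode a)\<bar> / 1"
        by (rule frac_le) auto
      also have "\<dots> \<le> real a" using int_decode_bound[of a] by simp
      also have "\<dots> \<le> real (g 0)" using \<open>a \<le> g 0\<close> by simp
      finally show ?thesis by (simp add: rat_of_code_def ad of_rat_divide del: of_nat_Suc)
    qed
    finally show ?thesis by simp
  qed
  have Ah: "real A \<ge> ln (height N P) + height_gap N S"
    using height_le_code[OF pc] gap by (simp add: A_def height_const_def)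
  have "ln B powr b \<le> real (c * A ^ c) * real (orbit_count N S P B) \<and>
      real (orbit_count N S P B) \<le> real (2 ^ (c * c)) * ln B powr (b + \<epsilon>)" if B: "B \<ge> real (3 ^ A)" for B
  proof -
    have ln3: "ln (3 :: real) \<ge> 1" using ln_mono[OF exp_le] by simp
    have "(3::real) ^ A > 0" by simp
    then have B0: "B > 0" using B by (simp only: of_nat_power of_nat_numeral)
    have "real A * 1 \<le> real A * ln 3" using ln3 by (intro mult_left_mono) auto
    also have "\<dots> = ln (3 ^ A)" by (simp add: ln_realpow)
    also have "\<dots> \<le> ln B" using B B0 by (intro ln_mono) auto
    finally have lB: "ln B \<ge> real A" by simp
    note bd = orbit_count_bounds[OF P big D Ah lB B0, folded b_def]
    have "ln B powr b \<le> card S * real A powr b * orbit_count N S P B" by (rule bd(1))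
    also have "\<dots> \<le> (real c * real A ^ c) * orbit_count N S P B"
    proof (intro mult_right_mono mult_mono)
      have "real A powr b \<le> real A powr real c" using A1 bc by (intro powr_mono) auto
      then show "real A powr b \<le> real A ^ c" using A1 by (simp add: powr_realpow)
    qed (use cS in auto)
    finally have 1: "ln B powr b \<le> real (c * A ^ c) * real (orbit_count N S P B)" by simp
    have "real (orbit_count N S P B) \<le> real (2 ^ c) powr b * ln B powr b" by (rule bd(2))
    also have "\<dots> \<le> real (2 ^ (c * c)) * ln B powr (b + \<epsilon>)"
    proof (intro mult_mono)
      have "real (2 ^ c) powr b \<le> real (2 ^ c) powr real c" using bc by (intro powr_mono) auto
      also have "\<dots> = real (2 ^ (c * c))" by (simp add: powr_realpow power_mult)
      finally show "real (2 ^ c) powr b \<le> real (2 ^ (c * c))" .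
      show "ln B powr b \<le> ln B powr (b + \<epsilon>)" using lB A1 e by (intro powr_mono) auto
    qed auto
    finally show ?thesis using 1 by blast
  qed
  moreover have "c * A ^ c > 0" "(2::nat) ^ (c * c) > 0" using A1 cS cardS by auto
  ultimately show "\<exists>c1 c2 B0. run [e, g] prg [c, p] = Some (list_encode [c1, c2, B0]) \<and> c1 > 0 \<and> c2 > 0 \<and>
      (\<forall>B. B \<ge> real B0 \<longrightarrow> ln B powr growth_exponent N S \<le> real c1 * real (orbit_count N S P B) \<and>
        real (orbit_count N S P B) \<le> real c2 * ln B powr (growth_exponent N S + \<epsilon>))"
    using prg[of e g c p] unfolding b_def A_def by blast
qed

end

text \<open>\<open>b\<close> and \<open>B_S\<close>, as functions of the data shown, and both
  programs are fixed before \<open>N\<close>, \<open>S\<close>, \<open>\<epsilon>\<close> and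
  \<open>P\<close>: so the threshold depends on the system alone, and computability is uniform in
  the data.\<close>

theorem theorem1p1:
  "\<exists>(b :: nat \<Rightarrow> pmap set \<Rightarrow> real \<Rightarrow> real) (BS :: nat \<Rightarrow> pmap set \<Rightarrow> real)
     (prog_b :: prog) (prog_c :: prog).
     \<forall>(N :: nat) (S :: pmap set) (deg :: pmap \<Rightarrow> nat).
       finite S \<and> card S \<ge> 2 \<and>
       (\<forall>\<phi>\<in>S. endo_of_degree N (deg \<phi>) \<phi> \<and> deg \<phi> \<ge> 2) \<and> inj_on deg S \<and>
       free_basis N S \<longrightarrow>
       (\<forall>\<epsilon>>0.
          b N S \<epsilon> > 0 \<and> computes_exponent prog_b N S \<epsilon> (b N S \<epsilon>) \<and>
          (\<forall>P\<in>PN N. height N P > BS N S \<longrightarrow>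
             (\<lambda>B. ln B powr b N S \<epsilon>) \<in> O[at_top](\<lambda>B. real (orbit_count N S P B)) \<and>
             (\<lambda>B. real (orbit_count N S P B)) \<in> O[at_top](\<lambda>B. ln B powr (b N S \<epsilon> + \<epsilon>)) \<and>
             computes_constants prog_c N S \<epsilon> (b N S \<epsilon>) (BS N S) P))"
proof -
  obtain prog_b where pb: "\<And>os c k. run os prog_b [c, k] = Some (exponent_code c k)"
    using exponent_program by blast
  obtain prog_c where pc: "\<And>e g c p. run [e, g] prog_c [c, p] =
     Some (list_encode [c * height_const (g 0) p ^ c, 2 ^ (c * c), 3 ^ height_const (g 0) p])"
    using constants_program by blast
  show ?thesis
  proof (rule exI[of _ "\<lambda>N S \<epsilon>. growth_exponent N S"], rule exI[of _ height_threshold],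
      rule exI[of _ prog_b], rule exI[of _ prog_c], intro allI impI)
    fix N :: nat and S :: "pmap set" and deg :: "pmap \<Rightarrow> nat" and \<epsilon> :: real
    assume a: "finite S \<and> card S \<ge> 2 \<and> (\<forall>\<phi>\<in>S. endo_of_degree N (deg \<phi>) \<phi> \<and> deg \<phi> \<ge> 2) \<and> inj_on deg S \<and> free_basis N S"
      and e: "\<epsilon> > 0"
    interpret free_system N S by unfold_locales (use a in auto)
    show "growth_exponent N S > 0 \<and> computes_exponent prog_b N S \<epsilon> (growth_exponent N S) \<and>
          (\<forall>P\<in>PN N. height N P > height_threshold N S \<longrightarrow>
             (\<lambda>B. ln B powr growth_exponent N S) \<in> O[at_top](\<lambda>B. real (orbit_count N S P B)) \<and>
             (\<lambda>B. real (orbit_count N S P B)) \<in> O[at_top](\<lambda>B. ln B powr (growth_exponent N S + \<epsilon>)) \<and>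
             computes_constants prog_c N S \<epsilon> (growth_exponent N S) (height_threshold N S) P)"
      using growth_exponent(1) computes_growth_exponent[OF pb] orbit_count_asymptotics[OF _ _ e]
        computes_orbit_constants[OF pc _ _ e] by blast
  qed
qed


end
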